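(* Let $P$ be a polygon in $\mathbb{T}^2$, and let $\chi_P$ be the characteristic function associated to $P$. Then $\dim_t(\chi_P)=\frac52$ for almost all $t$.
   Context: $\mathbb{T}^2$ is the two-dimensional flat torus. Let $u$ be the solution of the linear Schrödinger equation $iu_t+\Delta_{\mathbb{T}^2}u=0$, $u(\cdot,0)=\chi_P$. The fractal (upper Minkowski) dimension of a bounded set $E$ is $\limsup_{\epsilon\to0}\frac{\log\mathcal N(E,\epsilon)}{\log(1/\epsilon)}$, where $\mathcal N(E,\epsilon)$ is the minimum number of boxes of sidelength $\epsilon$ needed to cover $E$. $\dim_t(\chi_P)$ denotes the maximum of the fractal dimensions of the graphs of the real and imaginary parts of $u(\cdot,t)$. *)

theory Defs
  imports "HOL-Analysis.Analysis"
begin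

text \<open>
  The flat torus is \<open>\<real>\<^sup>2 / (2\<pi>\<int>)\<^sup>2\<close>. Points of the torus are represented by points of the plane,
  functions on it by functions on the plane that respect \<open>torus_eq\<close>, and its subsets by
  saturated subsets of the plane.
\<close>

definition torus_eq :: "real^2 \<Rightarrow> real^2 \<Rightarrow> bool" where
  "torus_eq x y \<longleftrightarrow> (\<forall>i. \<exists>k::int. x $ i - y $ i = 2 * pi * of_int k)"

definition torus_fun :: "(real^2 \<Rightarrow> complex) \<Rightarrow> bool" where
  "torus_fun f \<longleftrightarrow> (\<forall>x y. torus_eq x y \<longrightarrow> f x = f y)"

definition torus_cell :: "(real^2) set" where
  "torus_cell = {x. \<forall>i. 0 \<le> x $ i \<and> x $ i < 2 * pi}"

definition torus_measure :: "(real^2) measure" where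
  "torus_measure = restrict_space lborel torus_cell"


fun polygonal_path :: "(real^2) list \<Rightarrow> real \<Rightarrow> real^2" where
  "polygonal_path [] = linepath 0 0"
| "polygonal_path [a] = linepath a a"
| "polygonal_path [a, b] = linepath a b"
| "polygonal_path (a # b # c # vs) = linepath a b +++ polygonal_path (b # c # vs)"

definition closed_polygonal_path :: "(real^2) list \<Rightarrow> real \<Rightarrow> real^2" where
  "closed_polygonal_path vs = polygonal_path (vs @ [hd vs])"

definition planar_polygon :: "(real^2) set \<Rightarrow> bool" where
  "planar_polygon Q \<longleftrightarrow> (\<exists>vs. length vs \<ge> 3 \<and> simple_path (closed_polygonal_path vs) \<and>
     Q = path_image (closed_polygonal_path vs) \<union> inside (path_image (closed_polygonal_path vs)))"

text \<open>
  A polygon in the torus is a disc bounded by a simple closed curve made of finitely many geodesic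
  segments. Such a disc lifts to the plane, so it is the image of a planar polygon on which
  the projection is injective. Injectivity on the closed polygon excludes the whole torus,
  regarded as the image of a period square.
\<close>

definition torus_polygon :: "(real^2) set \<Rightarrow> bool" where
  "torus_polygon P \<longleftrightarrow> (\<exists>Q. planar_polygon Q \<and>
     (\<forall>x\<in>Q. \<forall>y\<in>Q. torus_eq x y \<longrightarrow> x = y) \<and>
     P = {x. \<exists>y\<in>Q. torus_eq x y})"


definition partial_deriv :: "2 \<Rightarrow> (real^2 \<Rightarrow> complex) \<Rightarrow> real^2 \<Rightarrow> complex" where
  "partial_deriv i f x = frechet_derivative f (at x) (axis i 1)"

definition laplacian :: "(real^2 \<Rightarrow> complex) \<Rightarrow> real^2 \<Rightarrow> complex" where
  "laplacian f x = (\<Sum>i\<in>UNIV. partial_deriv i (partial_deriv i f) x)"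

primrec C_k :: "nat \<Rightarrow> (real^2 \<Rightarrow> complex) \<Rightarrow> bool" where
  "C_k 0 f \<longleftrightarrow> continuous_on UNIV f"
| "C_k (Suc k) f \<longleftrightarrow> f differentiable_on UNIV \<and> (\<forall>i. C_k k (partial_deriv i f))"

definition torus_test_fun :: "(real^2 \<Rightarrow> complex) \<Rightarrow> bool" where
  "torus_test_fun \<phi> \<longleftrightarrow> torus_fun \<phi> \<and> (\<forall>k. C_k k \<phi>)"

definition torus_L2 :: "(real^2 \<Rightarrow> complex) \<Rightarrow> bool" where
  "torus_L2 f \<longleftrightarrow> torus_fun f \<and> f \<in> borel_measurable torus_measure \<and>
     integrable torus_measure (\<lambda>x. (cmod (f x))\<^sup>2)"

text \<open>
  Solutions of \<open>i u\<^sub>t + \<Delta> u = 0\<close>, \<open>u(\<cdot>,0) = g\<close>, for square-integrable data: continuous curves in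
  \<open>L\<^sup>2\<close> of the torus that satisfy \<open>u\<^sub>t = i \<Delta> u\<close> in the sense of distributions in space.
  Here \<open>u t\<close> is the function \<open>u(\<cdot>,t)\<close>, determined up to null sets only.
\<close>

definition schrodinger_solution ::
    "(real^2 \<Rightarrow> complex) \<Rightarrow> (real \<Rightarrow> real^2 \<Rightarrow> complex) \<Rightarrow> bool" where
  "schrodinger_solution g u \<longleftrightarrow>
     (\<forall>t. torus_L2 (u t)) \<and>
     (\<forall>t. ((\<lambda>s. LINT x|torus_measure. (cmod (u s x - u t x))\<^sup>2) \<longlongrightarrow> 0) (at t)) \<and>
     (\<forall>\<phi>. torus_test_fun \<phi> \<longrightarrow> (\<forall>t.
        ((\<lambda>s. LINT x|torus_measure. u s x * \<phi> x) has_vector_derivative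
           \<i> * (LINT x|torus_measure. u t x * laplacian \<phi> x)) (at t))) \<and>
     (AE x in torus_measure. u 0 x = g x)"

text \<open>
  The graph of an \<open>L\<^sup>2\<close> function is that of its continuous version, which is unique if it exists.
\<close>

definition continuous_version :: "(real^2 \<Rightarrow> complex) \<Rightarrow> (real^2 \<Rightarrow> complex) \<Rightarrow> bool" where
  "continuous_version f v \<longleftrightarrow>
     torus_fun v \<and> continuous_on UNIV v \<and> (AE x in torus_measure. v x = f x)"


definition box_covering_number :: "('a::euclidean_space) set \<Rightarrow> real \<Rightarrow> nat" where
  "box_covering_number E \<epsilon> =
     (LEAST n. \<exists>C. finite C \<and> card C = n \<and> E \<subseteq> (\<Union>c\<in>C. cbox c (c + \<epsilon> *\<^sub>R One)))"

definition fractal_dim :: "('a::euclidean_space) set \<Rightarrow> ereal" where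
  "fractal_dim E =
     Limsup (at_right 0) (\<lambda>\<epsilon>. ereal (ln (real (box_covering_number E \<epsilon>)) / ln (1 / \<epsilon>)))"

definition torus_graph :: "(real^2 \<Rightarrow> real) \<Rightarrow> ((real^2) \<times> real) set" where
  "torus_graph f = (\<lambda>x. (x, f x)) ` torus_cell"

definition graph_dim :: "(real^2 \<Rightarrow> complex) \<Rightarrow> ereal" where
  "graph_dim v = max (fractal_dim (torus_graph (\<lambda>x. Re (v x))))
                     (fractal_dim (torus_graph (\<lambda>x. Im (v x))))"

end

theory Submission
  imports Defs "HOL-Complex_Analysis.Winding_Numbers" "HOL-Real_Asymp.Real_Asymp"
begin

text \<open>
  The upper bound is Hoelder continuity of every order \<open>\<kappa> < 1/2\<close> at almost every time. For small \<open>h\<close>, the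
  winding number formula writes \<open>\<chi>\<^sub>P(\<cdot> - h e\<^sub>i) - \<chi>\<^sub>P\<close> as a signed sum of indicators of parallelograms of
  width \<open>h\<close>, one for each edge. For the evolution \<open>F(t, x)\<close> of a frequency-localised parallelogram, grouping
  \<open>\<bar>F\<bar>\<^sup>2\<close> by differences \<open>d\<close> of frequencies gives \<open>\<bar>F(t, x)\<bar>\<^sup>2 \<le> \<Sum>\<^sub>d \<bar>A\<^sub>d(t)\<bar>\<close> with a right-hand side free of \<open>x\<close>,
  where \<open>A\<^sub>d(t)\<close> is the autocorrelation of the coefficients twisted by \<open>e\<^bsup>-2it n\<cdot>d\<^esup>\<close>. Only \<open>n \<bottom> d\<close> survives averaging
  over a period, so that \<open>\<integral> sup\<^sub>x \<bar>F\<bar>\<^sup>2 dt \<le> C h log\<^sup>3 N\<close>. Summing over dyadic \<open>h\<close> and frequencies \<open>N = 16\<^sup>J\<close> controls, for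
  almost every \<open>t\<close>, all difference quotients of the Fejer means of \<open>u(\<cdot>, t)\<close>, which therefore converge uniformly to
  a Hoelder function \<open>v\<close>.

  For the lower bound, Parseval gives \<open>\<parallel>v(\<cdot> + h) - v\<parallel>\<^sub>2\<^sup>2 = \<parallel>\<chi>\<^sub>P(\<cdot> + h) - \<chi>\<^sub>P\<parallel>\<^sub>1\<close>, and subadditivity of the
  right-hand side in \<open>h\<close> makes it at least \<open>c/m\<close> for \<open>h = h\<^sub>0/m\<close>. With the Hoelder bound the \<open>L\<^sup>1\<close> modulus of \<open>v\<close> is
  at least \<open>c \<epsilon>\<^bsup>1-\<kappa>\<^esup>\<close> for \<open>\<epsilon> \<approx> 1/m\<close>, whereas it is at most \<open>C \<epsilon>\<^sup>3\<close> times the number of boxes in a covering of the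
  graphs of the real and imaginary parts, by the intermediate value theorem. Thus the dimension lies between
  \<open>2 + \<kappa>\<close> and \<open>3 - \<kappa>\<close> for every \<open>\<kappa> < 1/2\<close>.
\<close>

section \<open>Fejer kernels and exponential integrals\<close>

text \<open>The obstacle is the supremum over \<open>x\<close> at a fixed time, which orthogonality
  in \<open>x\<close> cannot see. Passing to absolute values after grouping by \<open>d\<close> is
  affordable because the coefficients of a strip split into a factor along the edge and one across
  it, and the autocorrelation of each factor is again a Fourier integral. The sum over
  \<open>n\<close> then becomes an average of kernels. Fejer weights make these kernels nonnegative,
  so one majorant serves every shift \<open>d\<close>, and its time average is computed exactly.

  The exponent 1/2 enters in one place: squared increments have mean size \<open>h\<close> up to
  logarithms, and the weights \<open>2 powr (2 * \<theta> * j)\<close> are summable against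
  \<open>h = 1 / 2^j\<close> exactly for \<open>\<theta> < 1/2\<close>. Summing over the frequencies
  costs a factor \<open>2 powr (\<eta> * J)\<close> with \<open>\<eta>\<close> small; it is absorbed
  because a Fejer mean of order \<open>16^J\<close> of a Hoelder function has error
  \<open>2 powr (- 2 * \<theta> * J)\<close>, twice the exponent required.

  The link between the two halves is \<open>\<parallel>g\<parallel>_2^2 \<le>
  \<parallel>g\<parallel>_\<infinity> \<parallel>g\<parallel>_1\<close> for an increment
  \<open>g\<close> of \<open>v\<close>: the Hoelder bound that limits the dimension from above also
  forces the \<open>L^1\<close> modulus, and with it the dimension, to be large.\<close>

definition fej :: "nat \<Rightarrow> int \<Rightarrow> real" where
  "fej N n = max 0 (1 - \<bar>real_of_int n\<bar> / real N)"

text \<open>Written through the square of a one-sided geometric sum, so that nonnegativity is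
  visible; \<open>fejer_kernel_eq\<close> recovers the triangular weights
  \<open>fej\<close>.\<close>

definition fejer_kernel :: "nat \<Rightarrow> real \<Rightarrow> real" where
  "fejer_kernel N x = (cmod (\<Sum>k<N. cis (real k * x)))\<^sup>2 / real N"

lemma fej_nonneg: "0 \<le> fej N n" and fej_le_1: "fej N n \<le> 1"
  by (auto simp: fej_def)

lemma fej_0: "fej N 0 = 1"
  by (simp add: fej_def)

lemma fej_1: "N \<ge> 1 \<Longrightarrow> fej N 1 = 1 - 1 / real N"
  by (simp add: fej_def)

lemma fej_eq_0: "N \<ge> 1 \<Longrightarrow> n \<notin> {- int N..int N} \<Longrightarrow> fej N n = 0"
  by (auto simp: fej_def divide_simps)

lemma sum_int_symmetric:
  fixes f :: "int \<Rightarrow> 'a::comm_monoid_add"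
  shows "(\<Sum>n\<in>{- int N..int N}. f n) = f 0 + (\<Sum>k<N. f (int (Suc k)) + f (- int (Suc k)))"
proof (induction N)
  case 0
  then show ?case by simp
next
  case (Suc N)
  have "{- int (Suc N)..int (Suc N)} = insert (int (Suc N)) (insert (- int (Suc N)) {- int N..int N})"
    by auto
  then have "(\<Sum>n\<in>{- int (Suc N)..int (Suc N)}. f n)
      = f (int (Suc N)) + (f (- int (Suc N)) + (\<Sum>n\<in>{- int N..int N}. f n))"
    by (simp add: sum.insert)
  also have "\<dots> = f 0 + (\<Sum>k<Suc N. f (int (Suc k)) + f (- int (Suc k)))"
    by (subst Suc.IH) (simp add: algebra_simps del: of_nat_Suc)
  finally show ?case .
qed

text \<open>Raising \<open>N\<close> adds a full two-sided exponential sum on the left. On the right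
  it adds the cross terms of \<open>|D + z|^2\<close> with \<open>z = cis (N x)\<close>, and these
  are the same sum after reversing \<open>k\<close> to \<open>N - k\<close>.\<close>

lemma sum_cis_square:
  "(\<Sum>n\<in>{- int N..int N}. complex_of_real (real N - \<bar>real_of_int n\<bar>) * cis (of_int n * x))
     = complex_of_real ((cmod (\<Sum>k<N. cis (real k * x)))\<^sup>2)"
proof (induction N)
  case 0
  then show ?case by simp
next
  case (Suc N)
  let ?D = "\<Sum>k<N. cis (real k * x)"
  let ?z = "cis (real N * x)"
  have e: "{- int (Suc N)..int (Suc N)} = insert (int (Suc N)) (insert (- int (Suc N)) {- int N..int N})"
    by auto
  \<comment> \<open>The two new outermost indices carry weight zero.\<close>
  have "(\<Sum>n\<in>{- int (Suc N)..int (Suc N)}. complex_of_real (real (Suc N) - \<bar>real_of_int n\<bar>) * cis (of_int n * x))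
      = (\<Sum>n\<in>{- int N..int N}. complex_of_real (real (Suc N) - \<bar>real_of_int n\<bar>) * cis (of_int n * x))"
    unfolding e by (subst sum.insert; simp)+
  also have "\<dots> = (\<Sum>n\<in>{- int N..int N}. complex_of_real (real N - \<bar>real_of_int n\<bar>) * cis (of_int n * x))
      + (\<Sum>n\<in>{- int N..int N}. cis (of_int n * x))"
    by (simp add: sum.distrib[symmetric] algebra_simps)
  also have "\<dots> = complex_of_real ((cmod ?D)\<^sup>2) + (\<Sum>n\<in>{- int N..int N}. cis (of_int n * x))"
    by (simp only: Suc.IH)
  also have "(\<Sum>n\<in>{- int N..int N}. cis (of_int n * x))
      = 1 + (\<Sum>k<N. cis (real (Suc k) * x) + cis (- real (Suc k) * x))"
    by (subst sum_int_symmetric) simp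
  also have "(\<Sum>k<N. cis (real (Suc k) * x) + cis (- real (Suc k) * x))
      = (\<Sum>k<N. cis (real (N - k) * x) + cis (- real (N - k) * x))"
    by (subst sum.nat_diff_reindex[symmetric]) (rule sum.cong, auto simp: Suc_diff_Suc)
  also have "\<dots> = (\<Sum>k<N. cis (real N * x) * cnj (cis (real k * x)) + cnj (cis (real N * x)) * cis (real k * x))"
    by (rule sum.cong) (auto simp: cis_mult cis_cnj of_nat_diff algebra_simps)
  also have "\<dots> = ?z * cnj ?D + cnj ?z * ?D"
    by (simp add: sum.distrib sum_distrib_left)
  also have "complex_of_real ((cmod ?D)\<^sup>2) + (1 + (?z * cnj ?D + cnj ?z * ?D)) = (?D + ?z) * cnj (?D + ?z)"
  proof -
    have "?z * cnj ?z = 1" by (simp add: cis_cnj cis_mult)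
    moreover have "complex_of_real ((cmod ?D)\<^sup>2) = ?D * cnj ?D" by (rule complex_norm_square)
    ultimately show ?thesis
      by (simp only: complex_cnj_add ring_distribs) (simp only: algebra_simps)
  qed
  also have "\<dots> = complex_of_real ((cmod (\<Sum>k<Suc N. cis (real k * x)))\<^sup>2)"
    by (subst complex_norm_square) simp
  finally show ?case .
qed

lemma fejer_kernel_eq:
  assumes "N \<ge> 1"
  shows "(\<Sum>n\<in>{- int N..int N}. complex_of_real (fej N n) * cis (of_int n * x)) = complex_of_real (fejer_kernel N x)"
proof -
  have "complex_of_real (fej N n) = complex_of_real (real N - \<bar>real_of_int n\<bar>) / of_nat N"
    if "n \<in> {- int N..int N}" for n
  proof -
    have "fej N n = (real N - \<bar>real_of_int n\<bar>) / real N"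
      using assms that by (auto simp: fej_def divide_simps)
    then show ?thesis by simp
  qed
  then have "(\<Sum>n\<in>{- int N..int N}. complex_of_real (fej N n) * cis (of_int n * x))
    = (\<Sum>n\<in>{- int N..int N}. (complex_of_real (real N - \<bar>real_of_int n\<bar>) * cis (of_int n * x)) / of_nat N)"
    by (intro sum.cong) auto
  then show ?thesis
    unfolding sum_divide_distrib[symmetric] sum_cis_square fejer_kernel_def by simp
qed

lemma fejer_kernel_nonneg: "0 \<le> fejer_kernel N x"
  by (simp add: fejer_kernel_def)

lemma continuous_on_cis' [continuous_intros]:
  "continuous_on A f \<Longrightarrow> continuous_on A (\<lambda>x. cis (f x))"
  by (simp add: cis_conv_exp continuous_intros)

lemma continuous_fejer_kernel [continuous_intros]:
  "continuous_on A f \<Longrightarrow> continuous_on A (\<lambda>x. fejer_kernel N (f x))"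
  unfolding fejer_kernel_def divide_inverse by (intro continuous_intros)

lemma cis_2pi_int: "cis (2 * pi * of_int k) = 1"
  by (simp add: complex_eq_iff cos_int_2pin sin_int_2pin)

lemma has_integral_cis:
  assumes "a \<le> b" "\<xi> \<noteq> 0"
  shows "((\<lambda>x. cis (\<xi> * x)) has_integral (cis (\<xi> * b) - cis (\<xi> * a)) / (\<i> * \<xi>)) {a..b}"
proof -
  have "((\<lambda>x. cis (\<xi> * x) / (\<i> * complex_of_real \<xi>)) has_vector_derivative cis (\<xi> * x)) (at x within {a..b})" for x
  proof -
    have "((\<lambda>z. exp (\<i> * complex_of_real \<xi> * z) / (\<i> * complex_of_real \<xi>)) has_field_derivative
            exp (\<i> * complex_of_real \<xi> * of_real x)) (at (of_real x))"
      by (rule derivative_eq_intros refl | use assms in simp)+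
    from has_vector_derivative_real_field[OF this, of "{a..b}"] show ?thesis
      by (simp add: cis_conv_exp mult_ac)
  qed
  from fundamental_theorem_of_calculus[OF assms(1) this] show ?thesis
    by (simp add: diff_divide_distrib)
qed

lemma norm_integral_cis_le:
  assumes "\<xi> \<noteq> 0"
  shows "norm (integral {a..b} (\<lambda>x. cis (\<xi> * x))) \<le> 2 / \<bar>\<xi>\<bar>"
proof (cases "a \<le> b")
  case True
  have "integral {a..b} (\<lambda>x. cis (\<xi> * x)) = (cis (\<xi> * b) - cis (\<xi> * a)) / (\<i> * \<xi>)"
    using has_integral_cis[OF True assms] by (rule integral_unique)
  moreover have "norm (cis (\<xi> * b) - cis (\<xi> * a)) \<le> 2"
    using norm_triangle_ineq4[of "cis (\<xi> * b)" "cis (\<xi> * a)"] by simp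
  ultimately show ?thesis using assms by (simp add: norm_divide norm_mult divide_right_mono)
qed (use assms in auto)

lemma norm_integral_cis_le_length:
  assumes "a \<le> b"
  shows "norm (integral {a..b} (\<lambda>x. cis (\<xi> * x))) \<le> b - a"
proof -
  have "norm (integral {a..b} (\<lambda>x. cis (\<xi> * x))) \<le> integral {a..b} (\<lambda>x. 1)"
    by (intro integral_norm_bound_integral integrable_continuous_real continuous_intros) auto
  then show ?thesis using assms by simp
qed

lemma min_quotient_le:
  fixes l v x :: real
  assumes "v \<le> l" "x \<noteq> 0 \<Longrightarrow> v \<le> 2 / \<bar>x\<bar>" "0 \<le> l"
  shows "v \<le> (l + 2) / (1 + \<bar>x\<bar>)"
proof (cases "x = 0")
  case False
  with assms have "v * \<bar>x\<bar> \<le> 2" by (simp add: field_simps)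
  with assms(1) have "v * (1 + \<bar>x\<bar>) \<le> l + 2" by (simp add: algebra_simps)
  then show ?thesis by (simp add: field_simps)
qed (use assms in auto)

lemma norm_integral_cis_le':
  assumes "a \<le> b" "b - a \<le> l"
  shows "norm (integral {a..b} (\<lambda>x. cis (\<xi> * x))) \<le> (l + 2) / (1 + \<bar>\<xi>\<bar>)"
  by (rule min_quotient_le)
     (use assms norm_integral_cis_le[of \<xi> a b] norm_integral_cis_le_length[of a b \<xi>] in auto)

lemma integral_cis_period:
  assumes "b = a + 2 * pi * of_nat m"
  shows "integral {a..b} (\<lambda>x. cis (of_int n * x)) = (if n = 0 then 2 * pi * of_nat m else 0)"
proof (cases "n = 0")
  case False
  have "cis (of_int n * b) = cis (of_int n * a) * cis (2 * pi * of_int (n * int m))"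
    unfolding cis_mult assms by (simp add: algebra_simps)
  then have "cis (of_int n * b) = cis (of_int n * a)"
    by (simp only: cis_2pi_int) simp
  moreover have "a \<le> b" using assms by simp
  ultimately show ?thesis
    using integral_unique[OF has_integral_cis[of a b "of_int n"]] False by simp
qed (use assms in \<open>simp add: scaleR_conv_of_real\<close>)

section \<open>Fourier transforms of intervals and their autocorrelations\<close>

definition box_ft :: "real \<Rightarrow> real \<Rightarrow> real \<Rightarrow> complex" where
  "box_ft a b \<xi> = integral {a..b} (\<lambda>x. cis (- \<xi> * x))"

lemma box_ft_lebesgue:
  "box_ft a b \<xi> = (LINT x|lborel. indicator {a..b} x * cis (- \<xi> * x))"
proof -
  have "set_integrable lborel {a..b} (\<lambda>x. cis (- \<xi> * x))"
    by (intro borel_integrable_atLeastAtMost' continuous_intros)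
  from set_borel_integral_eq_integral(2)[OF this]
  show ?thesis
    by (simp add: box_ft_def set_lebesgue_integral_def indicator_def of_bool_def if_distrib[where f="\<lambda>c. c *\<^sub>R _"]
        if_distrib[where f="\<lambda>c. c * _"] cong: if_cong)
qed

text \<open>As a function of \<open>\<xi>\<close> the product is the Fourier transform of the
  modulated autocorrelation of the interval,
  \<open>f y = \<integral> 1(x + y) 1(x) cis (- \<delta> x) dx\<close>. Since \<open>f y\<close> is
  an exponential integral over an interval of length at most \<open>b - a\<close>, both bounds hold
  uniformly in \<open>y\<close>. In this form the sum over frequencies can later be carried out
  under the integral.\<close>

lemma box_ft_autocorrelation:
  fixes a b \<delta> :: real
  assumes "a \<le> b"
  shows "\<exists>f. continuous_on {-(b-a)..b-a} f \<and> (\<forall>y\<in>{-(b-a)..b-a}. norm (f y) \<le> b - a) \<and>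
    (\<forall>y\<in>{-(b-a)..b-a}. \<delta> \<noteq> 0 \<longrightarrow> norm (f y) \<le> 2 / \<bar>\<delta>\<bar>) \<and>
    (\<forall>\<xi>. box_ft a b \<xi> * cnj (box_ft a b (\<xi> - \<delta>)) = integral {-(b-a)..b-a} (\<lambda>y. f y * cis (- \<xi> * y)))"
proof -
  \<comment> \<open>The endpoints are those of the overlap of \<open>[a, b]\<close> with its
    translate by \<open>- y\<close>.\<close>
  define f where "f y = box_ft (max a (a - y)) (min b (b - y)) \<delta>" for y
  have le: "max a (a - y) \<le> min b (b - y)" if "y \<in> {-(b-a)..b-a}" for y
    using that assms by auto
  have cont: "continuous_on {-(b-a)..b-a} f"
  \<comment> \<open>The antiderivative divides by \<open>\<delta>\<close>, so the unmodulated
    overlap is treated by its length.\<close>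
  proof (cases "\<delta> = 0")
    case True
    have "f y = complex_of_real (min b (b - y) - max a (a - y))" if "y \<in> {-(b-a)..b-a}" for y
      using le[OF that] by (simp add: f_def box_ft_def True scaleR_conv_of_real)
    moreover have "continuous_on {-(b-a)..b-a} (\<lambda>y. complex_of_real (min b (b - y) - max a (a - y)))"
      by (intro continuous_intros)
    ultimately show ?thesis by (subst continuous_on_cong[OF refl]) auto
  next
    case False
    have "f y = (cis (-\<delta> * min b (b - y)) - cis (-\<delta> * max a (a - y))) / (\<i> * complex_of_real (-\<delta>))"
      if "y \<in> {-(b-a)..b-a}" for y
      using integral_unique[OF has_integral_cis[OF le[OF that], of "-\<delta>"]] False
      by (simp add: f_def box_ft_def)
    moreover have "continuous_on {-(b-a)..b-a}
       (\<lambda>y. (cis (-\<delta> * min b (b - y)) - cis (-\<delta> * max a (a - y))) / (\<i> * complex_of_real (-\<delta>)))"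
      unfolding divide_inverse by (intro continuous_intros)
    ultimately show ?thesis by (subst continuous_on_cong[OF refl]) auto
  qed
  have f_le: "norm (f y) \<le> b - a" if "y \<in> {-(b-a)..b-a}" for y
    using norm_integral_cis_le_length[OF le[OF that], of "-\<delta>"] by (auto simp: f_def box_ft_def)
  have f_le': "norm (f y) \<le> 2 / \<bar>\<delta>\<bar>" if "\<delta> \<noteq> 0" for y
    using norm_integral_cis_le[of "-\<delta>"] that by (auto simp: f_def box_ft_def)
  have "box_ft a b \<xi> * cnj (box_ft a b (\<xi> - \<delta>)) = integral {-(b-a)..b-a} (\<lambda>y. f y * cis (- \<xi> * y))" for \<xi>
  proof -
  \<comment> \<open>The integrand after writing the first variable as \<open>x + y\<close>: the
    phases then separate into \<open>\<xi> y\<close> and \<open>\<delta> x\<close>, and Fubini can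
    integrate \<open>x\<close> first.\<close>
  define F where "F = (\<lambda>x y. (indicator {a..b} (x + y) * indicator {a..b} x) *
      (cis (-\<xi> * y) * cis (-\<delta> * x)) :: complex)"
  have "box_ft a b \<xi> * cnj (box_ft a b (\<xi> - \<delta>))
      = (LINT x|lborel. box_ft a b \<xi> * (indicator {a..b} x * cis ((\<xi> - \<delta>) * x)))"
  proof -
    have "cnj (box_ft a b (\<xi> - \<delta>)) = (LINT x|lborel. indicator {a..b} x * cis ((\<xi> - \<delta>) * x))"
      unfolding box_ft_lebesgue
      by (subst Bochner_Integration.integral_cnj[symmetric], intro Bochner_Integration.integral_cong refl)
         (auto simp: cis_cnj indicator_def algebra_simps)
    then show ?thesis by (simp only: integral_mult_right_zero)
  qed
  also have "\<dots> = (LINT x|lborel. LINT y|lborel. F x y)"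
  proof (rule Bochner_Integration.integral_cong[OF refl])
    fix x :: real
    have "box_ft a b \<xi> = (LINT y|lborel. indicator {a..b} (x + y) * cis (- \<xi> * (x + y)))"
      unfolding box_ft_lebesgue
      using lborel_integral_real_affine[of 1 "\<lambda>x. indicator {a..b} x * cis (- \<xi> * x)" x] by simp
    then have "box_ft a b \<xi> * (indicator {a..b} x * cis ((\<xi> - \<delta>) * x))
       = (LINT y|lborel. indicator {a..b} (x + y) * cis (- \<xi> * (x + y)) * (indicator {a..b} x * cis ((\<xi> - \<delta>) * x)))"
      by (simp add: integral_mult_left_zero)
    also have "\<dots> = (LINT y|lborel. F x y)"
    proof (rule Bochner_Integration.integral_cong[OF refl])
      fix y
      have "cis (- \<xi> * (x + y)) * cis ((\<xi> - \<delta>) * x) = cis (-\<xi> * y) * cis (-\<delta> * x)"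
        by (simp add: cis_mult algebra_simps)
      then show "indicator {a..b} (x + y) * cis (- \<xi> * (x + y)) * (indicator {a..b} x * cis ((\<xi> - \<delta>) * x)) = F x y"
        unfolding F_def by (simp add: indicator_def)
    qed
    finally show "box_ft a b \<xi> * (indicator {a..b} x * cis ((\<xi> - \<delta>) * x)) = (LINT y|lborel. F x y)" .
  qed
  also have "\<dots> = (LINT y|lborel. LINT x|lborel. F x y)"
  proof (rule lborel_pair.Fubini_integral[symmetric])
    let ?A = "{a..b} \<times> {a-b..b-a}"
    show "integrable (lborel \<Otimes>\<^sub>M lborel) (\<lambda>(x, y). F x y)"
    proof (rule integrableI_bounded_set[where A="?A" and B=1])
      show "?A \<in> sets (lborel \<Otimes>\<^sub>M lborel)" by simp
      show "(\<lambda>(x, y). F x y) \<in> borel_measurable (lborel \<Otimes>\<^sub>M lborel)"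
        unfolding F_def cis_conv_exp by measurable
      show "emeasure (lborel \<Otimes>\<^sub>M lborel) ?A < \<infinity>"
        by (subst lborel.emeasure_pair_measure_Times) (auto simp: ennreal_mult_less_top emeasure_lborel_Icc_eq)
      show "AE x in lborel \<Otimes>\<^sub>M lborel. x \<in> ?A \<longrightarrow> norm (case x of (x, y) \<Rightarrow> F x y) \<le> 1"
        by (rule AE_I2) (auto simp: F_def indicator_def norm_mult)
      show "AE x in lborel \<Otimes>\<^sub>M lborel. x \<notin> ?A \<longrightarrow> (case x of (x, y) \<Rightarrow> F x y) = 0"
        by (rule AE_I2) (auto simp: F_def indicator_def)
    qed
  qed
  also have "\<dots> = (LINT y|lborel. indicator {-(b-a)..b-a} y *\<^sub>R (f y * cis (-\<xi> * y)))"
  proof (rule Bochner_Integration.integral_cong[OF refl])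
    fix y
    have "(LINT x|lborel. F x y) = (LINT x|lborel. cis (-\<xi> * y) * (indicator {max a (a - y)..min b (b - y)} x * cis (-\<delta> * x)))"
      by (intro Bochner_Integration.integral_cong refl) (auto simp: F_def indicator_def)
    also have "\<dots> = cis (-\<xi> * y) * f y"
      unfolding f_def box_ft_lebesgue by (rule integral_mult_right_zero)
    also have "\<dots> = indicator {-(b-a)..b-a} y *\<^sub>R (f y * cis (-\<xi> * y))"
    proof (cases "y \<in> {-(b-a)..b-a}")
      case False
      then have "{max a (a - y)..min b (b - y)} = {}" by auto
      then have "f y = 0" unfolding f_def box_ft_def by simp
      then show ?thesis by simp
    qed simp
    finally show "(LINT x|lborel. F x y) = indicator {-(b-a)..b-a} y *\<^sub>R (f y * cis (-\<xi> * y))" .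
  qed
  also have "\<dots> = integral {-(b-a)..b-a} (\<lambda>y. f y * cis (- \<xi> * y))"
    using set_borel_integral_eq_integral(2)[of "{-(b-a)..b-a}" "\<lambda>y. f y * cis (- \<xi> * y)"]
      borel_integrable_atLeastAtMost'[of "-(b-a)" "b-a" "\<lambda>y. f y * cis (- \<xi> * y)"] cont
    by (simp add: set_lebesgue_integral_def continuous_intros)
  finally show ?thesis .
  qed
  with cont f_le f_le' show ?thesis by blast
qed

section \<open>The self-convolution of the Fejer kernel\<close>

definition fejer_conv :: "nat \<Rightarrow> real \<Rightarrow> real" where
  "fejer_conv N z = integral {0..2*pi} (\<lambda>x. fejer_kernel N x * fejer_kernel N (z - x)) / (2 * pi)"

lemma fejer_conv_nonneg: "0 \<le> fejer_conv N z"
  unfolding fejer_conv_def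
  by (intro divide_nonneg_nonneg integral_nonneg integrable_continuous_real continuous_intros)
     (auto simp: fejer_kernel_nonneg)

text \<open>The factor \<open>cis (d x)\<close> shifts the coefficients of one of the two convolved
  kernels by \<open>d\<close>; orthogonality over a period then selects
  \<open>m = n - d\<close>.\<close>

lemma shifted_fej_product_sum:
  assumes N: "N \<ge> 1"
  shows "(\<Sum>n\<in>{- int N..int N}. complex_of_real (fej N n * fej N (n - d)) * cis (of_int n * z))
    = integral {0..2*pi} (\<lambda>x. complex_of_real (fejer_kernel N x * fejer_kernel N (z - x)) * cis (of_int d * x)) / (2 * pi)"
proof -
  let ?B = "{- int N..int N}"
  have "complex_of_real (fejer_kernel N x * fejer_kernel N (z - x)) * cis (of_int d * x)
     = (\<Sum>n\<in>?B. \<Sum>m\<in>?B. complex_of_real (fej N n * fej N m) * cis (of_int n * z) * cis (of_int (m - n + d) * x))" for x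
  proof -
    have "complex_of_real (fejer_kernel N x * fejer_kernel N (z - x)) * cis (of_int d * x)
       = (\<Sum>n\<in>?B. complex_of_real (fej N n) * cis (of_int n * (z - x))) *
         (\<Sum>m\<in>?B. complex_of_real (fej N m) * cis (of_int m * x)) * cis (of_int d * x)"
      unfolding fejer_kernel_eq[OF N] by simp
    also have "\<dots> = (\<Sum>n\<in>?B. \<Sum>m\<in>?B. complex_of_real (fej N n) * cis (of_int n * (z - x)) *
          (complex_of_real (fej N m) * cis (of_int m * x)) * cis (of_int d * x))"
      by (simp only: sum_product) (simp only: sum_distrib_right)
    also have "\<dots> = (\<Sum>n\<in>?B. \<Sum>m\<in>?B. complex_of_real (fej N n * fej N m) * cis (of_int n * z) * cis (of_int (m - n + d) * x))"
    proof (intro sum.cong refl)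
      fix n m
      have "cis (of_int n * (z - x)) * cis (of_int m * x) * cis (of_int d * x) = cis (of_int n * z) * cis (of_int (m - n + d) * x)"
        by (simp add: cis_mult algebra_simps)
      then show "complex_of_real (fej N n) * cis (of_int n * (z - x)) * (complex_of_real (fej N m) * cis (of_int m * x)) * cis (of_int d * x)
        = complex_of_real (fej N n * fej N m) * cis (of_int n * z) * cis (of_int (m - n + d) * x)"
        by (simp add: mult_ac)
    qed
    finally show ?thesis .
  qed
  then have "integral {0..2*pi} (\<lambda>x. complex_of_real (fejer_kernel N x * fejer_kernel N (z - x)) * cis (of_int d * x))
    = integral {0..2*pi} (\<lambda>x. \<Sum>n\<in>?B. \<Sum>m\<in>?B. complex_of_real (fej N n * fej N m) * cis (of_int n * z) * cis (of_int (m - n + d) * x))"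
    by simp
  also have "\<dots> = (\<Sum>n\<in>?B. \<Sum>m\<in>?B. complex_of_real (fej N n * fej N m) * cis (of_int n * z) * integral {0..2*pi} (\<lambda>x. cis (of_int (m - n + d) * x)))"
    by (subst integral_sum, simp, intro integrable_continuous_real continuous_intros,
        intro sum.cong refl, subst integral_sum, simp, intro integrable_continuous_real continuous_intros,
        intro sum.cong refl integral_mult_right)
  also have "\<dots> = (\<Sum>n\<in>?B. \<Sum>m\<in>?B. if m = n - d then complex_of_real (fej N n * fej N m) * cis (of_int n * z) * (2 * pi) else 0)"
    by (intro sum.cong refl) (subst integral_cis_period[of _ _ 1], auto)
  also have "\<dots> = (\<Sum>n\<in>?B. complex_of_real (fej N n * fej N (n - d)) * cis (of_int n * z) * (2 * pi))"
  proof (intro sum.cong refl)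
    fix n
    \<comment> \<open>If \<open>n - d\<close> leaves the range of summation, its Fejer weight
      vanishes, so the truncation loses nothing.\<close>
    show "(\<Sum>m\<in>?B. if m = n - d then complex_of_real (fej N n * fej N m) * cis (of_int n * z) * (2 * pi) else 0)
      = complex_of_real (fej N n * fej N (n - d)) * cis (of_int n * z) * (2 * pi)"
      using fej_eq_0[OF N, of "n - d"] by (subst sum.delta) auto
  qed
  finally show ?thesis by (simp add: sum_distrib_right[symmetric])
qed

text \<open>The shift only inserts a unimodular factor into a convolution of nonnegative kernels, so
  it disappears in absolute value. The majorant is the same for every \<open>d\<close>, which is the
  reason for using Fejer weights.\<close>

lemma norm_shifted_fej_product_sum_le:
  assumes N: "N \<ge> 1"
  shows "norm (\<Sum>n\<in>{- int N..int N}. complex_of_real (fej N n * fej N (n - d)) * cis (of_int n * z)) \<le> fejer_conv N z"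
proof -
  have "norm (integral {0..2*pi} (\<lambda>x. complex_of_real (fejer_kernel N x * fejer_kernel N (z - x)) * cis (of_int d * x)))
    \<le> integral {0..2*pi} (\<lambda>x. fejer_kernel N x * fejer_kernel N (z - x))"
    by (intro integral_norm_bound_integral integrable_continuous_real continuous_intros)
       (auto simp: norm_mult fejer_kernel_nonneg)
  then show ?thesis
    unfolding shifted_fej_product_sum[OF N] fejer_conv_def by (simp add: norm_divide divide_right_mono norm_mult)
qed

lemma fejer_conv_eq:
  assumes N: "N \<ge> 1"
  shows "complex_of_real (fejer_conv N z) = (\<Sum>n\<in>{- int N..int N}. complex_of_real ((fej N n)\<^sup>2) * cis (of_int n * z))"
proof -
  have "integral {0..2*pi} (\<lambda>x. complex_of_real (fejer_kernel N x * fejer_kernel N (z - x)))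
     = complex_of_real (integral {0..2*pi} (\<lambda>x. fejer_kernel N x * fejer_kernel N (z - x)))"
    by (rule integral_linear[OF _ bounded_linear_of_real, unfolded o_def])
       (intro integrable_continuous_real continuous_intros)
  then show ?thesis
    using shifted_fej_product_sum[OF N, of 0 z] by (simp add: fejer_conv_def power2_eq_square)
qed

lemma continuous_fejer_conv [continuous_intros]:
  assumes "N \<ge> 1" "continuous_on A f"
  shows "continuous_on A (\<lambda>x. fejer_conv N (f x))"
proof -
  have "fejer_conv N z = Re (\<Sum>n\<in>{- int N..int N}. complex_of_real ((fej N n)\<^sup>2) * cis (of_int n * z))" for z
    by (subst fejer_conv_eq[OF assms(1), symmetric]) simp
  then show ?thesis
    by (simp only:) (intro continuous_intros assms(2))
qed

lemma integral_fejer_conv: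
  assumes "N \<ge> 1" "b = a + 2 * pi * of_nat m"
  shows "integral {a..b} (\<lambda>x. fejer_conv N (c - x)) = 2 * pi * of_nat m"
proof -
  let ?B = "{- int N..int N}"
  have "complex_of_real (integral {a..b} (\<lambda>x. fejer_conv N (c - x))) = integral {a..b} (\<lambda>x. complex_of_real (fejer_conv N (c - x)))"
    by (rule integral_linear[OF _ bounded_linear_of_real, unfolded o_def, symmetric])
       (intro integrable_continuous_real continuous_intros assms(1))
  also have "(\<lambda>x. complex_of_real (fejer_conv N (c - x)))
      = (\<lambda>x. \<Sum>n\<in>?B. complex_of_real ((fej N n)\<^sup>2) * cis (of_int n * c) * cis (of_int (- n) * x))"
    unfolding fejer_conv_eq[OF assms(1)]
    by (intro ext sum.cong refl) (simp add: mult.assoc cis_mult algebra_simps)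
  also have "integral {a..b} \<dots> = (\<Sum>n\<in>?B. complex_of_real ((fej N n)\<^sup>2) * cis (of_int n * c) * integral {a..b} (\<lambda>x. cis (of_int (- n) * x)))"
    by (subst integral_sum, simp, intro integrable_continuous_real continuous_intros,
        intro sum.cong refl integral_mult_right)
  also have "\<dots> = (\<Sum>n\<in>?B. if n = 0 then complex_of_real (2 * pi * of_nat m) else 0)"
    by (intro sum.cong refl, subst integral_cis_period[OF assms(2)]) (auto simp: fej_0)
  also have "\<dots> = complex_of_real (2 * pi * of_nat m)" by (subst sum.delta) auto
  finally show ?thesis by (simp only: of_real_eq_iff)
qed

lemma integral_fejer_conv_le:
  assumes "N \<ge> 1" "b - a \<le> 2 * pi * of_nat m"
  shows "integral {a..b} (\<lambda>x. fejer_conv N (c - x)) \<le> 2 * pi * of_nat m"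
proof -
  have "integral {a..b} (\<lambda>x. fejer_conv N (c - x)) \<le> integral {a..a + 2 * pi * of_nat m} (\<lambda>x. fejer_conv N (c - x))"
    by (intro integral_subset_le integrable_continuous_real continuous_intros assms(1))
       (use assms in \<open>auto simp: fejer_conv_nonneg\<close>)
  then show ?thesis by (simp add: integral_fejer_conv[OF assms(1) refl])
qed

section \<open>The maximal estimate for parallelograms\<close>

definition grid :: "nat \<Rightarrow> (int \<times> int) set" where
  "grid N = {- int N..int N} \<times> {- int N..int N}"

definition fej2 :: "nat \<Rightarrow> int \<times> int \<Rightarrow> real" where
  "fej2 N n = fej N (fst n) * fej N (snd n)"

definition phase :: "real \<Rightarrow> int \<times> int \<Rightarrow> real" where
  "phase t n = t * real_of_int ((fst n)\<^sup>2 + (snd n)\<^sup>2)"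

text \<open>The Fourier transform of the strip \<open>a \<le> x\<^sub>1 \<le> b\<close>, \<open>0 \<le> x\<^sub>2 - s x\<^sub>1 - c \<le> h\<close>, at the integer point \<open>n\<close>.\<close>

definition strip_coeff :: "real \<Rightarrow> real \<Rightarrow> real \<Rightarrow> real \<Rightarrow> real \<Rightarrow> int \<times> int \<Rightarrow> complex" where
  "strip_coeff s a b c h n = cis (- c * of_int (snd n)) * box_ft a b (of_int (fst n) + s * of_int (snd n))
      * box_ft 0 h (of_int (snd n))"

lemma finite_grid [simp]: "finite (grid N)"
  by (simp add: grid_def)

lemma fej2_eq_0: "N \<ge> 1 \<Longrightarrow> n \<notin> grid N \<Longrightarrow> fej2 N n = 0"
  by (cases n) (auto simp: grid_def fej2_def fej_eq_0)

lemma fej2_nonneg: "0 \<le> fej2 N n" and fej2_le_1: "fej2 N n \<le> 1"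
  using fej_nonneg[of N] fej_le_1[of N] by (auto simp: fej2_def mult_le_one)

text \<open>Grouping \<open>\<bar>F\<bar>\<^sup>2\<close> by frequency differences \<open>d\<close> removes the dependence on \<open>x\<close>,
  and \<open>\<bar>n\<bar>\<^sup>2 - \<bar>n - d\<bar>\<^sup>2\<close> is affine in \<open>n\<close>.\<close>

lemma evolution_square_le:
  fixes \<beta> :: "int \<times> int \<Rightarrow> complex"
  assumes \<beta>: "\<And>n. n \<notin> grid N \<Longrightarrow> \<beta> n = 0"
  shows "(norm (\<Sum>n\<in>grid N. \<beta> n * cis (- phase t n) * cis (of_int (fst n) * x + of_int (snd n) * y)))\<^sup>2
    \<le> (\<Sum>d\<in>grid (2 * N). norm (\<Sum>n\<in>grid N. \<beta> n * cnj (\<beta> (n - d))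
          * cis (of_int (fst n) * (- 2 * t * of_int (fst d)) + of_int (snd n) * (- 2 * t * of_int (snd d)))))"
proof -
  define \<theta> where "\<theta> n = - phase t n + (of_int (fst n) * x + of_int (snd n) * y)" for n
  define F where "F = (\<Sum>n\<in>grid N. \<beta> n * cis (\<theta> n))"
  define \<rho> where "\<rho> d = t * of_int ((fst d)\<^sup>2 + (snd d)\<^sup>2) + of_int (fst d) * x + of_int (snd d) * y" for d
  have F: "F = (\<Sum>n\<in>grid N. \<beta> n * cis (- phase t n) * cis (of_int (fst n) * x + of_int (snd n) * y))"
    by (simp add: F_def \<theta>_def cis_mult mult.assoc)
  have reindex: "(\<Sum>m\<in>grid N. cnj (\<beta> m) * cis (- \<theta> m))
      = (\<Sum>d\<in>grid (2 * N). cnj (\<beta> (n - d)) * cis (- \<theta> (n - d)))" if "n \<in> grid N" for n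
  proof -
    have "(\<Sum>d\<in>grid (2 * N). cnj (\<beta> (n - d)) * cis (- \<theta> (n - d)))
        = (\<Sum>d\<in>(\<lambda>m. n - m) ` grid N. cnj (\<beta> (n - d)) * cis (- \<theta> (n - d)))"
    proof (rule sum.mono_neutral_right)
      show "(\<lambda>m. n - m) ` grid N \<subseteq> grid (2 * N)"
        using that by (auto simp: grid_def)
      show "\<forall>i\<in>grid (2 * N) - (\<lambda>m. n - m) ` grid N. cnj (\<beta> (n - i)) * cis (- \<theta> (n - i)) = 0"
      proof
        fix i assume i: "i \<in> grid (2 * N) - (\<lambda>m. n - m) ` grid N"
        have "n - i \<notin> grid N"
        proof
          assume "n - i \<in> grid N"
          then have "n - (n - i) \<in> (\<lambda>m. n - m) ` grid N" by blast
          then show False using i by simp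
        qed
        then show "cnj (\<beta> (n - i)) * cis (- \<theta> (n - i)) = 0" using \<beta> by simp
      qed
    qed simp
    also have "\<dots> = (\<Sum>m\<in>grid N. cnj (\<beta> m) * cis (- \<theta> m))"
      by (subst sum.reindex) (auto simp: inj_on_def)
    finally show ?thesis ..
  qed
  have "complex_of_real ((norm F)\<^sup>2) = (\<Sum>n\<in>grid N. \<beta> n * cis (\<theta> n) * (\<Sum>m\<in>grid N. cnj (\<beta> m) * cis (- \<theta> m)))"
    unfolding complex_norm_square by (simp add: F_def sum_distrib_right cis_cnj)
  also have "\<dots> = (\<Sum>n\<in>grid N. \<Sum>d\<in>grid (2 * N). \<beta> n * cis (\<theta> n) * (cnj (\<beta> (n - d)) * cis (- \<theta> (n - d))))"
    by (intro sum.cong refl) (simp add: reindex sum_distrib_left)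
  also have "\<dots> = (\<Sum>d\<in>grid (2 * N). \<Sum>n\<in>grid N. \<beta> n * cis (\<theta> n) * (cnj (\<beta> (n - d)) * cis (- \<theta> (n - d))))"
    by (rule sum.swap)
  also have "\<dots> = (\<Sum>d\<in>grid (2 * N). cis (\<rho> d) * (\<Sum>n\<in>grid N. \<beta> n * cnj (\<beta> (n - d))
          * cis (of_int (fst n) * (- 2 * t * of_int (fst d)) + of_int (snd n) * (- 2 * t * of_int (snd d)))))"
    unfolding sum_distrib_left
  proof (intro sum.cong refl)
    fix d n
    have "\<theta> n - \<theta> (n - d) = \<rho> d + (of_int (fst n) * (- 2 * t * of_int (fst d)) + of_int (snd n) * (- 2 * t * of_int (snd d)))"
      by (simp add: \<theta>_def phase_def \<rho>_def power2_eq_square algebra_simps)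
    then have "cis (\<theta> n) * cis (- \<theta> (n - d)) = cis (\<rho> d) * cis (of_int (fst n) * (- 2 * t * of_int (fst d)) + of_int (snd n) * (- 2 * t * of_int (snd d)))"
      by (simp add: cis_mult)
    moreover have "\<beta> n * cis (\<theta> n) * (cnj (\<beta> (n - d)) * cis (- \<theta> (n - d))) =
        \<beta> n * cnj (\<beta> (n - d)) * (cis (\<theta> n) * cis (- \<theta> (n - d)))"
      by (simp only: mult_ac)
    ultimately show "\<beta> n * cis (\<theta> n) * (cnj (\<beta> (n - d)) * cis (- \<theta> (n - d))) = cis (\<rho> d) *
           (\<beta> n * cnj (\<beta> (n - d)) * cis (of_int (fst n) * (- 2 * t * of_int (fst d)) + of_int (snd n) * (- 2 * t * of_int (snd d))))"
      by (simp only: mult_ac)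
  qed
  finally have "norm (complex_of_real ((norm F)\<^sup>2)) \<le> (\<Sum>d\<in>grid (2 * N). norm (cis (\<rho> d) * (\<Sum>n\<in>grid N. \<beta> n * cnj (\<beta> (n - d))
          * cis (of_int (fst n) * (- 2 * t * of_int (fst d)) + of_int (snd n) * (- 2 * t * of_int (snd d))))))"
    by (simp only: norm_sum)
  then show ?thesis
    unfolding F[symmetric] norm_mult norm_cis by (simp only: norm_of_real abs_power2 mult_1)
qed

text \<open>Expanding both trigonometric polynomials leaves one exponential in \<open>y\<close> and
  one in \<open>r\<close> for each \<open>n\<close>. The shear \<open>Y2 - s * y - r\<close> adds
  \<open>s * snd n\<close> to the frequency in \<open>y\<close>, which reproduces the argument of
  the first factor of \<open>strip_coeff\<close>.\<close>

lemma sheared_integral_trig: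
  fixes f1 f2 :: "real \<Rightarrow> complex" and \<psi>1 \<psi>2 :: "int \<Rightarrow> complex"
  assumes f1: "continuous_on {l0..l1} f1" and f2: "continuous_on {h0..h1} f2"
  shows "integral {l0..l1} (\<lambda>y. integral {h0..h1} (\<lambda>r. f1 y * f2 r *
            ((\<Sum>n\<in>{- int N..int N}. \<psi>1 n * cis (of_int n * (Y1 - y))) *
             (\<Sum>n\<in>{- int N..int N}. \<psi>2 n * cis (of_int n * (Y2 - s * y - r))))))
    = (\<Sum>n\<in>grid N. \<psi>1 (fst n) * \<psi>2 (snd n) * cis (of_int (fst n) * Y1 + of_int (snd n) * Y2) *
        (integral {l0..l1} (\<lambda>y. f1 y * cis (- (of_int (fst n) + s * of_int (snd n)) * y)) *
         integral {h0..h1} (\<lambda>r. f2 r * cis (- of_int (snd n) * r))))"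
proof -
  let ?T = "\<lambda>n. \<psi>1 (fst n) * \<psi>2 (snd n) * cis (of_int (fst n) * Y1 + of_int (snd n) * Y2)"
  let ?e1 = "\<lambda>n y. f1 y * cis (- (of_int (fst n) + s * of_int (snd n)) * y)"
  let ?e2 = "\<lambda>n r. f2 r * cis (- of_int (snd n) * r)"
  have "f1 y * f2 r *
            ((\<Sum>n\<in>{- int N..int N}. \<psi>1 n * cis (of_int n * (Y1 - y))) *
             (\<Sum>n\<in>{- int N..int N}. \<psi>2 n * cis (of_int n * (Y2 - s * y - r))))
      = (\<Sum>n\<in>grid N. ?T n * (?e1 n y * ?e2 n r))" for y r
    unfolding sum_product unfolding sum.cartesian_product grid_def case_prod_beta unfolding sum_distrib_left
  proof (intro sum.cong refl)
    fix n :: "int \<times> int"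
    have "cis (of_int (fst n) * (Y1 - y)) * cis (of_int (snd n) * (Y2 - s * y - r))
        = cis (of_int (fst n) * Y1 + of_int (snd n) * Y2) * (cis (- (of_int (fst n) + s * of_int (snd n)) * y) * cis (- of_int (snd n) * r))"
      unfolding cis_mult by (rule arg_cong[where f=cis]) (simp add: algebra_simps)
    moreover have "f1 y * f2 r * (\<psi>1 (fst n) * cis (of_int (fst n) * (Y1 - y)) * (\<psi>2 (snd n) * cis (of_int (snd n) * (Y2 - s * y - r))))
      = f1 y * f2 r * \<psi>1 (fst n) * \<psi>2 (snd n) * (cis (of_int (fst n) * (Y1 - y)) * cis (of_int (snd n) * (Y2 - s * y - r)))"
      by (simp only: mult_ac)
    ultimately show "f1 y * f2 r * (\<psi>1 (fst n) * cis (of_int (fst n) * (Y1 - y)) * (\<psi>2 (snd n) * cis (of_int (snd n) * (Y2 - s * y - r)))) =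
       ?T n * (?e1 n y * ?e2 n r)"
      by (simp only: mult_ac)
  qed
  then have "integral {l0..l1} (\<lambda>y. integral {h0..h1} (\<lambda>r. f1 y * f2 r *
            ((\<Sum>n\<in>{- int N..int N}. \<psi>1 n * cis (of_int n * (Y1 - y))) *
             (\<Sum>n\<in>{- int N..int N}. \<psi>2 n * cis (of_int n * (Y2 - s * y - r))))))
     = integral {l0..l1} (\<lambda>y. integral {h0..h1} (\<lambda>r. \<Sum>n\<in>grid N. ?T n * (?e1 n y * ?e2 n r)))"
    by simp
  also have "\<dots> = integral {l0..l1} (\<lambda>y. \<Sum>n\<in>grid N. ?T n * (?e1 n y * integral {h0..h1} (?e2 n)))"
  proof (rule arg_cong[where f="integral _"], rule ext)
    fix y
    have "integral {h0..h1} (\<lambda>r. \<Sum>n\<in>grid N. ?T n * (?e1 n y * ?e2 n r))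
       = (\<Sum>n\<in>grid N. integral {h0..h1} (\<lambda>r. ?T n * (?e1 n y * ?e2 n r)))"
      by (rule integral_sum) (auto intro!: integrable_continuous_real continuous_intros f2)
    then show "integral {h0..h1} (\<lambda>r. \<Sum>n\<in>grid N. ?T n * (?e1 n y * ?e2 n r)) =
       (\<Sum>n\<in>grid N. ?T n * (?e1 n y * integral {h0..h1} (?e2 n)))"
      by simp
  qed
  also have "\<dots> = (\<Sum>n\<in>grid N. integral {l0..l1} (\<lambda>y. ?T n * (?e1 n y * integral {h0..h1} (?e2 n))))"
    by (rule integral_sum) (auto intro!: integrable_continuous_real continuous_intros f1)
  finally show ?thesis by simp
qed

text \<open>The kernel centred at \<open>(Y1, Y2)\<close> integrated over the difference set of a
  strip with base length \<open>l\<close>, height \<open>h\<close> and slope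
  \<open>s\<close>.\<close>

definition sheared_mass :: "nat \<Rightarrow> real \<Rightarrow> real \<Rightarrow> real \<Rightarrow> real \<Rightarrow> real \<Rightarrow> real" where
  "sheared_mass N s l h Y1 Y2 = integral {-l..l} (\<lambda>y. integral {-h..h} (\<lambda>r.
      fejer_conv N (Y1 - y) * fejer_conv N (Y2 - s * y - r)))"

lemma continuous_sheared_mass_inner:
  assumes "N \<ge> 1"
  shows "continuous_on A (\<lambda>y. integral {-h..h} (\<lambda>r. fejer_conv N (Y1 - y) * fejer_conv N (Y2 - s * y - r)))"
proof (cases "- h \<le> h")
  case True
  have "continuous_on (A \<times> cbox (-h) h) (\<lambda>(y, r). fejer_conv N (Y1 - y) * fejer_conv N (Y2 - s * y - r))"
    unfolding case_prod_beta by (intro continuous_intros assms)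
  from integral_continuous_on_param[OF this] show ?thesis by simp
qed simp

text \<open>Both factors of the strip coefficients turn into integrals against autocorrelations
  \<open>f1\<close> and \<open>f2\<close>, whose sizes depend on \<open>d\<close> alone. What
  remains of the sum over \<open>n\<close> is a product of two shifted Fejer sums, replaced by their
  nonnegative majorants.\<close>

lemma norm_strip_autocorrelation_le:
  assumes N: "N \<ge> 1" and ab: "a \<le> b" and h: "0 \<le> h"
  shows "norm (\<Sum>n\<in>grid N. (fej2 N n * strip_coeff s a b c h n) * cnj (fej2 N (n - d) * strip_coeff s a b c h (n - d))
            * cis (of_int (fst n) * Y1 + of_int (snd n) * Y2))
    \<le> (b - a + 2) / (1 + \<bar>of_int (fst d) + s * of_int (snd d)\<bar>) *
      (if snd d = 0 then h else min h (2 / \<bar>of_int (snd d)\<bar>)) * sheared_mass N s (b - a) h Y1 Y2"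
proof -
  \<comment> \<open>A shift of \<open>n\<close> by \<open>d\<close> moves the frequency along the
    edge by \<open>\<delta>\<close> and the frequency across it by \<open>snd d\<close>.\<close>
  define \<delta> where "\<delta> = of_int (fst d) + s * of_int (snd d)"
  obtain f1 where f1: "continuous_on {-(b-a)..b-a} f1"
    "\<And>y. y \<in> {-(b-a)..b-a} \<Longrightarrow> norm (f1 y) \<le> b - a"
    "\<And>y. \<delta> \<noteq> 0 \<Longrightarrow> y \<in> {-(b-a)..b-a} \<Longrightarrow> norm (f1 y) \<le> 2 / \<bar>\<delta>\<bar>"
    "\<And>\<xi>. box_ft a b \<xi> * cnj (box_ft a b (\<xi> - \<delta>)) = integral {-(b-a)..b-a} (\<lambda>y. f1 y * cis (- \<xi> * y))"
    using box_ft_autocorrelation[OF ab, of \<delta>] by blast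
  obtain f2 where f2: "continuous_on {-(h-0)..h-0} f2"
    "\<And>y. y \<in> {-(h-0)..h-0} \<Longrightarrow> norm (f2 y) \<le> h - 0"
    "\<And>y. real_of_int (snd d) \<noteq> 0 \<Longrightarrow> y \<in> {-(h-0)..h-0} \<Longrightarrow> norm (f2 y) \<le> 2 / \<bar>real_of_int (snd d)\<bar>"
    "\<And>\<xi>. box_ft 0 h \<xi> * cnj (box_ft 0 h (\<xi> - of_int (snd d))) = integral {-(h-0)..h-0} (\<lambda>y. f2 y * cis (- \<xi> * y))"
    using box_ft_autocorrelation[OF h, of "of_int (snd d)"] by blast
  define B1 where "B1 = (b - a + 2) / (1 + \<bar>\<delta>\<bar>)"
  define B2 where "B2 = (if snd d = 0 then h else min h (2 / \<bar>real_of_int (snd d)\<bar>))"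
  have B1: "norm (f1 y) \<le> B1" if "y \<in> {-(b-a)..b-a}" for y
    unfolding B1_def by (rule min_quotient_le) (use f1(2,3) that ab in auto)
  have B2: "norm (f2 r) \<le> B2" if "r \<in> {-h..h}" for r
    using f2(2,3) that by (auto simp: B2_def)
  have B1_nonneg: "0 \<le> B1" using ab by (simp add: B1_def)
  define M1 where "M1 z = (\<Sum>n\<in>{- int N..int N}. complex_of_real (fej N n * fej N (n - fst d)) * cis (of_int n * z))" for z
  define M2 where "M2 z = (\<Sum>n\<in>{- int N..int N}. complex_of_real (fej N n * fej N (n - snd d)) * cis (of_int n * z))" for z
  have contM: "continuous_on A (\<lambda>x. M1 (g x))" "continuous_on A (\<lambda>x. M2 (g x))" if "continuous_on A g" for A and g :: "'a::topological_space \<Rightarrow> real"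
    unfolding M1_def M2_def by (intro continuous_intros that)+
  define I where "I = integral {-(b-a)..b-a} (\<lambda>y. integral {-h..h} (\<lambda>r. f1 y * f2 r * (M1 (Y1 - y) * M2 (Y2 - s * y - r))))"
  \<comment> \<open>The offset \<open>c\<close> survives only as a unimodular factor depending on
    \<open>d\<close>, which the norm removes.\<close>
  have prod: "strip_coeff s a b c h n * cnj (strip_coeff s a b c h (n - d)) = cis (- c * of_int (snd d)) *
     (integral {-(b-a)..b-a} (\<lambda>y. f1 y * cis (- (of_int (fst n) + s * of_int (snd n)) * y)) *
      integral {-h..h} (\<lambda>y. f2 y * cis (- of_int (snd n) * y)))" for n
  proof -
    have e: "of_int (fst (n - d)) + s * (of_int (snd n) - of_int (snd d)) = (of_int (fst n) + s * of_int (snd n)) - \<delta>"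
      "real_of_int (snd (n - d)) = of_int (snd n) - of_int (snd d)"
      by (simp_all add: \<delta>_def algebra_simps)
    have "cis (- c * of_int (snd n)) * cnj (cis (- c * (of_int (snd n) - of_int (snd d)))) = cis (- c * of_int (snd d))"
      by (simp add: cis_cnj cis_mult algebra_simps)
    moreover have "(x * y * z) * (x' * y' * z') = x * x' * ((y * y') * (z * z'))" for x y z x' y' z' :: complex
      by (simp only: mult_ac)
    ultimately show ?thesis
      unfolding strip_coeff_def e f1(4)[symmetric] f2(4)[unfolded diff_zero, symmetric] complex_cnj_mult
      by (simp only:)
  qed
  have "(\<Sum>n\<in>grid N. (fej2 N n * strip_coeff s a b c h n) * cnj (fej2 N (n - d) * strip_coeff s a b c h (n - d))
            * cis (of_int (fst n) * Y1 + of_int (snd n) * Y2)) = cis (- c * of_int (snd d)) * I"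
  proof -
    have "I = (\<Sum>n\<in>grid N. complex_of_real (fej N (fst n) * fej N (fst n - fst d)) * complex_of_real (fej N (snd n) * fej N (snd n - snd d))
        * cis (of_int (fst n) * Y1 + of_int (snd n) * Y2) *
        (integral {-(b-a)..b-a} (\<lambda>y. f1 y * cis (- (of_int (fst n) + s * of_int (snd n)) * y)) *
         integral {-h..h} (\<lambda>r. f2 r * cis (- of_int (snd n) * r))))"
      unfolding I_def M1_def M2_def by (rule sheared_integral_trig[OF f1(1) f2(1)[unfolded diff_zero]])
    moreover have "(fej2 N n * strip_coeff s a b c h n) * cnj (fej2 N (n - d) * strip_coeff s a b c h (n - d)) * e
       = complex_of_real (fej2 N n) * complex_of_real (fej2 N (n - d)) * e * (strip_coeff s a b c h n * cnj (strip_coeff s a b c h (n - d)))" for n e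
      by (simp only: complex_cnj_mult complex_cnj_complex_of_real mult_ac)
    ultimately show ?thesis
      by (simp only: sum_distrib_left prod) (intro sum.cong refl, simp add: fej2_def)
  qed
  also have "norm \<dots> = norm I" by (simp add: norm_mult)
  also have "norm I \<le> integral {-(b-a)..b-a} (\<lambda>y. B1 * (B2 * integral {-h..h} (\<lambda>r. fejer_conv N (Y1 - y) * fejer_conv N (Y2 - s * y - r))))"
    unfolding I_def
  proof (rule integral_norm_bound_integral)
    have "continuous_on ({-(b-a)..b-a} \<times> cbox (-h) h) (\<lambda>(y, r). f1 y * f2 r * (M1 (Y1 - y) * M2 (Y2 - s * y - r)))"
      unfolding case_prod_beta
      by (intro continuous_intros contM continuous_on_compose2[OF f1(1)] continuous_on_compose2[OF f2(1)]) auto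
    from integral_continuous_on_param[OF this]
    show "(\<lambda>y. integral {-h..h} (\<lambda>r. f1 y * f2 r * (M1 (Y1 - y) * M2 (Y2 - s * y - r)))) integrable_on {-(b-a)..b-a}"
      by (intro integrable_continuous_real) simp
    show "(\<lambda>y. B1 * (B2 * integral {-h..h} (\<lambda>r. fejer_conv N (Y1 - y) * fejer_conv N (Y2 - s * y - r)))) integrable_on {-(b-a)..b-a}"
      by (intro integrable_continuous_real continuous_intros continuous_sheared_mass_inner N)
    fix y assume y: "y \<in> {-(b-a)..b-a}"
    have "norm (integral {-h..h} (\<lambda>r. f1 y * f2 r * (M1 (Y1 - y) * M2 (Y2 - s * y - r))))
       \<le> integral {-h..h} (\<lambda>r. B1 * (B2 * (fejer_conv N (Y1 - y) * fejer_conv N (Y2 - s * y - r))))"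
    proof (intro integral_norm_bound_integral integrable_continuous_real continuous_intros contM N f2(1)[unfolded diff_zero])
      fix r assume r: "r \<in> {-h..h}"
      have "norm (M1 (Y1 - y)) \<le> fejer_conv N (Y1 - y)" "norm (M2 (Y2 - s * y - r)) \<le> fejer_conv N (Y2 - s * y - r)"
        unfolding M1_def M2_def by (rule norm_shifted_fej_product_sum_le[OF N])+
      then have "norm (f1 y * f2 r * (M1 (Y1 - y) * M2 (Y2 - s * y - r)))
          \<le> B1 * B2 * (fejer_conv N (Y1 - y) * fejer_conv N (Y2 - s * y - r))"
        unfolding norm_mult
        by (intro mult_mono B1[OF y] B2[OF r] mult_nonneg_nonneg B1_nonneg order_trans[OF norm_ge_zero B2[OF r]]) (auto simp: fejer_conv_nonneg)
      then show "norm (f1 y * f2 r * (M1 (Y1 - y) * M2 (Y2 - s * y - r)))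
          \<le> B1 * (B2 * (fejer_conv N (Y1 - y) * fejer_conv N (Y2 - s * y - r)))" by (simp add: mult.assoc)
    qed
    then show "norm (integral {-h..h} (\<lambda>r. f1 y * f2 r * (M1 (Y1 - y) * M2 (Y2 - s * y - r))))
       \<le> B1 * (B2 * integral {-h..h} (\<lambda>r. fejer_conv N (Y1 - y) * fejer_conv N (Y2 - s * y - r)))" by simp
  qed
  finally show ?thesis by (simp add: B1_def B2_def \<delta>_def sheared_mass_def mult.assoc)
qed

text \<open>Among \<open>m\<close> distinct integers one satisfies
  \<open>2 * |k| + 1 \<ge> m\<close>, so its term is at most \<open>2 / m\<close>; removing an
  element of largest absolute value gives the induction.\<close>

lemma sum_inverse_int_le_harm:
  assumes "finite A" "card A \<le> m"
  shows "(\<Sum>k\<in>A. 1 / (1 + \<bar>real_of_int k\<bar>)) \<le> 2 * harm m"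
  using assms
proof (induction m arbitrary: A)
  case 0
  then show ?case by (simp add: harm_def)
next
  case (Suc m)
  show ?case
  proof (cases "A = {}")
    case True
    then show ?thesis by (simp add: harm_nonneg)
  next
    case False
    have "Max (abs ` A) \<in> abs ` A" by (rule Max_in) (use Suc.prems(1) False in auto)
    then obtain k where k1: "k \<in> A" "\<bar>k\<bar> = Max (abs ` A)" by auto
    have k2: "\<bar>j\<bar> \<le> \<bar>k\<bar>" if "j \<in> A" for j
      unfolding k1(2) by (rule Max_ge) (use Suc.prems(1) that in auto)
    show ?thesis
    proof (cases "card A \<le> m")
      case True
      from Suc.IH[OF Suc.prems(1) this] have "(\<Sum>k\<in>A. 1 / (1 + \<bar>real_of_int k\<bar>)) \<le> 2 * harm m" .
      also have "\<dots> \<le> 2 * harm (Suc m)" by (simp add: harm_Suc)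
      finally show ?thesis .
    next
      case False
      then have card: "card A = Suc m" using Suc.prems(2) by simp
      have "A \<subseteq> {-\<bar>k\<bar>..\<bar>k\<bar>}"
      proof
        fix j assume "j \<in> A"
        from k2[OF this] show "j \<in> {-\<bar>k\<bar>..\<bar>k\<bar>}" by (auto simp: abs_le_iff)
      qed
      then have "card A \<le> card {-\<bar>k\<bar>..\<bar>k\<bar>}" by (intro card_mono) auto
      also have "\<dots> = nat (2 * \<bar>k\<bar> + 1)" by simp
      finally have "real (Suc m) \<le> 2 * \<bar>real_of_int k\<bar> + 1" using card by linarith
      then have le: "1 / (1 + \<bar>real_of_int k\<bar>) \<le> 2 * (1 / real (Suc m))"
        by (simp add: field_simps)
      have "(\<Sum>k\<in>A - {k}. 1 / (1 + \<bar>real_of_int k\<bar>)) \<le> 2 * harm m"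
        by (rule Suc.IH) (use Suc.prems k1 card in auto)
      moreover have "(\<Sum>k\<in>A. 1 / (1 + \<bar>real_of_int k\<bar>)) = 1 / (1 + \<bar>real_of_int k\<bar>) + (\<Sum>k\<in>A - {k}. 1 / (1 + \<bar>real_of_int k\<bar>))"
        by (rule sum.remove) (use Suc.prems k1 in auto)
      ultimately show ?thesis using le by (simp add: harm_Suc inverse_eq_divide)
    qed
  qed
qed

text \<open>Replacing \<open>\<alpha>\<close> by its floor costs a factor 2 in each term, and then
  the terms run over \<open>2 * M + 1\<close> distinct integers. The bound is uniform in the
  shift.\<close>

lemma sum_inverse_shifted_le_harm:
  "(\<Sum>d\<in>{- int M..int M}. 1 / (1 + \<bar>real_of_int d + \<alpha>\<bar>)) \<le> 4 * harm (2 * M + 1)"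
proof -
  have "(\<Sum>d\<in>{- int M..int M}. 1 / (1 + \<bar>real_of_int d + \<alpha>\<bar>))
      \<le> (\<Sum>d\<in>{- int M..int M}. 2 * (1 / (1 + \<bar>real_of_int (d + \<lfloor>\<alpha>\<rfloor>)\<bar>)))"
  proof (rule sum_mono)
    fix d
    have "\<bar>real_of_int (d + \<lfloor>\<alpha>\<rfloor>)\<bar> \<le> \<bar>real_of_int d + \<alpha>\<bar> + 1" by linarith
    then have "1 + \<bar>real_of_int (d + \<lfloor>\<alpha>\<rfloor>)\<bar> \<le> 2 * (1 + \<bar>real_of_int d + \<alpha>\<bar>)"
      using abs_ge_zero[of "real_of_int d + \<alpha>"] by argo
    then show "1 / (1 + \<bar>real_of_int d + \<alpha>\<bar>) \<le> 2 * (1 / (1 + \<bar>real_of_int (d + \<lfloor>\<alpha>\<rfloor>)\<bar>))"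
      by (simp add: field_simps)
  qed
  also have "\<dots> = 2 * (\<Sum>k\<in>(\<lambda>d. d + \<lfloor>\<alpha>\<rfloor>) ` {- int M..int M}. 1 / (1 + \<bar>real_of_int k\<bar>))"
    by (subst sum.reindex) (auto simp: inj_on_def sum_distrib_left)
  also have "\<dots> \<le> 2 * (2 * harm (2 * M + 1))"
    by (intro mult_left_mono sum_inverse_int_le_harm) (auto simp: card_image)
  finally show ?thesis by simp
qed

lemma sheared_mass_nonneg:
  assumes "N \<ge> 1"
  shows "0 \<le> sheared_mass N s l h Y1 Y2"
  unfolding sheared_mass_def
  by (intro integral_nonneg integrable_continuous_real continuous_sheared_mass_inner continuous_intros assms)
     (auto simp: fejer_conv_nonneg)

text \<open>The kernel has mass \<open>2 * pi\<close> on each period, and \<open>[-h, h]\<close> has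
  length at most 2, hence fits into one. This pointwise bound carries no factor \<open>h\<close>;
  for that one has to average in time.\<close>

lemma sheared_mass_le:
  assumes N: "N \<ge> 1" and l: "2 * l \<le> 2 * pi * of_nat m" and h: "h \<le> 1"
  shows "sheared_mass N s l h Y1 Y2 \<le> 4 * pi\<^sup>2 * of_nat m"
proof -
  have "sheared_mass N s l h Y1 Y2 \<le> integral {-l..l} (\<lambda>y. 2 * pi * fejer_conv N (Y1 - y))"
    unfolding sheared_mass_def
  proof (rule integral_le)
    fix y
    have "integral {-h..h} (\<lambda>r. fejer_conv N (Y2 - s * y - r)) \<le> 2 * pi * of_nat 1"
      by (rule integral_fejer_conv_le[OF N]) (use h pi_gt3 in auto)
    from mult_right_mono[OF this fejer_conv_nonneg[of N "Y1 - y"]]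
    show "integral {-h..h} (\<lambda>r. fejer_conv N (Y1 - y) * fejer_conv N (Y2 - s * y - r)) \<le> 2 * pi * fejer_conv N (Y1 - y)"
      by (simp add: mult.commute)
  qed (intro integrable_continuous_real continuous_sheared_mass_inner continuous_intros N)+
  also have "\<dots> = 2 * pi * integral {-l..l} (\<lambda>y. fejer_conv N (Y1 - y))" by simp
  also have "\<dots> \<le> 2 * pi * (2 * pi * of_nat m)"
    by (intro mult_left_mono integral_fejer_conv_le[OF N]) (use l in auto)
  finally show ?thesis by (simp add: power2_eq_square)
qed

lemma sheared_mass_eq:
  assumes N: "N \<ge> 1"
  shows "complex_of_real (sheared_mass N s l h Y1 Y2) = (\<Sum>n\<in>grid N. complex_of_real ((fej2 N n)\<^sup>2) *
      cis (of_int (fst n) * Y1 + of_int (snd n) * Y2) *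
      (box_ft (-l) l (of_int (fst n) + s * of_int (snd n)) * box_ft (-h) h (of_int (snd n))))"
proof -
  let ?B = "{- int N..int N}"
  have "complex_of_real (sheared_mass N s l h Y1 Y2) = integral {-l..l} (\<lambda>y. complex_of_real (integral {-h..h} (\<lambda>r.
      fejer_conv N (Y1 - y) * fejer_conv N (Y2 - s * y - r))))"
    unfolding sheared_mass_def
    by (rule integral_linear[OF _ bounded_linear_of_real, unfolded o_def, symmetric])
       (intro integrable_continuous_real continuous_sheared_mass_inner N)
  also have "\<dots> = integral {-l..l} (\<lambda>y. integral {-h..h} (\<lambda>r. complex_of_real
      (fejer_conv N (Y1 - y) * fejer_conv N (Y2 - s * y - r))))"
    by (rule arg_cong[where f="integral _"], rule ext,
        rule integral_linear[OF _ bounded_linear_of_real, unfolded o_def, symmetric])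
       (intro integrable_continuous_real continuous_intros N)
  also have "\<dots> = integral {-l..l} (\<lambda>y. integral {-h..h} (\<lambda>r. 1 * 1 *
      ((\<Sum>n\<in>?B. complex_of_real ((fej N n)\<^sup>2) * cis (of_int n * (Y1 - y))) *
       (\<Sum>n\<in>?B. complex_of_real ((fej N n)\<^sup>2) * cis (of_int n * (Y2 - s * y - r))))))"
    by (simp only: of_real_mult fejer_conv_eq[OF N] mult_1)
  also have "\<dots> = (\<Sum>n\<in>grid N. complex_of_real ((fej N (fst n))\<^sup>2) * complex_of_real ((fej N (snd n))\<^sup>2) *
      cis (of_int (fst n) * Y1 + of_int (snd n) * Y2) *
      (integral {-l..l} (\<lambda>y. 1 * cis (- (of_int (fst n) + s * of_int (snd n)) * y)) *
         integral {-h..h} (\<lambda>r. 1 * cis (- of_int (snd n) * r))))"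
    by (rule sheared_integral_trig) (intro continuous_intros)+
  finally show ?thesis
    by (simp add: box_ft_def fej2_def power_mult_distrib)
qed

section \<open>Averaging over a period of time and sums over frequency differences\<close>

definition dotp :: "int \<times> int \<Rightarrow> int \<times> int \<Rightarrow> int" where
  "dotp n d = fst n * fst d + snd n * snd d"

lemma norm_box_ft_le:
  assumes "0 \<le> l"
  shows "norm (box_ft (-l) l \<xi>) \<le> (2 * l + 2) / (1 + \<bar>\<xi>\<bar>)" "norm (box_ft (-l) l \<xi>) \<le> 2 * l"
  using norm_integral_cis_le'[of "-l" l "2*l" "-\<xi>"] norm_integral_cis_le_length[of "-l" l "-\<xi>"] assms
  by (auto simp: box_ft_def)

text \<open>Along \<open>(Y1, Y2) = - 2 * t * d\<close> the term of index \<open>n\<close>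
  oscillates in \<open>t\<close> with the integer frequency \<open>- 2 * dotp n d\<close>, so a
  period of length \<open>2 * pi\<close> keeps only \<open>n\<close> orthogonal to \<open>d\<close>.
  Each survivor contains the transform of \<open>[-h, h]\<close>, at most \<open>2 * h\<close>, and
  this supplies the gain in \<open>h\<close>.\<close>

lemma integral_sheared_mass_le:
  assumes N: "N \<ge> 1" and l: "0 \<le> l" and h: "0 \<le> h"
  shows "integral {2 * pi * of_int k..2 * pi * of_int k + 2 * pi}
           (\<lambda>t. sheared_mass N s l h (- 2 * t * of_int (fst d)) (- 2 * t * of_int (snd d)))
       \<le> 8 * pi * h * (l + 1) * (\<Sum>n\<in>{n\<in>grid N. dotp n d = 0}. 1 / (1 + \<bar>of_int (fst n) + s * of_int (snd n)\<bar>))"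
proof -
  let ?I = "{2 * pi * of_int k..2 * pi * of_int k + 2 * pi}"
  let ?m = "\<lambda>t. sheared_mass N s l h (- 2 * t * of_int (fst d)) (- 2 * t * of_int (snd d))"
  let ?c = "\<lambda>n. complex_of_real ((fej2 N n)\<^sup>2) * (box_ft (-l) l (of_int (fst n) + s * of_int (snd n)) * box_ft (-h) h (of_int (snd n)))"
  have eq: "complex_of_real (?m t) = (\<Sum>n\<in>grid N. ?c n * cis (of_int (- 2 * dotp n d) * t))" for t
    unfolding sheared_mass_eq[OF N]
  proof (rule sum.cong[OF refl])
    fix n
    have "of_int (fst n) * (- 2 * t * of_int (fst d)) + of_int (snd n) * (- 2 * t * of_int (snd d)) = of_int (- 2 * dotp n d) * t"
      by (simp add: dotp_def algebra_simps)
    then show "complex_of_real ((fej2 N n)\<^sup>2) * cis (of_int (fst n) * (- 2 * t * of_int (fst d)) + of_int (snd n) * (- 2 * t * of_int (snd d))) *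
         (box_ft (-l) l (of_int (fst n) + s * of_int (snd n)) * box_ft (-h) h (of_int (snd n))) = ?c n * cis (of_int (- 2 * dotp n d) * t)"
      by (simp only: mult_ac)
  qed
  have cont: "continuous_on ?I (\<lambda>t. complex_of_real (?m t))"
    unfolding eq by (intro continuous_intros)
  have int: "?m integrable_on ?I"
    using integrable_linear[OF integrable_continuous_real[OF cont] bounded_linear_Re] by (simp add: o_def)
  have "complex_of_real (integral ?I ?m) = integral ?I (\<lambda>t. complex_of_real (?m t))"
    by (rule integral_linear[OF int bounded_linear_of_real, unfolded o_def, symmetric])
  also have "\<dots> = (\<Sum>n\<in>grid N. integral ?I (\<lambda>t. ?c n * cis (of_int (- 2 * dotp n d) * t)))"
    unfolding eq by (rule integral_sum) (auto intro!: integrable_continuous_real continuous_intros)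
  also have "\<dots> = (\<Sum>n\<in>grid N. ?c n * integral ?I (\<lambda>t. cis (of_int (- 2 * dotp n d) * t)))"
    by (intro sum.cong refl integral_mult_right)
  also have "\<dots> = (\<Sum>n\<in>grid N. if dotp n d = 0 then ?c n * (2 * pi) else 0)"
    by (intro sum.cong refl, subst integral_cis_period[of _ _ 1]) auto
  also have "\<dots> = (\<Sum>n\<in>{n\<in>grid N. dotp n d = 0}. ?c n * (2 * pi))"
    by (rule sum.inter_filter[OF finite_grid, symmetric])
  finally have "norm (complex_of_real (integral ?I ?m)) \<le> (\<Sum>n\<in>{n\<in>grid N. dotp n d = 0}. norm (?c n * (2 * pi)))"
    by (simp only: norm_sum)
  also have "\<dots> \<le> (\<Sum>n\<in>{n\<in>grid N. dotp n d = 0}. 8 * pi * h * (l + 1) * (1 / (1 + \<bar>of_int (fst n) + s * of_int (snd n)\<bar>)))"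
  proof (rule sum_mono)
    fix n
    have "norm (?c n) \<le> 1 * ((2 * l + 2) / (1 + \<bar>of_int (fst n) + s * of_int (snd n)\<bar>) * (2 * h))"
      unfolding norm_mult
      by (intro mult_mono norm_box_ft_le l h)
         (use fej2_nonneg[of N n] fej2_le_1[of N n] l in \<open>auto simp: norm_power power_le_one\<close>)
    then have "norm (?c n) * (2 * pi) \<le> (2 * l + 2) / (1 + \<bar>of_int (fst n) + s * of_int (snd n)\<bar>) * (2 * h) * (2 * pi)"
      by (intro mult_right_mono) auto
    also have "\<dots> = 8 * pi * h * (l + 1) * (1 / (1 + \<bar>of_int (fst n) + s * of_int (snd n)\<bar>))"
      by (simp add: field_simps)
    finally show "norm (?c n * (2 * pi)) \<le> 8 * pi * h * (l + 1) * (1 / (1 + \<bar>of_int (fst n) + s * of_int (snd n)\<bar>))"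
      by (simp add: norm_mult)
  qed
  finally show ?thesis
    by (simp add: sum_distrib_left)
qed

text \<open>The lattice points orthogonal to \<open>d\<close> are \<open>n = k (-b, a)\<close>, so \<open>n\<^sub>1 + s n\<^sub>2 = k (s a - b)\<close> moves by at least 1 with \<open>k\<close> and
  the sum over them is logarithmic. Otherwise \<open>a\<close> leaves two choices for \<open>b\<close>, few enough for the trivial bound.\<close>

definition transversal :: "real \<Rightarrow> int \<times> int \<Rightarrow> bool" where
  "transversal s d \<longleftrightarrow> (\<exists>g a b. d = (g * a, g * b) \<and> g \<noteq> 0 \<and> coprime a b \<and> 1 \<le> \<bar>of_int b - s * of_int a\<bar>)"

lemma transversal_orthogonal_sum_le:
  assumes "transversal s d"
  shows "(\<Sum>n\<in>{n\<in>grid N. dotp n d = 0}. 1 / (1 + \<bar>of_int (fst n) + s * of_int (snd n)\<bar>)) \<le> 2 * harm (4 * N + 1)"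
proof -
  obtain g a b where d: "d = (g * a, g * b)" "g \<noteq> 0" "coprime a b" and ge: "1 \<le> \<bar>of_int b - s * of_int a\<bar>"
    using assms by (auto simp: transversal_def)
  define \<phi> where "\<phi> k = (- k * b, k * a)" for k :: int
  have ab: "a \<noteq> 0 \<or> b \<noteq> 0" using d by auto
  have "{n\<in>grid N. dotp n d = 0} \<subseteq> \<phi> ` {- int N..int N}"
  proof
    fix n assume "n \<in> {n\<in>grid N. dotp n d = 0}"
    then have n: "n \<in> grid N" "fst n * (g * a) + snd n * (g * b) = 0" by (auto simp: dotp_def d)
    then have "g * (fst n * a + snd n * b) = 0" by (simp add: algebra_simps)
    with d have e: "fst n * a = - (snd n * b)" by simp
    then have "a dvd snd n * b" by (metis dvd_minus_iff dvd_triv_right)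
    then have "a dvd snd n" using d(3) coprime_dvd_mult_left_iff by blast
    then obtain k where k: "snd n = a * k" by auto
    have "b dvd fst n * a" using e by simp
    then have "b dvd fst n" using d(3) coprime_dvd_mult_left_iff coprime_commute by blast
    then obtain k' where k': "fst n = b * k'" by auto
    have "b * a * (k' + k) = 0" using e k k' by (simp add: algebra_simps)
    \<comment> \<open>If \<open>a\<close> or \<open>b\<close> vanishes, the product gives no
      relation between \<open>k\<close> and \<open>k'\<close>; but then one coordinate of
      \<open>n\<close> is zero and the multiplier is read off from the other.\<close>
    then consider "a = 0" | "b = 0" | "k' = - k" by auto
    then obtain j where j: "n = (- j * b, j * a)"
    proof cases
      case 1
      then have "\<bar>b\<bar> = 1" using d(3) by simp
      show ?thesis
        by (rule that[of "- k'"]) (use 1 k k' in \<open>auto simp: prod_eq_iff\<close>)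
    next
      case 2
      show ?thesis
        by (rule that[of k]) (use 2 k k' in \<open>auto simp: prod_eq_iff\<close>)
    next
      case 3
      show ?thesis
        by (rule that[of k]) (use 3 k k' in \<open>auto simp: prod_eq_iff\<close>)
    qed
    have "\<bar>j\<bar> \<le> int N"
    proof -
      have "\<bar>j * b\<bar> \<le> int N" "\<bar>j * a\<bar> \<le> int N" using n(1) j by (auto simp: grid_def)
      moreover have "\<bar>j\<bar> \<le> \<bar>j * a\<bar> \<or> \<bar>j\<bar> \<le> \<bar>j * b\<bar>"
        using ab by (auto simp: abs_mult mult_le_cancel_left1)
      ultimately show ?thesis by linarith
    qed
    then have "j \<in> {- int N..int N}" by auto
    then show "n \<in> \<phi> ` {- int N..int N}" unfolding \<phi>_def j by (rule imageI)
  qed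
  then have "(\<Sum>n\<in>{n\<in>grid N. dotp n d = 0}. 1 / (1 + \<bar>of_int (fst n) + s * of_int (snd n)\<bar>))
     \<le> (\<Sum>n\<in>\<phi> ` {- int N..int N}. 1 / (1 + \<bar>of_int (fst n) + s * of_int (snd n)\<bar>))"
    by (intro sum_mono2) auto
  also have "\<dots> \<le> (\<Sum>k\<in>{- int N..int N}. 1 / (1 + \<bar>of_int (fst (\<phi> k)) + s * of_int (snd (\<phi> k))\<bar>))"
    by (rule order_trans[OF sum_image_le]) auto
  also have "\<dots> \<le> (\<Sum>k\<in>{- int N..int N}. 1 / (1 + \<bar>of_int k\<bar>))"
  proof (rule sum_mono)
    fix k
    have "of_int (fst (\<phi> k)) + s * of_int (snd (\<phi> k)) = - of_int k * (of_int b - s * of_int a)"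
      by (simp add: \<phi>_def algebra_simps)
    then have "\<bar>of_int (fst (\<phi> k)) + s * of_int (snd (\<phi> k))\<bar> = \<bar>real_of_int k\<bar> * \<bar>of_int b - s * of_int a\<bar>"
      by (simp add: abs_mult)
    also have "\<dots> \<ge> \<bar>real_of_int k\<bar>" using ge mult_left_mono[OF ge, of "\<bar>real_of_int k\<bar>"] by simp
    finally show "1 / (1 + \<bar>of_int (fst (\<phi> k)) + s * of_int (snd (\<phi> k))\<bar>) \<le> 1 / (1 + \<bar>real_of_int k\<bar>)"
      by (simp add: frac_le)
  qed
  \<comment> \<open>There are only \<open>2 * N + 1\<close> terms; the larger index matches the sums
    over \<open>grid (2 * N)\<close>, so that a single harmonic number occurs later.\<close>
  also have "\<dots> \<le> 2 * harm (4 * N + 1)"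
    by (rule sum_inverse_int_le_harm) auto
  finally show ?thesis .
qed

lemma sum_inverse_nonzero_int:
  "(\<Sum>a\<in>{- int M..int M} - {0}. 1 / \<bar>real_of_int a\<bar>) = 2 * harm M"
proof -
  have "(\<Sum>a\<in>{- int M..int M} - {0}. 1 / \<bar>real_of_int a\<bar>) = (\<Sum>a\<in>{- int M..int M}. 1 / \<bar>real_of_int a\<bar>)"
    by (rule sum.mono_neutral_left) auto
  also have "\<dots> = 2 * (\<Sum>k<M. 1 / real (Suc k))"
    by (subst sum_int_symmetric) (simp add: sum_distrib_left add.commute)
  also have "(\<Sum>k<M. 1 / real (Suc k)) = harm M"
    unfolding harm_def by (simp add: sum.atLeast1_atMost_eq inverse_eq_divide)
  finally show ?thesis .
qed

text \<open>A nonzero \<open>d = g (a, b)\<close> of this kind has \<open>b\<close> within distance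
  1 of \<open>s * a\<close>, so it is nearly parallel to \<open>(1, s)\<close> and
  \<open>|fst d + s * snd d| \<ge> (3/4) * g * |a|\<close>. Summing \<open>1 / (g * |a|)\<close>
  over \<open>g\<close> and \<open>a\<close> gives two logarithms, and \<open>d = 0\<close> gives
  the summand 1.\<close>

lemma nontransversal_sum_le:
  "(\<Sum>d\<in>{d\<in>grid M. \<not> transversal s d}. 1 / (1 + \<bar>of_int (fst d) + s * of_int (snd d)\<bar>)) \<le> 1 + 6 * (harm M)\<^sup>2"
proof -
  let ?f = "\<lambda>d. 1 / (1 + \<bar>of_int (fst d) + s * of_int (snd d)\<bar>) :: real"
  \<comment> \<open>Here \<open>e\<close> chooses between the two integers that can lie within
    distance less than 1 of \<open>s * a\<close>.\<close>
  define \<phi> :: "int \<times> int \<times> int \<Rightarrow> int \<times> int" where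
    "\<phi> = (\<lambda>(g, a, e). (g * a, g * (\<lfloor>s * of_int a\<rfloor> + e)))"
  define J where "J = {1..int M} \<times> ({- int M..int M} - {0}) \<times> {0, 1::int}"
  have sub: "{d\<in>grid M. \<not> transversal s d} \<subseteq> insert (0, 0) (\<phi> ` J)"
  proof
    fix d assume d: "d \<in> {d\<in>grid M. \<not> transversal s d}"
    show "d \<in> insert (0, 0) (\<phi> ` J)"
    proof (cases "d = (0, 0)")
      case False
      define g where "g = gcd (fst d) (snd d)"
      define a where "a = fst d div g"
      define b where "b = snd d div g"
      have g0: "g > 0" using False by (cases d) (auto simp: g_def)
      have dab: "fst d = g * a" "snd d = g * b" by (auto simp: a_def b_def g_def)
      have cop: "coprime a b" unfolding a_def b_def g_def
        by (rule div_gcd_coprime) (use False in \<open>cases d, auto\<close>)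
      have lt: "\<bar>of_int b - s * of_int a\<bar> < 1"
      proof (rule ccontr)
        assume "\<not> ?thesis"
        then have "transversal s d" unfolding transversal_def
          using dab cop g0 by (intro exI[of _ g] exI[of _ a] exI[of _ b]) (auto simp: prod_eq_iff)
        with d show False by simp
      qed
      have a0: "a \<noteq> 0"
      proof
        assume "a = 0"
        with cop lt have "\<bar>b\<bar> = 1" "\<bar>b\<bar> < 1" by auto
        then show False by simp
      qed
      have "b = \<lfloor>s * of_int a\<rfloor> \<or> b = \<lfloor>s * of_int a\<rfloor> + 1" using lt by linarith
      then obtain e where e: "e \<in> {0,1}" "b = \<lfloor>s * of_int a\<rfloor> + e" by auto
      have "\<bar>g * a\<bar> \<le> int M" using d dab by (auto simp: grid_def)
      then have "g * \<bar>a\<bar> \<le> int M" using g0 by (simp add: abs_mult)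
      moreover have "g * 1 \<le> g * \<bar>a\<bar>" by (rule mult_left_mono) (use a0 g0 in auto)
      moreover have "1 * \<bar>a\<bar> \<le> g * \<bar>a\<bar>" by (rule mult_right_mono) (use a0 g0 in auto)
      ultimately have "g \<le> int M" "\<bar>a\<bar> \<le> int M" by auto
      then have "(g, a, e) \<in> J" using g0 a0 e by (auto simp: J_def)
      moreover have "d = \<phi> (g, a, e)" by (simp add: \<phi>_def dab e(2)[symmetric] prod_eq_iff)
      ultimately show ?thesis by blast
    qed simp
  qed
  have finJ: "finite J" by (simp add: J_def)
  have "(\<Sum>d\<in>{d\<in>grid M. \<not> transversal s d}. ?f d) \<le> (\<Sum>d\<in>insert (0, 0) (\<phi> ` J). ?f d)"
    by (intro sum_mono2 sub) (use finJ in auto)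
  also have "\<dots> \<le> 1 + (\<Sum>d\<in>\<phi> ` J. ?f d)"
    using finJ by (subst sum.insert_if) auto
  also have "(\<Sum>d\<in>\<phi> ` J. ?f d) \<le> (\<Sum>i\<in>J. ?f (\<phi> i))"
    by (rule order_trans[OF sum_image_le]) (use finJ in auto)
  also have "\<dots> \<le> (\<Sum>i\<in>J. 4 / 3 * ((1 / real_of_int (fst i)) * (1 / \<bar>real_of_int (fst (snd i))\<bar>)))"
  proof (rule sum_mono)
    fix i assume i: "i \<in> J"
    obtain g a e where ie: "i = (g, a, e)" by (cases i) auto
    define b where "b = \<lfloor>s * of_int a\<rfloor> + e"
    have g: "1 \<le> real_of_int g" and a: "1 \<le> \<bar>real_of_int a\<bar>" and e: "e = 0 \<or> e = 1"
      using i by (auto simp: J_def ie)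
    have "\<bar>of_int b - s * of_int a\<bar> \<le> 1" using e unfolding b_def by linarith
    then have *: "\<bar>s * (of_int b - s * of_int a)\<bar> \<le> \<bar>s\<bar> * 1" unfolding abs_mult by (intro mult_left_mono) auto
    have "of_int a + s * of_int b = of_int a * (1 + s\<^sup>2) + s * (of_int b - s * of_int a)"
      by (simp add: algebra_simps power2_eq_square)
    then have "\<bar>of_int a + s * of_int b\<bar> \<ge> \<bar>of_int a * (1 + s\<^sup>2)\<bar> - \<bar>s\<bar>" using * by linarith
    also have "\<bar>of_int a * (1 + s\<^sup>2)\<bar> = \<bar>of_int a\<bar> * (1 + s\<^sup>2)" by (simp add: abs_mult)
    finally have "\<bar>of_int a + s * of_int b\<bar> \<ge> \<bar>of_int a\<bar> * (1 + s\<^sup>2) - \<bar>of_int a\<bar> * \<bar>s\<bar>"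
      using mult_right_mono[OF a, of "\<bar>s\<bar>"] by simp
    also have "\<bar>of_int a\<bar> * (1 + s\<^sup>2) - \<bar>of_int a\<bar> * \<bar>s\<bar> = \<bar>of_int a\<bar> * (1 + s\<^sup>2 - \<bar>s\<bar>)" by (simp add: algebra_simps)
    finally have "\<bar>of_int a + s * of_int b\<bar> \<ge> \<bar>of_int a\<bar> * (1 + s\<^sup>2 - \<bar>s\<bar>)" .
    \<comment> \<open>The minimum is attained at \<open>|s| = 1/2\<close>.\<close>
    moreover have "3/4 \<le> 1 + s\<^sup>2 - \<bar>s\<bar>"
      using zero_le_power2[of "\<bar>s\<bar> - 1/2"] by (simp add: power2_eq_square algebra_simps flip: abs_mult)
    ultimately have ge: "\<bar>of_int a + s * of_int b\<bar> \<ge> \<bar>of_int a\<bar> * (3/4)"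
      using mult_left_mono[of "3/4" "1 + s\<^sup>2 - \<bar>s\<bar>" "\<bar>real_of_int a\<bar>"] by linarith
    have "of_int (fst (\<phi> i)) + s * of_int (snd (\<phi> i)) = of_int g * (of_int a + s * of_int b)"
      by (simp add: ie \<phi>_def b_def algebra_simps)
    then have "\<bar>of_int (fst (\<phi> i)) + s * of_int (snd (\<phi> i))\<bar> = of_int g * \<bar>of_int a + s * of_int b\<bar>"
      using g by (simp add: abs_mult)
    moreover have "of_int g * (\<bar>of_int a\<bar> * (3/4)) \<le> of_int g * \<bar>of_int a + s * of_int b\<bar>"
      by (rule mult_left_mono[OF ge]) (use g in auto)
    ultimately have "1 + \<bar>of_int (fst (\<phi> i)) + s * of_int (snd (\<phi> i))\<bar> \<ge> of_int g * (\<bar>of_int a\<bar> * (3/4))"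
      by linarith
    then have "?f (\<phi> i) \<le> 1 / (of_int g * (\<bar>of_int a\<bar> * (3/4)))"
      using g a by (intro divide_left_mono) auto
    then show "?f (\<phi> i) \<le> 4 / 3 * ((1 / real_of_int (fst i)) * (1 / \<bar>real_of_int (fst (snd i))\<bar>))"
      by (simp add: ie)
  qed
  also have "\<dots> = 4 / 3 * ((\<Sum>g\<in>{1..int M}. 1 / real_of_int g) * ((\<Sum>a\<in>{- int M..int M} - {0}. 1 / \<bar>real_of_int a\<bar>) * 2))"
  proof -
    let ?A = "{- int M..int M} - {0}"
    have "(\<Sum>i\<in>J. 4 / 3 * ((1 / real_of_int (fst i)) * (1 / \<bar>real_of_int (fst (snd i))\<bar>)))
       = (\<Sum>g\<in>{1..int M}. \<Sum>p\<in>?A \<times> {0, 1::int}. 4 / 3 * ((1 / real_of_int g) * (1 / \<bar>real_of_int (fst p)\<bar>)))"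
      unfolding J_def sum.cartesian_product by (simp add: case_prod_beta)
    also have "\<dots> = (\<Sum>g\<in>{1..int M}. \<Sum>a\<in>?A. \<Sum>e\<in>{0, 1::int}. 4 / 3 * ((1 / real_of_int g) * (1 / \<bar>real_of_int a\<bar>)))"
      by (rule sum.cong[OF refl], subst sum.cartesian_product) (simp add: case_prod_beta)
    also have "\<dots> = (\<Sum>g\<in>{1..int M}. \<Sum>a\<in>?A. 4 / 3 * ((1 / real_of_int g) * (1 / \<bar>real_of_int a\<bar> * 2)))"
      by (intro sum.cong refl) simp
    finally show ?thesis
      by (simp only: sum_product sum_distrib_left sum_distrib_right) (rule sum.swap)
  qed
  also have "(\<Sum>g\<in>{1..int M}. 1 / real_of_int g) = harm M"
  proof -
    have "{1..int M} = int ` {1..M}" by (simp add: image_int_atLeastAtMost)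
    then show ?thesis by (simp add: sum.reindex harm_def inverse_eq_divide)
  qed
  \<comment> \<open>A factor 2 for the sign of \<open>a\<close> and another for \<open>e\<close>
    give \<open>16 / 3 \<le> 6\<close>.\<close>
  also have "4 / 3 * (harm M * ((\<Sum>a\<in>{- int M..int M} - {0}. 1 / \<bar>real_of_int a\<bar>) * 2)) \<le> 6 * (harm M)\<^sup>2"
    unfolding sum_inverse_nonzero_int by (simp add: power2_eq_square harm_nonneg)
  finally show ?thesis by simp
qed

lemma one_le_harm: "1 \<le> (harm (Suc n) :: real)"
proof (induction n)
  case 0
  then show ?case by (simp add: harm_def)
next
  case (Suc n)
  have "harm (Suc n) \<le> (harm (Suc (Suc n)) :: real)" by (subst (2) harm_Suc) simp
  with Suc show ?case by linarith
qed

text \<open>The majorant \<open>Z\<close> does not involve \<open>x\<close>, so the supremum over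
  \<open>x\<close> is free. The factor \<open>h\<close> has two sources: for transversal
  \<open>d\<close> the time average of \<open>sheared_mass\<close>, otherwise the height of the
  strip. Of the three logarithms, two come from summing over \<open>d\<close> and one from summing
  over the \<open>n\<close> orthogonal to \<open>d\<close>. The constant is independent of
  \<open>N\<close> and \<open>h\<close>.\<close>

lemma strip_maximal_estimate:
  assumes ab: "a \<le> b"
  obtains C where "0 \<le> C" "\<And>N h. \<lbrakk>N \<ge> 1; 0 < h; h \<le> 1\<rbrakk> \<Longrightarrow> \<exists>Z. continuous_on UNIV Z \<and>
     (\<forall>t x y. (norm (\<Sum>n\<in>grid N. fej2 N n * strip_coeff s a b c h n * cis (- phase t n) *
         cis (of_int (fst n) * x + of_int (snd n) * y)))\<^sup>2 \<le> Z t) \<and>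
     (\<forall>k::int. integral {2 * pi * of_int k..2 * pi * of_int k + 2 * pi} Z \<le> C * h * (harm (4 * N + 1)) ^ 3)"
proof -
  define l where "l = b - a"
  have l: "0 \<le> l" using ab by (simp add: l_def)
  obtain m :: nat where m: "l / pi \<le> real m" using real_arch_simple by blast
  have m: "2 * l \<le> 2 * pi * of_nat m" using m by (simp add: field_simps)
  \<comment> \<open>The first summand collects the transversal differences
    (\<open>384 = 16 * 24\<close>), the second the others, whose weights sum to at most
    \<open>7 * H^2\<close>.\<close>
  define C where "C = 384 * pi * (l + 1) * (l + 2) + 2 * pi * (4 * pi\<^sup>2 * real m) * (l + 2) * 7"
  have C1: "0 \<le> 384 * pi * (l + 1) * (l + 2)" and C2: "0 \<le> 2 * pi * (4 * pi\<^sup>2 * real m) * (l + 2) * 7"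
    using l by auto
  show thesis
  proof (rule that[of C])
    show "0 \<le> C" unfolding C_def using C1 C2 by linarith
    fix N :: nat and h :: real
    assume N: "N \<ge> 1" and h0: "0 < h" and h1: "h \<le> 1"
    define H where "H = (harm (4 * N + 1) :: real)"
    have H1: "1 \<le> H" unfolding H_def using one_le_harm[of "4 * N"] by simp
    define S where "S t d = sheared_mass N s l h (- 2 * t * of_int (fst d)) (- 2 * t * of_int (snd d))" for t d
    define \<beta> where "\<beta> n = fej2 N n * strip_coeff s a b c h n" for n
    define A where "A t d = (\<Sum>n\<in>grid N. \<beta> n * cnj (\<beta> (n - d))
            * cis (of_int (fst n) * (- 2 * t * of_int (fst d)) + of_int (snd n) * (- 2 * t * of_int (snd d))))" for t d
    define w where "w d = 1 / (1 + \<bar>of_int (fst d) + s * of_int (snd d)\<bar>)" for d :: "int \<times> int"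
    define Z where "Z t = (\<Sum>d\<in>grid (2 * N). norm (A t d))" for t
    have w0: "0 \<le> w d" for d by (simp add: w_def)
    have contA: "continuous_on X (\<lambda>t. norm (A t d))" for X d
      unfolding A_def by (intro continuous_intros)
    have S0: "0 \<le> S t d" for t d unfolding S_def by (rule sheared_mass_nonneg[OF N])
    have S_le: "S t d \<le> 4 * pi\<^sup>2 * of_nat m" for t d unfolding S_def by (rule sheared_mass_le[OF N m h1])
    have contS: "continuous_on X (\<lambda>t. S t d)" for X d
    proof -
      have "S t d = Re (complex_of_real (S t d))" for t by simp
      then show ?thesis
        unfolding S_def sheared_mass_eq[OF N] by (subst (1) \<open>\<And>t. S t d = Re (complex_of_real (S t d))\<close>[unfolded S_def sheared_mass_eq[OF N]]) (intro continuous_intros)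
    qed
    have A_le: "norm (A t d) \<le> (l + 2) * w d * (if snd d = 0 then h else min h (2 / \<bar>of_int (snd d)\<bar>)) * S t d" for t d
      using norm_strip_autocorrelation_le[OF N ab less_imp_le[OF h0], of s c d "- 2 * t * of_int (fst d)" "- 2 * t * of_int (snd d)"]
      by (simp add: A_def \<beta>_def w_def S_def l_def)
    \<comment> \<open>The factor across the edge is spent on decay in \<open>snd d\<close>; the
      power of \<open>h\<close> comes from the time average.\<close>
    have intA1: "integral {2 * pi * of_int k..2 * pi * of_int k + 2 * pi} (\<lambda>t. norm (A t d))
        \<le> 16 * pi * (l + 1) * (l + 2) * h * H * (w d * (3 / (1 + \<bar>of_int (snd d)\<bar>)))" if "transversal s d" for k :: int and d
    proof -
      have "norm (A t d) \<le> (l + 2) * w d * (3 / (1 + \<bar>of_int (snd d)\<bar>)) * S t d" for t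
      proof -
        have "(if snd d = 0 then h else min h (2 / \<bar>of_int (snd d)\<bar>)) \<le> (1 + 2) / (1 + \<bar>real_of_int (snd d)\<bar>)"
          by (rule min_quotient_le) (use h1 in auto)
        then have "(l + 2) * w d * (if snd d = 0 then h else min h (2 / \<bar>of_int (snd d)\<bar>)) * S t d
          \<le> (l + 2) * w d * (3 / (1 + \<bar>of_int (snd d)\<bar>)) * S t d"
          by (intro mult_right_mono mult_left_mono S0 mult_nonneg_nonneg w0) (use l in auto)
        with A_le[of t d] show ?thesis by linarith
      qed
      then have "integral {2 * pi * of_int k..2 * pi * of_int k + 2 * pi} (\<lambda>t. norm (A t d))
         \<le> integral {2 * pi * of_int k..2 * pi * of_int k + 2 * pi} (\<lambda>t. (l + 2) * w d * (3 / (1 + \<bar>of_int (snd d)\<bar>)) * S t d)"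
        by (intro integral_le integrable_continuous_real contA continuous_intros contS)
      also have "\<dots> = (l + 2) * w d * (3 / (1 + \<bar>of_int (snd d)\<bar>)) * integral {2 * pi * of_int k..2 * pi * of_int k + 2 * pi} (\<lambda>t. S t d)"
        by simp
      also have "\<dots> \<le> (l + 2) * w d * (3 / (1 + \<bar>of_int (snd d)\<bar>)) * (8 * pi * h * (l + 1) * (2 * H))"
      proof (rule mult_left_mono)
        have "integral {2 * pi * of_int k..2 * pi * of_int k + 2 * pi} (\<lambda>t. S t d)
          \<le> 8 * pi * h * (l + 1) * (\<Sum>n\<in>{n\<in>grid N. dotp n d = 0}. 1 / (1 + \<bar>of_int (fst n) + s * of_int (snd n)\<bar>))"
          unfolding S_def by (rule integral_sheared_mass_le[OF N l]) (use h0 in auto)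
        also have "\<dots> \<le> 8 * pi * h * (l + 1) * (2 * H)"
          unfolding H_def by (intro mult_left_mono transversal_orthogonal_sum_le that) (use h0 l in auto)
        finally show "integral {2 * pi * of_int k..2 * pi * of_int k + 2 * pi} (\<lambda>t. S t d) \<le> 8 * pi * h * (l + 1) * (2 * H)" .
      qed (use l w0[of d] in auto)
      also have "\<dots> = 16 * pi * (l + 1) * (l + 2) * h * H * (w d * (3 / (1 + \<bar>of_int (snd d)\<bar>)))"
      proof -
        have "(x * y * z) * (8 * p * q * r * (2 * u)) = 16 * p * r * x * q * u * (y * z)" for x y z p q r u :: real
          by simp
        then show ?thesis .
      qed
      finally show ?thesis .
    qed
    \<comment> \<open>The factor across the edge is spent on \<open>h\<close> instead, and the
      kernel mass is bounded pointwise. No decay in \<open>snd d\<close> is left, which is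
      acceptable only because these \<open>d\<close> are few.\<close>
    have intA2: "integral {2 * pi * of_int k..2 * pi * of_int k + 2 * pi} (\<lambda>t. norm (A t d))
        \<le> 2 * pi * (4 * pi\<^sup>2 * of_nat m) * (l + 2) * h * w d" for k :: int and d
    proof -
      have "norm (A t d) \<le> (l + 2) * w d * h * (4 * pi\<^sup>2 * of_nat m)" for t
      proof -
        have "(l + 2) * w d * (if snd d = 0 then h else min h (2 / \<bar>of_int (snd d)\<bar>)) * S t d
          \<le> (l + 2) * w d * h * (4 * pi\<^sup>2 * of_nat m)"
          by (intro mult_mono mult_nonneg_nonneg w0 S0 S_le order_refl) (use l h0 in auto)
        with A_le[of t d] show ?thesis by linarith
      qed
      then have "integral {2 * pi * of_int k..2 * pi * of_int k + 2 * pi} (\<lambda>t. norm (A t d))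
         \<le> integral {2 * pi * of_int k..2 * pi * of_int k + 2 * pi} (\<lambda>t. (l + 2) * w d * h * (4 * pi\<^sup>2 * of_nat m))"
        by (intro integral_le integrable_continuous_real contA continuous_intros)
      then show ?thesis by (simp add: mult_ac)
    qed
    \<comment> \<open>Summing over \<open>fst d\<close> first treats \<open>s * snd d\<close> as a
      fixed shift, against which the harmonic bound is uniform.\<close>
    have sum1: "(\<Sum>d\<in>grid (2 * N). w d * (3 / (1 + \<bar>real_of_int (snd d)\<bar>))) \<le> 24 * H\<^sup>2"
    proof -
      have "(\<Sum>d\<in>grid (2 * N). w d * (3 / (1 + \<bar>real_of_int (snd d)\<bar>)))
         = (\<Sum>i\<in>{- int (2 * N)..int (2 * N)}. \<Sum>j\<in>{- int (2 * N)..int (2 * N)}. w (i, j) * (3 / (1 + \<bar>real_of_int j\<bar>)))"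
        by (simp add: grid_def sum.cartesian_product case_prod_beta)
      also have "\<dots> = (\<Sum>j\<in>{- int (2 * N)..int (2 * N)}. \<Sum>i\<in>{- int (2 * N)..int (2 * N)}. w (i, j) * (3 / (1 + \<bar>real_of_int j\<bar>)))"
        by (rule sum.swap)
      also have "\<dots> = (\<Sum>j\<in>{- int (2 * N)..int (2 * N)}. (\<Sum>i\<in>{- int (2 * N)..int (2 * N)}. w (i, j)) * (3 / (1 + \<bar>real_of_int j\<bar>)))"
        by (simp only: sum_distrib_right)
      also have "\<dots> \<le> (\<Sum>j\<in>{- int (2 * N)..int (2 * N)}. (4 * H) * (3 / (1 + \<bar>real_of_int j\<bar>)))"
      proof (intro sum_mono mult_right_mono)
        fix j
        show "(\<Sum>i\<in>{- int (2 * N)..int (2 * N)}. w (i, j)) \<le> 4 * H"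
          using sum_inverse_shifted_le_harm[where M="2 * N" and \<alpha>="s * of_int j"] by (simp add: w_def H_def)
      qed simp
      also have "\<dots> = 12 * H * (\<Sum>j\<in>{- int (2 * N)..int (2 * N)}. 1 / (1 + \<bar>real_of_int j\<bar>))"
        by (simp add: sum_distrib_left mult_ac)
      also have "\<dots> \<le> 12 * H * (2 * H)"
        unfolding H_def by (intro mult_left_mono sum_inverse_int_le_harm) (auto simp: harm_nonneg)
      finally show ?thesis by (simp add: power2_eq_square)
    qed
    have sum2: "(\<Sum>d\<in>{d\<in>grid (2 * N). \<not> transversal s d}. w d) \<le> 7 * H\<^sup>2"
    proof -
      have "harm (2 * N) \<le> H" unfolding H_def harm_def by (intro sum_mono2) auto
      then have "(harm (2 * N))\<^sup>2 \<le> H\<^sup>2" by (intro power_mono harm_nonneg)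
      moreover have "1 \<le> H\<^sup>2" using H1 by simp
      ultimately show ?thesis using nontransversal_sum_le[where M="2 * N" and s=s] by (simp add: w_def)
    qed
    have "continuous_on UNIV Z" unfolding Z_def by (intro continuous_intros contA)
    moreover have "(norm (\<Sum>n\<in>grid N. fej2 N n * strip_coeff s a b c h n * cis (- phase t n) *
         cis (of_int (fst n) * x + of_int (snd n) * y)))\<^sup>2 \<le> Z t" for t x y
      unfolding Z_def A_def \<beta>_def
      by (rule evolution_square_le) (simp add: fej2_eq_0[OF N])
    moreover have "integral {2 * pi * of_int k..2 * pi * of_int k + 2 * pi} Z \<le> C * h * H ^ 3" for k :: int
    proof -
      let ?I = "{2 * pi * of_int k..2 * pi * of_int k + 2 * pi}"
      have "integral ?I Z = (\<Sum>d\<in>grid (2 * N). integral ?I (\<lambda>t. norm (A t d)))"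
        unfolding Z_def by (intro integral_sum integrable_continuous_real contA) simp
      also have "\<dots> = (\<Sum>d\<in>{d\<in>grid (2 * N). transversal s d}. integral ?I (\<lambda>t. norm (A t d)))
                   + (\<Sum>d\<in>{d\<in>grid (2 * N). \<not> transversal s d}. integral ?I (\<lambda>t. norm (A t d)))"
        by (subst sum.union_disjoint[symmetric]) (auto intro!: sum.cong)
      also have "\<dots> \<le> (\<Sum>d\<in>{d\<in>grid (2 * N). transversal s d}. 16 * pi * (l + 1) * (l + 2) * h * H * (w d * (3 / (1 + \<bar>of_int (snd d)\<bar>))))
                   + (\<Sum>d\<in>{d\<in>grid (2 * N). \<not> transversal s d}. 2 * pi * (4 * pi\<^sup>2 * of_nat m) * (l + 2) * h * w d)"
        by (intro add_mono sum_mono intA1 intA2) auto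
      also have "\<dots> \<le> (\<Sum>d\<in>grid (2 * N). 16 * pi * (l + 1) * (l + 2) * h * H * (w d * (3 / (1 + \<bar>of_int (snd d)\<bar>))))
                   + (\<Sum>d\<in>{d\<in>grid (2 * N). \<not> transversal s d}. 2 * pi * (4 * pi\<^sup>2 * of_nat m) * (l + 2) * h * w d)"
        by (intro add_right_mono sum_mono2) (use l h0 H1 w0 in auto)
      also have "\<dots> = 16 * pi * (l + 1) * (l + 2) * h * H * (\<Sum>d\<in>grid (2 * N). w d * (3 / (1 + \<bar>of_int (snd d)\<bar>)))
                   + 2 * pi * (4 * pi\<^sup>2 * of_nat m) * (l + 2) * h * (\<Sum>d\<in>{d\<in>grid (2 * N). \<not> transversal s d}. w d)"
        by (simp only: sum_distrib_left)
      also have "\<dots> \<le> 16 * pi * (l + 1) * (l + 2) * h * H * (24 * H\<^sup>2) + 2 * pi * (4 * pi\<^sup>2 * of_nat m) * (l + 2) * h * (7 * H\<^sup>2)"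
        by (intro add_mono mult_left_mono sum1 sum2) (use l h0 H1 in auto)
      also have "\<dots> = 384 * pi * (l + 1) * (l + 2) * (h * H ^ 3) + 2 * pi * (4 * pi\<^sup>2 * of_nat m) * (l + 2) * 7 * (h * H\<^sup>2)"
        by (simp add: power2_eq_square power3_eq_cube)
      also have "\<dots> \<le> 384 * pi * (l + 1) * (l + 2) * (h * H ^ 3) + 2 * pi * (4 * pi\<^sup>2 * of_nat m) * (l + 2) * 7 * (h * H ^ 3)"
        by (intro add_left_mono mult_left_mono C2 power_increasing H1) (use h0 in auto)
      also have "\<dots> = C * h * H ^ 3" by (simp add: C_def algebra_simps)
      finally show ?thesis .
    qed
    ultimately show "\<exists>Z. continuous_on UNIV Z \<and>
     (\<forall>t x y. (norm (\<Sum>n\<in>grid N. fej2 N n * strip_coeff s a b c h n * cis (- phase t n) *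
         cis (of_int (fst n) * x + of_int (snd n) * y)))\<^sup>2 \<le> Z t) \<and>
     (\<forall>k::int. integral {2 * pi * of_int k..2 * pi * of_int k + 2 * pi} Z \<le> C * h * (harm (4 * N + 1)) ^ 3)"
      unfolding H_def by blast
  qed
qed

section \<open>Fourier analysis on the torus\<close>

definition tchar :: "int \<times> int \<Rightarrow> real^2 \<Rightarrow> complex" where
  "tchar n x = cis (of_int (fst n) * x $ 1 + of_int (snd n) * x $ 2)"

definition lattice_vec :: "int \<times> int \<Rightarrow> real^2" where
  "lattice_vec k = vector [2 * pi * of_int (fst k), 2 * pi * of_int (snd k)]"

lemma lattice_vec_nth [simp]:
  "lattice_vec k $ 1 = 2 * pi * of_int (fst k)" "lattice_vec k $ 2 = 2 * pi * of_int (snd k)"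
  by (simp_all add: lattice_vec_def)

lemma vec2_eq_iff: "x = y \<longleftrightarrow> x $ 1 = y $ 1 \<and> x $ 2 = y $ 2" for x y :: "'a^2"
  by (simp add: vec_eq_iff forall_2)

lemma torus_eq_iff: "torus_eq x y \<longleftrightarrow> (\<exists>k. x = y + lattice_vec k)"
proof
  assume "torus_eq x y"
  then obtain a b :: int where "x $ 1 - y $ 1 = 2 * pi * of_int a" "x $ 2 - y $ 2 = 2 * pi * of_int b"
    by (auto simp: torus_eq_def forall_2)
  then have "x = y + lattice_vec (a, b)" by (simp add: vec2_eq_iff)
  then show "\<exists>k. x = y + lattice_vec k" by blast
next
  assume "\<exists>k. x = y + lattice_vec k"
  then show "torus_eq x y" by (auto simp: torus_eq_def forall_2)
qed

lemma torus_funD: "torus_fun f \<Longrightarrow> f (x + lattice_vec k) = f x"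
  unfolding torus_fun_def torus_eq_iff by blast

lemma torus_funI: "(\<And>x k. f (x + lattice_vec k) = f x) \<Longrightarrow> torus_fun f"
  unfolding torus_fun_def torus_eq_iff by auto

lemma lattice_vec_uminus: "lattice_vec (- k) = - lattice_vec k"
  by (simp add: vec2_eq_iff)

lemma lattice_vec_0: "lattice_vec 0 = 0"
  by (simp add: vec2_eq_iff)

lemma tchar_add: "tchar n (x + y) = tchar n x * tchar n y"
  by (simp add: tchar_def cis_mult algebra_simps)

lemma tchar_minus: "tchar n (- x) = cnj (tchar n x)"
  by (simp add: tchar_def cis_cnj algebra_simps)

lemma tchar_diff: "tchar n (x - y) = tchar n x * cnj (tchar n y)"
  using tchar_add[of n x "- y"] by (simp add: tchar_minus)

lemma tchar_mult: "tchar m x * tchar n x = tchar (m + n) x"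
  by (simp add: tchar_def cis_mult algebra_simps)

lemma tchar_cnj: "cnj (tchar n x) = tchar (- n) x"
  by (simp add: tchar_def cis_cnj algebra_simps)

lemma norm_tchar [simp]: "norm (tchar n x) = 1"
  by (simp add: tchar_def)

lemma tchar_lattice [simp]: "tchar n (lattice_vec k) = 1"
proof -
  have "tchar n (lattice_vec k) = cis (2 * pi * of_int (fst n * fst k + snd n * snd k))"
    by (simp add: tchar_def algebra_simps)
  then show ?thesis by (simp only: cis_2pi_int)
qed

lemma torus_fun_tchar: "torus_fun (tchar n)"
  by (rule torus_funI) (simp add: tchar_add)

lemma tchar_0 [simp]: "tchar 0 x = 1"
  by (simp add: tchar_def)

lemma continuous_on_tchar [continuous_intros]:
  "continuous_on A f \<Longrightarrow> continuous_on A (\<lambda>x. tchar n (f x))"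
  unfolding tchar_def by (intro continuous_intros)

lemma tchar_measurable [measurable]: "tchar n \<in> borel_measurable borel"
  by (intro borel_measurable_continuous_onI continuous_intros)

lemma torus_cell_iff: "x \<in> torus_cell \<longleftrightarrow> 0 \<le> x $ 1 \<and> x $ 1 < 2 * pi \<and> 0 \<le> x $ 2 \<and> x $ 2 < 2 * pi"
  by (auto simp: torus_cell_def forall_2)

lemma torus_cell_sets [measurable]: "torus_cell \<in> sets borel"
proof -
  have "torus_cell = {x. 0 \<le> x $ 1} \<inter> {x. x $ 1 < 2 * pi} \<inter> {x. 0 \<le> x $ 2} \<inter> {x. x $ 2 < 2 * pi}"
    by (auto simp: torus_cell_iff)
  also have "\<dots> \<in> sets borel"
    by (intro sets.Int borel_open borel_closed open_halfspace_component_lt_cart closed_halfspace_component_ge_cart)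
  finally show ?thesis .
qed

lemma emeasure_torus_cell: "emeasure lborel torus_cell = ennreal (4 * pi\<^sup>2)"
proof -
  let ?b = "(\<chi> i. 2 * pi) :: real^2"
  have sub: "box 0 ?b \<subseteq> torus_cell" "torus_cell \<subseteq> cbox 0 ?b"
    by (auto simp: torus_cell_def mem_box_cart less_imp_le) 
  have c: "measure lborel (cbox 0 ?b) = 4 * pi\<^sup>2"
    by (subst content_cbox_cart) (auto simp: interval_ne_empty_cart UNIV_2 power2_eq_square less_imp_le)
  have "emeasure lborel (cbox 0 ?b) = ennreal (4 * pi\<^sup>2)"
    by (subst emeasure_eq_ennreal_measure) (auto simp: c emeasure_lborel_cbox_eq)
  moreover have "emeasure lborel (box 0 ?b) = emeasure lborel (cbox 0 ?b)"
    by (simp add: emeasure_lborel_box_eq emeasure_lborel_cbox_eq)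
  ultimately show ?thesis
    using emeasure_mono[OF sub(1), of lborel] emeasure_mono[OF sub(2), of lborel] by auto
qed

lemma space_torus_measure [simp]: "space torus_measure = torus_cell"
  by (simp add: torus_measure_def space_restrict_space)

interpretation torus: finite_measure torus_measure
proof
  show "emeasure torus_measure (space torus_measure) \<noteq> \<infinity>"
    by (simp add: torus_measure_def emeasure_restrict_space space_restrict_space emeasure_torus_cell)
qed

lemma measure_torus: "measure torus_measure torus_cell = 4 * pi\<^sup>2"
  by (simp add: torus_measure_def emeasure_restrict_space measure_def emeasure_torus_cell)

lemma borel_measurable_torus [measurable (raw)]: "f \<in> borel_measurable borel \<Longrightarrow> f \<in> borel_measurable torus_measure"
  unfolding torus_measure_def by (rule measurable_restrict_space1) simp

lemma integral_torus:
  fixes f :: "real^2 \<Rightarrow> 'a::{banach, second_countable_topology}"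
  shows "(LINT x|torus_measure. f x) = (LINT x|lborel. indicator torus_cell x *\<^sub>R f x)"
  unfolding torus_measure_def by (rule integral_restrict_space) simp

lemma integrable_torus_bounded:
  fixes f :: "real^2 \<Rightarrow> 'a::{banach, second_countable_topology}"
  assumes "f \<in> borel_measurable torus_measure" "\<And>x. norm (f x) \<le> B"
  shows "integrable torus_measure f"
  by (rule torus.integrable_const_bound[where B=B]) (use assms in auto)

lemma AE_torus: "(AE x in torus_measure. Q x) \<longleftrightarrow> (AE x in lborel. x \<in> torus_cell \<longrightarrow> Q x)"
  unfolding torus_measure_def by (subst AE_restrict_space_iff) auto

section \<open>Periodisation and translation invariance on the torus\<close>

lemma lborel_integral_translate:
  fixes f :: "'b::euclidean_space \<Rightarrow> 'a::{banach, second_countable_topology}"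
  assumes "f \<in> borel_measurable borel"
  shows "(LINT x|lborel. f (x + c)) = (LINT x|lborel. f x)"
proof -
  have "(LINT x|lborel. f x) = (LINT x|distr lborel borel ((+) c). f x)" by (simp add: lborel_distr_plus)
  also have "\<dots> = (LINT x|lborel. f (c + x))" by (rule integral_distr) (use assms in auto)
  finally show ?thesis by (simp add: add.commute)
qed

lemma cell_translate_unique:
  fixes y :: "real^2"
  obtains k where "y - lattice_vec k \<in> torus_cell" "\<And>k'. y - lattice_vec k' \<in> torus_cell \<Longrightarrow> k' = k"
proof -
  have *: "0 \<le> r - 2 * pi * of_int k \<and> r - 2 * pi * of_int k < 2 * pi \<longleftrightarrow> k = \<lfloor>r / (2 * pi)\<rfloor>" for r :: real and k :: int
    by (subst eq_commute, subst floor_eq_iff) (auto simp: field_simps)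
  have "y - lattice_vec k \<in> torus_cell \<longleftrightarrow> k = (\<lfloor>y $ 1 / (2 * pi)\<rfloor>, \<lfloor>y $ 2 / (2 * pi)\<rfloor>)" for k
    using *[of "y $ 1" "fst k"] *[of "y $ 2" "snd k"] by (auto simp: torus_cell_iff prod_eq_iff)
  then show thesis using that by blast
qed

lemma sum_cell_indicator:
  fixes y :: "real^2"
  assumes "\<And>k. y - lattice_vec k \<in> torus_cell \<Longrightarrow> k \<in> K" "finite K"
  shows "(\<Sum>k\<in>K. indicator torus_cell (y - lattice_vec k)) = (1::real)"
proof -
  obtain k where k: "y - lattice_vec k \<in> torus_cell" "\<And>k'. y - lattice_vec k' \<in> torus_cell \<Longrightarrow> k' = k"
    using cell_translate_unique[of y] by blast
  have "(\<Sum>k\<in>K. indicator torus_cell (y - lattice_vec k)) = (\<Sum>k'\<in>K. if k' = k then 1 else 0 :: real)"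
  proof (intro sum.cong refl)
    fix k' show "indicator torus_cell (y - lattice_vec k') = (if k' = k then 1 else 0 :: real)"
    proof (cases "k' = k")
      case True
      then show ?thesis using k(1) by (simp only: indicator_simps if_True refl)
    next
      case False
      then have "y - lattice_vec k' \<notin> torus_cell" using k(2) by blast
      with False show ?thesis by (simp only: indicator_simps if_False not_False_eq_True)
    qed
  qed
  also have "\<dots> = 1" using assms(1)[OF k(1)] assms(2) by (simp only: sum.delta if_True)
  finally show ?thesis .
qed

lemma cell_index_bound:
  assumes "\<bar>r\<bar> \<le> R" "0 \<le> r - 2 * pi * real_of_int j" "r - 2 * pi * real_of_int j < 2 * pi" "R + 2 * pi \<le> 2 * pi * real M"
  shows "\<bar>real_of_int j\<bar> \<le> real M"
proof -
  have "\<bar>2 * pi * real_of_int j\<bar> \<le> 2 * pi * real M" using assms by linarith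
  then have "2 * pi * \<bar>real_of_int j\<bar> \<le> 2 * pi * real M" by (simp add: abs_mult)
  then show ?thesis by simp
qed

lemma grid_iff: "k \<in> grid M \<longleftrightarrow> \<bar>real_of_int (fst k)\<bar> \<le> real M \<and> \<bar>real_of_int (snd k)\<bar> \<le> real M"
proof -
  have "\<bar>real_of_int j\<bar> \<le> real M \<longleftrightarrow> - int M \<le> j \<and> j \<le> int M" for j by linarith
  then show ?thesis by (auto simp: grid_def mem_Times_iff)
qed

text \<open>Tiling the plane by translates of the cell and moving each tile back gives the integral
  of the periodisation. The condition on \<open>M\<close> makes \<open>grid M\<close> contain every
  tile that meets the support, so the periodisation is a finite sum.\<close>

lemma integral_unfold:
  fixes G :: "real^2 \<Rightarrow> complex"
  assumes G: "integrable lborel G" and supp: "\<And>y. G y \<noteq> 0 \<Longrightarrow> \<bar>y $ 1\<bar> \<le> R \<and> \<bar>y $ 2\<bar> \<le> R"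
    and M: "R + 2 * pi \<le> 2 * pi * real M"
  shows "(LINT y|lborel. G y) = (LINT x|torus_measure. (\<Sum>k\<in>grid M. G (x + lattice_vec k)))"
proof -
  have [measurable]: "G \<in> borel_measurable borel" using G by auto
  have ind: "indicator torus_cell (y - lattice_vec k) *\<^sub>R G y = 0" if "k \<notin> grid M" for k y
  proof (rule ccontr)
    assume "\<not> ?thesis"
    then have y: "y - lattice_vec k \<in> torus_cell" "G y \<noteq> 0" by (auto simp: indicator_def split: if_splits)
    have "k \<in> grid M" unfolding grid_iff
      using cell_index_bound[of "y $ 1" R "fst k" M] cell_index_bound[of "y $ 2" R "snd k" M] supp[OF y(2)] y(1) M
      by (simp add: torus_cell_iff)
    with that show False by simp
  qed
  have int: "integrable lborel (\<lambda>y. indicator torus_cell (y - lattice_vec k) *\<^sub>R G y)" for k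
  proof (rule Bochner_Integration.integrable_bound[OF G])
    show "AE x in lborel. norm (indicator torus_cell (x - lattice_vec k) *\<^sub>R G x) \<le> norm (G x)"
      by (auto simp: indicator_def)
  qed measurable
  have "(LINT y|lborel. G y) = (LINT y|lborel. (\<Sum>k\<in>grid M. indicator torus_cell (y - lattice_vec k) *\<^sub>R G y))"
  proof (rule Bochner_Integration.integral_cong[OF refl])
    fix y
    show "G y = (\<Sum>k\<in>grid M. indicator torus_cell (y - lattice_vec k) *\<^sub>R G y)"
    proof (cases "G y = 0")
      case False
      have "k \<in> grid M" if "y - lattice_vec k \<in> torus_cell" for k
        using ind[of k y] that False by (auto simp: indicator_def)
      then have "(\<Sum>k\<in>grid M. indicator torus_cell (y - lattice_vec k)) = (1::real)"
        by (rule sum_cell_indicator) simp_all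
      then show ?thesis by (simp add: scaleR_sum_left[symmetric])
    qed simp
  qed
  also have "\<dots> = (\<Sum>k\<in>grid M. LINT y|lborel. indicator torus_cell (y - lattice_vec k) *\<^sub>R G y)"
    by (rule Bochner_Integration.integral_sum) (rule int)
  also have "\<dots> = (\<Sum>k\<in>grid M. LINT x|lborel. indicator torus_cell x *\<^sub>R G (x + lattice_vec k))"
  proof (rule sum.cong[OF refl])
    fix k
    show "(LINT y|lborel. indicator torus_cell (y - lattice_vec k) *\<^sub>R G y) = (LINT x|lborel. indicator torus_cell x *\<^sub>R G (x + lattice_vec k))"
      using lborel_integral_translate[of "\<lambda>y. indicator torus_cell (y - lattice_vec k) *\<^sub>R G y" "lattice_vec k"] by simp
  qed
  also have "\<dots> = (LINT x|lborel. (\<Sum>k\<in>grid M. indicator torus_cell x *\<^sub>R G (x + lattice_vec k)))"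
  proof (rule Bochner_Integration.integral_sum[symmetric])
    fix k
    have "integrable (distr lborel borel ((+) (lattice_vec k))) (\<lambda>y. indicator torus_cell (y - lattice_vec k) *\<^sub>R G y)"
      using int[of k] by (simp add: lborel_distr_plus)
    then have "integrable lborel (\<lambda>x. indicator torus_cell (lattice_vec k + x - lattice_vec k) *\<^sub>R G (lattice_vec k + x))"
      by (subst (asm) integrable_distr_eq) auto
    then show "integrable lborel (\<lambda>x. indicator torus_cell x *\<^sub>R G (x + lattice_vec k))"
      by (simp add: add.commute)
  qed
  also have "\<dots> = (LINT x|torus_measure. (\<Sum>k\<in>grid M. G (x + lattice_vec k)))"
    unfolding integral_torus by (simp add: scaleR_sum_right)
  finally show ?thesis .
qed

lemma integral_torus_translate:
  fixes f :: "real^2 \<Rightarrow> complex"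
  assumes f: "torus_fun f" and [measurable]: "f \<in> borel_measurable borel" and B: "\<And>x. norm (f x) \<le> B"
  shows "(LINT x|torus_measure. f (x + h)) = (LINT x|torus_measure. f x)"
proof -
  \<comment> \<open>Cutting \<open>f\<close> off to the translated cell makes unfolding applicable;
    each point has exactly one lattice translate in that cell, so the periodisation of
    \<open>G\<close> is \<open>f\<close> again.\<close>
  define G where "G y = indicator torus_cell (y - h) *\<^sub>R f y" for y
  define R where "R = \<bar>h $ 1\<bar> + \<bar>h $ 2\<bar> + 2 * pi"
  obtain M :: nat where "(R + 2 * pi) / (2 * pi) \<le> real M" using real_arch_simple by blast
  then have M: "R + 2 * pi \<le> 2 * pi * real M" by (simp add: field_simps)
  have supp: "\<bar>y $ 1\<bar> \<le> R \<and> \<bar>y $ 2\<bar> \<le> R" if "G y \<noteq> 0" for y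
    using that by (auto simp: G_def R_def indicator_def torus_cell_iff split: if_splits)
  have cell_bd: "emeasure lborel ((\<lambda>x. x + h) ` torus_cell) < \<infinity>"
  proof -
    have "bounded torus_cell" by (rule bounded_subset[of "cbox 0 (\<chi> i. 2 * pi)"]) (auto simp: torus_cell_def mem_box_cart less_imp_le)
    then have "bounded ((\<lambda>x. x + h) ` torus_cell)" using bounded_translation[of torus_cell h] by (simp add: add.commute)
    then show ?thesis by (rule emeasure_bounded_finite)
  qed
  have set: "(\<lambda>x. x + h) ` torus_cell = {y. y - h \<in> torus_cell}" by (auto simp: image_iff) (metis diff_add_cancel)
  have intG: "integrable lborel G"
  proof (rule integrableI_bounded_set[where A="(\<lambda>x. x + h) ` torus_cell" and B=B])
    show "(\<lambda>x. x + h) ` torus_cell \<in> sets lborel" unfolding set by measurable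
    show "G \<in> borel_measurable lborel" unfolding G_def by measurable
  qed (use B cell_bd in \<open>auto simp: G_def set\<close>)
  have "(LINT x|torus_measure. f (x + h)) = (LINT y|lborel. G y)"
  proof -
    have "G \<in> borel_measurable borel" unfolding G_def by measurable
    from lborel_integral_translate[OF this, of h] show ?thesis unfolding integral_torus by (simp add: G_def)
  qed
  also have "\<dots> = (LINT x|torus_measure. (\<Sum>k\<in>grid M. G (x + lattice_vec k)))"
    by (rule integral_unfold[OF intG supp M])
  also have "\<dots> = (LINT x|torus_measure. f x)"
  proof (rule Bochner_Integration.integral_cong[OF refl])
    fix x :: "real^2" assume "x \<in> space torus_measure"
    then have x: "x \<in> torus_cell" by simp
    have "G (x + lattice_vec k) = indicator torus_cell ((x - h) - lattice_vec (- k)) *\<^sub>R f x" for k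
      by (simp add: G_def torus_funD[OF f] lattice_vec_uminus algebra_simps)
    then have "(\<Sum>k\<in>grid M. G (x + lattice_vec k)) = (\<Sum>k\<in>grid M. indicator torus_cell ((x - h) - lattice_vec (- k))) *\<^sub>R f x"
      by (simp add: scaleR_sum_left)
    also have "(\<Sum>k\<in>grid M. indicator torus_cell ((x - h) - lattice_vec (- k))) = (\<Sum>k\<in>grid M. indicator torus_cell ((x - h) - lattice_vec k) :: real)"
      by (rule sum.reindex_bij_witness[of _ uminus uminus]) (auto simp: grid_def)
    also have "\<dots> = 1"
    proof (rule sum_cell_indicator)
      fix k assume k: "x - h - lattice_vec k \<in> torus_cell"
      have "\<bar>(x - h) $ 1\<bar> \<le> R" "\<bar>(x - h) $ 2\<bar> \<le> R" using x unfolding torus_cell_iff R_def vector_minus_component by linarith+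
      then show "k \<in> grid M" unfolding grid_iff
        using cell_index_bound[of "(x - h) $ 1" R "fst k" M] cell_index_bound[of "(x - h) $ 2" R "snd k" M] k M
        by (simp add: torus_cell_iff)
    qed simp
    finally show "(\<Sum>k\<in>grid M. G (x + lattice_vec k)) = f x" by simp
  qed
  finally show ?thesis .
qed

section \<open>Fourier coefficients and Fejer means\<close>

definition fcoef :: "(real^2 \<Rightarrow> complex) \<Rightarrow> int \<times> int \<Rightarrow> complex" where
  "fcoef f n = (LINT y|torus_measure. f y * cnj (tchar n y)) / (4 * pi\<^sup>2)"

definition fejm :: "nat \<Rightarrow> (real^2 \<Rightarrow> complex) \<Rightarrow> real^2 \<Rightarrow> complex" where
  "fejm N f x = (\<Sum>n\<in>grid N. fej2 N n * fcoef f n * tchar n x)"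

definition fejer_kernel2 :: "nat \<Rightarrow> real^2 \<Rightarrow> real" where
  "fejer_kernel2 N x = fejer_kernel N (x $ 1) * fejer_kernel N (x $ 2)"

lemma fejer_kernel2_eq:
  assumes "N \<ge> 1"
  shows "complex_of_real (fejer_kernel2 N x) = (\<Sum>n\<in>grid N. fej2 N n * tchar n x)"
proof -
  have "complex_of_real (fejer_kernel2 N x) = (\<Sum>m\<in>{- int N..int N}. complex_of_real (fej N m) * cis (of_int m * x $ 1)) *
     (\<Sum>n\<in>{- int N..int N}. complex_of_real (fej N n) * cis (of_int n * x $ 2))"
    unfolding fejer_kernel_eq[OF assms] by (simp add: fejer_kernel2_def)
  also have "\<dots> = (\<Sum>n\<in>grid N. (complex_of_real (fej N (fst n)) * cis (of_int (fst n) * x $ 1)) * (complex_of_real (fej N (snd n)) * cis (of_int (snd n) * x $ 2)))"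
    unfolding sum_product grid_def sum.cartesian_product by (simp add: case_prod_beta)
  also have "\<dots> = (\<Sum>n\<in>grid N. fej2 N n * tchar n x)"
  proof (rule sum.cong[OF refl])
    fix n
    have "(complex_of_real (fej N (fst n)) * cis (of_int (fst n) * x $ 1)) * (complex_of_real (fej N (snd n)) * cis (of_int (snd n) * x $ 2))
      = complex_of_real (fej N (fst n)) * complex_of_real (fej N (snd n)) * (cis (of_int (fst n) * x $ 1) * cis (of_int (snd n) * x $ 2))"
      by (simp only: mult_ac)
    then show "(complex_of_real (fej N (fst n)) * cis (of_int (fst n) * x $ 1)) * (complex_of_real (fej N (snd n)) * cis (of_int (snd n) * x $ 2))
      = fej2 N n * tchar n x" by (simp only: cis_mult fej2_def tchar_def of_real_mult)
  qed
  finally show ?thesis .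
qed

lemma fejer_kernel2_nonneg: "0 \<le> fejer_kernel2 N x"
  by (simp add: fejer_kernel2_def fejer_kernel_nonneg)

text \<open>For \<open>n \<noteq> 0\<close> a translation by a vector \<open>h\<close> with
  \<open>tchar n h = -1\<close> preserves the integral and also changes its sign.\<close>

lemma integral_tchar: "(LINT x|torus_measure. tchar n x) = (if n = 0 then 4 * pi\<^sup>2 else 0)"
proof (cases "n = 0")
  case True
  then show ?thesis by (simp add: measure_torus scaleR_conv_of_real)
next
  case False
  obtain h where h: "tchar n h \<noteq> 1"
  proof (cases "fst n = 0")
    case True
    with False have "snd n \<noteq> 0" by (simp add: prod_eq_iff)
    with True show thesis by (intro that[of "vector [0, pi / of_int (snd n)]"]) (simp add: tchar_def complex_eq_iff)
  next
    case False
    then show thesis by (intro that[of "vector [pi / of_int (fst n), 0]"]) (simp add: tchar_def complex_eq_iff)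
  qed
  have "(LINT x|torus_measure. tchar n (x + h)) = (LINT x|torus_measure. tchar n x)"
    by (rule integral_torus_translate[where B=1]) (auto simp: torus_fun_tchar)
  then have "tchar n h * (LINT x|torus_measure. tchar n x) = (LINT x|torus_measure. tchar n x)"
    by (simp add: tchar_add mult.commute)
  with h False show ?thesis by auto
qed

lemma integrable_tchar_mult:
  assumes "integrable torus_measure f"
  shows "integrable torus_measure (\<lambda>y. f y * tchar n y)" "integrable torus_measure (\<lambda>y. f y * cnj (tchar n y))"
proof -
  show "integrable torus_measure (\<lambda>y. f y * tchar n y)"
    by (rule Bochner_Integration.integrable_bound[OF assms])
       (use assms in \<open>auto simp: norm_mult intro!: borel_measurable_times\<close>)
  show "integrable torus_measure (\<lambda>y. f y * cnj (tchar n y))"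
    unfolding tchar_cnj
    by (rule Bochner_Integration.integrable_bound[OF assms])
       (use assms in \<open>auto simp: norm_mult intro!: borel_measurable_times\<close>)
qed

lemma fejer_kernel2_measurable [measurable]: "fejer_kernel2 N \<in> borel_measurable borel"
  unfolding fejer_kernel2_def by (intro borel_measurable_continuous_onI continuous_intros)

lemma fejm_eq_integral:
  assumes N: "N \<ge> 1" and f: "integrable torus_measure f"
  shows "fejm N f x = (LINT y|torus_measure. f y * fejer_kernel2 N (x - y)) / (4 * pi\<^sup>2)"
    and "integrable torus_measure (\<lambda>y. f y * fejer_kernel2 N (x - y))"
proof -
  have eq: "f y * complex_of_real (fejer_kernel2 N (x - y)) = (\<Sum>n\<in>grid N. fej2 N n * tchar n x * (f y * cnj (tchar n y)))" for y
    unfolding fejer_kernel2_eq[OF N] tchar_diff sum_distrib_left by (simp add: mult_ac)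
  have int: "integrable torus_measure (\<lambda>y. fej2 N n * tchar n x * (f y * cnj (tchar n y)))" for n
    by (intro integrable_mult_right integrable_tchar_mult f)
  show "integrable torus_measure (\<lambda>y. f y * fejer_kernel2 N (x - y))"
    unfolding eq by (rule Bochner_Integration.integrable_sum) (rule int)
  have "(LINT y|torus_measure. f y * fejer_kernel2 N (x - y)) = (\<Sum>n\<in>grid N. LINT y|torus_measure. fej2 N n * tchar n x * (f y * cnj (tchar n y)))"
    unfolding eq by (rule Bochner_Integration.integral_sum) (rule int)
  also have "\<dots> = (\<Sum>n\<in>grid N. fej2 N n * tchar n x * (LINT y|torus_measure. f y * cnj (tchar n y)))"
    by (simp only: integral_mult_right_zero)
  finally show "fejm N f x = (LINT y|torus_measure. f y * fejer_kernel2 N (x - y)) / (4 * pi\<^sup>2)"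
    by (simp add: fejm_def fcoef_def sum_divide_distrib mult_ac)
qed

lemma integrable_tchar [simp]: "integrable torus_measure (tchar n)"
  by (rule integrable_torus_bounded[where B=1]) auto

lemma fcoef_tchar: "fcoef (tchar m) n = (if m = n then 1 else 0)"
proof -
  have "(LINT y|torus_measure. tchar m y * cnj (tchar n y)) = (LINT y|torus_measure. tchar (m - n) y)"
    by (simp add: tchar_cnj tchar_mult)
  then show ?thesis by (auto simp: fcoef_def integral_tchar)
qed

lemma fcoef_sum:
  assumes "\<And>i. i \<in> I \<Longrightarrow> integrable torus_measure (f i)"
  shows "fcoef (\<lambda>x. \<Sum>i\<in>I. c i * f i x) n = (\<Sum>i\<in>I. c i * fcoef (f i) n)"
proof -
  have "(LINT y|torus_measure. (\<Sum>i\<in>I. c i * f i y) * cnj (tchar n y)) = (LINT y|torus_measure. (\<Sum>i\<in>I. c i * (f i y * cnj (tchar n y))))"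
    by (simp add: sum_distrib_right mult.assoc)
  also have "\<dots> = (\<Sum>i\<in>I. LINT y|torus_measure. c i * (f i y * cnj (tchar n y)))"
    by (rule Bochner_Integration.integral_sum) (intro integrable_mult_right integrable_tchar_mult assms)
  finally show ?thesis by (simp add: fcoef_def sum_divide_distrib)
qed

lemma fcoef_fejm:
  assumes N: "N \<ge> 1"
  shows "fcoef (fejm N f) n = fej2 N n * fcoef f n"
proof -
  have "fcoef (fejm N f) n = fcoef (\<lambda>x. \<Sum>m\<in>grid N. (fej2 N m * fcoef f m) * tchar m x) n"
    by (rule arg_cong[where f="\<lambda>g. fcoef g n"]) (simp add: fejm_def fun_eq_iff)
  also have "\<dots> = (\<Sum>m\<in>grid N. (fej2 N m * fcoef f m) * fcoef (tchar m) n)"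
    by (rule fcoef_sum) simp
  also have "\<dots> = (\<Sum>m\<in>grid N. if m = n then fej2 N n * fcoef f n else 0)"
    by (intro sum.cong refl) (auto simp: fcoef_tchar)
  also have "\<dots> = fej2 N n * fcoef f n" using fej2_eq_0[OF N, of n] by auto
  finally show ?thesis .
qed

lemma continuous_fejm [continuous_intros]:
  "continuous_on A g \<Longrightarrow> continuous_on A (\<lambda>x. fejm N f (g x))"
  unfolding fejm_def by (intro continuous_intros)

lemma torus_fun_fejm: "torus_fun (fejm N f)"
  by (rule torus_funI) (simp add: fejm_def tchar_add)

lemma norm_fejm_le_sum: "norm (fejm N f x) \<le> (\<Sum>n\<in>grid N. norm (fej2 N n * fcoef f n))"
  unfolding fejm_def by (rule order_trans[OF norm_sum]) (simp add: norm_mult)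

lemma fejm_measurable [measurable]: "fejm N f \<in> borel_measurable borel"
  by (intro borel_measurable_continuous_onI continuous_intros)

lemma integrable_fejm: "integrable torus_measure (fejm N f)"
  by (rule integrable_torus_bounded[OF _ norm_fejm_le_sum]) measurable

text \<open>Both means are Fourier multipliers. This is used to compare Fejer means of two orders
  through a function smoothed by both.\<close>

lemma fejm_commute:
  assumes "M \<ge> 1" "N \<ge> 1"
  shows "fejm M (fejm N f) x = fejm N (fejm M f) x"
proof -
  have "fejm K (fejm L f) x = (\<Sum>n\<in>grid (max K L). fej2 K n * fej2 L n * fcoef f n * tchar n x)" if "K \<ge> 1" "L \<ge> 1" for K L
  proof -
    have "fejm K (fejm L f) x = (\<Sum>n\<in>grid K. fej2 K n * fej2 L n * fcoef f n * tchar n x)"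
      by (simp add: fejm_def[of K] fcoef_fejm[OF that(2)] mult_ac)
    also have "\<dots> = (\<Sum>n\<in>grid (max K L). fej2 K n * fej2 L n * fcoef f n * tchar n x)"
      by (rule sum.mono_neutral_left) (auto simp: grid_iff fej2_eq_0[OF that(1), unfolded grid_iff])
    finally show ?thesis .
  qed
  from this[of M N] this[of N M] assms show ?thesis by (simp add: max.commute mult_ac)
qed

lemma fejm_tchar:
  assumes "N \<ge> 1"
  shows "fejm N (tchar m) x = fej2 N m * tchar m x"
proof -
  have "fejm N (tchar m) x = (\<Sum>n\<in>grid N. if n = m then fej2 N m * tchar m x else 0)"
    unfolding fejm_def by (intro sum.cong refl) (auto simp: fcoef_tchar)
  then show ?thesis using fej2_eq_0[OF assms, of m] by auto
qed

lemma integral_fejer_kernel2_tchar: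
  assumes N: "N \<ge> 1"
  shows "(LINT y|torus_measure. tchar m (y - x) * fejer_kernel2 N (x - y)) = 4 * pi\<^sup>2 * fej2 N m"
    "integrable torus_measure (\<lambda>y. tchar m (y - x) * fejer_kernel2 N (x - y))"
proof -
  have eq: "tchar m (y - x) * fejer_kernel2 N (x - y) = cnj (tchar m x) * (tchar m y * fejer_kernel2 N (x - y))" for y
    by (simp add: tchar_diff)
  show "integrable torus_measure (\<lambda>y. tchar m (y - x) * fejer_kernel2 N (x - y))"
    unfolding eq by (intro integrable_mult_right fejm_eq_integral(2)[OF N] integrable_tchar)
  have "cnj (tchar m x) * tchar m x = 1" by (simp add: tchar_cnj tchar_mult)
  moreover have "(LINT y|torus_measure. tchar m y * fejer_kernel2 N (x - y)) = 4 * pi\<^sup>2 * fej2 N m * tchar m x"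
    using fejm_eq_integral(1)[OF N integrable_tchar, of m x] fejm_tchar[OF N, of m x] by (simp add: field_simps)
  moreover have "(LINT y|torus_measure. tchar m (y - x) * fejer_kernel2 N (x - y)) = cnj (tchar m x) * (LINT y|torus_measure. tchar m y * fejer_kernel2 N (x - y))"
    by (simp only: eq integral_mult_right_zero)
  ultimately show "(LINT y|torus_measure. tchar m (y - x) * fejer_kernel2 N (x - y)) = 4 * pi\<^sup>2 * fej2 N m"
    by (simp add: mult.left_commute)
qed

lemma cos_kernel_integrals:
  assumes N: "N \<ge> 1"
  shows "integrable torus_measure (\<lambda>y. cos (y $ i - x $ i) * fejer_kernel2 N (x - y))"
    and "(LINT y|torus_measure. cos (y $ i - x $ i) * fejer_kernel2 N (x - y)) = 4 * pi\<^sup>2 * (1 - 1 / N)"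
    and "integrable torus_measure (\<lambda>y. fejer_kernel2 N (x - y))"
    and "(LINT y|torus_measure. fejer_kernel2 N (x - y)) = 4 * pi\<^sup>2"
proof -
  obtain m where m: "\<And>z. cos (z $ i) = Re (tchar m z)" "fej2 N m = 1 - 1 / N"
  proof (cases "i = 1")
    case True
    then show thesis by (intro that[of "(1, 0)"]) (use N in \<open>auto simp: tchar_def fej2_def fej_0 fej_1\<close>)
  next
    case False
    then have "i = 2" using exhaust_2 by auto
    then show thesis by (intro that[of "(0, 1)"]) (use N in \<open>auto simp: tchar_def fej2_def fej_0 fej_1\<close>)
  qed
  have eq: "cos (y $ i - x $ i) * fejer_kernel2 N (x - y) = Re (tchar m (y - x) * fejer_kernel2 N (x - y))" for y
    using m(1)[of "y - x"] by simp
  show "integrable torus_measure (\<lambda>y. cos (y $ i - x $ i) * fejer_kernel2 N (x - y))"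
    unfolding eq by (intro integrable_Re integral_fejer_kernel2_tchar(2) N)
  show "(LINT y|torus_measure. cos (y $ i - x $ i) * fejer_kernel2 N (x - y)) = 4 * pi\<^sup>2 * (1 - 1 / N)"
    unfolding eq integral_Re[OF integral_fejer_kernel2_tchar(2)[OF N]] integral_fejer_kernel2_tchar(1)[OF N] by (simp add: m)
  have eq0: "fejer_kernel2 N (x - y) = Re (tchar 0 (y - x) * fejer_kernel2 N (x - y))" for y by simp
  show "integrable torus_measure (\<lambda>y. fejer_kernel2 N (x - y))"
    by (subst eq0) (intro integrable_Re integral_fejer_kernel2_tchar(2) N)
  show "(LINT y|torus_measure. fejer_kernel2 N (x - y)) = 4 * pi\<^sup>2"
    by (subst eq0, subst integral_Re[OF integral_fejer_kernel2_tchar(2)[OF N]], subst integral_fejer_kernel2_tchar(1)[OF N])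
       (simp add: fej2_def fej_0)
qed

text \<open>A Korovkin type argument: the kernel is nonnegative of mean 1, and its first cosine
  coefficients are \<open>1 - 1/N\<close>, so the trigonometric substitute for a squared distance
  has mean \<open>4/N\<close>. Any deviation dominated by \<open>\<epsilon>\<close> plus a multiple
  of that substitute is averaged accordingly. All convergence of Fejer means below is an instance of
  this.\<close>

lemma fejer_approximation:
  assumes N: "N \<ge> 1" and f: "integrable torus_measure f" and C: "0 \<le> C"
    and bd: "\<And>y. y \<in> torus_cell \<Longrightarrow> norm (f y - w) \<le> \<epsilon> + C * (4 - 2 * cos (y $ 1 - x $ 1) - 2 * cos (y $ 2 - x $ 2))"
  shows "norm (fejm N f x - w) \<le> \<epsilon> + 4 * C / N"
proof -
  let ?K = "\<lambda>y. fejer_kernel2 N (x - y)"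
  let ?g = "\<lambda>y. (\<epsilon> + 4 * C) * ?K y - 2 * C * (cos (y $ 1 - x $ 1) * ?K y) - 2 * C * (cos (y $ 2 - x $ 2) * ?K y)"
  note ints = cos_kernel_integrals[OF N]
  have int: "integrable torus_measure ?g"
    by (intro Bochner_Integration.integrable_diff integrable_mult_right ints)
  have intw: "integrable torus_measure (\<lambda>y. w * complex_of_real (?K y))"
    by (intro integrable_mult_right integrable_of_real ints)
  have K: "(LINT y|torus_measure. complex_of_real (?K y)) = 4 * pi\<^sup>2"
    by (subst integral_complex_of_real) (simp add: ints)
  have "(LINT y|torus_measure. (f y - w) * ?K y) = (LINT y|torus_measure. f y * ?K y) - (LINT y|torus_measure. w * ?K y)"
    unfolding left_diff_distrib by (rule Bochner_Integration.integral_diff[OF fejm_eq_integral(2)[OF N f] intw])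
  also have "(LINT y|torus_measure. w * ?K y) = w * (4 * pi\<^sup>2)"
    using K by simp
  finally have "fejm N f x - w = (LINT y|torus_measure. (f y - w) * ?K y) / (4 * pi\<^sup>2)"
    unfolding fejm_eq_integral(1)[OF N f] by (simp add: diff_divide_distrib)
  then have "norm (fejm N f x - w) = norm (LINT y|torus_measure. (f y - w) * ?K y) / (4 * pi\<^sup>2)"
    by (simp add: norm_divide norm_mult norm_power)
  also have "norm (LINT y|torus_measure. (f y - w) * ?K y) \<le> (LINT y|torus_measure. ?g y)"
  proof (rule Bochner_Integration.integral_norm_bound_integral[OF _ int])
    show "integrable torus_measure (\<lambda>y. (f y - w) * ?K y)"
      unfolding left_diff_distrib by (intro Bochner_Integration.integrable_diff fejm_eq_integral(2) N f intw)
    fix y assume "y \<in> space torus_measure"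
    then have "norm (f y - w) \<le> \<epsilon> + C * (4 - 2 * cos (y $ 1 - x $ 1) - 2 * cos (y $ 2 - x $ 2))" by (intro bd) simp
    from mult_right_mono[OF this fejer_kernel2_nonneg[of N "x - y"]]
    have "norm (f y - w) * ?K y \<le> ?g y" by (simp add: algebra_simps)
    moreover have "norm ((f y - w) * ?K y) = norm (f y - w) * ?K y"
      unfolding norm_mult by (simp add: fejer_kernel2_nonneg)
    ultimately show "norm ((f y - w) * ?K y) \<le> ?g y" by simp
  qed
  also have "(LINT y|torus_measure. ?g y) = (\<epsilon> + 4 * C) * (4 * pi\<^sup>2) - 2 * C * (4 * pi\<^sup>2 * (1 - 1 / N)) - 2 * C * (4 * pi\<^sup>2 * (1 - 1 / N))"
    by (simp only: Bochner_Integration.integral_diff Bochner_Integration.integrable_diff integrable_mult_right ints integral_mult_right_zero)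
  finally have "norm (fejm N f x - w) \<le> ((\<epsilon> + 4 * C) * (4 * pi\<^sup>2) - 2 * C * (4 * pi\<^sup>2 * (1 - 1 / N)) - 2 * C * (4 * pi\<^sup>2 * (1 - 1 / N))) / (4 * pi\<^sup>2)"
    by (simp add: divide_right_mono)
  also have "\<dots> = \<epsilon> + 4 * C / N" using N by (simp add: field_simps)
  finally show ?thesis .
qed

lemma fejm_bounded:
  assumes "N \<ge> 1" "integrable torus_measure f" "\<And>y. norm (f y) \<le> B"
  shows "norm (fejm N f x) \<le> B"
  using fejer_approximation[of N f 0 0 B x] assms by simp

lemma parseval_fejm:
  fixes c :: "int \<times> int \<Rightarrow> complex"
  shows "(LINT x|torus_measure. (norm (\<Sum>n\<in>grid N. c n * tchar n x))\<^sup>2) = 4 * pi\<^sup>2 * (\<Sum>n\<in>grid N. (norm (c n))\<^sup>2)"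
proof -
  let ?S = "\<lambda>x. \<Sum>n\<in>grid N. c n * tchar n x"
  have "complex_of_real ((norm (?S x))\<^sup>2) = (\<Sum>m\<in>grid N. \<Sum>n\<in>grid N. (c m * cnj (c n)) * tchar (m - n) x)" for x
  proof -
    have "tchar m x * tchar (- n) x = tchar (m - n) x" for m n by (simp add: tchar_mult)
    then show ?thesis
      unfolding complex_norm_square cnj_sum sum_product complex_cnj_mult tchar_cnj by (simp add: mult_ac)
  qed
  then have "complex_of_real (LINT x|torus_measure. (norm (?S x))\<^sup>2) = (LINT x|torus_measure. (\<Sum>m\<in>grid N. \<Sum>n\<in>grid N. (c m * cnj (c n)) * tchar (m - n) x))"
    by (subst integral_complex_of_real[symmetric]) simp
  also have "\<dots> = (\<Sum>m\<in>grid N. \<Sum>n\<in>grid N. (c m * cnj (c n)) * (LINT x|torus_measure. tchar (m - n) x))"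
    by (simp add: Bochner_Integration.integral_sum Bochner_Integration.integrable_sum integrable_mult_right)
  also have "\<dots> = (\<Sum>m\<in>grid N. \<Sum>n\<in>grid N. if n = m then (c m * cnj (c m)) * (4 * pi\<^sup>2) else 0)"
    by (intro sum.cong refl) (auto simp: integral_tchar)
  also have "\<dots> = (\<Sum>m\<in>grid N. (c m * cnj (c m)) * (4 * pi\<^sup>2))"
    by (intro sum.cong refl) simp
  also have "\<dots> = complex_of_real (4 * pi\<^sup>2 * (\<Sum>n\<in>grid N. (norm (c n))\<^sup>2))"
    by (simp add: complex_norm_square[symmetric] sum_distrib_left sum_distrib_right mult_ac del: of_real_power)
  finally show ?thesis by (simp only: of_real_eq_iff)
qed

section \<open>Hoelder continuity from dyadic differences\<close>

lemma cos_nearest_multiple: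
  fixes r :: real
  obtains k :: int where "\<bar>r - 2 * pi * of_int k\<bar> \<le> pi" "cos r = cos \<bar>r - 2 * pi * of_int k\<bar>"
proof -
  define k where "k = \<lfloor>(r + pi) / (2 * pi)\<rfloor>"
  have "of_int k \<le> (r + pi) / (2 * pi)" "(r + pi) / (2 * pi) < of_int k + 1"
    unfolding k_def by linarith+
  then have "2 * pi * of_int k \<le> r + pi" "r + pi < 2 * pi * of_int k + 2 * pi"
    by (auto simp: field_simps)
  then have 1: "\<bar>r - 2 * pi * of_int k\<bar> \<le> pi" by linarith
  have "cos r = cos (r - 2 * pi * of_int k)"
    by (simp add: cos_diff cos_int_2pin sin_int_2pin)
  then have "cos r = cos \<bar>r - 2 * pi * of_int k\<bar>" by simp
  with 1 show thesis by (rule that)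
qed

text \<open>Chaining: deleting the last binary digit of \<open>m\<close> moves the point by at most
  one dyadic step of length \<open>1 / 2^(k+i)\<close> and leaves a point of the next coarser
  level.\<close>

lemma dyadic_difference_bound:
  fixes f :: "real \<Rightarrow> 'a::real_normed_vector" and r :: real
  assumes H: "0 \<le> H" and r: "0 \<le> r" "r < 1" and d: "\<And>j x. norm (f (x + 1 / 2 ^ j) - f x) \<le> H * r ^ j"
    and m: "m \<le> 2 ^ i"
  shows "norm (f (x + real m / 2 ^ (k + i)) - f x) \<le> H * (\<Sum>j<Suc i. r ^ (k + j))"
  using m
proof (induction i arbitrary: m)
  case 0
  then have "m = 0 \<or> m = 1" by auto
  then show ?case using d[of x k] H r by auto
next
  case (Suc i)
  define q where "q = m div 2"
  have q: "q \<le> 2 ^ i" using Suc.prems by (auto simp: q_def)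
  have e: "real (2 * q) / 2 ^ (k + Suc i) = real q / 2 ^ (k + i)" by simp
  have "norm (f (x + real m / 2 ^ (k + Suc i)) - f (x + real q / 2 ^ (k + i))) \<le> H * r ^ (k + Suc i)"
  proof (cases "even m")
    case True
    then have "m = 2 * q" by (simp add: q_def)
    then show ?thesis using H r by (simp only: e) simp
  next
    case False
    then have "m = 2 * q + 1" by (simp add: q_def)
    then have "x + real m / 2 ^ (k + Suc i) = (x + real q / 2 ^ (k + i)) + 1 / 2 ^ (k + Suc i)"
      using e by (simp add: add_divide_distrib)
    then show ?thesis using d[of "x + real q / 2 ^ (k + i)" "k + Suc i"] by (simp only:)
  qed
  from norm_triangle_mono[OF this Suc.IH[OF q]]
  show ?case by (simp add: algebra_simps)
qed

lemma dyadic_hoelder: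
  fixes f :: "real \<Rightarrow> 'a::real_normed_vector" and \<theta> :: real
  assumes cont: "continuous_on UNIV f" and H: "0 \<le> H" and \<theta>: "0 < \<theta>" "\<theta> \<le> 1"
    and d: "\<And>j x. norm (f (x + 1 / 2 ^ j) - f x) \<le> H * (2 powr (- \<theta>)) ^ j"
    and z: "0 \<le> z" "z \<le> 1"
  shows "norm (f (x + z) - f x) \<le> (2 / (1 - 2 powr (- \<theta>))) * H * z powr \<theta>"
proof (cases "z = 0")
  case False
  define r where "r = 2 powr (- \<theta>)"
  have r: "0 < r" "r < 1" using \<theta> powr_less_mono[of "- \<theta>" 0 2] by (auto simp: r_def)
  \<comment> \<open>The level with \<open>1 / 2^(k+1) < z \<le> 1 / 2^k\<close>; chaining from this
    level on yields a geometric series of size \<open>r^k\<close>, comparable to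
    \<open>z powr \<theta>\<close>.\<close>
  define k where "k = nat \<lfloor>- log 2 z\<rfloor>"
  have z0: "0 < z" using z False by simp
  have "0 \<le> - log 2 z" using z z0 by (simp add: log_le_zero_cancel_iff)
  then have k: "real k \<le> - log 2 z" "- log 2 z < real k + 1" unfolding k_def by linarith+
  have zk: "z \<le> 1 / 2 ^ k"
  proof -
    have "z = 2 powr (log 2 z)" using z0 by simp
    also have "\<dots> \<le> 2 powr (- real k)" using k by (intro powr_mono) auto
    finally show ?thesis by (simp add: powr_minus powr_realpow inverse_eq_divide)
  qed
  have rk: "r ^ k \<le> 2 * z powr \<theta>"
  proof -
    have "r ^ k = 2 powr (- \<theta> * real k)" by (simp add: r_def powr_powr flip: powr_realpow)
    also have "\<dots> \<le> 2 powr (\<theta> + \<theta> * log 2 z)"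
    proof (rule powr_mono)
      have "\<theta> * (- real k) \<le> \<theta> * (1 + log 2 z)" using k \<theta> by (intro mult_left_mono) auto
      then show "- \<theta> * real k \<le> \<theta> + \<theta> * log 2 z" by (simp add: algebra_simps)
    qed simp
    also have "\<dots> = 2 powr \<theta> * (2 powr log 2 z) powr \<theta>" by (simp add: powr_add powr_powr mult.commute)
    also have "\<dots> \<le> 2 * z powr \<theta>" using z0 \<theta> powr_mono[of \<theta> 1 2] by (simp add: mult_right_mono)
    finally show ?thesis .
  qed
  have sum_le: "(\<Sum>j<Suc i. r ^ (k + j)) \<le> r ^ k / (1 - r)" for i
  proof -
    have "(\<Sum>j<Suc i. r ^ (k + j)) = r ^ k * (\<Sum>j<Suc i. r ^ j)" by (simp only: power_add sum_distrib_left)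
    also have "(\<Sum>j<Suc i. r ^ j) \<le> 1 / (1 - r)"
      using sum_le_suminf[of "\<lambda>j. r ^ j" "{..<Suc i}"] r by (simp add: suminf_geometric summable_geometric)
    finally show ?thesis using r by (simp add: mult_left_mono)
  qed
  \<comment> \<open>The binary expansion of \<open>z\<close> truncated after \<open>k + i\<close>
    digits. As \<open>z \<le> 1 / 2^k\<close>, its numerator is at most \<open>2^i\<close>, as
    chaining requires, and continuity carries the bound to \<open>z\<close>.\<close>
  define m where "m i = nat \<lfloor>z * 2 ^ (k + i)\<rfloor>" for i
  have mreal: "real (m i) = of_int \<lfloor>z * 2 ^ (k + i)\<rfloor>" for i using z by (simp add: m_def)
  have m_le: "m i \<le> 2 ^ i" for i
  proof -
    have "z * 2 ^ (k + i) \<le> 2 ^ i" using mult_right_mono[OF zk, of "2 ^ (k + i)"] by (simp add: power_add)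
    then have "\<lfloor>z * 2 ^ (k + i)\<rfloor> \<le> \<lfloor>2 ^ i :: real\<rfloor>" by (rule floor_mono)
    also have "\<lfloor>2 ^ i :: real\<rfloor> = 2 ^ i" by (metis floor_of_int of_int_numeral of_int_power)
    finally show ?thesis by (simp add: m_def nat_le_iff)
  qed
  have lim: "(\<lambda>i. real (m i) / 2 ^ (k + i)) \<longlonglongrightarrow> z"
  proof -
    have le: "norm (real (m i) / 2 ^ (k + i) - z) \<le> (1 / 2) ^ i" for i
    proof -
      have "\<bar>real (m i) - z * 2 ^ (k + i)\<bar> \<le> 1" unfolding mreal by linarith
      then have "\<bar>real (m i) - z * 2 ^ (k + i)\<bar> / 2 ^ (k + i) \<le> 1 / 2 ^ (k + i)" by (intro divide_right_mono) auto
      also have "\<bar>real (m i) - z * 2 ^ (k + i)\<bar> / 2 ^ (k + i) = \<bar>real (m i) / 2 ^ (k + i) - z\<bar>"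
      proof -
        have "real (m i) / 2 ^ (k + i) - z = (real (m i) - z * 2 ^ (k + i)) / 2 ^ (k + i)" by (simp add: field_simps)
        then show ?thesis by (simp only: abs_divide) simp
      qed
      also have "1 / 2 ^ (k + i) \<le> (1 / 2 :: real) ^ i" by (simp add: power_add field_simps)
      finally show ?thesis by (simp only: real_norm_def)
    qed
    have "(\<lambda>i. (1 / 2 :: real) ^ i) \<longlonglongrightarrow> 0" by (simp add: LIMSEQ_power_zero)
    then have "(\<lambda>i. real (m i) / 2 ^ (k + i) - z) \<longlonglongrightarrow> 0"
      by (rule Lim_null_comparison[OF eventuallyI[OF le]])
    then show ?thesis by (rule LIM_zero_cancel)
  qed
  have "(\<lambda>i. f (x + real (m i) / 2 ^ (k + i)) - f x) \<longlonglongrightarrow> f (x + z) - f x"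
    by (intro tendsto_diff tendsto_const continuous_on_tendsto_compose[OF cont] tendsto_add lim) auto
  then have lim': "(\<lambda>i. norm (f (x + real (m i) / 2 ^ (k + i)) - f x)) \<longlonglongrightarrow> norm (f (x + z) - f x)" by (rule tendsto_norm)
  have "norm (f (x + real (m i) / 2 ^ (k + i)) - f x) \<le> H * (r ^ k / (1 - r))" for i
    by (rule order_trans[OF dyadic_difference_bound[OF H less_imp_le[OF r(1)] r(2) d[folded r_def] m_le] mult_left_mono[OF sum_le H]])
  then have "norm (f (x + z) - f x) \<le> H * (r ^ k / (1 - r))"
    by (intro LIMSEQ_le_const2[OF lim']) auto
  also have "\<dots> \<le> H * (2 * z powr \<theta> / (1 - r))"
    using rk H r by (intro mult_left_mono divide_right_mono) auto
  finally show ?thesis by (simp add: r_def mult_ac)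
qed (use assms in simp)

text \<open>Concavity of the sine gives \<open>sin u \<ge> 2 * u / pi\<close> for
  \<open>u = |z| / 2\<close>; with \<open>1 - cos z = 2 * (sin u)^2\<close> and
  \<open>pi^2 \<le> 12\<close> the constant 3 results.\<close>

lemma cos_quadratic_lower:
  fixes z :: real
  assumes "\<bar>z\<bar> \<le> pi"
  shows "z\<^sup>2 \<le> 3 * (2 - 2 * cos z)"
proof -
  have conc: "concave_on {0..pi} sin"
  proof (rule f''_le0_imp_concave)
    show "DERIV sin x :> cos x" for x :: real by (rule DERIV_sin)
    show "DERIV cos x :> - sin x" for x :: real by (rule DERIV_cos)
    show "- sin x \<le> 0" if "x \<in> {0..pi}" for x :: real using that sin_ge_zero by simp
  qed simp
  define u where "u = \<bar>z\<bar> / 2"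
  have u: "0 \<le> u" "u \<le> pi / 2" using assms by (auto simp: u_def)
  define t where "t = 2 * u / pi"
  have t: "0 \<le> t" "t \<le> 1" using u by (auto simp: t_def field_simps)
  have "sin ((1 - t) *\<^sub>R 0 + t *\<^sub>R (pi / 2)) \<ge> (1 - t) * sin 0 + t * sin (pi / 2)"
    by (rule concave_onD[OF conc t]) auto
  then have "t \<le> sin u" by (simp add: t_def)
  then have "t\<^sup>2 \<le> (sin u)\<^sup>2" using t by (intro power_mono) auto
  moreover have "cos z = 1 - 2 * (sin u)\<^sup>2"
    using cos_double_sin[of u] by (simp add: u_def)
  moreover have "z\<^sup>2 \<le> 12 * t\<^sup>2"
  proof -
    have "z\<^sup>2 = pi\<^sup>2 * t\<^sup>2" by (simp add: t_def u_def power_divide power_mult_distrib)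
    also have "pi\<^sup>2 * t\<^sup>2 \<le> 12 * t\<^sup>2"
  proof (rule mult_right_mono)
    have "pi\<^sup>2 \<le> (3.4)\<^sup>2" using pi_less_4 pi_approx by (intro power_mono) auto
    then show "pi\<^sup>2 \<le> 12" by (simp add: power2_eq_square)
  qed simp
    finally show ?thesis .
  qed
  ultimately show ?thesis by (simp add: algebra_simps)
qed

text \<open>One coordinate is moved after the other. The range 4 contains \<open>[-pi, pi]\<close>,
  so every difference of points on the torus has a representative in it.\<close>

lemma torus_dyadic_hoelder:
  fixes w :: "real^2 \<Rightarrow> complex"
  assumes cont: "continuous_on UNIV w" and H: "0 \<le> H" and \<theta>: "0 < \<theta>" "\<theta> \<le> 1"
    and d1: "\<And>j x. norm (w (x + vector [1 / 2 ^ j, 0]) - w x) \<le> H * (2 powr (- \<theta>)) ^ j"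
    and d2: "\<And>j x. norm (w (x + vector [0, 1 / 2 ^ j]) - w x) \<le> H * (2 powr (- \<theta>)) ^ j"
    and z: "\<bar>z $ 1\<bar> \<le> 4" "\<bar>z $ 2\<bar> \<le> 4"
  shows "norm (w (x + z) - w x) \<le> (8 / (1 - 2 powr (- \<theta>))) * H * (\<bar>z $ 1\<bar> powr \<theta> + \<bar>z $ 2\<bar> powr \<theta>)"
proof -
  define c where "c = 2 / (1 - 2 powr (- \<theta>)) * H"
  have c: "0 \<le> c" using H \<theta> powr_less_mono[of "- \<theta>" 0 2] by (auto simp: c_def)
  have main: "norm (w (y + s *\<^sub>R e) - w y) \<le> 4 * c * \<bar>s\<bar> powr \<theta>"
    if d: "\<And>j x. norm (w (x + (1 / 2 ^ j) *\<^sub>R e) - w x) \<le> H * (2 powr (- \<theta>)) ^ j" and s: "\<bar>s\<bar> \<le> 4" for e y s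
  proof -
    have pos: "norm (w (y + s *\<^sub>R e) - w y) \<le> c * s powr \<theta>" if "0 \<le> s" "s \<le> 1" for s y
    proof -
      have "norm (w (y + (0 + s) *\<^sub>R e) - w (y + 0 *\<^sub>R e)) \<le> (2 / (1 - 2 powr (- \<theta>))) * H * s powr \<theta>"
      proof (rule dyadic_hoelder[where f="\<lambda>s. w (y + s *\<^sub>R e)", OF _ H \<theta> _ that])
        show "continuous_on UNIV (\<lambda>s. w (y + s *\<^sub>R e))"
          by (intro continuous_on_compose2[OF cont] continuous_intros) auto
        show "norm (w (y + (x + 1 / 2 ^ j) *\<^sub>R e) - w (y + x *\<^sub>R e)) \<le> H * (2 powr - \<theta>) ^ j" for j x
          using d[of "y + x *\<^sub>R e" j] by (simp add: scaleR_add_left add.assoc)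
      qed
      then show ?thesis by (simp add: c_def)
    qed
    have abs: "norm (w (y + s *\<^sub>R e) - w y) \<le> c * \<bar>s\<bar> powr \<theta>" if "\<bar>s\<bar> \<le> 1" for s y
    proof (cases "0 \<le> s")
      case False
      have "norm (w ((y + s *\<^sub>R e) + (- s) *\<^sub>R e) - w (y + s *\<^sub>R e)) \<le> c * (- s) powr \<theta>"
        by (rule pos) (use False that in auto)
      then show ?thesis using False by (simp add: norm_minus_commute)
    qed (use pos that in auto)
    \<comment> \<open>Steps of length up to 4 are cut into four equal ones, since the dyadic
      estimate reaches only to length 1.\<close>
    define q where "q = s / 4"
    have q: "\<bar>q\<bar> \<le> 1" using s by (simp add: q_def)
    have e: "y + s *\<^sub>R e = (((y + q *\<^sub>R e) + q *\<^sub>R e) + q *\<^sub>R e) + q *\<^sub>R e"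
      by (simp add: q_def algebra_simps flip: scaleR_add_left)
    have tri: "norm (p4 - p0) \<le> norm (p1 - p0) + norm (p2 - p1) + norm (p3 - p2) + norm (p4 - p3)" for p0 p1 p2 p3 p4 :: complex
      by norm
    have "norm (w (y + s *\<^sub>R e) - w y) \<le> 4 * (c * \<bar>q\<bar> powr \<theta>)"
      unfolding e using tri[of "w ((((y + q *\<^sub>R e) + q *\<^sub>R e) + q *\<^sub>R e) + q *\<^sub>R e)" "w y" "w (y + q *\<^sub>R e)" "w ((y + q *\<^sub>R e) + q *\<^sub>R e)" "w (((y + q *\<^sub>R e) + q *\<^sub>R e) + q *\<^sub>R e)"] abs[OF q, of y] abs[OF q, of "y + q *\<^sub>R e"] abs[OF q, of "(y + q *\<^sub>R e) + q *\<^sub>R e"] abs[OF q, of "((y + q *\<^sub>R e) + q *\<^sub>R e) + q *\<^sub>R e"]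
      by linarith
    also have "\<dots> \<le> 4 * (c * \<bar>s\<bar> powr \<theta>)"
      using c \<theta> by (intro mult_left_mono powr_mono2) (auto simp: q_def)
    finally show ?thesis by simp
  qed
  have v: "(1 / 2 ^ j) *\<^sub>R vector [1, 0] = (vector [1 / 2 ^ j, 0] :: real^2)" "(1 / 2 ^ j) *\<^sub>R vector [0, 1] = (vector [0, 1 / 2 ^ j] :: real^2)" for j :: nat
    by (simp_all add: vec2_eq_iff)
  have "norm (w (x + (z $ 1) *\<^sub>R vector [1, 0]) - w x) \<le> 4 * c * \<bar>z $ 1\<bar> powr \<theta>"
    by (rule main[OF _ z(1)]) (simp only: v d1)
  moreover have "norm (w ((x + (z $ 1) *\<^sub>R vector [1, 0]) + (z $ 2) *\<^sub>R vector [0, 1]) - w (x + (z $ 1) *\<^sub>R vector [1, 0])) \<le> 4 * c * \<bar>z $ 2\<bar> powr \<theta>"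
    by (rule main[OF _ z(2)]) (simp only: v d2)
  moreover have "(x + (z $ 1) *\<^sub>R vector [1, 0]) + (z $ 2) *\<^sub>R vector [0, 1] = x + z"
    by (simp add: vec2_eq_iff)
  ultimately have "norm (w (x + z) - w x) \<le> 4 * c * \<bar>z $ 1\<bar> powr \<theta> + 4 * c * \<bar>z $ 2\<bar> powr \<theta>"
    using norm_triangle_mono by fastforce
  then show ?thesis by (simp add: c_def algebra_simps add_divide_distrib)
qed

text \<open>Splitting at \<open>s = \<delta>\<close> puts a Hoelder bound into the form constant
  plus multiple of the squared distance that \<open>fejer_approximation\<close> accepts.\<close>

lemma powr_le_quadratic:
  fixes s \<delta> \<theta> :: real
  assumes "0 \<le> s" "0 < \<delta>" "0 < \<theta>" "\<theta> \<le> 1"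
  shows "s powr \<theta> \<le> \<delta> powr \<theta> + \<delta> powr (\<theta> - 2) * s\<^sup>2"
proof (cases "s \<le> \<delta>")
  case True
  then have "s powr \<theta> \<le> \<delta> powr \<theta>" using assms by (intro powr_mono2) auto
  then show ?thesis by (simp add: add_increasing2)
next
  case False
  then have "0 < s" using assms by linarith
  then have "s powr \<theta> = s powr (\<theta> - 2) * s\<^sup>2" using powr_diff[of s \<theta> 2] by simp
  also have "\<dots> \<le> \<delta> powr (\<theta> - 2) * s\<^sup>2"
    using False assms by (intro mult_right_mono powr_mono2') auto
  finally show ?thesis using False assms by (simp add: add_increasing)
qed

lemma fejm_hoelder_error:
  fixes w :: "real^2 \<Rightarrow> complex"
  assumes N: "N \<ge> 1" and tf: "torus_fun w" and int: "integrable torus_measure w" and C: "0 \<le> C" and \<theta>: "0 < \<theta>" "\<theta> \<le> 1"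
    and hd: "\<And>x z. \<bar>z $ 1\<bar> \<le> 4 \<Longrightarrow> \<bar>z $ 2\<bar> \<le> 4 \<Longrightarrow> norm (w (x + z) - w x) \<le> C * (\<bar>z $ 1\<bar> powr \<theta> + \<bar>z $ 2\<bar> powr \<theta>)"
  shows "norm (fejm N w x - w x) \<le> 14 * C * real N powr (- \<theta> / 2)"
proof -
  \<comment> \<open>This choice balances \<open>\<delta> powr \<theta>\<close> against
    \<open>\<delta> powr (\<theta> - 2) / N\<close>; the constants \<open>2\<close> and
    \<open>4 * 3\<close> add up to 14.\<close>
  define \<delta> where "\<delta> = real N powr (- 1 / 2)"
  have \<delta>: "0 < \<delta>" using N by (simp add: \<delta>_def)
  have "norm (fejm N w x - w x) \<le> 2 * C * \<delta> powr \<theta> + 4 * (3 * C * \<delta> powr (\<theta> - 2)) / N"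
  proof (rule fejer_approximation[OF N int])
    show "0 \<le> 3 * C * \<delta> powr (\<theta> - 2)" using C by simp
    fix y :: "real^2"
    obtain k1 :: int where k1: "\<bar>(y $ 1 - x $ 1) - 2 * pi * of_int k1\<bar> \<le> pi" "cos (y $ 1 - x $ 1) = cos \<bar>(y $ 1 - x $ 1) - 2 * pi * of_int k1\<bar>"
      using cos_nearest_multiple .
    obtain k2 :: int where k2: "\<bar>(y $ 2 - x $ 2) - 2 * pi * of_int k2\<bar> \<le> pi" "cos (y $ 2 - x $ 2) = cos \<bar>(y $ 2 - x $ 2) - 2 * pi * of_int k2\<bar>"
      using cos_nearest_multiple .
    define z where "z = y - x - lattice_vec (k1, k2)"
    have z: "\<bar>z $ 1\<bar> \<le> pi" "\<bar>z $ 2\<bar> \<le> pi" "cos (z $ 1) = cos (y $ 1 - x $ 1)" "cos (z $ 2) = cos (y $ 2 - x $ 2)"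
      using k1 k2 by (auto simp: z_def)
    have "w (x + z) = w y" using torus_funD[OF tf, of "x + z" "(k1, k2)"] by (simp add: z_def)
    then have "norm (w y - w x) \<le> C * (\<bar>z $ 1\<bar> powr \<theta> + \<bar>z $ 2\<bar> powr \<theta>)"
      using hd[of z x] z pi_less_4 by simp
    also have "\<dots> \<le> C * ((\<delta> powr \<theta> + \<delta> powr (\<theta> - 2) * (3 * (2 - 2 * cos (z $ 1)))) + (\<delta> powr \<theta> + \<delta> powr (\<theta> - 2) * (3 * (2 - 2 * cos (z $ 2)))))"
    proof (intro mult_left_mono add_mono C)
      have *: "\<bar>s\<bar> powr \<theta> \<le> \<delta> powr \<theta> + \<delta> powr (\<theta> - 2) * (3 * (2 - 2 * cos s))" if "\<bar>s\<bar> \<le> pi" for s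
      proof -
        have "\<bar>s\<bar> powr \<theta> \<le> \<delta> powr \<theta> + \<delta> powr (\<theta> - 2) * \<bar>s\<bar>\<^sup>2" by (rule powr_le_quadratic) (use \<delta> \<theta> in auto)
        also have "\<dots> \<le> \<delta> powr \<theta> + \<delta> powr (\<theta> - 2) * (3 * (2 - 2 * cos s))"
          using cos_quadratic_lower[OF that] by (intro add_left_mono mult_left_mono) auto
        finally show ?thesis .
      qed
      show "\<bar>z $ 1\<bar> powr \<theta> \<le> \<delta> powr \<theta> + \<delta> powr (\<theta> - 2) * (3 * (2 - 2 * cos (z $ 1)))" by (rule *[OF z(1)])
      show "\<bar>z $ 2\<bar> powr \<theta> \<le> \<delta> powr \<theta> + \<delta> powr (\<theta> - 2) * (3 * (2 - 2 * cos (z $ 2)))" by (rule *[OF z(2)])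
    qed
    also have "\<dots> = 2 * C * \<delta> powr \<theta> + (3 * C * \<delta> powr (\<theta> - 2)) * (4 - 2 * cos (y $ 1 - x $ 1) - 2 * cos (y $ 2 - x $ 2))"
      unfolding z(3,4) by (simp add: algebra_simps)
    finally show "norm (w y - w x) \<le> 2 * C * \<delta> powr \<theta> + (3 * C * \<delta> powr (\<theta> - 2)) * (4 - 2 * cos (y $ 1 - x $ 1) - 2 * cos (y $ 2 - x $ 2))" .
  qed
  also have "\<delta> powr (\<theta> - 2) = real N * \<delta> powr \<theta>"
    using N by (simp add: \<delta>_def powr_powr algebra_simps powr_diff powr_add)
  also have "2 * C * \<delta> powr \<theta> + 4 * (3 * C * (real N * \<delta> powr \<theta>)) / N = 14 * C * \<delta> powr \<theta>"
    using N by (simp add: field_simps)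
  also have "\<delta> powr \<theta> = real N powr (- \<theta> / 2)" by (simp add: \<delta>_def powr_powr)
  finally show ?thesis .
qed

lemma dyadic_scale:
  fixes z :: real
  assumes "0 < z" "z \<le> 1"
  obtains k :: nat where "z \<le> 1 / 2 ^ k" "1 / 2 ^ k \<le> 2 * z"
proof -
  define k where "k = nat \<lfloor>- log 2 z\<rfloor>"
  have "0 \<le> - log 2 z" using assms by (simp add: log_le_zero_cancel_iff)
  then have k: "real k \<le> - log 2 z" "- log 2 z < real k + 1" unfolding k_def by linarith+
  have e: "2 powr (- real k) = 1 / 2 ^ k" by (simp add: powr_minus powr_realpow inverse_eq_divide)
  have "z = 2 powr (log 2 z)" using assms by simp
  also have "\<dots> \<le> 2 powr (- real k)" using k by (intro powr_mono) auto
  finally have 1: "z \<le> 1 / 2 ^ k" by (simp only: e)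
  have "1 / 2 ^ k = 2 powr (- real k)" by (simp only: e)
  also have "\<dots> \<le> 2 powr (1 + log 2 z)" using k by (intro powr_mono) auto
  also have "\<dots> = 2 * z" using assms by (simp add: powr_add)
  finally show thesis using 1 by (intro that)
qed

text \<open>The Hoelder constants of the means may grow like \<open>2 powr (\<eta> * J)\<close>, but
  smoothing at order \<open>16^J\<close> has an error with the factor \<open>r^J * r^J\<close>,
  where \<open>r = 2 powr (- \<theta>)\<close>. One factor \<open>r^J\<close> absorbs the growth
  because \<open>\<eta> < \<theta>\<close>, the other makes the telescoping series converge. At
  distance \<open>\<epsilon>\<close> the limit is compared with the mean whose index satisfies
  \<open>2^J \<approx> 1/\<epsilon>\<close>, and there the growth costs exactly
  \<open>\<eta>\<close> in the exponent.\<close>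

lemma fejer_means_limit:
  fixes f :: "real^2 \<Rightarrow> complex" and \<theta> \<eta> H :: real
  assumes f: "integrable torus_measure f" and H: "0 \<le> H" and \<theta>: "0 < \<eta>" "\<eta> < \<theta>" "\<theta> \<le> 1"
    and d1: "\<And>J j x. norm (fejm (16 ^ J) f (x + vector [1 / 2 ^ j, 0]) - fejm (16 ^ J) f x) \<le> H * 2 powr (\<eta> * real J) * (2 powr (- \<theta>)) ^ j"
    and d2: "\<And>J j x. norm (fejm (16 ^ J) f (x + vector [0, 1 / 2 ^ j]) - fejm (16 ^ J) f x) \<le> H * 2 powr (\<eta> * real J) * (2 powr (- \<theta>)) ^ j"
  obtains v C where "torus_fun v" "continuous_on UNIV v" "0 \<le> C"
    "\<And>\<epsilon> x y. 0 < \<epsilon> \<Longrightarrow> \<epsilon> \<le> 1 \<Longrightarrow> \<bar>x $ 1 - y $ 1\<bar> \<le> \<epsilon> \<Longrightarrow> \<bar>x $ 2 - y $ 2\<bar> \<le> \<epsilon> \<Longrightarrow> norm (v x - v y) \<le> C * \<epsilon> powr (\<theta> - \<eta>)"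
    "uniform_limit UNIV (\<lambda>J. fejm (16 ^ J) f) v sequentially"
proof -
  define w where "w J = fejm (16 ^ J) f" for J :: nat
  define r where "r = 2 powr (- \<theta>)"
  have r: "0 < r" "r < 1" using \<theta> powr_less_mono[of "- \<theta>" 0 2] by (auto simp: r_def)
  define B where "B = 8 / (1 - r) * H"
  have B: "0 \<le> B" using r H by (simp add: B_def)
  \<comment> \<open>\<open>14 * B\<close> for smoothing the coarser mean and \<open>28 * B\<close>
    for the finer one, whose Hoelder constant is up to twice as large since
    \<open>\<eta> \<le> 1\<close>.\<close>
  define A where "A = 42 * B"
  have A: "0 \<le> A" using B by (simp add: A_def)
  have wcont: "continuous_on UNIV (w J)" for J
    unfolding w_def using continuous_fejm[OF continuous_on_id, of UNIV] by simp
  have hoelder: "norm (w J (x + z) - w J x) \<le> (B * 2 powr (\<eta> * real J)) * (\<bar>z $ 1\<bar> powr \<theta> + \<bar>z $ 2\<bar> powr \<theta>)"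
    if "\<bar>z $ 1\<bar> \<le> 4" "\<bar>z $ 2\<bar> \<le> 4" for J x z
    using torus_dyadic_hoelder[OF wcont _ _ \<theta>(3) d1[folded w_def] d2[folded w_def] that, of J x] H \<theta>
    by (simp add: B_def r_def mult.assoc)
  have N1: "(16::nat) ^ J \<ge> 1" for J by simp
  have scale: "real (16 ^ J) powr (- \<theta> / 2) = r ^ J * r ^ J" for J
  proof -
    have "real (16 ^ J) = (2 ^ 4) ^ J" by simp
    also have "\<dots> = 2 ^ (4 * J)" by (simp only: power_mult)
    also have "\<dots> = 2 powr real (4 * J)" by (rule powr_realpow[symmetric]) simp
    finally have "real (16 ^ J) = 2 powr real (4 * J)" .
    then have "real (16 ^ J) powr (- \<theta> / 2) = 2 powr (- \<theta> * real J * 2)" 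
    proof -
      have "real (4 * J) * (- \<theta> / 2) = - \<theta> * real J * 2" by simp
      then show ?thesis using \<open>real (16 ^ J) = 2 powr real (4 * J)\<close> by (simp only: powr_powr)
    qed
    also have "\<dots> = (2 powr (- \<theta> * real J)) * (2 powr (- \<theta> * real J))"
    proof -
      have "- \<theta> * real J * 2 = - \<theta> * real J + - \<theta> * real J" by simp
      then show ?thesis by (simp only: powr_add)
    qed
    also have "2 powr (- \<theta> * real J) = r ^ J" by (simp add: r_def powr_powr flip: powr_realpow)
    finally show ?thesis .
  qed
  have \<eta>r: "2 powr (\<eta> * real J) * r ^ J \<le> 1" for J
  proof -
    have "r ^ J = 2 powr (- \<theta> * real J)" by (simp add: r_def powr_powr flip: powr_realpow)
    then have "2 powr (\<eta> * real J) * r ^ J = 2 powr ((\<eta> - \<theta>) * real J)" by (simp add: powr_add[symmetric] algebra_simps)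
    also have "\<dots> \<le> 2 powr 0" using \<theta> by (intro powr_mono) (auto simp: mult_nonpos_nonneg)
    finally show ?thesis by simp
  qed
  have err: "norm (fejm (16 ^ K) (w L) x - w L x) \<le> 14 * (B * 2 powr (\<eta> * real L)) * (r ^ K * r ^ K)" for K L x
  proof -
    have "norm (fejm (16 ^ K) (w L) x - w L x) \<le> 14 * (B * 2 powr (\<eta> * real L)) * real (16 ^ K) powr (- \<theta> / 2)"
      by (rule fejm_hoelder_error[OF N1 _ _ _ _ \<theta>(3) hoelder]) (use B \<theta> in \<open>auto simp: w_def torus_fun_fejm integrable_fejm\<close>)
    then show ?thesis by (simp only: scale)
  qed
  have step: "norm (w (Suc J) x - w J x) \<le> A * r ^ J" for J x
  proof -
    \<comment> \<open>Consecutive means are compared through the function smoothed at both orders: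
      it is close to \<open>w (Suc J)\<close> and to \<open>w J\<close>, each time by the Hoelder
      error bound.\<close>
    have comm: "fejm (16 ^ J) (w (Suc J)) x = fejm (16 ^ Suc J) (w J) x"
      unfolding w_def by (rule fejm_commute) auto
    have "norm (fejm (16 ^ J) (w (Suc J)) x - w (Suc J) x) \<le> 28 * B * (2 powr (\<eta> * real J) * r ^ J) * r ^ J"
    proof -
      have "2 powr (\<eta> * real (Suc J)) \<le> 2 * 2 powr (\<eta> * real J)"
        using \<theta> powr_mono[of \<eta> 1 2] by (simp add: algebra_simps powr_add)
      then have "14 * (B * 2 powr (\<eta> * real (Suc J))) * (r ^ J * r ^ J) \<le> 14 * (B * (2 * 2 powr (\<eta> * real J))) * (r ^ J * r ^ J)"
        using B r by (intro mult_right_mono mult_left_mono) auto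
      with err[of J "Suc J" x] show ?thesis by (simp add: mult_ac)
    qed
    also have "\<dots> \<le> 28 * B * 1 * r ^ J" using B r \<eta>r[of J] by (intro mult_right_mono mult_left_mono) auto
    finally have 1: "norm (fejm (16 ^ J) (w (Suc J)) x - w (Suc J) x) \<le> 28 * B * r ^ J" by simp
    have "norm (fejm (16 ^ Suc J) (w J) x - w J x) \<le> 14 * B * (2 powr (\<eta> * real J) * r ^ J) * (r ^ J * (r * r))"
      using err[of "Suc J" J x] by (simp add: mult_ac)
    also have "\<dots> \<le> 14 * B * 1 * (r ^ J * 1)"
      using B r \<eta>r[of J] by (intro mult_mono mult_left_mono mult_nonneg_nonneg) (auto simp: mult_le_one)
    finally have 2: "norm (fejm (16 ^ Suc J) (w J) x - w J x) \<le> 14 * B * r ^ J" by simp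
    have e: "w (Suc J) x - w J x = (fejm (16 ^ Suc J) (w J) x - w J x) - (fejm (16 ^ J) (w (Suc J)) x - w (Suc J) x)"
      unfolding comm by simp
    have "norm (w (Suc J) x - w J x) \<le> norm (fejm (16 ^ Suc J) (w J) x - w J x) + norm (fejm (16 ^ J) (w (Suc J)) x - w (Suc J) x)"
      unfolding e by (rule norm_triangle_ineq4)
    with 1 2 show ?thesis by (simp add: A_def)
  qed
  define v where "v x = w 0 x + (\<Sum>i. w (Suc i) x - w i x)" for x
  have "uniform_limit UNIV (\<lambda>n x. \<Sum>i<n. w (Suc i) x - w i x) (\<lambda>x. \<Sum>i. w (Suc i) x - w i x) sequentially"
    by (rule Weierstrass_m_test[where M="\<lambda>i. A * r ^ i"]) (use step r in \<open>auto intro!: summable_mult summable_geometric\<close>)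
  then have "uniform_limit UNIV (\<lambda>n x. w 0 x + (\<Sum>i<n. w (Suc i) x - w i x)) v sequentially"
    unfolding v_def by (intro uniform_limit_add uniform_limit_const)
  moreover have "w 0 x + (\<Sum>i<n. w (Suc i) x - w i x) = w n x" for n x
    using sum_lessThan_telescope[of "\<lambda>i. w i x" n] by simp
  ultimately have ul: "uniform_limit UNIV w v sequentially" by simp
  have lim: "(\<lambda>J. w J x) \<longlonglongrightarrow> v x" for x by (rule tendsto_uniform_limitI[OF ul]) simp
  have vcont: "continuous_on UNIV v"
    by (rule uniform_limit_theorem[OF _ ul]) (auto simp: wcont)
  have vtorus: "torus_fun v"
  proof (rule torus_funI)
    fix x k
    have "(\<lambda>J. w J (x + lattice_vec k)) = (\<lambda>J. w J x)" unfolding w_def using torus_funD[OF torus_fun_fejm] by (intro ext)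
    then show "v (x + lattice_vec k) = v x" using LIMSEQ_unique[OF lim[of "x + lattice_vec k"]] lim[of x] by simp
  qed
  have tail: "norm (v x - w J x) \<le> A * r ^ J / (1 - r)" for J x
  proof -
    have part: "norm (w (J + k) x - w J x) \<le> A * r ^ J * (\<Sum>i<k. r ^ i)" for k
    proof (induction k)
      case (Suc k)
      have "norm (w (J + Suc k) x - w (J + k) x) \<le> A * r ^ J * r ^ k" using step[of "J + k" x] by (simp add: power_add mult_ac)
      from norm_triangle_mono[OF this Suc.IH] show ?case by (simp add: algebra_simps)
    qed simp
    have geo: "A * r ^ J * (\<Sum>i<k. r ^ i) \<le> A * r ^ J * (1 / (1 - r))" for k
      using sum_le_suminf[of "\<lambda>j. r ^ j" "{..<k}"] r A by (intro mult_left_mono) (auto simp: suminf_geometric summable_geometric)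
    have "norm (w (J + k) x - w J x) \<le> A * r ^ J / (1 - r)" for k using order_trans[OF part geo, of k] by simp
    moreover have "(\<lambda>k. norm (w (J + k) x - w J x)) \<longlonglongrightarrow> norm (v x - w J x)"
      using LIMSEQ_ignore_initial_segment[OF lim[of x], of J] by (intro tendsto_norm tendsto_diff tendsto_const) (simp add: add.commute)
    ultimately show ?thesis by (intro LIMSEQ_le_const2) auto
  qed
  define C where "C = 4 * A / (1 - r) + 2 * B"
  have C: "0 \<le> C" using A B r by (simp add: C_def)
  have vhoelder: "norm (v x - v y) \<le> C * \<epsilon> powr (\<theta> - \<eta>)" if \<epsilon>: "0 < \<epsilon>" "\<epsilon> \<le> 1" and xy: "\<bar>x $ 1 - y $ 1\<bar> \<le> \<epsilon>" "\<bar>x $ 2 - y $ 2\<bar> \<le> \<epsilon>" for \<epsilon> x y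
  proof -
    \<comment> \<open>At this index the tail \<open>r^J\<close> and the increment of
      \<open>w J\<close> are both of order \<open>\<epsilon> powr (\<theta> - \<eta>)\<close> or
      smaller.\<close>
    obtain J :: nat where J: "\<epsilon> \<le> 1 / 2 ^ J" "1 / 2 ^ J \<le> 2 * \<epsilon>" using dyadic_scale[OF \<epsilon>] .
    have p2: "2 powr (- real J) = 1 / 2 ^ J" by (simp add: powr_minus powr_realpow inverse_eq_divide)
    have "r ^ J = (2 powr (- real J)) powr \<theta>" by (simp add: r_def powr_powr mult.commute flip: powr_realpow)
    also have "\<dots> \<le> (2 * \<epsilon>) powr \<theta>" unfolding p2 using J \<theta> by (intro powr_mono2) auto
    also have "\<dots> \<le> 2 * \<epsilon> powr \<theta>" using \<epsilon> \<theta> powr_mono[of \<theta> 1 2] by (simp add: powr_mult mult_right_mono)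
    also have "\<dots> \<le> 2 * \<epsilon> powr (\<theta> - \<eta>)" using \<epsilon> \<theta> by (intro mult_left_mono powr_mono') auto
    finally have rJ: "r ^ J \<le> 2 * \<epsilon> powr (\<theta> - \<eta>)" .
    have "2 powr (\<eta> * real J) = (2 powr (- real J)) powr (- \<eta>)" by (simp add: powr_powr mult.commute)
    also have "\<dots> \<le> \<epsilon> powr (- \<eta>)" unfolding p2 using J \<theta> \<epsilon> by (intro powr_mono2') auto
    finally have "2 powr (\<eta> * real J) * \<epsilon> powr \<theta> \<le> \<epsilon> powr (- \<eta>) * \<epsilon> powr \<theta>" by (intro mult_right_mono) auto
    also have "\<dots> = \<epsilon> powr (\<theta> - \<eta>)" by (simp add: powr_add[symmetric])
    finally have \<eta>J: "2 powr (\<eta> * real J) * \<epsilon> powr \<theta> \<le> \<epsilon> powr (\<theta> - \<eta>)" .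
    have "norm (w J (y + (x - y)) - w J y) \<le> (B * 2 powr (\<eta> * real J)) * (\<bar>(x - y) $ 1\<bar> powr \<theta> + \<bar>(x - y) $ 2\<bar> powr \<theta>)"
      by (rule hoelder) (use xy \<epsilon> in auto)
    also have "\<dots> \<le> (B * 2 powr (\<eta> * real J)) * (\<epsilon> powr \<theta> + \<epsilon> powr \<theta>)"
      using B xy \<theta> by (intro mult_left_mono add_mono powr_mono2) auto
    also have "\<dots> = 2 * B * (2 powr (\<eta> * real J) * \<epsilon> powr \<theta>)" by (simp add: algebra_simps)
    also have "\<dots> \<le> 2 * B * \<epsilon> powr (\<theta> - \<eta>)" using \<eta>J B by (intro mult_left_mono) auto
    finally have w: "norm (w J x - w J y) \<le> 2 * B * \<epsilon> powr (\<theta> - \<eta>)" by simp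
    have t: "A * r ^ J / (1 - r) \<le> 2 * A / (1 - r) * \<epsilon> powr (\<theta> - \<eta>)"
    proof -
      have "A / (1 - r) * r ^ J \<le> A / (1 - r) * (2 * \<epsilon> powr (\<theta> - \<eta>))" using A r rJ by (intro mult_left_mono) auto
      then show ?thesis by (simp add: mult_ac)
    qed
    have "v x - v y = (v x - w J x) + (w J x - w J y) - (v y - w J y)" by simp
    then have "norm (v x - v y) \<le> norm (v x - w J x) + norm (w J x - w J y) + norm (v y - w J y)"
      using norm_triangle_ineq4[of "(v x - w J x) + (w J x - w J y)" "v y - w J y"] norm_triangle_ineq[of "v x - w J x" "w J x - w J y"] by simp
    also have "\<dots> \<le> 2 * A / (1 - r) * \<epsilon> powr (\<theta> - \<eta>) + 2 * B * \<epsilon> powr (\<theta> - \<eta>) + 2 * A / (1 - r) * \<epsilon> powr (\<theta> - \<eta>)"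
      using tail[of x J] tail[of y J] w t by linarith
    also have "\<dots> = C * \<epsilon> powr (\<theta> - \<eta>)" by (simp add: C_def algebra_simps)
    finally show ?thesis .
  qed
  show thesis by (rule that[OF vtorus vcont C vhoelder ul[unfolded w_def]])
qed

section \<open>Convergence of Fejer means and uniqueness\<close>

lemma integrable_indicator_torus:
  assumes [measurable]: "E \<in> sets borel"
  shows "integrable torus_measure (indicator E :: real^2 \<Rightarrow> complex)"
  by (rule integrable_torus_bounded[where B=1]) (auto simp: indicator_def)

text \<open>The indicator is constant near \<open>x\<close> modulo the lattice, and away from it
  \<open>4 - 2 cos - 2 cos\<close> is bounded below by \<open>c > 0\<close>. So the deviation is at
  most \<open>1/c\<close> times this expression, and the approximation lemma applies with
  \<open>\<epsilon> = 0\<close>.\<close>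

lemma fejm_indicator_tendsto:
  fixes x :: "real^2"
  assumes sat: "\<And>x k. x + lattice_vec k \<in> E \<longleftrightarrow> x \<in> E" and E [measurable]: "E \<in> sets borel"
    and U: "open U" "x \<in> U" "\<And>y. y \<in> U \<Longrightarrow> y \<in> E \<longleftrightarrow> x \<in> E"
  shows "(\<lambda>j. fejm (Suc j) (indicator E) x) \<longlonglongrightarrow> indicator E x"
proof -
  obtain e where e: "e > 0" "ball x e \<subseteq> U" using U(1,2) open_contains_ball by blast
  define \<delta> where "\<delta> = min 1 (e / 2)"
  have \<delta>: "0 < \<delta>" "\<delta> \<le> 1" using e by (auto simp: \<delta>_def)
  then have \<delta>pi: "\<delta> < pi" using pi_gt3 by linarith
  define c where "c = 2 - 2 * cos \<delta>"
  have c: "0 < c" using cos_monotone_0_pi[of 0 \<delta>] \<delta> \<delta>pi by (simp add: c_def)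
  have key: "norm (indicator E y - indicator E x :: complex) \<le> 0 + (1 / c) * (4 - 2 * cos (y $ 1 - x $ 1) - 2 * cos (y $ 2 - x $ 2))" for y
  proof -
    obtain k1 :: int where k1: "\<bar>(y $ 1 - x $ 1) - 2 * pi * of_int k1\<bar> \<le> pi" "cos (y $ 1 - x $ 1) = cos \<bar>(y $ 1 - x $ 1) - 2 * pi * of_int k1\<bar>"
      using cos_nearest_multiple .
    obtain k2 :: int where k2: "\<bar>(y $ 2 - x $ 2) - 2 * pi * of_int k2\<bar> \<le> pi" "cos (y $ 2 - x $ 2) = cos \<bar>(y $ 2 - x $ 2) - 2 * pi * of_int k2\<bar>"
      using cos_nearest_multiple .
    have pos: "0 \<le> 2 - 2 * cos r" for r :: real by simp
    show ?thesis
    proof (cases "\<bar>(y $ 1 - x $ 1) - 2 * pi * of_int k1\<bar> < \<delta> \<and> \<bar>(y $ 2 - x $ 2) - 2 * pi * of_int k2\<bar> < \<delta>")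
      case True
      define z where "z = y + lattice_vec (- k1, - k2)"
      have "norm (z - x) \<le> \<bar>(z - x) $ 1\<bar> + \<bar>(z - x) $ 2\<bar>"
        using norm_le_l1_cart[of "z - x"] by (simp add: UNIV_2)
      also have "\<dots> < e" using True by (simp add: z_def \<delta>_def algebra_simps)
      finally have "z \<in> U" using e(2) by (auto simp: dist_norm norm_minus_commute)
      then have "y \<in> E \<longleftrightarrow> x \<in> E" using U(3)[of z] sat[of y] by (simp add: z_def)
      then have "norm (indicator E y - indicator E x :: complex) = 0" by (simp add: indicator_def)
      moreover have "0 \<le> (1 / c) * (4 - 2 * cos (y $ 1 - x $ 1) - 2 * cos (y $ 2 - x $ 2))"
      proof (rule mult_nonneg_nonneg)
        show "0 \<le> 4 - 2 * cos (y $ 1 - x $ 1) - 2 * cos (y $ 2 - x $ 2)"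
          using pos[of "y $ 1 - x $ 1"] pos[of "y $ 2 - x $ 2"] by linarith
      qed (use c in simp)
      ultimately show ?thesis by simp
    next
      case False
      have *: "c \<le> 2 - 2 * cos r" if "\<delta> \<le> r" "r \<le> pi" for r
        using cos_monotone_0_pi_le[of \<delta> r] that \<delta> by (simp add: c_def)
      have "c \<le> 4 - 2 * cos (y $ 1 - x $ 1) - 2 * cos (y $ 2 - x $ 2)"
      proof (cases "\<delta> \<le> \<bar>(y $ 1 - x $ 1) - 2 * pi * of_int k1\<bar>")
        case True
        from *[OF this k1(1)] show ?thesis using pos[of "y $ 2 - x $ 2"] k1(2) by linarith
      next
        case False2: False
        with False have "\<delta> \<le> \<bar>(y $ 2 - x $ 2) - 2 * pi * of_int k2\<bar>" by linarith
        from *[OF this k2(1)] show ?thesis using pos[of "y $ 1 - x $ 1"] k2(2) by linarith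
      qed
      then have "1 \<le> (1 / c) * (4 - 2 * cos (y $ 1 - x $ 1) - 2 * cos (y $ 2 - x $ 2))"
        using c by (simp add: field_simps)
      moreover have "norm (indicator E y - indicator E x :: complex) \<le> 1" by (simp add: indicator_def)
      ultimately show ?thesis by linarith
    qed
  qed
  have le: "norm (fejm (Suc j) (indicator E) x - indicator E x) \<le> 4 * (1 / c) * inverse (real (Suc j))" for j
  proof -
    have "norm (fejm (Suc j) (indicator E) x - indicator E x) \<le> 0 + 4 * (1 / c) / real (Suc j)"
      by (rule fejer_approximation[OF _ integrable_indicator_torus[OF E] _ key]) (use c in auto)
    then show ?thesis by (simp only: divide_inverse add_0)
  qed
  have lim0: "(\<lambda>j. 4 * (1 / c) * inverse (real (Suc j))) \<longlonglongrightarrow> 0"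
    using tendsto_mult[OF tendsto_const LIMSEQ_inverse_real_of_nat, of "4 * (1 / c)"] by simp
  have "(\<lambda>j. fejm (Suc j) (indicator E) x - indicator E x) \<longlonglongrightarrow> 0"
    by (rule Lim_null_comparison[OF eventuallyI[OF le] lim0])
  then show ?thesis by (rule LIM_zero_cancel)
qed

lemma AE_not_component_eq: "AE x in lborel. x $ i \<noteq> (c::real)" for i :: 2
proof -
  have "negligible {x::real^2. x $ i = c}"
    using negligible_standard_hyperplane[where k="axis i 1 :: real^2" and c=c] by (simp add: axis_in_Basis_iff inner_axis)
  then have "{x::real^2. x $ i = c} \<in> null_sets (completion lborel)" by (simp add: negligible_iff_null_sets)
  moreover have "closed {x::real^2. x $ i = c}" by (intro closed_Collect_eq continuous_intros)
  then have "{x::real^2. x $ i = c} \<in> sets lborel" by simp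
  ultimately have "{x::real^2. x $ i = c} \<in> null_sets lborel" by (simp add: null_sets_completion_iff)
  from AE_not_in[OF this] show ?thesis by simp
qed

text \<open>Vanishing coefficients make \<open>f\<close> orthogonal to every trigonometric
  polynomial, in particular to the Fejer means of the periodised box. These are bounded by 1 and
  converge almost everywhere to its indicator.\<close>

lemma fcoef_zero_imp_box_zero:
  assumes f: "integrable torus_measure f" and z: "\<And>n. fcoef f n = 0"
  shows "(LINT x|torus_measure. indicator (box a b) x *\<^sub>R f x) = 0"
proof -
  let ?B = "box 0 (\<chi> i. 2 * pi) :: (real^2) set"
  \<comment> \<open>Clipping to the open cell before periodising keeps different translates apart,
    so inside the cell \<open>E\<close> agrees with the box.\<close>
  define E where "E = (\<Union>k. (\<lambda>x. x + lattice_vec k) -` (box a b \<inter> ?B))"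
  have openE: "open E"
    unfolding E_def by (intro open_UN ballI open_vimage open_Int open_box continuous_intros) 
  then have E [measurable]: "E \<in> sets borel" by simp
  have sat: "x + lattice_vec k \<in> E \<longleftrightarrow> x \<in> E" for x k
  proof -
    have *: "x + lattice_vec k \<in> E" if "x \<in> E" for x k
    proof -
      obtain j where j: "x + lattice_vec j \<in> box a b \<inter> ?B" using \<open>x \<in> E\<close> by (auto simp: E_def)
      have "(x + lattice_vec k) + lattice_vec (j - k) = x + lattice_vec j" by (simp add: vec2_eq_iff algebra_simps)
      with j show ?thesis unfolding E_def by (metis UN_I UNIV_I vimageI)
    qed
    have "(x + lattice_vec k) + lattice_vec (- k) = x" by (simp add: lattice_vec_uminus)
    with *[of x k] *[of "x + lattice_vec k" "- k"] show ?thesis by auto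
  qed
  have mem: "y \<in> E \<longleftrightarrow> y \<in> box a b" if "y \<in> ?B" for y
  proof
    assume "y \<in> E"
    then obtain k where k: "y + lattice_vec k \<in> box a b" "y + lattice_vec k \<in> ?B" by (auto simp: E_def)
    have "k' = 0" if "0 < r" "r < 2 * pi" "0 < r + 2 * pi * of_int k'" "r + 2 * pi * of_int k' < 2 * pi" for r and k' :: int
    proof -
      have "2 * pi * of_int k' < 2 * pi * 1" using that by linarith
      then have "real_of_int k' < 1" by (subst (asm) mult_less_cancel_left_pos) auto
      moreover have "2 * pi * (-1) < 2 * pi * of_int k'" using that by linarith
      then have "-1 < real_of_int k'" by (subst (asm) mult_less_cancel_left_pos) auto
      ultimately have "real_of_int k' < 1 \<and> -1 < real_of_int k'" by simp
      then show ?thesis by linarith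
    qed
    from this[of "y $ 1" "fst k"] this[of "y $ 2" "snd k"] have "k = 0"
      using that k(2) by (auto simp: mem_box_cart forall_2 prod_eq_iff)
    then show "y \<in> box a b" using k(1) by (simp add: lattice_vec_0)
  next
    assume "y \<in> box a b"
    with that have "y + lattice_vec 0 \<in> box a b \<inter> ?B" by (simp add: lattice_vec_0)
    then show "y \<in> E" unfolding E_def by blast
  qed
  have AE1: "AE x in torus_measure. x \<in> ?B \<and> (x \<in> box a b \<or> x \<notin> cbox a b)"
    unfolding AE_torus
    using AE_not_component_eq[of 1 0] AE_not_component_eq[of 2 0] AE_not_component_eq[of 1 "a $ 1"] AE_not_component_eq[of 2 "a $ 2"]
      AE_not_component_eq[of 1 "b $ 1"] AE_not_component_eq[of 2 "b $ 2"]
    by eventually_elim (auto simp: torus_cell_iff mem_box_cart forall_2)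
  have lim: "AE x in torus_measure. (\<lambda>j. f x * fejm (Suc j) (indicator E) x) \<longlonglongrightarrow> f x * indicator E x"
    using AE1
  proof eventually_elim
    case (elim x)
    have "\<exists>U. open U \<and> x \<in> U \<and> (\<forall>y\<in>U. y \<in> E \<longleftrightarrow> x \<in> E)"
    proof (cases "x \<in> box a b")
      case True
      then have "x \<in> E" using elim mem by simp
      then show ?thesis using openE by auto
    next
      case False
      with elim have x: "x \<notin> cbox a b" "x \<in> ?B" by auto
      show ?thesis
      proof (intro exI[of _ "?B - cbox a b"] conjI ballI)
        fix y assume "y \<in> ?B - cbox a b"
        then have "y \<notin> E" using mem[of y] box_subset_cbox by blast
        moreover have "x \<notin> E" using mem[of x] x False by simp
        ultimately show "y \<in> E \<longleftrightarrow> x \<in> E" by simp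
      qed (use x in \<open>auto intro: open_Diff\<close>)
    qed
    then have "(\<lambda>j. fejm (Suc j) (indicator E) x) \<longlonglongrightarrow> indicator E x"
      using fejm_indicator_tendsto[OF sat E] by blast
    then show ?case by (intro tendsto_intros)
  qed
  have zero: "(LINT x|torus_measure. f x * fejm (Suc j) (indicator E) x) = 0" for j
  proof -
    have "(LINT x|torus_measure. f x * fejm (Suc j) (indicator E) x)
      = (LINT x|torus_measure. (\<Sum>n\<in>grid (Suc j). fej2 (Suc j) n * fcoef (indicator E) n * (f x * tchar n x)))"
      unfolding fejm_def sum_distrib_left by (simp add: mult_ac)
    also have "\<dots> = (\<Sum>n\<in>grid (Suc j). fej2 (Suc j) n * fcoef (indicator E) n * (LINT x|torus_measure. f x * tchar n x))"
      by (subst Bochner_Integration.integral_sum) (intro integrable_mult_right integrable_tchar_mult f, simp only: integral_mult_right_zero)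
    also have "\<dots> = 0"
    proof (rule sum.neutral, rule ballI)
      fix n
      have "(LINT x|torus_measure. f x * tchar n x) = 0"
        using z[of "- n"] by (simp add: fcoef_def tchar_cnj)
      then show "fej2 (Suc j) n * fcoef (indicator E) n * (LINT x|torus_measure. f x * tchar n x) = 0" by simp
    qed
    finally show ?thesis .
  qed
  have "(\<lambda>j. LINT x|torus_measure. f x * fejm (Suc j) (indicator E) x) \<longlonglongrightarrow> (LINT x|torus_measure. f x * indicator E x)"
  proof (rule integral_dominated_convergence[where w="\<lambda>x. norm (f x)"])
    show "(\<lambda>x. f x * indicator E x) \<in> borel_measurable torus_measure" using f by measurable
    show "\<And>j. (\<lambda>x. f x * fejm (Suc j) (indicator E) x) \<in> borel_measurable torus_measure" using f by measurable
    show "integrable torus_measure (\<lambda>x. norm (f x))" using f by simp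
    show "AE x in torus_measure. norm (f x * fejm (Suc j) (indicator E) x) \<le> norm (f x)" for j
    proof (rule AE_I2)
      fix x
      have "norm (fejm (Suc j) (indicator E) x) \<le> 1"
        by (rule fejm_bounded[OF _ integrable_indicator_torus[OF E]]) (auto simp: indicator_def)
      then show "norm (f x * fejm (Suc j) (indicator E) x) \<le> norm (f x)"
        unfolding norm_mult using mult_left_mono[of "norm (fejm (Suc j) (indicator E) x)" 1 "norm (f x)"] by simp
    qed
  qed (rule lim)
  then have "(LINT x|torus_measure. f x * indicator E x) = 0"
    unfolding zero LIMSEQ_const_iff by (rule sym)
  also have "(LINT x|torus_measure. f x * indicator E x) = (LINT x|torus_measure. indicator (box a b) x *\<^sub>R f x)"
  proof (rule Bochner_Integration.integral_cong_AE)
    show "AE x in torus_measure. f x * indicator E x = indicator (box a b) x *\<^sub>R f x"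
      using AE1
    proof eventually_elim
      case (elim x)
      then have "x \<in> E \<longleftrightarrow> x \<in> box a b" using mem[of x] by blast
      then show ?case by (cases "x \<in> box a b") simp_all
    qed
  qed (use f in measurable)
  finally show ?thesis .
qed

text \<open>Boxes form an intersection-stable generator of the Borel sets, so the vanishing of
  integrals extends from boxes to all of them; complements are handled by the vanishing of the
  coefficient at 0.\<close>

lemma fcoef_zero_imp_AE_zero:
  assumes f: "integrable torus_measure f" and z: "\<And>n. fcoef f n = 0"
  shows "AE x in torus_measure. f x = 0"
proof (rule torus.density_zero[OF f])
  have all0: "(LINT x|torus_measure. f x) = 0" using z[of 0] by (simp add: fcoef_def)
  have int: "set_integrable torus_measure A f" if "A \<in> sets borel" for A
    unfolding set_integrable_def
  proof (rule Bochner_Integration.integrable_bound[OF f])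
    have "indicator A \<in> borel_measurable borel" using that by simp
    then have [measurable]: "(indicator A :: real^2 \<Rightarrow> real) \<in> borel_measurable torus_measure" by (rule borel_measurable_torus)
    show "(\<lambda>x. indicator A x *\<^sub>R f x) \<in> borel_measurable torus_measure" using f by measurable
  qed (auto simp: indicator_def)
  have main: "set_lebesgue_integral torus_measure A f = 0" if "A \<in> sets borel" for A
  proof -
    have "Int_stable (range (\<lambda>(a, b). box a b :: (real^2) set))" by (auto simp: Int_stable_def box_Int_box)
    moreover have "(range (\<lambda>(a, b). box a b :: (real^2) set)) \<subseteq> Pow UNIV" by auto
    moreover have "A \<in> sigma_sets UNIV (range (\<lambda>(a, b). box a b))" using that unfolding borel_eq_box by simp
    ultimately show ?thesis
    proof (induction rule: sigma_sets_induct_disjoint)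
      case (basic A)
      then show ?case using fcoef_zero_imp_box_zero[OF f z] by (auto simp: set_lebesgue_integral_def)
    next
      case empty
      then show ?case by (simp add: set_lebesgue_integral_def)
    next
      case (compl A)
      then have A: "A \<in> sets borel" by (simp add: borel_eq_box)
      have "set_lebesgue_integral torus_measure (UNIV - A) f = (LINT x|torus_measure. f x - indicator A x *\<^sub>R f x)"
        unfolding set_lebesgue_integral_def by (intro Bochner_Integration.integral_cong refl) (auto simp: indicator_def)
      also have "\<dots> = (LINT x|torus_measure. f x) - set_lebesgue_integral torus_measure A f"
        unfolding set_lebesgue_integral_def
        by (rule Bochner_Integration.integral_diff[OF f int[OF A, unfolded set_integrable_def]])
      finally show ?case using compl.IH all0 by simp
    next
      case (union F)
      then have F: "\<And>i. F i \<in> sets borel" by (simp add: borel_eq_box subset_eq)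
      have G: "F i \<inter> torus_cell \<in> sets torus_measure" for i
        using F[of i] by (auto simp: torus_measure_def sets_restrict_space)
      have eq: "set_lebesgue_integral torus_measure (A \<inter> torus_cell) f = set_lebesgue_integral torus_measure A f" for A
        unfolding set_lebesgue_integral_def by (intro Bochner_Integration.integral_cong refl) (auto simp: indicator_def)
      have "set_lebesgue_integral torus_measure (\<Union>i. F i \<inter> torus_cell) f = (\<Sum>i. set_lebesgue_integral torus_measure (F i \<inter> torus_cell) f)"
      proof (rule lebesgue_integral_countable_add[OF G])
        show "i \<noteq> j \<Longrightarrow> (F i \<inter> torus_cell) \<inter> (F j \<inter> torus_cell) = {}" for i j
          using union.hyps(1) by (auto simp: disjoint_family_on_def)
        have "(\<Union>i. F i) \<in> sets borel" using F by blast
        from int[OF this] show "set_integrable torus_measure (\<Union>i. F i \<inter> torus_cell) f"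
          unfolding set_integrable_def
          by (rule Bochner_Integration.integrable_cong[THEN iffD1, rotated 2]) (auto simp: indicator_def)
      qed
      also have "(\<Union>i. F i \<inter> torus_cell) = (\<Union>i. F i) \<inter> torus_cell" by auto
      finally show ?case using union.IH by (simp only: eq) simp
    qed
  qed
  fix A assume "A \<in> sets torus_measure"
  then obtain A' where "A' \<in> sets borel" "A = torus_cell \<inter> A'"
    by (auto simp: torus_measure_def sets_restrict_space)
  then have "A \<in> sets borel" by simp
  then show "set_lebesgue_integral torus_measure A f = 0" by (rule main)
qed

section \<open>Fourier coefficients of solutions\<close>

lemma has_derivative_tchar:
  "((\<lambda>x. c * tchar n x) has_derivative (\<lambda>h. c * tchar n x * (\<i> * complex_of_real (of_int (fst n) * h $ 1 + of_int (snd n) * h $ 2)))) (at x)"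
proof -
  have "((\<lambda>x::real^2. c * exp (\<i> * complex_of_real (of_int (fst n) * x $ 1 + of_int (snd n) * x $ 2))) has_derivative
     (\<lambda>h. c * exp (\<i> * complex_of_real (of_int (fst n) * x $ 1 + of_int (snd n) * x $ 2)) * (\<i> * complex_of_real (of_int (fst n) * h $ 1 + of_int (snd n) * h $ 2)))) (at x)"
  proof -
    have "((\<lambda>x::real^2. \<i> * complex_of_real (of_int (fst n) * x $ 1 + of_int (snd n) * x $ 2)) has_derivative
       (\<lambda>h. \<i> * complex_of_real (of_int (fst n) * h $ 1 + of_int (snd n) * h $ 2))) (at x)"
      by (intro has_derivative_mult_right has_derivative_of_real has_derivative_add bounded_linear.has_derivative[OF bounded_linear_vec_nth] has_derivative_ident)
    from has_derivative_mult_right[OF has_derivative_compose[OF this DERIV_exp[unfolded has_field_derivative_def]], of c]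
    show ?thesis by (simp add: mult.assoc)
  qed
  then show ?thesis unfolding tchar_def cis_conv_exp .
qed

lemma partial_deriv_tchar:
  "partial_deriv i (\<lambda>x. c * tchar n x) = (\<lambda>x. (c * (\<i> * of_int (if i = 1 then fst n else snd n))) * tchar n x)"
proof
  fix x
  have "frechet_derivative (\<lambda>x. c * tchar n x) (at x) = (\<lambda>h. c * tchar n x * (\<i> * complex_of_real (of_int (fst n) * h $ 1 + of_int (snd n) * h $ 2)))"
    by (rule frechet_derivative_at[OF has_derivative_tchar, symmetric])
  moreover have "i = 1 \<or> i = 2" using exhaust_2 by auto
  ultimately show "partial_deriv i (\<lambda>x. c * tchar n x) x = (c * (\<i> * of_int (if i = 1 then fst n else snd n))) * tchar n x"
    by (auto simp: partial_deriv_def axis_def mult_ac)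
qed

lemma C_k_tchar: "C_k k (\<lambda>x. c * tchar n x)"
proof (induction k arbitrary: c)
  case 0
  then show ?case by (simp add: continuous_intros)
next
  case (Suc k)
  have "(\<lambda>x. c * tchar n x) differentiable_on UNIV"
    unfolding differentiable_on_def differentiable_def by (intro ballI exI) (rule has_derivative_tchar)
  then show ?case using Suc.IH by (simp add: partial_deriv_tchar)
qed

lemma torus_test_fun_tchar: "torus_test_fun (tchar n)"
  using C_k_tchar[where c=1] torus_fun_tchar by (simp add: torus_test_fun_def)

lemma laplacian_tchar: "laplacian (tchar n) x = - of_int ((fst n)\<^sup>2 + (snd n)\<^sup>2) * tchar n x"
proof -
  have "partial_deriv i (tchar n) = (\<lambda>x. (\<i> * of_int (if i = 1 then fst n else snd n)) * tchar n x)" for i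
    using partial_deriv_tchar[of i 1 n] by simp
  then show ?thesis
    unfolding laplacian_def by (simp add: partial_deriv_tchar UNIV_2) (simp add: algebra_simps power2_eq_square)
qed

lemma torus_L2_integrable:
  assumes "torus_L2 f"
  shows "integrable torus_measure f"
proof -
  have m: "f \<in> borel_measurable torus_measure" and i: "integrable torus_measure (\<lambda>x. (cmod (f x))\<^sup>2)"
    using assms by (auto simp: torus_L2_def)
  show ?thesis
  proof (rule Bochner_Integration.integrable_bound)
    show "integrable torus_measure (\<lambda>x. 1 + (cmod (f x))\<^sup>2)" using i by simp
    have "cmod (f x) \<le> 1 + (cmod (f x))\<^sup>2" for x
      using zero_le_power2[of "cmod (f x) - 1/2"] by (simp add: power2_eq_square algebra_simps)
    then show "AE x in torus_measure. norm (f x) \<le> norm (1 + (cmod (f x))\<^sup>2)"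
      by (intro AE_I2) (simp add: abs_of_nonneg add_nonneg_nonneg)
  qed (rule m)
qed

text \<open>Characters are test functions and eigenfunctions of the Laplacian, so the weak equation
  tested against \<open>tchar (- n)\<close> is a scalar linear differential equation, solved by an
  integrating factor. Thus every solution has the coefficients of the free evolution of
  \<open>g\<close>.\<close>

lemma fcoef_solution:
  assumes u: "schrodinger_solution g u" and g: "g \<in> borel_measurable torus_measure"
  shows "fcoef (u t) n = cis (- phase t n) * fcoef g n"
proof -
  define \<mu> where "\<mu> = real_of_int ((fst n)\<^sup>2 + (snd n)\<^sup>2)"
  define c where "c t = (LINT x|torus_measure. u t x * tchar (- n) x)" for t
  have "(c has_vector_derivative - (\<i> * \<mu>) * c t) (at t)" for t
  proof -
    have "(c has_vector_derivative \<i> * (LINT x|torus_measure. u t x * laplacian (tchar (- n)) x)) (at t)"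
      using u torus_test_fun_tchar[of "- n"] unfolding schrodinger_solution_def c_def by blast
    also have "(LINT x|torus_measure. u t x * laplacian (tchar (- n)) x) = (LINT x|torus_measure. (- \<mu>) * (u t x * tchar (- n) x))"
      unfolding laplacian_tchar by (intro Bochner_Integration.integral_cong refl) (simp add: \<mu>_def)
    also have "\<dots> = (- \<mu>) * c t" unfolding c_def by (simp only: integral_mult_right_zero)
    finally show ?thesis by (simp add: mult.assoc)
  qed
  then have "((\<lambda>t. exp (\<i> * \<mu> * t) * c t) has_vector_derivative 0) (at t)" for t
  proof -
    assume *: "\<And>t. (c has_vector_derivative - (\<i> * \<mu>) * c t) (at t)"
    have "((\<lambda>z. exp (\<i> * \<mu> * z)) has_field_derivative \<i> * \<mu> * exp (\<i> * \<mu> * of_real t)) (at (of_real t))"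
      by (auto intro!: derivative_eq_intros simp: mult_ac)
    from has_vector_derivative_mult[OF has_vector_derivative_real_field[OF this] *[of t]]
    show ?thesis by (simp add: algebra_simps)
  qed
  then have "(\<lambda>t. exp (\<i> * \<mu> * complex_of_real t) * c t) t = (\<lambda>t. exp (\<i> * \<mu> * complex_of_real t) * c t) 0"
    using has_vector_derivative_zero_constant[of UNIV "\<lambda>t. exp (\<i> * \<mu> * complex_of_real t) * c t"]
    by (metis UNIV_I convex_UNIV has_vector_derivative_at_within)
  then have e: "exp (\<i> * \<mu> * t) * c t = c 0" by simp
  have c0: "c 0 = (LINT x|torus_measure. g x * tchar (- n) x)"
    unfolding c_def
  proof (rule Bochner_Integration.integral_cong_AE)
    have "AE x in torus_measure. u 0 x = g x" using u by (simp add: schrodinger_solution_def)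
    then show "AE x in torus_measure. u 0 x * tchar (- n) x = g x * tchar (- n) x" by eventually_elim simp
    have [measurable]: "u 0 \<in> borel_measurable torus_measure" using u by (simp add: schrodinger_solution_def torus_L2_def)
    show "(\<lambda>x. u 0 x * tchar (- n) x) \<in> borel_measurable torus_measure" by measurable
    show "(\<lambda>x. g x * tchar (- n) x) \<in> borel_measurable torus_measure" using g by measurable
  qed
  have "cis (- phase t n) * exp (\<i> * \<mu> * t) = 1"
    by (simp add: phase_def \<mu>_def cis_conv_exp exp_add[symmetric] mult_ac)
  then have "c t = cis (- phase t n) * c 0" unfolding e[symmetric] by (simp add: mult.assoc[symmetric])
  then show ?thesis by (simp add: fcoef_def c_def c0[unfolded c_def] tchar_cnj)
qed

section \<open>Polygons and winding numbers\<close>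

text \<open>Winding numbers belong to complex paths, polygons to \<open>real^2\<close>; this linear
  bijection carries segments, components and insides across.\<close>

definition cplx :: "real^2 \<Rightarrow> complex" where
  "cplx x = Complex (x $ 1) (x $ 2)"

lemma linear_cplx: "linear cplx"
  by (rule linearI) (simp_all add: cplx_def complex_eq_iff)

lemma inj_cplx: "inj cplx"
  by (rule injI) (simp add: cplx_def vec_eq_iff forall_2)

lemma surj_cplx: "surj cplx"
proof (rule surjI)
  show "cplx (vector [Re z, Im z]) = z" for z by (simp add: cplx_def)
qed

lemma bij_cplx: "bij cplx"
  using inj_cplx surj_cplx by (rule bijI)

definition uncplx :: "complex \<Rightarrow> real^2" where
  "uncplx z = vector [Re z, Im z]"

lemma cplx_uncplx [simp]: "cplx (uncplx z) = z" and uncplx_cplx [simp]: "uncplx (cplx x) = x"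
  by (simp_all add: cplx_def uncplx_def vec_eq_iff forall_2)

lemma linear_uncplx: "linear uncplx"
  by (rule linearI) (simp_all add: uncplx_def vec_eq_iff forall_2)

lemma cplx_image_Compl: "cplx ` (- S) = - (cplx ` S)"
  by (rule bij_image_Compl_eq[OF bij_cplx])

lemma connected_component_cplx:
  "connected_component (cplx ` S) (cplx x) (cplx y) \<longleftrightarrow> connected_component S x y"
proof
  assume "connected_component S x y"
  then obtain T where "connected T" "T \<subseteq> S" "x \<in> T" "y \<in> T" by (auto simp: connected_component_def)
  then show "connected_component (cplx ` S) (cplx x) (cplx y)"
    unfolding connected_component_def
    by (intro exI[of _ "cplx ` T"]) (auto intro: connected_linear_image[OF linear_cplx])
next
  assume "connected_component (cplx ` S) (cplx x) (cplx y)"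
  then obtain T where T: "connected T" "T \<subseteq> cplx ` S" "cplx x \<in> T" "cplx y \<in> T" by (auto simp: connected_component_def)
  have "uncplx ` T \<subseteq> S" using T(2) by auto
  moreover have "x \<in> uncplx ` T" "y \<in> uncplx ` T"
    using T(3,4) uncplx_cplx by (metis image_eqI)+
  ultimately show "connected_component S x y"
    unfolding connected_component_def
    using connected_linear_image[OF linear_uncplx T(1)] by blast
qed

lemma inside_cplx: "cplx x \<in> inside (cplx ` S) \<longleftrightarrow> x \<in> inside S"
proof -
  have "connected_component_set (- cplx ` S) (cplx x) = cplx ` connected_component_set (- S) x"
  proof (rule set_eqI)
    fix w
    have "w = cplx (uncplx w)" by simp
    then show "w \<in> connected_component_set (- cplx ` S) (cplx x) \<longleftrightarrow> w \<in> cplx ` connected_component_set (- S) x"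
      using connected_component_cplx[of "- S" x "uncplx w"] unfolding cplx_image_Compl[symmetric]
      by (metis (no_types, lifting) connected_component_cplx image_iff mem_Collect_eq)
  qed
  moreover have "bounded (cplx ` T) \<longleftrightarrow> bounded T" for T
  proof
    assume "bounded (cplx ` T)"
    then have "bounded (uncplx ` cplx ` T)" using linear_uncplx bounded_linear_image linear_conv_bounded_linear by blast
    then show "bounded T" by (simp add: image_image)
  next
    assume "bounded T" then show "bounded (cplx ` T)" using linear_cplx bounded_linear_image linear_conv_bounded_linear by blast
  qed
  moreover have "cplx x \<in> cplx ` S \<longleftrightarrow> x \<in> S" using inj_cplx by (simp add: inj_image_mem_iff)
  ultimately show ?thesis by (simp add: inside_def)
qed

text \<open>The winding number of an open path, a complex number in general. Only its additivity is
  used until the segments close up.\<close>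

definition line_winding :: "complex \<Rightarrow> complex \<Rightarrow> complex \<Rightarrow> complex" where
  "line_winding a b z = winding_number (linepath a b) z"

lemma line_winding_rev: "z \<notin> closed_segment a b \<Longrightarrow> line_winding b a z = - line_winding a b z"
  using winding_number_reversepath[of "linepath a b" z] by (simp add: line_winding_def)

lemma line_winding_translate: "line_winding (a + h) (b + h) z = line_winding a b (z - h)"
proof -
  have "(\<lambda>w. linepath (a + h) (b + h) w - z) = (\<lambda>w. linepath a b w - (z - h))"
    by (simp add: linepath_def fun_eq_iff algebra_simps)
  then show ?thesis
    unfolding line_winding_def winding_number_offset[of _ z] winding_number_offset[of _ "z - h"] by (simp only:)
qed

lemma triangle_winding_sum:
  assumes "z \<notin> closed_segment a b" "z \<notin> closed_segment b c" "z \<notin> closed_segment c a"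
  shows "winding_number (linepath a b +++ linepath b c +++ linepath c a) z = line_winding a b z + line_winding b c z + line_winding c a z"
proof -
  have "z \<notin> path_image (linepath b c +++ linepath c a)" using assms by (simp add: path_image_join)
  with assms show ?thesis by (simp add: winding_number_join line_winding_def)
qed

section \<open>Winding numbers of triangles and parallelograms\<close>

definition cross :: "complex \<Rightarrow> complex \<Rightarrow> real" where
  "cross p q = Im (cnj p * q)"

lemma cross_zero [simp]: "cross p 0 = 0" "cross 0 p = 0"
  by (simp_all add: cross_def)

lemma cross_linear:
  "cross p (of_real u * q + of_real v * r) = u * cross p q + v * cross p r"
  "cross (of_real u * q + of_real v * r) p = u * cross q p + v * cross r p"
  by (simp_all add: cross_def algebra_simps)

lemma cross_self [simp]: "cross p p = 0"
  by (simp add: cross_def)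

text \<open>In affine coordinates at \<open>p\<close> the open triangle is \<open>x, y > 0\<close>,
  \<open>x + y < 1\<close>. Inside, the orientation test is the sign of
  \<open>y * cross (q - p) (r - p)\<close>; outside, the path lies in a convex set that avoids
  \<open>z\<close>.\<close>

lemma triangle_winding:
  assumes cr: "cross (q - p) (r - p) \<noteq> 0" and z: "z = p + of_real x * (q - p) + of_real y * (r - p)"
  shows "0 < x \<Longrightarrow> 0 < y \<Longrightarrow> x + y < 1 \<Longrightarrow>
      winding_number (linepath p q +++ linepath q r +++ linepath r p) z = of_real (sgn (cross (q - p) (r - p)))" (is "_ \<Longrightarrow> _ \<Longrightarrow> _ \<Longrightarrow> ?I")
    and "x < 0 \<or> y < 0 \<or> x + y > 1 \<Longrightarrow> winding_number (linepath p q +++ linepath q r +++ linepath r p) z = 0" (is "_ \<Longrightarrow> ?O")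
proof -
  \<comment> \<open>Taking \<open>cross\<close> with one side annihilates that side and isolates the
    other coordinate.\<close>
  have uniq: "x' = x \<and> y' = y" if "z = p + of_real x' * (q - p) + of_real y' * (r - p)" for x' y'
  proof -
    have e: "of_real (x' - x) * (q - p) + of_real (y' - y) * (r - p) = 0" using that z by (simp add: algebra_simps)
    have "(y' - y) * cross (q - p) (r - p) = 0" "(x' - x) * cross (q - p) (r - p) = 0"
      using cross_linear(1)[of "q - p" "x' - x" "q - p" "y' - y" "r - p"]
        cross_linear(2)[of "x' - x" "q - p" "y' - y" "r - p" "r - p"] unfolding e by simp_all
    with cr show ?thesis by simp
  qed
  show ?I if xy: "0 < x" "0 < y" "x + y < 1"
  proof -
    have "\<not> collinear {p, q, r}"
    proof
      assume "collinear {p, q, r}"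
      then have "p = r \<or> (\<exists>u. q = u *\<^sub>R p + (1 - u) *\<^sub>R r)" by (simp add: collinear_3_expand)
      then show False
      proof
        assume "p = r" with cr show False by (simp add: cross_def)
      next
        assume "\<exists>u. q = u *\<^sub>R p + (1 - u) *\<^sub>R r"
        then obtain u where "q = u *\<^sub>R p + (1 - u) *\<^sub>R r" ..
        then have "q - p = of_real (1 - u) * (r - p)" by (simp add: scaleR_conv_of_real algebra_simps)
        then have "cross (q - p) (r - p) = 0"
          using cross_linear(2)[of "1 - u" "r - p" 0 0 "r - p"] by simp
        with cr show False by simp
      qed
    qed
    then have int: "interior (convex hull {p, q, r}) = {v. \<exists>x y z. 0 < x \<and> 0 < y \<and> 0 < z \<and> x + y + z = 1 \<and> x *\<^sub>R p + y *\<^sub>R q + z *\<^sub>R r = v}"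
      by (rule interior_convex_hull_3_minimal) simp
    have zin: "z \<in> interior (convex hull {p, q, r})"
      unfolding int using xy z by (intro CollectI exI[of _ "1 - x - y"] exI[of _ x] exI[of _ y]) (simp add: scaleR_conv_of_real algebra_simps)
    have "Im ((q - p) * cnj (q - z)) = y * cross (q - p) (r - p)"
    proof -
      have e: "q - z = of_real (1 - x) * (q - p) + of_real (- y) * (r - p)" using z by (simp add: algebra_simps)
      have "Im ((q - p) * cnj (q - z)) = - cross (q - p) (q - z)" by (simp add: cross_def algebra_simps)
      then show ?thesis unfolding e cross_linear by simp
    qed
    then show ?I using winding_number_triangle[OF zin] xy cr by (auto simp: sgn_if zero_less_mult_iff)
  qed
  show ?O if out: "x < 0 \<or> y < 0 \<or> x + y > 1"
  proof (rule winding_number_zero_outside[where s="convex hull {p, q, r}"])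
    show "z \<notin> convex hull {p, q, r}"
    proof
      assume "z \<in> convex hull {p, q, r}"
      then obtain u v w where uvw: "0 \<le> u" "0 \<le> v" "0 \<le> w" "u + v + w = 1" "z = u *\<^sub>R p + v *\<^sub>R q + w *\<^sub>R r"
        by (auto simp: convex_hull_3)
      have u: "u = 1 - v - w" using uvw(4) by simp
      have "z = p + of_real v * (q - p) + of_real w * (r - p)"
        using uvw(5) unfolding u by (simp add: scaleR_conv_of_real algebra_simps)
      from uniq[OF this] uvw out show False by auto
    qed
    show "path_image (linepath p q +++ linepath q r +++ linepath r p) \<subseteq> convex hull {p, q, r}"
      by (auto simp: path_image_join segment_convex_hull intro: hull_mono[THEN subsetD, rotated])
  qed auto
qed

text \<open>The contribution of the edge \<open>[a, b]\<close> to the winding number minus its translate by \<open>h\<close>, completed to a closed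
  parallelogram. The sides \<open>[b, b + h]\<close> and \<open>[a + h, a]\<close> cancel when summed around a closed polygon.\<close>

definition edge_difference :: "complex \<Rightarrow> complex \<Rightarrow> complex \<Rightarrow> complex \<Rightarrow> complex" where
  "edge_difference a b h z = line_winding a b z + line_winding b (b + h) z - line_winding (a + h) (b + h) z - line_winding a (a + h) z"

text \<open>The parallelogram is cut along the diagonal from \<open>a\<close> to
  \<open>b + h\<close>, which the two triangles traverse in opposite directions.\<close>

lemma edge_difference_eq:
  assumes off: "z \<notin> closed_segment a b" "z \<notin> closed_segment b (b + h)" "z \<notin> closed_segment (a + h) (b + h)" "z \<notin> closed_segment a (a + h)" "z \<notin> closed_segment a (b + h)"
  shows "edge_difference a b h z = winding_number (linepath a b +++ linepath b (b + h) +++ linepath (b + h) a) z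
     + winding_number (linepath a (b + h) +++ linepath (b + h) (a + h) +++ linepath (a + h) a) z"
  using off line_winding_rev[OF off(3)] line_winding_rev[OF off(4)] line_winding_rev[OF off(5)]
  by (subst (1 2) triangle_winding_sum) (auto simp: closed_segment_commute edge_difference_def)

text \<open>The diagonal is \<open>\<alpha> = \<beta>\<close>, so one triangle is
  \<open>0 < \<beta> < \<alpha> < 1\<close> and the other \<open>0 < \<alpha> < \<beta> < 1\<close>;
  both have the orientation of the parallelogram. Points on the lines that carry sides or diagonal
  are excluded, so closed and open inequalities agree.\<close>

lemma edge_difference_parallelogram:
  assumes off: "z \<notin> closed_segment a b" "z \<notin> closed_segment b (b + h)" "z \<notin> closed_segment (a + h) (b + h)" "z \<notin> closed_segment a (a + h)" "z \<notin> closed_segment a (b + h)"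
    and cr: "cross (b - a) h \<noteq> 0" and z: "z = a + of_real \<alpha> * (b - a) + of_real \<beta> * h"
    and ne: "\<alpha> \<noteq> 0" "\<alpha> \<noteq> 1" "\<beta> \<noteq> 0" "\<beta> \<noteq> 1" "\<alpha> \<noteq> \<beta>"
  shows "edge_difference a b h z = (if 0 \<le> \<alpha> \<and> \<alpha> \<le> 1 \<and> 0 \<le> \<beta> \<and> \<beta> \<le> 1 then of_real (sgn (cross (b - a) h)) else 0)"
proof -
  have c1: "cross (b - a) (b + h - a) = cross (b - a) h" and c2: "cross (b + h - a) (a + h - a) = cross (b - a) h"
    by (simp_all add: cross_def algebra_simps)
  have z1: "z = a + of_real (\<alpha> - \<beta>) * (b - a) + of_real \<beta> * (b + h - a)" and z2: "z = a + of_real \<alpha> * (b + h - a) + of_real (\<beta> - \<alpha>) * (a + h - a)"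
    using z by (simp_all add: algebra_simps)
  note t1 = triangle_winding[OF _ z1, unfolded c1, OF cr] and t2 = triangle_winding[OF _ z2, unfolded c2, OF cr]
  consider "0 < \<beta>" "\<beta> < \<alpha>" "\<alpha> < 1" | "0 < \<alpha>" "\<alpha> < \<beta>" "\<beta> < 1" | "\<alpha> < 0" | "1 < \<alpha>" | "\<beta> < 0" | "1 < \<beta>"
    using ne by linarith
  then show ?thesis
  proof cases
    case 1
    then show ?thesis using t1(1) t2(2) by (simp add: edge_difference_eq[OF off])
  next
    case 2
    then show ?thesis using t1(2) t2(1) by (simp add: edge_difference_eq[OF off])
  next
    case 3
    then have "\<alpha> - \<beta> < 0 \<or> \<beta> < 0 \<or> \<alpha> - \<beta> + \<beta> > 1" "\<alpha> < 0 \<or> \<beta> - \<alpha> < 0 \<or> \<alpha> + (\<beta> - \<alpha>) > 1" by linarith+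
    from t1(2)[OF this(1)] t2(2)[OF this(2)] 3 show ?thesis by (simp add: edge_difference_eq[OF off])
  next
    case 4
    then have "\<alpha> - \<beta> < 0 \<or> \<beta> < 0 \<or> \<alpha> - \<beta> + \<beta> > 1" "\<alpha> < 0 \<or> \<beta> - \<alpha> < 0 \<or> \<alpha> + (\<beta> - \<alpha>) > 1" by linarith+
    from t1(2)[OF this(1)] t2(2)[OF this(2)] 4 show ?thesis by (simp add: edge_difference_eq[OF off])
  next
    case 5
    then have "\<alpha> - \<beta> < 0 \<or> \<beta> < 0 \<or> \<alpha> - \<beta> + \<beta> > 1" "\<alpha> < 0 \<or> \<beta> - \<alpha> < 0 \<or> \<alpha> + (\<beta> - \<alpha>) > 1" by linarith+
    from t1(2)[OF this(1)] t2(2)[OF this(2)] 5 show ?thesis by (simp add: edge_difference_eq[OF off])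
  next
    case 6
    then have "\<alpha> - \<beta> < 0 \<or> \<beta> < 0 \<or> \<alpha> - \<beta> + \<beta> > 1" "\<alpha> < 0 \<or> \<beta> - \<alpha> < 0 \<or> \<alpha> + (\<beta> - \<alpha>) > 1" by linarith+
    from t1(2)[OF this(1)] t2(2)[OF this(2)] 6 show ?thesis by (simp add: edge_difference_eq[OF off])
  qed
qed

text \<open>When \<open>h\<close> is parallel to the edge, all vertices lie on one line, a convex
  set that misses \<open>z\<close>, and no loop in it winds around \<open>z\<close>.\<close>

lemma edge_difference_degenerate:
  assumes off: "z \<notin> closed_segment a b" "z \<notin> closed_segment b (b + h)" "z \<notin> closed_segment (a + h) (b + h)" "z \<notin> closed_segment a (a + h)" "z \<notin> closed_segment a (b + h)"
    and cr: "cross (b - a) h = 0" and z: "cross h (z - a) \<noteq> 0"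
  shows "edge_difference a b h z = 0"
proof -
  define L where "L = {w. cross h (w - a) = 0}"
  have eq: "(1 - t) *\<^sub>R x + t *\<^sub>R y - a = of_real (1 - t) * (x - a) + of_real t * (y - a)" for x y and t :: real
    by (simp add: scaleR_conv_of_real algebra_simps)
  have "convex L"
    unfolding convex_alt L_def by (auto simp: eq cross_linear simp del: of_real_diff)
  have mem: "a \<in> L" "b \<in> L" "a + h \<in> L" "b + h \<in> L"
    using cr by (auto simp: L_def cross_def algebra_simps)
  have seg: "closed_segment p q \<subseteq> L" if "p \<in> L" "q \<in> L" for p q
    using closed_segment_subset[OF that \<open>convex L\<close>] .
  have "z \<notin> L" using z by (simp add: L_def)
  have "winding_number (linepath p q +++ linepath q r +++ linepath r p) z = 0" if "p \<in> L" "q \<in> L" "r \<in> L" for p q r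
    by (rule winding_number_zero_outside[OF _ \<open>convex L\<close> _ \<open>z \<notin> L\<close>]) (use seg that in \<open>auto simp: path_image_join\<close>)
  then show ?thesis unfolding edge_difference_eq[OF off] using mem by simp
qed

section \<open>The strips swept by the edges under coordinate translations\<close>

lemma AE_not_line:
  assumes "A \<noteq> 0 \<or> B \<noteq> (0::real)"
  shows "AE x::real^2 in lborel. A * x $ 1 + B * x $ 2 \<noteq> C"
proof -
  have e: "(vector [A, B] :: real^2) \<bullet> x = A * x $ 1 + B * x $ 2" for x by (simp add: inner_vec_def UNIV_2)
  have "(vector [A, B] :: real^2) \<noteq> 0" using assms by (auto simp: vec_eq_iff forall_2)
  then have "negligible {x::real^2. A * x $ 1 + B * x $ 2 = C}"
    using negligible_hyperplane[of "vector [A, B] :: real^2" C] by (simp add: e)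
  then have "{x::real^2. A * x $ 1 + B * x $ 2 = C} \<in> null_sets (completion lborel)" by (simp add: negligible_iff_null_sets)
  moreover have "closed {x::real^2. A * x $ 1 + B * x $ 2 = C}" by (intro closed_Collect_eq continuous_intros)
  then have "{x::real^2. A * x $ 1 + B * x $ 2 = C} \<in> sets lborel" by simp
  ultimately have "{x::real^2. A * x $ 1 + B * x $ 2 = C} \<in> null_sets lborel" by (simp add: null_sets_completion_iff)
  from AE_not_in[OF this] show ?thesis by simp
qed

lemma AE_not_closed_segment: "AE x in lborel. cplx x \<notin> closed_segment p q"
proof (cases "p = q")
  case True
  have "AE x::real^2 in lborel. 1 * x $ 1 + 0 * x $ 2 \<noteq> Re p" by (rule AE_not_line) simp
  then show ?thesis by eventually_elim (auto simp: True cplx_def complex_eq_iff)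
next
  case False
  have "AE x::real^2 in lborel. (Im q - Im p) * x $ 1 + (Re p - Re q) * x $ 2 \<noteq> (Im q - Im p) * Re p + (Re p - Re q) * Im p"
    by (rule AE_not_line) (use False in \<open>auto simp: complex_eq_iff\<close>)
  then show ?thesis
  proof eventually_elim
    case (elim x)
    show ?case
    proof
      assume "cplx x \<in> closed_segment p q"
      then obtain u where "cplx x = (1 - u) *\<^sub>R p + u *\<^sub>R q" by (auto simp: in_segment)
      then have "x $ 1 = Re p + u * (Re q - Re p)" "x $ 2 = Im p + u * (Im q - Im p)"
        by (auto simp: cplx_def complex_eq_iff algebra_simps)
      with elim show False by (simp add: algebra_simps)
    qed
  qed
qed

definition vstrip :: "real \<Rightarrow> real \<Rightarrow> real \<Rightarrow> real \<Rightarrow> real \<Rightarrow> (real^2) set" where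
  "vstrip s p q c \<eta> = {x. p \<le> x $ 1 \<and> x $ 1 \<le> q \<and> 0 \<le> x $ 2 - s * x $ 1 - c \<and> x $ 2 - s * x $ 1 - c \<le> \<eta>}"

definition hstrip :: "real \<Rightarrow> real \<Rightarrow> real \<Rightarrow> real \<Rightarrow> real \<Rightarrow> (real^2) set" where
  "hstrip s p q c \<eta> = {x. p \<le> x $ 2 \<and> x $ 2 \<le> q \<and> 0 \<le> x $ 1 - s * x $ 2 - c \<and> x $ 1 - s * x $ 2 - c \<le> \<eta>}"

lemma between_quotient:
  fixes a b x :: real
  assumes "a \<noteq> b"
  shows "0 \<le> (x - a) / (b - a) \<and> (x - a) / (b - a) \<le> 1 \<longleftrightarrow> min a b \<le> x \<and> x \<le> max a b"
  using assms by (cases "a < b") (auto simp: field_simps)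

text \<open>A vertical translation sweeps the edge, seen as a graph over the first coordinate, into
  the strip above it; the sign records the direction in which the edge is traversed. A vertical edge
  sweeps nothing.\<close>

lemma edge_difference_vertical:
  assumes \<eta>: "\<eta> > 0"
  shows "AE x in lborel. edge_difference a b (Complex 0 \<eta>) (cplx x) = (if Re a = Re b then 0 else of_real (sgn (Re b - Re a)) *
     indicator (vstrip ((Im b - Im a) / (Re b - Re a)) (min (Re a) (Re b)) (max (Re a) (Re b)) (Im a - (Im b - Im a) / (Re b - Re a) * Re a) \<eta>) x)"
proof (cases "Re a = Re b")
  case True
  have "AE x::real^2 in lborel. 1 * x $ 1 + 0 * x $ 2 \<noteq> Re a" by (rule AE_not_line) simp
  then show ?thesis
    using AE_not_closed_segment[of a b] AE_not_closed_segment[of b "b + Complex 0 \<eta>"] AE_not_closed_segment[of "a + Complex 0 \<eta>" "b + Complex 0 \<eta>"]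
      AE_not_closed_segment[of a "a + Complex 0 \<eta>"] AE_not_closed_segment[of a "b + Complex 0 \<eta>"]
  proof eventually_elim
    case (elim x)
    have "edge_difference a b (Complex 0 \<eta>) (cplx x) = 0"
      by (rule edge_difference_degenerate) (use elim \<eta> True in \<open>auto simp: cross_def cplx_def\<close>)
    then show ?case using True by simp
  qed
next
  case False
  define d where "d = Re b - Re a"
  define s where "s = (Im b - Im a) / d"
  define c where "c = Im a - s * Re a"
  have d: "d \<noteq> 0" using False by (simp add: d_def)
  \<comment> \<open>The five null lines carry the four sides and the diagonal of the parallelogram,
    that is \<open>\<alpha> = 0\<close>, \<open>\<alpha> = 1\<close>, \<open>\<beta> = 0\<close>,
    \<open>\<beta> = 1\<close> and \<open>\<alpha> = \<beta>\<close>.\<close>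
  have "AE x::real^2 in lborel. 1 * x $ 1 + 0 * x $ 2 \<noteq> Re a" "AE x::real^2 in lborel. 1 * x $ 1 + 0 * x $ 2 \<noteq> Re b"
    "AE x::real^2 in lborel. (- s) * x $ 1 + 1 * x $ 2 \<noteq> c" "AE x::real^2 in lborel. (- s) * x $ 1 + 1 * x $ 2 \<noteq> c + \<eta>"
    "AE x::real^2 in lborel. (\<eta> + d * s) * x $ 1 + (- d) * x $ 2 \<noteq> \<eta> * Re a - d * c"
    by (rule AE_not_line, use d in simp)+
  then show ?thesis
    using AE_not_closed_segment[of a b] AE_not_closed_segment[of b "b + Complex 0 \<eta>"] AE_not_closed_segment[of "a + Complex 0 \<eta>" "b + Complex 0 \<eta>"]
      AE_not_closed_segment[of a "a + Complex 0 \<eta>"] AE_not_closed_segment[of a "b + Complex 0 \<eta>"]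
  proof eventually_elim
    case (elim x)
    define \<alpha> where "\<alpha> = (x $ 1 - Re a) / d"
    define \<beta> where "\<beta> = (x $ 2 - s * x $ 1 - c) / \<eta>"
    have sd: "s * d = Im b - Im a" using d by (simp add: s_def)
    have x1: "x $ 1 = Re a + \<alpha> * d" using d by (simp add: \<alpha>_def)
    have x2: "x $ 2 = c + s * x $ 1 + \<beta> * \<eta>" using \<eta> by (simp add: \<beta>_def)
    have "x $ 2 = Im a + \<alpha> * (Im b - Im a) + \<beta> * \<eta>"
      using x2 x1 by (simp add: c_def sd[symmetric] algebra_simps)
    then have z: "cplx x = a + of_real \<alpha> * (b - a) + of_real \<beta> * Complex 0 \<eta>"
      using x1 by (simp add: cplx_def complex_eq_iff d_def)
    have cr: "cross (b - a) (Complex 0 \<eta>) = d * \<eta>" by (simp add: cross_def d_def)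
    have "\<alpha> \<noteq> \<beta>"
    proof
      assume "\<alpha> = \<beta>"
      then have "\<eta> * (x $ 1 - Re a) = d * (x $ 2 - s * x $ 1 - c)" using d \<eta> by (simp add: \<alpha>_def \<beta>_def field_simps)
      with elim(5) show False by (simp add: algebra_simps)
    qed
    moreover have "\<alpha> \<noteq> 0" "\<alpha> \<noteq> 1" "\<beta> \<noteq> 0" "\<beta> \<noteq> 1" using elim d \<eta> by (auto simp: \<alpha>_def \<beta>_def d_def)
    ultimately have "edge_difference a b (Complex 0 \<eta>) (cplx x) = (if 0 \<le> \<alpha> \<and> \<alpha> \<le> 1 \<and> 0 \<le> \<beta> \<and> \<beta> \<le> 1 then of_real (sgn (cross (b - a) (Complex 0 \<eta>))) else 0)"
      by (intro edge_difference_parallelogram[OF elim(6-10) _ z]) (use d \<eta> cr in auto)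
    moreover have "0 \<le> \<alpha> \<and> \<alpha> \<le> 1 \<and> 0 \<le> \<beta> \<and> \<beta> \<le> 1 \<longleftrightarrow> x \<in> vstrip s (min (Re a) (Re b)) (max (Re a) (Re b)) c \<eta>"
    proof -
      have "0 \<le> \<alpha> \<and> \<alpha> \<le> 1 \<longleftrightarrow> min (Re a) (Re b) \<le> x $ 1 \<and> x $ 1 \<le> max (Re a) (Re b)"
        unfolding \<alpha>_def d_def by (rule between_quotient[OF False])
      moreover have "0 \<le> \<beta> \<longleftrightarrow> 0 \<le> x $ 2 - s * x $ 1 - c" "\<beta> \<le> 1 \<longleftrightarrow> x $ 2 - s * x $ 1 - c \<le> \<eta>"
        using \<eta> by (auto simp: \<beta>_def zero_le_divide_iff divide_le_eq)
      ultimately show ?thesis by (auto simp: vstrip_def)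
    qed
    moreover have "sgn (cross (b - a) (Complex 0 \<eta>)) = sgn (Re b - Re a)" using \<eta> by (simp add: cr sgn_mult d_def)
    ultimately show ?case using False by (simp add: s_def c_def d_def indicator_def)
  qed
qed

text \<open>The mirror image of the vertical case, with the edge as a graph over the second
  coordinate. Exchanging the coordinates reverses orientation, whence the opposite sign.\<close>

lemma edge_difference_horizontal:
  assumes \<eta>: "\<eta> > 0"
  shows "AE x in lborel. edge_difference a b (Complex \<eta> 0) (cplx x) = (if Im a = Im b then 0 else of_real (- sgn (Im b - Im a)) *
     indicator (hstrip ((Re b - Re a) / (Im b - Im a)) (min (Im a) (Im b)) (max (Im a) (Im b)) (Re a - (Re b - Re a) / (Im b - Im a) * Im a) \<eta>) x)"
proof (cases "Im a = Im b")
  case True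
  have "AE x::real^2 in lborel. 0 * x $ 1 + 1 * x $ 2 \<noteq> Im a" by (rule AE_not_line) simp
  then show ?thesis
    using AE_not_closed_segment[of a b] AE_not_closed_segment[of b "b + Complex \<eta> 0"] AE_not_closed_segment[of "a + Complex \<eta> 0" "b + Complex \<eta> 0"]
      AE_not_closed_segment[of a "a + Complex \<eta> 0"] AE_not_closed_segment[of a "b + Complex \<eta> 0"]
  proof eventually_elim
    case (elim x)
    have "edge_difference a b (Complex \<eta> 0) (cplx x) = 0"
      by (rule edge_difference_degenerate) (use elim \<eta> True in \<open>auto simp: cross_def cplx_def\<close>)
    then show ?case using True by simp
  qed
next
  case False
  define d where "d = Im b - Im a"
  define s where "s = (Re b - Re a) / d"
  define c where "c = Re a - s * Im a"
  have d: "d \<noteq> 0" using False by (simp add: d_def)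
  have "AE x::real^2 in lborel. 0 * x $ 1 + 1 * x $ 2 \<noteq> Im a" "AE x::real^2 in lborel. 0 * x $ 1 + 1 * x $ 2 \<noteq> Im b"
    "AE x::real^2 in lborel. 1 * x $ 1 + (- s) * x $ 2 \<noteq> c" "AE x::real^2 in lborel. 1 * x $ 1 + (- s) * x $ 2 \<noteq> c + \<eta>"
    "AE x::real^2 in lborel. (- d) * x $ 1 + (\<eta> + d * s) * x $ 2 \<noteq> \<eta> * Im a - d * c"
    by (rule AE_not_line, use d in simp)+
  then show ?thesis
    using AE_not_closed_segment[of a b] AE_not_closed_segment[of b "b + Complex \<eta> 0"] AE_not_closed_segment[of "a + Complex \<eta> 0" "b + Complex \<eta> 0"]
      AE_not_closed_segment[of a "a + Complex \<eta> 0"] AE_not_closed_segment[of a "b + Complex \<eta> 0"]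
  proof eventually_elim
    case (elim x)
    define \<alpha> where "\<alpha> = (x $ 2 - Im a) / d"
    define \<beta> where "\<beta> = (x $ 1 - s * x $ 2 - c) / \<eta>"
    have sd: "s * d = Re b - Re a" using d by (simp add: s_def)
    have x1: "x $ 2 = Im a + \<alpha> * d" using d by (simp add: \<alpha>_def)
    have x2: "x $ 1 = c + s * x $ 2 + \<beta> * \<eta>" using \<eta> by (simp add: \<beta>_def)
    have "x $ 1 = Re a + \<alpha> * (Re b - Re a) + \<beta> * \<eta>"
      using x2 x1 by (simp add: c_def sd[symmetric] algebra_simps)
    then have z: "cplx x = a + of_real \<alpha> * (b - a) + of_real \<beta> * Complex \<eta> 0"
      using x1 by (simp add: cplx_def complex_eq_iff d_def)
    have cr: "cross (b - a) (Complex \<eta> 0) = - d * \<eta>" by (simp add: cross_def d_def)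
    have "\<alpha> \<noteq> \<beta>"
    proof
      assume "\<alpha> = \<beta>"
      then have "\<eta> * (x $ 2 - Im a) = d * (x $ 1 - s * x $ 2 - c)" using d \<eta> by (simp add: \<alpha>_def \<beta>_def field_simps)
      with elim(5) show False by (simp add: algebra_simps)
    qed
    moreover have "\<alpha> \<noteq> 0" "\<alpha> \<noteq> 1" "\<beta> \<noteq> 0" "\<beta> \<noteq> 1" using elim d \<eta> by (auto simp: \<alpha>_def \<beta>_def d_def)
    ultimately have "edge_difference a b (Complex \<eta> 0) (cplx x) = (if 0 \<le> \<alpha> \<and> \<alpha> \<le> 1 \<and> 0 \<le> \<beta> \<and> \<beta> \<le> 1 then of_real (sgn (cross (b - a) (Complex \<eta> 0))) else 0)"
      by (intro edge_difference_parallelogram[OF elim(6-10) _ z]) (use d \<eta> cr in auto)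
    moreover have "0 \<le> \<alpha> \<and> \<alpha> \<le> 1 \<and> 0 \<le> \<beta> \<and> \<beta> \<le> 1 \<longleftrightarrow> x \<in> hstrip s (min (Im a) (Im b)) (max (Im a) (Im b)) c \<eta>"
    proof -
      have "0 \<le> \<alpha> \<and> \<alpha> \<le> 1 \<longleftrightarrow> min (Im a) (Im b) \<le> x $ 2 \<and> x $ 2 \<le> max (Im a) (Im b)"
        unfolding \<alpha>_def d_def by (rule between_quotient[OF False])
      moreover have "0 \<le> \<beta> \<longleftrightarrow> 0 \<le> x $ 1 - s * x $ 2 - c" "\<beta> \<le> 1 \<longleftrightarrow> x $ 1 - s * x $ 2 - c \<le> \<eta>"
        using \<eta> by (auto simp: \<beta>_def zero_le_divide_iff divide_le_eq)
      ultimately show ?thesis by (auto simp: hstrip_def)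
    qed
    moreover have "sgn (cross (b - a) (Complex \<eta> 0)) = - sgn (Im b - Im a)" using \<eta> by (simp add: cr sgn_mult d_def flip: sgn_minus)
    ultimately show ?case using False by (simp add: s_def c_def d_def indicator_def)
  qed
qed

section \<open>The indicator of a polygon as a sum over its edges\<close>

lemma cplx_linepath: "cplx \<circ> linepath a b = linepath (cplx a) (cplx b)"
  by (rule ext) (simp add: linepath_def linear_add[OF linear_cplx] linear_scale[OF linear_cplx])

text \<open>All five facts are proved in one induction because joining a further segment needs the
  endpoints and the image of the rest before its winding number can be added.\<close>

lemma polygonal_path_cplx:
  assumes "length us \<ge> 2"
  shows "path (cplx \<circ> polygonal_path us) \<and> pathstart (cplx \<circ> polygonal_path us) = cplx (hd us) \<and>
    pathfinish (cplx \<circ> polygonal_path us) = cplx (last us) \<and>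
    path_image (cplx \<circ> polygonal_path us) = (\<Union>i<length us - 1. closed_segment (cplx (us ! i)) (cplx (us ! Suc i))) \<and>
    (\<forall>z. z \<notin> path_image (cplx \<circ> polygonal_path us) \<longrightarrow> winding_number (cplx \<circ> polygonal_path us) z
       = (\<Sum>i<length us - 1. line_winding (cplx (us ! i)) (cplx (us ! Suc i)) z))"
  using assms
proof (induction us rule: polygonal_path.induct)
  case (3 a b)
  then show ?case by (simp add: cplx_linepath line_winding_def lessThan_Suc)
next
  case (4 a b c vs)
  let ?g = "cplx \<circ> polygonal_path (b # c # vs)"
  have "2 \<le> length (b # c # vs)" by simp
  note I = "4.IH"[OF this]
  have IH: "path ?g" "pathstart ?g = cplx b" "pathfinish ?g = cplx (last (b # c # vs))"
    "path_image ?g = (\<Union>i<length (b # c # vs) - 1. closed_segment (cplx ((b # c # vs) ! i)) (cplx ((b # c # vs) ! Suc i)))"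
    "\<And>z. z \<notin> path_image ?g \<Longrightarrow> winding_number ?g z = (\<Sum>i<length (b # c # vs) - 1. line_winding (cplx ((b # c # vs) ! i)) (cplx ((b # c # vs) ! Suc i)) z)"
    using I[THEN conjunct1] I[THEN conjunct2, THEN conjunct1] I[THEN conjunct2, THEN conjunct2, THEN conjunct1]
      I[THEN conjunct2, THEN conjunct2, THEN conjunct2, THEN conjunct1]
      I[THEN conjunct2, THEN conjunct2, THEN conjunct2, THEN conjunct2, rule_format]
    by (simp_all only: list.sel)
  have e: "cplx \<circ> polygonal_path (a # b # c # vs) = linepath (cplx a) (cplx b) +++ ?g"
    by (simp add: path_compose_join cplx_linepath)
  have len: "length (a # b # c # vs) - 1 = Suc (length (b # c # vs) - 1)" by simp
  have img: "path_image (linepath (cplx a) (cplx b) +++ ?g) = closed_segment (cplx a) (cplx b) \<union> path_image ?g"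
    using IH(2) by (simp add: path_image_join)
  show ?case
    unfolding e
  proof (intro conjI allI impI)
    show "path (linepath (cplx a) (cplx b) +++ ?g)" using IH(1,2) by simp
    show "pathstart (linepath (cplx a) (cplx b) +++ ?g) = cplx (hd (a # b # c # vs))" by simp
    show "pathfinish (linepath (cplx a) (cplx b) +++ ?g) = cplx (last (a # b # c # vs))" using IH(3) by simp
    show "path_image (linepath (cplx a) (cplx b) +++ ?g)
       = (\<Union>i<length (a # b # c # vs) - 1. closed_segment (cplx ((a # b # c # vs) ! i)) (cplx ((a # b # c # vs) ! Suc i)))"
      unfolding img IH(4) len lessThan_Suc_eq_insert_0 by simp
    fix z assume z: "z \<notin> path_image (linepath (cplx a) (cplx b) +++ ?g)"
    then have z': "z \<notin> closed_segment (cplx a) (cplx b)" "z \<notin> path_image ?g" by (simp_all add: img)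
    then have "winding_number (linepath (cplx a) (cplx b) +++ ?g) z = line_winding (cplx a) (cplx b) z + winding_number ?g z"
      using IH(1,2) by (simp add: winding_number_join line_winding_def)
    also have "winding_number ?g z = (\<Sum>i<length (b # c # vs) - 1. line_winding (cplx ((b # c # vs) ! i)) (cplx ((b # c # vs) ! Suc i)) z)"
      by (rule IH(5)[OF z'(2)])
    finally show "winding_number (linepath (cplx a) (cplx b) +++ ?g) z
       = (\<Sum>i<length (a # b # c # vs) - 1. line_winding (cplx ((a # b # c # vs) ! i)) (cplx ((a # b # c # vs) ! Suc i)) z)"
      unfolding len sum.lessThan_Suc_shift by (simp only: nth_Cons_0 nth_Cons_Suc)
  qed
qed auto

text \<open>By the Jordan curve theorem the winding number is 0 outside and a constant 1 or -1
  inside. The factor \<open>\<epsilon>\<close> is this orientation, its own inverse. The telescoping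
  identity in \<open>f\<close> expresses that the edges form a cycle and will remove the auxiliary
  sides of the parallelograms.\<close>

lemma planar_polygon_winding:
  assumes "planar_polygon Q"
  obtains n :: nat and A B :: "nat \<Rightarrow> complex" and \<epsilon> :: complex
  where "\<And>x. cplx x \<notin> (\<Union>i<n. closed_segment (A i) (B i)) \<Longrightarrow> indicator Q x = \<epsilon> * (\<Sum>i<n. line_winding (A i) (B i) (cplx x))"
    and "\<And>f :: complex \<Rightarrow> complex. (\<Sum>i<n. f (B i) - f (A i)) = 0"
    and "compact Q" and "interior Q \<noteq> {}"
    and "frontier Q \<subseteq> {x. cplx x \<in> (\<Union>i<n. closed_segment (A i) (B i))}"
proof -
  obtain vs where vs: "length vs \<ge> 3" "simple_path (closed_polygonal_path vs)"
     "Q = path_image (closed_polygonal_path vs) \<union> inside (path_image (closed_polygonal_path vs))"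
    using assms by (auto simp: planar_polygon_def)
  define us where "us = vs @ [hd vs]"
  define p where "p = closed_polygonal_path vs"
  define \<gamma> where "\<gamma> = cplx \<circ> p"
  define n where "n = length vs"
  define A where "A i = cplx (us ! i)" for i
  define B where "B i = A (Suc i)" for i
  have p: "p = polygonal_path us" by (simp add: p_def us_def closed_polygonal_path_def)
  have n: "length us - 1 = n" "length us \<ge> 2" using vs(1) by (auto simp: us_def n_def)
  note P = polygonal_path_cplx[OF n(2), folded p, folded \<gamma>_def, unfolded n(1), folded A_def B_def]
  note P_ends = P[THEN conjunct2, THEN conjunct1] P[THEN conjunct2, THEN conjunct2, THEN conjunct1]
  note S = P[THEN conjunct2, THEN conjunct2, THEN conjunct2, THEN conjunct1]
  note P_winding = P[THEN conjunct2, THEN conjunct2, THEN conjunct2, THEN conjunct2, rule_format]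
  have ends: "hd us = last us" using vs(1) by (cases vs) (auto simp: us_def)
  have simple: "simple_path \<gamma>"
    unfolding \<gamma>_def p_def using simple_path_linear_image_eq[OF linear_cplx inj_cplx] vs(2) by blast
  have loop: "pathfinish \<gamma> = pathstart \<gamma>" using P_ends ends by simp
  have img: "path_image \<gamma> = cplx ` path_image p" by (simp add: \<gamma>_def path_image_compose)
  have imgmem: "cplx x \<in> path_image \<gamma> \<longleftrightarrow> x \<in> path_image p" for x
    unfolding img using inj_cplx by (simp add: inj_image_mem_iff)
  have insmem: "cplx x \<in> inside (path_image \<gamma>) \<longleftrightarrow> x \<in> inside (path_image p)" for x
    unfolding img by (rule inside_cplx)
  obtain \<epsilon> :: complex where \<epsilon>: "\<epsilon> * \<epsilon> = 1" "\<And>z. z \<in> inside (path_image \<gamma>) \<Longrightarrow> winding_number \<gamma> z = \<epsilon>"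
  proof (rule simple_closed_path_winding_number_inside[OF simple])
    assume *: "\<And>z. z \<in> inside (path_image \<gamma>) \<Longrightarrow> winding_number \<gamma> z = 1"
    show thesis by (rule that[of 1]) (simp, rule *)
  next
    assume *: "\<And>z. z \<in> inside (path_image \<gamma>) \<Longrightarrow> winding_number \<gamma> z = -1"
    show thesis by (rule that[of "-1"]) (simp, rule *)
  qed
  show thesis
  proof (rule that[where n=n and A=A and B=B and \<epsilon>=\<epsilon>])
    fix x assume x: "cplx x \<notin> (\<Union>i<n. closed_segment (A i) (B i))"
    then have off: "cplx x \<notin> path_image \<gamma>" unfolding S .
    then have "(\<Sum>i<n. line_winding (A i) (B i) (cplx x)) = winding_number \<gamma> (cplx x)" by (rule P_winding[symmetric])
    also have "\<dots> = indicator Q x * \<epsilon>"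
    proof (cases "x \<in> inside (path_image p)")
      case True
      then show ?thesis using \<epsilon>(2) insmem[of x] vs(3) by (simp add: p_def)
    next
      case False
      have "cplx x \<in> outside (path_image \<gamma>)" using False off insmem[of x] union_with_outside[of "path_image \<gamma>"] by (auto simp: inside_Un_outside)
      then have "winding_number \<gamma> (cplx x) = 0"
        using winding_number_zero_in_outside[of \<gamma> "cplx x"] loop simple_path_imp_path[OF simple] by simp
      moreover have "x \<notin> Q" using vs(3) False off imgmem by (auto simp: p_def)
      ultimately show ?thesis by simp
    qed
    finally show "indicator Q x = \<epsilon> * (\<Sum>i<n. line_winding (A i) (B i) (cplx x))"
      using \<epsilon>(1) by (simp add: mult.left_commute)
  next
    fix f :: "complex \<Rightarrow> complex"
    have "(\<Sum>i<n. f (B i) - f (A i)) = (\<Sum>i<n. f (cplx (us ! Suc i)) - f (cplx (us ! i)))" by (simp add: A_def B_def)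
    also have "\<dots> = f (cplx (us ! n)) - f (cplx (us ! 0))" by (rule sum_lessThan_telescope)
    \<comment> \<open>The closing vertex was appended as a copy of the first one.\<close>
    also have "us ! n = us ! 0" using vs(1) by (cases vs) (auto simp: us_def n_def nth_append)
    finally show "(\<Sum>i<n. f (B i) - f (A i)) = 0" by simp
  next
    have pp: "path p" using vs(2) by (simp add: p_def simple_path_imp_path)
    have JI: "inside (path_image \<gamma>) \<noteq> {}" "open (inside (path_image \<gamma>))" "bounded (inside (path_image \<gamma>))"
      using Jordan_inside_outside[OF simple loop] by auto
    have ins: "inside (path_image p) = cplx -` inside (path_image \<gamma>)" using insmem by auto
    have contc: "continuous_on UNIV cplx" using linear_cplx linear_continuous_on linear_conv_bounded_linear by blast
    have opn: "open (inside (path_image p))" unfolding ins by (rule open_vimage[OF JI(2) contc])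
    have ne: "inside (path_image p) \<noteq> {}"
    proof -
      obtain w where "w \<in> inside (path_image \<gamma>)" using JI(1) by auto
      then have "uncplx w \<in> inside (path_image p)" using insmem[of "uncplx w"] by simp
      then show ?thesis by auto
    qed
    have sub: "inside (path_image p) \<subseteq> interior Q" using opn vs(3) by (intro interior_maximal) (auto simp: p_def)
    then show "interior Q \<noteq> {}" using ne by auto
    have closedQ: "closed Q" using closed_path_image_Un_inside[OF pp] vs(3) by (simp add: p_def)
    have "inside (path_image p) = uncplx ` inside (path_image \<gamma>)"
    proof (rule set_eqI, rule iffI)
      fix x assume "x \<in> inside (path_image p)"
      then have "cplx x \<in> inside (path_image \<gamma>)" by (simp only: insmem)
      then have "uncplx (cplx x) \<in> uncplx ` inside (path_image \<gamma>)" by (rule imageI)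
      then show "x \<in> uncplx ` inside (path_image \<gamma>)" by simp
    next
      fix x assume "x \<in> uncplx ` inside (path_image \<gamma>)"
      then obtain w where "w \<in> inside (path_image \<gamma>)" "x = uncplx w" by auto
      then show "x \<in> inside (path_image p)" using insmem[of "uncplx w"] by simp
    qed
    then have "bounded (inside (path_image p))"
      using JI(3) linear_uncplx bounded_linear_image linear_conv_bounded_linear by metis
    then have "bounded Q" using vs(3) bounded_path_image[OF pp] by (simp add: p_def)
    with closedQ show "compact Q" by (simp add: compact_eq_bounded_closed)
    show "frontier Q \<subseteq> {x. cplx x \<in> (\<Union>i<n. closed_segment (A i) (B i))}"
    proof
      fix x assume "x \<in> frontier Q"
      then have "x \<in> Q" "x \<notin> interior Q" using closedQ by (auto simp: frontier_def)
      then have "x \<in> path_image p" using sub vs(3) by (auto simp: p_def)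
      then show "x \<in> {x. cplx x \<in> (\<Union>i<n. closed_segment (A i) (B i))}" using imgmem[of x] S by simp
    qed
  qed
qed

lemma AE_not_segments: "AE x in lborel. cplx x \<notin> (\<Union>i<n. closed_segment (A i) (B i))" for n :: nat
proof -
  have "AE x in lborel. \<forall>i\<in>{..<n}. cplx x \<notin> closed_segment (A i) (B i)"
    by (rule AE_finite_allI) (auto intro: AE_not_closed_segment)
  then show ?thesis by eventually_elim auto
qed

lemma polygon_translation_difference:
  fixes n :: nat and A B :: "nat \<Rightarrow> complex" and \<epsilon> :: complex
  assumes ind: "\<And>x. cplx x \<notin> (\<Union>i<n. closed_segment (A i) (B i)) \<Longrightarrow> (indicator Q x :: complex) = \<epsilon> * (\<Sum>i<n. line_winding (A i) (B i) (cplx x))"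
    and cyc: "\<And>f :: complex \<Rightarrow> complex. (\<Sum>i<n. f (B i) - f (A i)) = 0"
  shows "AE x in lborel. (indicator Q (x - h) - indicator Q x :: complex) = (\<Sum>i<n. - \<epsilon> * edge_difference (A i) (B i) (cplx h) (cplx x))"
  using AE_not_segments[where n=n and A=A and B=B] AE_not_segments[where n=n and A="\<lambda>i. A i + cplx h" and B="\<lambda>i. B i + cplx h"]
proof eventually_elim
  case (elim x)
  let ?z = "cplx x" and ?h = "cplx h"
  have zh: "cplx (x - h) = ?z - ?h" by (simp add: linear_diff[OF linear_cplx])
  have "?z - ?h \<notin> closed_segment (A i) (B i)" if "i < n" for i
  proof
    assume "?z - ?h \<in> closed_segment (A i) (B i)"
    then have "?h + (?z - ?h) \<in> closed_segment (?h + A i) (?h + B i)" by (rule closed_segment_translation_eq[THEN iffD2])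
    with elim(2) that show False by (simp add: add.commute)
  qed
  then have "(indicator Q (x - h) :: complex) = \<epsilon> * (\<Sum>i<n. line_winding (A i) (B i) (?z - ?h))"
    using ind[of "x - h"] by (simp add: zh)
  moreover have "(indicator Q x :: complex) = \<epsilon> * (\<Sum>i<n. line_winding (A i) (B i) ?z)" by (rule ind[OF elim(1)])
  moreover have "(\<Sum>i<n. edge_difference (A i) (B i) ?h ?z) = (\<Sum>i<n. line_winding (A i) (B i) ?z) - (\<Sum>i<n. line_winding (A i) (B i) (?z - ?h))"
  proof -
    have "(\<Sum>i<n. edge_difference (A i) (B i) ?h ?z) = (\<Sum>i<n. line_winding (A i) (B i) ?z - line_winding (A i) (B i) (?z - ?h)
       + (line_winding (B i) (B i + ?h) ?z - line_winding (A i) (A i + ?h) ?z))"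
      by (intro sum.cong refl) (simp add: edge_difference_def line_winding_translate)
    also have "\<dots> = (\<Sum>i<n. line_winding (A i) (B i) ?z - line_winding (A i) (B i) (?z - ?h))"
      \<comment> \<open>The auxiliary side attached to a vertex \<open>w\<close> runs from
        \<open>w\<close> to \<open>w + h\<close>, so its contribution is a function of the vertex
        alone and telescopes around the cycle.\<close>
      using cyc[of "\<lambda>w. line_winding w (w + ?h) ?z"] by (simp add: sum.distrib)
    finally show ?thesis by (simp add: sum_subtractf)
  qed
  ultimately show ?case by (simp add: sum_distrib_left[symmetric] right_diff_distrib sum_negf)
qed

lemma planar_polygon_strips:
  assumes "planar_polygon Q"
  obtains n :: nat and \<sigma> \<sigma>' :: "nat \<Rightarrow> complex" and s p q c s' p' q' c' :: "nat \<Rightarrow> real"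
  where "compact Q" "interior Q \<noteq> {}" "AE x in lborel. x \<notin> frontier Q"
    and "\<And>e. p e \<le> q e" "\<And>e. p' e \<le> q' e"
    and "\<And>\<eta>. \<eta> > 0 \<Longrightarrow> AE x in lborel. (indicator Q (x - vector [0, \<eta>]) - indicator Q x :: complex)
       = (\<Sum>e<n. \<sigma> e * indicator (vstrip (s e) (p e) (q e) (c e) \<eta>) x)"
    and "\<And>\<eta>. \<eta> > 0 \<Longrightarrow> AE x in lborel. (indicator Q (x - vector [\<eta>, 0]) - indicator Q x :: complex)
       = (\<Sum>e<n. \<sigma>' e * indicator (hstrip (s' e) (p' e) (q' e) (c' e) \<eta>) x)"
proof (rule planar_polygon_winding[OF assms])
  fix n :: nat and A B :: "nat \<Rightarrow> complex" and \<epsilon> :: complex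
  assume W: "\<And>x. cplx x \<notin> (\<Union>i<n. closed_segment (A i) (B i)) \<Longrightarrow> indicator Q x = \<epsilon> * (\<Sum>i<n. line_winding (A i) (B i) (cplx x))"
    and cyc: "\<And>f :: complex \<Rightarrow> complex. (\<Sum>i<n. f (B i) - f (A i)) = 0"
    and Q: "compact Q" "interior Q \<noteq> {}" and fr: "frontier Q \<subseteq> {x. cplx x \<in> (\<Union>i<n. closed_segment (A i) (B i))}"
  have diff: "AE x in lborel. (indicator Q (x - h) - indicator Q x :: complex) = (\<Sum>i<n. - \<epsilon> * edge_difference (A i) (B i) (cplx h) (cplx x))" for h
    by (rule polygon_translation_difference) (erule W, rule cyc)
  \<comment> \<open>Edges parallel to the translation get weight 0, which hides the meaningless
    slope of their strip.\<close>
  define \<sigma> where "\<sigma> i = (if Re (A i) = Re (B i) then 0 else - \<epsilon> * of_real (sgn (Re (B i) - Re (A i))))" for i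
  define \<sigma>' where "\<sigma>' i = (if Im (A i) = Im (B i) then 0 else - \<epsilon> * of_real (- sgn (Im (B i) - Im (A i))))" for i
  show thesis
  proof (rule that[where n=n and \<sigma>=\<sigma> and \<sigma>'=\<sigma>' and s="\<lambda>i. (Im (B i) - Im (A i)) / (Re (B i) - Re (A i))" and p="\<lambda>i. min (Re (A i)) (Re (B i))"
       and q="\<lambda>i. max (Re (A i)) (Re (B i))" and c="\<lambda>i. Im (A i) - (Im (B i) - Im (A i)) / (Re (B i) - Re (A i)) * Re (A i)"
       and s'="\<lambda>i. (Re (B i) - Re (A i)) / (Im (B i) - Im (A i))" and p'="\<lambda>i. min (Im (A i)) (Im (B i))"
       and q'="\<lambda>i. max (Im (A i)) (Im (B i))" and c'="\<lambda>i. Re (A i) - (Re (B i) - Re (A i)) / (Im (B i) - Im (A i)) * Im (A i)"])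
    show "AE x in lborel. x \<notin> frontier Q"
      using AE_not_segments[where n=n and A=A and B=B] by eventually_elim (use fr in auto)
    fix \<eta> :: real assume \<eta>: "\<eta> > 0"
    have cv: "cplx (vector [0, \<eta>]) = Complex 0 \<eta>" "cplx (vector [\<eta>, 0]) = Complex \<eta> 0" by (simp_all add: cplx_def)
    have "AE x in lborel. \<forall>i\<in>{..<n}. edge_difference (A i) (B i) (Complex 0 \<eta>) (cplx x) = (if Re (A i) = Re (B i) then 0 else of_real (sgn (Re (B i) - Re (A i))) *
     indicator (vstrip ((Im (B i) - Im (A i)) / (Re (B i) - Re (A i))) (min (Re (A i)) (Re (B i))) (max (Re (A i)) (Re (B i))) (Im (A i) - (Im (B i) - Im (A i)) / (Re (B i) - Re (A i)) * Re (A i)) \<eta>) x)"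
      by (rule AE_finite_allI) (rule finite_lessThan, rule edge_difference_vertical[OF \<eta>])
    then show "AE x in lborel. (indicator Q (x - vector [0, \<eta>]) - indicator Q x :: complex)
       = (\<Sum>i<n. \<sigma> i * indicator (vstrip ((Im (B i) - Im (A i)) / (Re (B i) - Re (A i))) (min (Re (A i)) (Re (B i))) (max (Re (A i)) (Re (B i))) (Im (A i) - (Im (B i) - Im (A i)) / (Re (B i) - Re (A i)) * Re (A i)) \<eta>) x)"
      using diff[of "vector [0, \<eta>]"]
    proof eventually_elim
      case (elim x)
      show ?case unfolding elim(2) cv
        by (rule sum.cong[OF refl]) (use elim(1) in \<open>simp add: \<sigma>_def\<close>)
    qed
    have "AE x in lborel. \<forall>i\<in>{..<n}. edge_difference (A i) (B i) (Complex \<eta> 0) (cplx x) = (if Im (A i) = Im (B i) then 0 else of_real (- sgn (Im (B i) - Im (A i))) *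
     indicator (hstrip ((Re (B i) - Re (A i)) / (Im (B i) - Im (A i))) (min (Im (A i)) (Im (B i))) (max (Im (A i)) (Im (B i))) (Re (A i) - (Re (B i) - Re (A i)) / (Im (B i) - Im (A i)) * Im (A i)) \<eta>) x)"
      by (rule AE_finite_allI) (rule finite_lessThan, rule edge_difference_horizontal[OF \<eta>])
    then show "AE x in lborel. (indicator Q (x - vector [\<eta>, 0]) - indicator Q x :: complex)
       = (\<Sum>i<n. \<sigma>' i * indicator (hstrip ((Re (B i) - Re (A i)) / (Im (B i) - Im (A i))) (min (Im (A i)) (Im (B i))) (max (Im (A i)) (Im (B i))) (Re (A i) - (Re (B i) - Re (A i)) / (Im (B i) - Im (A i)) * Im (A i)) \<eta>) x)"
      using diff[of "vector [\<eta>, 0]"]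
    proof eventually_elim
      case (elim x)
      show ?case unfolding elim(2) cv
        by (rule sum.cong[OF refl]) (use elim(1) in \<open>simp add: \<sigma>'_def\<close>)
    qed
  qed (use Q in auto)
qed

section \<open>Fourier coefficients of strips\<close>

lemma vec2_measurable: "(\<lambda>(a, b). vector [a, b] :: real^2) \<in> borel_measurable (lborel \<Otimes>\<^sub>M lborel)"
proof -
  have "(\<lambda>(a, b). vector [a, b] :: real^2) = (\<lambda>p. fst p *\<^sub>R vector [1, 0] + snd p *\<^sub>R vector [0, 1])"
    by (auto simp: fun_eq_iff vec_eq_iff forall_2)
  moreover have "continuous_on UNIV (\<lambda>p :: real \<times> real. fst p *\<^sub>R vector [1, 0] + snd p *\<^sub>R vector [0, 1] :: real^2)"
    by (intro continuous_intros)
  ultimately have "(\<lambda>(a, b). vector [a, b] :: real^2) \<in> borel_measurable borel"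
    by (simp only: borel_measurable_continuous_onI)
  then show ?thesis by (simp add: lborel_prod)
qed

text \<open>Identifies Lebesgue measure on \<open>real^2\<close> with a product measure, so that
  Fubini becomes available in coordinates.\<close>

lemma lborel_vec2: "distr (lborel \<Otimes>\<^sub>M lborel) borel (\<lambda>(a, b). vector [a, b] :: real^2) = lborel"
proof (rule lborel_eqI[symmetric])
  note m = vec2_measurable
  fix l u :: "real^2" assume le: "\<And>b. b \<in> Basis \<Longrightarrow> l \<bullet> b \<le> u \<bullet> b"
  have "l $ i \<le> u $ i" for i using le[of "axis i 1"] by (simp add: inner_axis axis_in_Basis_iff)
  then have le': "l $ 1 \<le> u $ 1" "l $ 2 \<le> u $ 2" by auto
  have "(\<lambda>(a, b). vector [a, b] :: real^2) -` box l u \<inter> space (lborel \<Otimes>\<^sub>M lborel) = {l $ 1<..<u $ 1} \<times> {l $ 2<..<u $ 2}"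
    by (auto simp: mem_box_cart forall_2 space_pair_measure)
  then have "emeasure (distr (lborel \<Otimes>\<^sub>M lborel) borel (\<lambda>(a, b). vector [a, b] :: real^2)) (box l u)
     = ennreal (u $ 1 - l $ 1) * ennreal (u $ 2 - l $ 2)"
    using le' by (subst emeasure_distr[OF m]) (auto simp: lborel.emeasure_pair_measure_Times)
  also have "\<dots> = ennreal (\<Prod>b\<in>Basis. (u - l) \<bullet> b)"
  proof -
    have B: "(Basis :: (real^2) set) = {axis 1 1, axis 2 1}" by (auto simp: Basis_vec_def UNIV_2)
    have "(\<Prod>b\<in>Basis. (u - l) \<bullet> b) = (u $ 1 - l $ 1) * (u $ 2 - l $ 2)"
      unfolding B by (simp add: axis_eq_axis inner_axis)
    then show ?thesis using le' by (simp add: ennreal_mult)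
  qed
  finally show "emeasure (distr (lborel \<Otimes>\<^sub>M lborel) borel (\<lambda>(a, b). vector [a, b] :: real^2)) (box l u) = (\<Prod>b\<in>Basis. (u - l) \<bullet> b)" .
qed simp

lemma integral_vec2:
  fixes f :: "real^2 \<Rightarrow> complex"
  assumes f: "integrable lborel f"
  shows "(LINT x|lborel. f x) = (LINT a|lborel. LINT b|lborel. f (vector [a, b]))"
    and "(LINT x|lborel. f x) = (LINT b|lborel. LINT a|lborel. f (vector [a, b]))"
proof -
  note m = vec2_measurable
  have fm: "f \<in> borel_measurable borel" using f by auto
  have "integrable (distr (lborel \<Otimes>\<^sub>M lborel) borel (\<lambda>(a, b). vector [a, b] :: real^2)) f"
    using f by (simp add: lborel_vec2)
  then have i: "integrable (lborel \<Otimes>\<^sub>M lborel) (\<lambda>(a, b). f (vector [a, b]))"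
    by (subst (asm) integrable_distr_eq[OF m fm]) (simp add: case_prod_unfold)
  have "(LINT x|lborel. f x) = (LINT x|distr (lborel \<Otimes>\<^sub>M lborel) borel (\<lambda>(a, b). vector [a, b] :: real^2). f x)"
    by (simp add: lborel_vec2)
  also have "\<dots> = integral\<^sup>L (lborel \<Otimes>\<^sub>M lborel) (\<lambda>(a, b). f (vector [a, b]))"
    by (subst integral_distr[OF m fm]) (simp add: case_prod_unfold)
  finally have e: "(LINT x|lborel. f x) = integral\<^sup>L (lborel \<Otimes>\<^sub>M lborel) (\<lambda>(a, b). f (vector [a, b]))" .
  show "(LINT x|lborel. f x) = (LINT a|lborel. LINT b|lborel. f (vector [a, b]))"
    unfolding e using lborel_pair.integral_fst'[OF i] by simp
  show "(LINT x|lborel. f x) = (LINT b|lborel. LINT a|lborel. f (vector [a, b]))"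
    unfolding e using lborel_pair.integral_snd[OF i] by simp
qed

lemma vstrip_bounded: "bounded (vstrip s p q c \<eta>)"
proof (rule bounded_subset[OF bounded_cbox])
  define R where "R = \<bar>s\<bar> * (\<bar>p\<bar> + \<bar>q\<bar>) + \<bar>c\<bar> + \<bar>\<eta>\<bar>"
  show "vstrip s p q c \<eta> \<subseteq> cbox (vector [p, - R]) (vector [q, R])"
  proof
    fix x assume x: "x \<in> vstrip s p q c \<eta>"
    then have "\<bar>x $ 1\<bar> \<le> \<bar>p\<bar> + \<bar>q\<bar>" by (auto simp: vstrip_def)
    then have "\<bar>s * x $ 1\<bar> \<le> \<bar>s\<bar> * (\<bar>p\<bar> + \<bar>q\<bar>)" unfolding abs_mult by (intro mult_left_mono) auto
    with x show "x \<in> cbox (vector [p, - R]) (vector [q, R])" by (auto simp: vstrip_def R_def mem_box_cart forall_2)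
  qed
qed

lemma hstrip_bounded: "bounded (hstrip s p q c \<eta>)"
proof (rule bounded_subset[OF bounded_cbox])
  define R where "R = \<bar>s\<bar> * (\<bar>p\<bar> + \<bar>q\<bar>) + \<bar>c\<bar> + \<bar>\<eta>\<bar>"
  show "hstrip s p q c \<eta> \<subseteq> cbox (vector [- R, p]) (vector [R, q])"
  proof
    fix x assume x: "x \<in> hstrip s p q c \<eta>"
    then have "\<bar>x $ 2\<bar> \<le> \<bar>p\<bar> + \<bar>q\<bar>" by (auto simp: hstrip_def)
    then have "\<bar>s * x $ 2\<bar> \<le> \<bar>s\<bar> * (\<bar>p\<bar> + \<bar>q\<bar>)" unfolding abs_mult by (intro mult_left_mono) auto
    with x show "x \<in> cbox (vector [- R, p]) (vector [R, q])" by (auto simp: hstrip_def R_def mem_box_cart forall_2)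
  qed
qed

lemma closed_strips: "closed (vstrip s p q c \<eta>)" "closed (hstrip s p q c \<eta>)"
  unfolding vstrip_def hstrip_def by (intro closed_Collect_conj closed_Collect_le continuous_intros)+

lemma integrable_bounded_indicator_tchar:
  assumes [measurable]: "E \<in> sets borel" and "bounded E"
  shows "integrable lborel (\<lambda>x. indicator E x * cnj (tchar n x))"
proof (rule integrableI_bounded_set[where A=E and B=1])
  show "(\<lambda>x. indicator E x * cnj (tchar n x)) \<in> borel_measurable lborel" unfolding tchar_cnj by measurable
qed (use assms emeasure_bounded_finite in \<open>auto simp: indicator_def\<close>)

lemma box_ft_cnj_lebesgue: "(LINT r|lborel. indicator {a..b} r * cis (- (\<xi> * r))) = box_ft a b \<xi>"
  using box_ft_lebesgue[of a b \<xi>] by simp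

text \<open>For fixed first coordinate \<open>a\<close> the substitution
  \<open>b = c + s * a + r\<close> straightens the strip to a rectangle, and the character splits
  into a factor in \<open>a\<close> of frequency \<open>n1 + s * n2\<close> and one in
  \<open>r\<close> of frequency \<open>n2\<close>.\<close>

lemma integral_vstrip:
  "(LINT x|lborel. indicator (vstrip s p q c \<eta>) x * cnj (tchar n x)) = strip_coeff s p q c \<eta> n"
proof -
  let ?n1 = "real_of_int (fst n)" and ?n2 = "real_of_int (snd n)"
  have "(LINT x|lborel. indicator (vstrip s p q c \<eta>) x * cnj (tchar n x))
     = (LINT a|lborel. LINT b|lborel. indicator (vstrip s p q c \<eta>) (vector [a, b]) * cnj (tchar n (vector [a, b])))"
    by (rule integral_vec2) (intro integrable_bounded_indicator_tchar borel_closed closed_strips vstrip_bounded)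
  also have "\<dots> = (LINT a|lborel. (cis (- c * ?n2) * box_ft 0 \<eta> ?n2) * (indicator {p..q} a * cis (- ((?n1 + s * ?n2) * a))))"
  proof (rule Bochner_Integration.integral_cong[OF refl])
    fix a
    have "(LINT b|lborel. indicator (vstrip s p q c \<eta>) (vector [a, b]) * cnj (tchar n (vector [a, b])))
       = (LINT r|lborel. indicator (vstrip s p q c \<eta>) (vector [a, (c + s * a) + 1 * r]) * cnj (tchar n (vector [a, (c + s * a) + 1 * r])))"
      by (subst lborel_integral_real_affine[where c=1 and t="c + s * a"]) auto
    also have "\<dots> = (LINT r|lborel. (indicator {p..q} a * cis (- ((?n1 + s * ?n2) * a)) * cis (- c * ?n2)) * (indicator {0..\<eta>} r * cis (- (?n2 * r))))"
    proof (rule Bochner_Integration.integral_cong[OF refl])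
      fix r
      have i: "(indicator (vstrip s p q c \<eta>) (vector [a, (c + s * a) + 1 * r]) :: complex) = indicator {p..q} a * indicator {0..\<eta>} r"
        by (auto simp: vstrip_def indicator_def)
      have e: "cnj (tchar n (vector [a, (c + s * a) + 1 * r])) = cis (- ((?n1 + s * ?n2) * a)) * cis (- c * ?n2) * cis (- (?n2 * r))"
        by (simp add: tchar_def cis_cnj cis_mult algebra_simps)
      show "indicator (vstrip s p q c \<eta>) (vector [a, (c + s * a) + 1 * r]) * cnj (tchar n (vector [a, (c + s * a) + 1 * r]))
         = (indicator {p..q} a * cis (- ((?n1 + s * ?n2) * a)) * cis (- c * ?n2)) * (indicator {0..\<eta>} r * cis (- (?n2 * r)))"
        unfolding i e by (simp only: mult_ac)
    qed
    also have "\<dots> = (indicator {p..q} a * cis (- ((?n1 + s * ?n2) * a)) * cis (- c * ?n2)) * box_ft 0 \<eta> ?n2"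
      by (simp only: integral_mult_right_zero box_ft_cnj_lebesgue)
    finally show "(LINT b|lborel. indicator (vstrip s p q c \<eta>) (vector [a, b]) * cnj (tchar n (vector [a, b])))
       = (cis (- c * ?n2) * box_ft 0 \<eta> ?n2) * (indicator {p..q} a * cis (- ((?n1 + s * ?n2) * a)))"
      by (simp only: mult_ac)
  qed
  also have "\<dots> = (cis (- c * ?n2) * box_ft 0 \<eta> ?n2) * box_ft p q (?n1 + s * ?n2)"
    by (simp only: integral_mult_right_zero box_ft_cnj_lebesgue)
  finally show ?thesis by (simp add: strip_coeff_def mult_ac)
qed

lemma integral_hstrip:
  "(LINT x|lborel. indicator (hstrip s p q c \<eta>) x * cnj (tchar n x)) = strip_coeff s p q c \<eta> (prod.swap n)"
proof -
  let ?n1 = "real_of_int (fst n)" and ?n2 = "real_of_int (snd n)"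
  have "(LINT x|lborel. indicator (hstrip s p q c \<eta>) x * cnj (tchar n x))
     = (LINT b|lborel. LINT a|lborel. indicator (hstrip s p q c \<eta>) (vector [a, b]) * cnj (tchar n (vector [a, b])))"
    by (rule integral_vec2) (intro integrable_bounded_indicator_tchar borel_closed closed_strips hstrip_bounded)
  also have "\<dots> = (LINT b|lborel. (cis (- c * ?n1) * box_ft 0 \<eta> ?n1) * (indicator {p..q} b * cis (- ((?n2 + s * ?n1) * b))))"
  proof (rule Bochner_Integration.integral_cong[OF refl])
    fix b
    have "(LINT a|lborel. indicator (hstrip s p q c \<eta>) (vector [a, b]) * cnj (tchar n (vector [a, b])))
       = (LINT r|lborel. indicator (hstrip s p q c \<eta>) (vector [(c + s * b) + 1 * r, b]) * cnj (tchar n (vector [(c + s * b) + 1 * r, b])))"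
      by (subst lborel_integral_real_affine[where c=1 and t="c + s * b"]) auto
    also have "\<dots> = (LINT r|lborel. (indicator {p..q} b * cis (- ((?n2 + s * ?n1) * b)) * cis (- c * ?n1)) * (indicator {0..\<eta>} r * cis (- (?n1 * r))))"
    proof (rule Bochner_Integration.integral_cong[OF refl])
      fix r
      have i: "(indicator (hstrip s p q c \<eta>) (vector [(c + s * b) + 1 * r, b]) :: complex) = indicator {p..q} b * indicator {0..\<eta>} r"
        by (auto simp: hstrip_def indicator_def)
      have e: "cnj (tchar n (vector [(c + s * b) + 1 * r, b])) = cis (- ((?n2 + s * ?n1) * b)) * cis (- c * ?n1) * cis (- (?n1 * r))"
        by (simp add: tchar_def cis_cnj cis_mult algebra_simps)
      show "indicator (hstrip s p q c \<eta>) (vector [(c + s * b) + 1 * r, b]) * cnj (tchar n (vector [(c + s * b) + 1 * r, b]))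
         = (indicator {p..q} b * cis (- ((?n2 + s * ?n1) * b)) * cis (- c * ?n1)) * (indicator {0..\<eta>} r * cis (- (?n1 * r)))"
        unfolding i e by (simp only: mult_ac)
    qed
    also have "\<dots> = (indicator {p..q} b * cis (- ((?n2 + s * ?n1) * b)) * cis (- c * ?n1)) * box_ft 0 \<eta> ?n1"
      by (simp only: integral_mult_right_zero box_ft_cnj_lebesgue)
    finally show "(LINT a|lborel. indicator (hstrip s p q c \<eta>) (vector [a, b]) * cnj (tchar n (vector [a, b])))
       = (cis (- c * ?n1) * box_ft 0 \<eta> ?n1) * (indicator {p..q} b * cis (- ((?n2 + s * ?n1) * b)))"
      by (simp only: mult_ac)
  qed
  also have "\<dots> = (cis (- c * ?n1) * box_ft 0 \<eta> ?n1) * box_ft p q (?n2 + s * ?n1)"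
    by (simp only: integral_mult_right_zero box_ft_cnj_lebesgue)
  finally show ?thesis by (simp add: strip_coeff_def mult_ac)
qed

section \<open>The period lattice and the translates of a polygon\<close>

lemma closed_lattice: "closed (range lattice_vec)"
proof -
  have "range lattice_vec = {x. cos (x $ 1) = 1 \<and> cos (x $ 2) = 1}"
  proof (rule set_eqI, rule iffI)
    fix x assume "x \<in> {x :: real^2. cos (x $ 1) = 1 \<and> cos (x $ 2) = 1}"
    then obtain a b :: int where "x $ 1 = of_int a * (2 * pi)" "x $ 2 = of_int b * (2 * pi)"
      by (auto simp: cos_one_2pi_int mult.assoc)
    then have "x = lattice_vec (a, b)" by (simp add: vec2_eq_iff)
    then show "x \<in> range lattice_vec" by blast
  qed auto
  then show ?thesis by (simp only:) (intro closed_Collect_conj closed_Collect_eq continuous_intros)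
qed

lemma norm_lattice_vec_ge:
  assumes "k \<noteq> 0"
  shows "1 \<le> norm (lattice_vec k)"
proof -
  have *: "1 \<le> \<bar>2 * pi * real_of_int j\<bar>" if "j \<noteq> 0" for j :: int
  proof -
    have "1 \<le> \<bar>real_of_int j\<bar>" using that by linarith
    then have "2 * pi * 1 \<le> 2 * pi * \<bar>real_of_int j\<bar>" by (intro mult_left_mono) auto
    then have "1 \<le> 2 * pi * \<bar>real_of_int j\<bar>" using pi_gt3 by linarith
    then show ?thesis by (simp add: abs_mult)
  qed
  from assms have "fst k \<noteq> 0 \<or> snd k \<noteq> 0" by (simp add: prod_eq_iff)
  then show ?thesis
    using *[of "fst k"] *[of "snd k"] component_le_norm_cart[of "lattice_vec k" 1] component_le_norm_cart[of "lattice_vec k" 2] by auto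
qed

text \<open>If the translates covered the plane, \<open>Q\<close> and the union of its translates by
  nonzero lattice vectors would be disjoint closed sets covering a connected space. Then
  \<open>Q\<close> would be the whole plane, against compactness. Disjointness is where injectivity
  of the projection enters.\<close>

lemma torus_translates_not_UNIV:
  assumes Q: "compact Q" "Q \<noteq> {}" and inj: "\<And>x y. x \<in> Q \<Longrightarrow> y \<in> Q \<Longrightarrow> torus_eq x y \<Longrightarrow> x = y"
  shows "closed {x. \<exists>y\<in>Q. torus_eq x y}" "{x. \<exists>y\<in>Q. torus_eq x y} \<noteq> UNIV"
proof -
  define L where "L = range lattice_vec - {0}"
  have e: "{x. \<exists>y\<in>Q. torus_eq x y} = (\<Union>x\<in>range lattice_vec. \<Union>y\<in>Q. {x + y})"
    by (auto simp: torus_eq_iff add.commute)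
  show "closed {x. \<exists>y\<in>Q. torus_eq x y}" unfolding e by (rule closed_compact_sums[OF closed_lattice Q(1)])
  \<comment> \<open>Closedness survives the removal of 0 because the lattice is discrete.\<close>
  have "L = range lattice_vec \<inter> {x. 1 \<le> norm x}"
  proof (rule set_eqI, rule iffI)
    fix x assume "x \<in> L"
    then obtain k where k: "x = lattice_vec k" "x \<noteq> 0" by (auto simp: L_def)
    then have "k \<noteq> 0" using lattice_vec_0 by auto
    with k norm_lattice_vec_ge show "x \<in> range lattice_vec \<inter> {x. 1 \<le> norm x}" by auto
  qed (auto simp: L_def)
  then have "closed L" by (simp only:) (intro closed_Int closed_lattice closed_Collect_le continuous_intros)
  then have cl: "closed (\<Union>x\<in>L. \<Union>y\<in>Q. {x + y})" by (rule closed_compact_sums[OF _ Q(1)])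
  show "{x. \<exists>y\<in>Q. torus_eq x y} \<noteq> UNIV"
  proof
    assume U: "{x. \<exists>y\<in>Q. torus_eq x y} = UNIV"
    have disj: "Q \<inter> (\<Union>x\<in>L. \<Union>y\<in>Q. {x + y}) = {}"
    proof (rule ccontr)
      assume "\<not> ?thesis"
      then obtain l y where ly: "l \<in> L" "y \<in> Q" "l + y \<in> Q" by auto
      then have "torus_eq (l + y) y" by (auto simp: torus_eq_iff L_def add.commute)
      from inj[OF ly(3,2) this] ly(1) show False by (simp add: L_def)
    qed
    have sub: "UNIV \<subseteq> Q \<union> (\<Union>x\<in>L. \<Union>y\<in>Q. {x + y})"
    proof
      fix x :: "real^2"
      have "x \<in> {x. \<exists>y\<in>Q. torus_eq x y}" by (simp only: U UNIV_I)
      then obtain y k where "y \<in> Q" "x = y + lattice_vec k" by (auto simp: torus_eq_iff)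
      then show "x \<in> Q \<union> (\<Union>x\<in>L. \<Union>y\<in>Q. {x + y})"
      proof (cases "lattice_vec k = 0")
        case False
        then have "lattice_vec k \<in> L" by (simp add: L_def)
        then have "lattice_vec k + y \<in> (\<Union>x\<in>L. \<Union>y\<in>Q. {x + y})" using \<open>y \<in> Q\<close> by blast
        then show ?thesis by (simp add: \<open>x = y + lattice_vec k\<close> add.commute)
      qed simp
    qed
    have "Q \<inter> UNIV = {} \<or> (\<Union>x\<in>L. \<Union>y\<in>Q. {x + y}) \<inter> UNIV = {}"
      by (rule connected_closedD[OF connected_UNIV _ sub compact_imp_closed[OF Q(1)] cl]) (simp only: disj Int_UNIV_right)
    then have "(\<Union>x\<in>L. \<Union>y\<in>Q. {x + y}) = {}" using Q(2) by blast
    then have "Q = UNIV" using sub by blast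
    then show False using Q(1) not_bounded_UNIV[where 'a="real^2"] compact_imp_bounded by auto
  qed
qed

section \<open>Covering numbers of graphs\<close>

lemma mem_cube_iff:
  fixes c :: "(real^2) \<times> real"
  shows "(x, t) \<in> cbox c (c + \<epsilon> *\<^sub>R One) \<longleftrightarrow>
    fst c $ 1 \<le> x $ 1 \<and> x $ 1 \<le> fst c $ 1 + \<epsilon> \<and> fst c $ 2 \<le> x $ 2 \<and> x $ 2 \<le> fst c $ 2 + \<epsilon> \<and> snd c \<le> t \<and> t \<le> snd c + \<epsilon>"
proof -
  have one: "(One :: (real^2) \<times> real) \<bullet> b = 1" if "b \<in> Basis" for b
    using that by (simp add: inner_sum_left inner_Basis)
  have B: "(Basis :: ((real^2) \<times> real) set) = {(axis 1 1, 0), (axis 2 1, 0), (0, 1)}"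
    by (auto simp: Basis_prod_def Basis_vec_def UNIV_2)
  have "(x, t) \<in> cbox c (c + \<epsilon> *\<^sub>R One) \<longleftrightarrow> (\<forall>b\<in>Basis. c \<bullet> b \<le> (x, t) \<bullet> b \<and> (x, t) \<bullet> b \<le> c \<bullet> b + \<epsilon>)"
    unfolding mem_box inner_add_left inner_scaleR_left using one by auto
  then show ?thesis unfolding B by (cases c) (auto simp: inner_axis)
qed

lemma box_covering_number_le:
  assumes "finite C" "E \<subseteq> (\<Union>c\<in>C. cbox c (c + \<epsilon> *\<^sub>R One))"
  shows "box_covering_number E \<epsilon> \<le> card C"
  unfolding box_covering_number_def by (rule Least_le) (intro exI[of _ C] conjI assms refl)

text \<open>The \<open>LEAST\<close> in the definition is attained only if some finite covering
  exists, which is why one has to be supplied.\<close>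

lemma box_covering_number_witness:
  assumes "finite C" "E \<subseteq> (\<Union>c\<in>C. cbox c (c + \<epsilon> *\<^sub>R One))"
  obtains C' where "finite C'" "card C' = box_covering_number E \<epsilon>" "E \<subseteq> (\<Union>c\<in>C'. cbox c (c + \<epsilon> *\<^sub>R One))"
proof -
  have "\<exists>n C. finite C \<and> card C = n \<and> E \<subseteq> (\<Union>c\<in>C. cbox c (c + \<epsilon> *\<^sub>R One))"
    by (intro exI[of _ "card C"] exI[of _ C] conjI assms refl)
  from LeastI_ex[OF this, folded box_covering_number_def] show thesis
    by (elim exE conjE) (rule that)
qed

lemma grid_point_exists:
  fixes r \<epsilon> L :: real
  assumes "0 < \<epsilon>" "0 \<le> r" "r < L"
  obtains i :: nat where "i < nat \<lceil>L / \<epsilon>\<rceil>" "real i * \<epsilon> \<le> r" "r \<le> real i * \<epsilon> + \<epsilon>"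
proof -
  define i where "i = nat \<lfloor>r / \<epsilon>\<rfloor>"
  have nn: "0 \<le> \<lfloor>r / \<epsilon>\<rfloor>" using assms by simp
  then have ri: "real i = of_int \<lfloor>r / \<epsilon>\<rfloor>" by (simp add: i_def)
  have "real i \<le> r / \<epsilon>" "r / \<epsilon> < real i + 1" unfolding ri by linarith+
  then have *: "real i * \<epsilon> \<le> r" "r < real i * \<epsilon> + \<epsilon>" using assms by (auto simp: field_simps)
  have "r / \<epsilon> < L / \<epsilon>" using assms by (simp add: divide_strict_right_mono)
  then have "\<lfloor>r / \<epsilon>\<rfloor> < \<lceil>L / \<epsilon>\<rceil>" by linarith
  moreover have "0 < L / \<epsilon>" using assms by simp
  ultimately have "i < nat \<lceil>L / \<epsilon>\<rceil>" using nn by (simp add: i_def)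
  with * show thesis by (intro that) auto
qed

text \<open>Over each of about \<open>\<epsilon> powr (- 2)\<close> grid squares the graph
  oscillates by at most \<open>2 * C * \<epsilon> powr \<theta>\<close> and is covered by a column
  of about \<open>\<epsilon> powr (\<theta> - 1)\<close> boxes. Since
  \<open>\<theta> \<le> 1\<close>, rounding up is absorbed in the constant.\<close>

lemma hoelder_graph_cover:
  fixes f :: "real^2 \<Rightarrow> real"
  assumes C: "0 \<le> C" and H: "\<And>x y. \<bar>x $ 1 - y $ 1\<bar> \<le> \<epsilon> \<Longrightarrow> \<bar>x $ 2 - y $ 2\<bar> \<le> \<epsilon> \<Longrightarrow> \<bar>f x - f y\<bar> \<le> C * \<epsilon> powr \<theta>"
    and \<epsilon>: "0 < \<epsilon>" "\<epsilon> \<le> 1" and \<theta>: "\<theta> \<le> 1"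
  obtains B where "finite B" "real (card B) \<le> ((2 * pi + 1)\<^sup>2 * (2 * C + 3)) * \<epsilon> powr (\<theta> - 3)"
    "torus_graph f \<subseteq> (\<Union>c\<in>B. cbox c (c + \<epsilon> *\<^sub>R One))"
proof -
  define m where "m = nat \<lceil>2 * pi / \<epsilon>\<rceil>"
  \<comment> \<open>The added \<open>\<epsilon>\<close> makes the height strictly smaller than the
    column, as \<open>grid_point_exists\<close> demands.\<close>
  define K where "K = nat \<lceil>(2 * C * \<epsilon> powr \<theta> + \<epsilon>) / \<epsilon>\<rceil>"
  define g :: "nat \<Rightarrow> nat \<Rightarrow> real^2" where "g i j = vector [real i * \<epsilon>, real j * \<epsilon>]" for i j
  define b where "b = (\<lambda>(i, j, k::nat). (g i j, f (g i j) - C * \<epsilon> powr \<theta> + real k * \<epsilon>))"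
  define B where "B = b ` ({..<m} \<times> {..<m} \<times> {..<K})"
  have pw: "\<epsilon> powr \<theta> / \<epsilon> = \<epsilon> powr (\<theta> - 1)" using \<epsilon> by (simp add: powr_diff)
  have pw1: "1 \<le> \<epsilon> powr (\<theta> - 1)" using \<epsilon> \<theta> powr_mono'[of "\<theta> - 1" 0 \<epsilon>] by simp
  have "card B \<le> m * (m * K)" unfolding B_def
    by (rule order_trans[OF card_image_le]) (auto simp: card_cartesian_product)
  then have "real (card B) \<le> real m * (real m * real K)"
    by (metis of_nat_le_iff of_nat_mult)
  also have "\<dots> \<le> ((2 * pi + 1) / \<epsilon>) * (((2 * pi + 1) / \<epsilon>) * ((2 * C + 3) * \<epsilon> powr (\<theta> - 1)))"
  proof -
    have "real m \<le> 2 * pi / \<epsilon> + 1" unfolding m_def using \<epsilon> pi_gt_zero by (simp add: of_nat_nat)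
    also have "\<dots> \<le> (2 * pi + 1) / \<epsilon>" using \<epsilon> by (simp add: field_simps)
    finally have m: "real m \<le> (2 * pi + 1) / \<epsilon>" .
    have "0 \<le> (2 * C * \<epsilon> powr \<theta> + \<epsilon>) / \<epsilon>" using C \<epsilon> by simp
    then have "real K \<le> (2 * C * \<epsilon> powr \<theta> + \<epsilon>) / \<epsilon> + 1" unfolding K_def by linarith
    also have "\<dots> = 2 * C * \<epsilon> powr (\<theta> - 1) + 2" using \<epsilon> by (simp add: add_divide_distrib pw[symmetric])
    also have "\<dots> \<le> (2 * C + 3) * \<epsilon> powr (\<theta> - 1)" using pw1 by (simp add: algebra_simps)
    finally have "real K \<le> (2 * C + 3) * \<epsilon> powr (\<theta> - 1)" .
    with m show ?thesis by (intro mult_mono mult_nonneg_nonneg) (use C \<epsilon> in auto)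
  qed
  also have "\<dots> = ((2 * pi + 1)\<^sup>2 * (2 * C + 3)) * \<epsilon> powr (\<theta> - 3)"
  proof -
    have "\<epsilon> powr (\<theta> - 3) = \<epsilon> powr (\<theta> - 1) / (\<epsilon> * \<epsilon>)"
      using powr_diff[of \<epsilon> "\<theta> - 1" 2] \<epsilon> by (simp add: power2_eq_square)
    then show ?thesis by (simp add: power2_eq_square)
  qed
  finally have card: "real (card B) \<le> ((2 * pi + 1)\<^sup>2 * (2 * C + 3)) * \<epsilon> powr (\<theta> - 3)" .
  have cover: "torus_graph f \<subseteq> (\<Union>c\<in>B. cbox c (c + \<epsilon> *\<^sub>R One))"
  proof
    fix p assume "p \<in> torus_graph f"
    then obtain x where p: "p = (x, f x)" and x: "x \<in> torus_cell" by (auto simp: torus_graph_def)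
    obtain i where i: "i < m" "real i * \<epsilon> \<le> x $ 1" "x $ 1 \<le> real i * \<epsilon> + \<epsilon>"
      using grid_point_exists[of \<epsilon> "x $ 1" "2 * pi"] x \<epsilon> unfolding torus_cell_iff m_def by metis
    obtain j where j: "j < m" "real j * \<epsilon> \<le> x $ 2" "x $ 2 \<le> real j * \<epsilon> + \<epsilon>"
      using grid_point_exists[of \<epsilon> "x $ 2" "2 * pi"] x \<epsilon> unfolding torus_cell_iff m_def by metis
    have "\<bar>f x - f (g i j)\<bar> \<le> C * \<epsilon> powr \<theta>"
      by (rule H) (use i j in \<open>auto simp: g_def abs_le_iff\<close>)
    then have "0 \<le> f x - f (g i j) + C * \<epsilon> powr \<theta>" "f x - f (g i j) + C * \<epsilon> powr \<theta> < 2 * C * \<epsilon> powr \<theta> + \<epsilon>"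
      using \<epsilon> by linarith+
    from grid_point_exists[OF \<epsilon>(1) this] obtain k where k: "k < K" "real k * \<epsilon> \<le> f x - f (g i j) + C * \<epsilon> powr \<theta>"
       "f x - f (g i j) + C * \<epsilon> powr \<theta> \<le> real k * \<epsilon> + \<epsilon>" unfolding K_def by metis
    have "b (i, j, k) \<in> B" using i(1) j(1) k(1) by (auto simp: B_def)
    moreover have "p \<in> cbox (b (i, j, k)) (b (i, j, k) + \<epsilon> *\<^sub>R One)"
      unfolding p mem_cube_iff using i j k by (simp add: b_def g_def)
    ultimately show "p \<in> (\<Union>c\<in>B. cbox c (c + \<epsilon> *\<^sub>R One))" by blast
  qed
  show thesis by (rule that[OF _ card cover]) (simp add: B_def)
qed

lemma fractal_dim_le:
  fixes E :: "'a::euclidean_space set"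
  assumes N: "\<And>\<epsilon>. 0 < \<epsilon> \<Longrightarrow> \<epsilon> \<le> 1 \<Longrightarrow> real (box_covering_number E \<epsilon>) \<le> A * \<epsilon> powr (- D)" and A: "1 \<le> A" and D: "0 \<le> D"
  shows "fractal_dim E \<le> ereal D"
proof -
  have "fractal_dim E \<le> Limsup (at_right 0) (\<lambda>\<epsilon>. ereal (ln A / ln (1 / \<epsilon>) + D))"
    unfolding fractal_dim_def
  proof (rule Limsup_mono)
    have "eventually (\<lambda>\<epsilon>::real. 0 < \<epsilon> \<and> \<epsilon> < 1) (at_right 0)"
      using eventually_at_right_real[OF zero_less_one] by eventually_elim auto
    then show "eventually (\<lambda>\<epsilon>. ereal (ln (real (box_covering_number E \<epsilon>)) / ln (1 / \<epsilon>)) \<le> ereal (ln A / ln (1 / \<epsilon>) + D)) (at_right 0)"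
    proof eventually_elim
      case (elim \<epsilon>)
      then have \<epsilon>: "0 < \<epsilon>" "\<epsilon> < 1" by auto
      have l: "0 < ln (1 / \<epsilon>)" using \<epsilon> by (simp add: ln_div)
      have "ln (real (box_covering_number E \<epsilon>)) \<le> ln A + D * ln (1 / \<epsilon>)"
      proof (cases "box_covering_number E \<epsilon> = 0")
        case True
        then show ?thesis using l A D by simp
      next
        case False
        then have "ln (real (box_covering_number E \<epsilon>)) \<le> ln (A * \<epsilon> powr (- D))"
          using N[of \<epsilon>] \<epsilon> by (subst ln_le_cancel_iff) (use A in auto)
        also have "\<dots> = ln A + D * ln (1 / \<epsilon>)"
          using A \<epsilon> by (simp add: ln_mult ln_powr ln_div)
        finally show ?thesis .
      qed
      then have "ln (real (box_covering_number E \<epsilon>)) / ln (1 / \<epsilon>) \<le> (ln A + D * ln (1 / \<epsilon>)) / ln (1 / \<epsilon>)"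
        using l by (intro divide_right_mono) auto
      also have "\<dots> = ln A / ln (1 / \<epsilon>) + D" using l by (simp add: add_divide_distrib)
      finally show ?case by simp
    qed
  qed
  also have "Limsup (at_right 0) (\<lambda>\<epsilon>. ereal (ln A / ln (1 / \<epsilon>) + D)) = ereal D"
  proof (rule lim_imp_Limsup)
    have "((\<lambda>\<epsilon>::real. ln A / ln (1 / \<epsilon>) + D) \<longlongrightarrow> D) (at_right 0)" by real_asymp
    then show "((\<lambda>\<epsilon>. ereal (ln A / ln (1 / \<epsilon>) + D)) \<longlongrightarrow> ereal D) (at_right 0)" by simp
  qed simp
  finally show ?thesis .
qed

text \<open>A lower bound along one sequence of scales suffices for an upper limit. Which of the two
  sets has the larger covering number may change with the scale, so the contradiction bounds both of
  them at once.\<close>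

lemma max_fractal_dim_ge:
  fixes E F :: "'a::euclidean_space set" and e :: "nat \<Rightarrow> real"
  assumes e: "e \<longlonglongrightarrow> 0" "\<And>m. 0 < e m" and A: "0 < A"
    and N: "\<And>m. A * e m powr (- D) \<le> real (max (box_covering_number E (e m)) (box_covering_number F (e m)))"
  shows "ereal D \<le> max (fractal_dim E) (fractal_dim F)"
proof (rule ccontr)
  assume "\<not> ?thesis"
  then have "max (fractal_dim E) (fractal_dim F) < ereal D" by (simp only: not_le)
  then obtain D' where D': "max (fractal_dim E) (fractal_dim F) < ereal D'" "ereal D' < ereal D"
    using ereal_dense2 by blast
  have ev: "eventually (\<lambda>\<epsilon>. ln (real (box_covering_number G \<epsilon>)) / ln (1 / \<epsilon>) < D') (at_right 0)" if "fractal_dim G < ereal D'" for G :: "'a set"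
    using Limsup_lessD[OF that[unfolded fractal_dim_def]] by simp
  have small: "eventually (\<lambda>\<epsilon>::real. 0 < \<epsilon> \<and> \<epsilon> < 1) (at_right 0)"
    using eventually_at_right_real[OF zero_less_one] by eventually_elim auto
  \<comment> \<open>The strict gap between \<open>D'\<close> and \<open>D\<close> absorbs the
    constant \<open>A\<close> at small scales.\<close>
  have gap: "eventually (\<lambda>\<epsilon>::real. \<epsilon> powr (- D') < A * \<epsilon> powr (- D)) (at_right 0)"
  proof -
    have "filterlim (\<lambda>\<epsilon>::real. A * \<epsilon> powr (D' - D)) at_top (at_right 0)" using A D'(2) by real_asymp
    then have "eventually (\<lambda>\<epsilon>::real. 1 < A * \<epsilon> powr (D' - D)) (at_right 0)"
      by (simp add: filterlim_at_top_dense)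
    then show ?thesis using small
    proof eventually_elim
      case (elim \<epsilon>)
      have "\<epsilon> powr (- D) = \<epsilon> powr (D' - D) * \<epsilon> powr (- D')" using elim by (simp add: powr_add[symmetric])
      then show ?case using mult_strict_right_mono[OF elim(1), of "\<epsilon> powr (- D')"] elim by simp
    qed
  qed
  have ER: "fractal_dim E < ereal D'" "fractal_dim F < ereal D'" using D'(1) by auto
  have "eventually (\<lambda>\<epsilon>. real (max (box_covering_number E \<epsilon>) (box_covering_number F \<epsilon>)) < A * \<epsilon> powr (- D)) (at_right 0)"
    using ev[OF ER(1)] ev[OF ER(2)] small gap
  proof eventually_elim
    case (elim \<epsilon>)
    have *: "real n < A * \<epsilon> powr (- D)" if "ln (real n) / ln (1 / \<epsilon>) < D'" for n :: nat
    proof (cases "n = 0")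
      case False
      have l: "0 < ln (1 / \<epsilon>)" using elim by (simp add: ln_div)
      have "ln (real n) < D' * ln (1 / \<epsilon>)" using that l by (simp add: field_simps)
      also have "\<dots> = ln (\<epsilon> powr (- D'))" using elim by (simp add: ln_powr ln_div)
      finally have "real n < \<epsilon> powr (- D')" using False elim by (subst (asm) ln_less_cancel_iff) auto
      with elim show ?thesis by simp
    qed (use A elim in auto)
    from *[OF elim(1)] *[OF elim(2)] show ?case by (simp add: max_def)
  qed
  moreover have "filterlim e (at_right 0) sequentially"
  proof -
    have "e m \<noteq> 0" for m using e(2)[of m] by simp
    then show ?thesis using e by (simp add: filterlim_at)
  qed
  ultimately have "eventually (\<lambda>m. real (max (box_covering_number E (e m)) (box_covering_number F (e m))) < A * e m powr (- D)) sequentially"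
    by (rule eventually_compose_filterlim)
  then obtain m where "real (max (box_covering_number E (e m)) (box_covering_number F (e m))) < A * e m powr (- D)"
    using eventually_happens' sequentially_bot by blast
  with N[of m] show False by simp
qed

text \<open>By the intermediate value theorem the interval between \<open>f x\<close> and
  \<open>f (x + h)\<close> is covered by the vertical sides of the boxes met by the graph over the
  segment from \<open>x\<close> to \<open>x + h\<close>. Hence the increment is at most
  \<open>\<epsilon>\<close> times the number of boxes based near \<open>x\<close>. Integrating in
  \<open>x\<close>, each box is counted on an area of at most \<open>9 * \<epsilon>^2\<close>; with
  nine lattice translates the constant is 81.\<close>

lemma oscillation_le_covering:
  fixes f :: "real^2 \<Rightarrow> real"
  assumes per: "\<And>x k. f (x + lattice_vec k) = f x" and cont: "continuous_on UNIV f"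
    and h: "\<bar>h $ 1\<bar> \<le> \<epsilon>" "\<bar>h $ 2\<bar> \<le> \<epsilon>" and \<epsilon>: "0 < \<epsilon>" "\<epsilon> \<le> 1"
    and C: "finite C" "torus_graph f \<subseteq> (\<Union>c\<in>C. cbox c (c + \<epsilon> *\<^sub>R One))"
  shows "(LINT x|torus_measure. \<bar>f (x + h) - f x\<bar>) \<le> 81 * \<epsilon> ^ 3 * real (card C)"
proof -
  \<comment> \<open>The segment may leave the cell by at most 1, so the covering is repeated over
    the neighbouring cells.\<close>
  define I where "I = C \<times> grid 1"
  define w :: "((real^2) \<times> real) \<times> (int \<times> int) \<Rightarrow> real^2" where "w i = fst (fst i) + lattice_vec (snd i)" for i
  define u :: "((real^2) \<times> real) \<times> (int \<times> int) \<Rightarrow> real" where "u i = snd (fst i)" for i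
  \<comment> \<open>The base of the box enlarged by \<open>\<epsilon>\<close> on every side: all
    \<open>x\<close> from which a step of size at most \<open>\<epsilon>\<close> can reach
    it.\<close>
  define B where "B i = cbox (w i - (\<chi> j. \<epsilon>)) (w i + (\<chi> j. 2 * \<epsilon>))" for i
  have finI: "finite I" using C by (simp add: I_def)
  have cover: "\<exists>i\<in>I. w i $ 1 \<le> y $ 1 \<and> y $ 1 \<le> w i $ 1 + \<epsilon> \<and> w i $ 2 \<le> y $ 2 \<and> y $ 2 \<le> w i $ 2 + \<epsilon> \<and> u i \<le> f y \<and> f y \<le> u i + \<epsilon>"
    if y: "- 1 \<le> y $ 1" "y $ 1 \<le> 2 * pi + 1" "- 1 \<le> y $ 2" "y $ 2 \<le> 2 * pi + 1" for y
  proof -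
    have ex: "\<exists>k::int. \<bar>real_of_int k\<bar> \<le> 1 \<and> 0 \<le> r - 2 * pi * of_int k \<and> r - 2 * pi * of_int k < 2 * pi"
      if "-1 \<le> r" "r \<le> 2 * pi + 1" for r :: real
    proof -
      consider "r < 0" | "0 \<le> r" "r < 2 * pi" | "2 * pi \<le> r" by linarith
      then show ?thesis
      proof cases
        case 1 then show ?thesis by (intro exI[of _ "-1"]) (use that pi_gt3 in auto)
      next
        case 2 then show ?thesis by (intro exI[of _ "0"]) (use that pi_gt3 in auto)
      next
        case 3 then show ?thesis by (intro exI[of _ "1"]) (use that pi_gt3 in auto)
      qed
    qed
    obtain k1 where k1: "\<bar>real_of_int k1\<bar> \<le> 1" "0 \<le> y $ 1 - 2 * pi * of_int k1" "y $ 1 - 2 * pi * of_int k1 < 2 * pi"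
      using ex[OF y(1,2)] by blast
    obtain k2 where k2: "\<bar>real_of_int k2\<bar> \<le> 1" "0 \<le> y $ 2 - 2 * pi * of_int k2" "y $ 2 - 2 * pi * of_int k2 < 2 * pi"
      using ex[OF y(3,4)] by blast
    define k where "k = (k1, k2)"
    have k: "k \<in> grid 1" using k1(1) k2(1) by (simp add: grid_iff k_def)
    have "y - lattice_vec k \<in> torus_cell" using k1 k2 by (simp add: torus_cell_iff k_def)
    then have "(y - lattice_vec k, f (y - lattice_vec k)) \<in> torus_graph f" by (auto simp: torus_graph_def)
    moreover have "f (y - lattice_vec k) = f y" using per[of "y - lattice_vec k" k] by simp
    ultimately obtain c where c: "c \<in> C" "(y - lattice_vec k, f y) \<in> cbox c (c + \<epsilon> *\<^sub>R One)" using C(2) by auto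
    then show ?thesis
      unfolding mem_cube_iff using k by (intro bexI[of _ "(c, k)"]) (auto simp: I_def w_def u_def)
  qed
  have bound: "\<bar>f (x + h) - f x\<bar> \<le> (\<Sum>i\<in>I. \<epsilon> * indicator (B i) x)" if x: "x \<in> torus_cell" for x
  proof -
    define J where "J = {i\<in>I. x \<in> B i}"
    have finJ: "finite J" using finI by (simp add: J_def)
    have "f ` closed_segment x (x + h) \<subseteq> (\<Union>i\<in>J. {u i..u i + \<epsilon>})"
    proof
      fix t assume "t \<in> f ` closed_segment x (x + h)"
      then obtain y where y: "y \<in> closed_segment x (x + h)" "t = f y" by auto
      then obtain s where s: "0 \<le> s" "s \<le> 1" "y = (1 - s) *\<^sub>R x + s *\<^sub>R (x + h)" by (auto simp: in_segment)
      then have yx: "y $ 1 = x $ 1 + s * h $ 1" "y $ 2 = x $ 2 + s * h $ 2" by (auto simp: algebra_simps)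
      have sh: "\<bar>s * h $ 1\<bar> \<le> \<epsilon>" "\<bar>s * h $ 2\<bar> \<le> \<epsilon>"
        using mult_mono[of "\<bar>s\<bar>" 1 "\<bar>h $ 1\<bar>" \<epsilon>] mult_mono[of "\<bar>s\<bar>" 1 "\<bar>h $ 2\<bar>" \<epsilon>] s h \<epsilon> by (auto simp: abs_mult)
      have "\<exists>i\<in>I. w i $ 1 \<le> y $ 1 \<and> y $ 1 \<le> w i $ 1 + \<epsilon> \<and> w i $ 2 \<le> y $ 2 \<and> y $ 2 \<le> w i $ 2 + \<epsilon> \<and> u i \<le> f y \<and> f y \<le> u i + \<epsilon>"
        by (rule cover; use x sh \<epsilon> yx in \<open>simp add: torus_cell_iff\<close>; linarith)
      then obtain i where i: "i \<in> I" "w i $ 1 \<le> y $ 1" "y $ 1 \<le> w i $ 1 + \<epsilon>" "w i $ 2 \<le> y $ 2" "y $ 2 \<le> w i $ 2 + \<epsilon>" "u i \<le> f y" "f y \<le> u i + \<epsilon>" by blast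
      have "w i $ 1 - \<epsilon> \<le> x $ 1 \<and> x $ 1 \<le> w i $ 1 + 2 * \<epsilon> \<and> w i $ 2 - \<epsilon> \<le> x $ 2 \<and> x $ 2 \<le> w i $ 2 + 2 * \<epsilon>"
        using i sh yx by linarith
      then have "x \<in> B i" by (auto simp: B_def mem_box_cart forall_2)
      then have "i \<in> J" using i(1) by (simp add: J_def)
      then show "t \<in> (\<Union>i\<in>J. {u i..u i + \<epsilon>})" by (rule UN_I) (use i y(2) in simp)
    qed
    moreover have "closed_segment (f x) (f (x + h)) \<subseteq> f ` closed_segment x (x + h)"
    proof -
      have "connected (f ` closed_segment x (x + h))"
        by (intro connected_continuous_image continuous_on_subset[OF cont]) auto
      then have "convex (f ` closed_segment x (x + h))" by (simp add: is_interval_convex_1[symmetric] is_interval_connected_1)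
      then show ?thesis by (intro closed_segment_subset) auto
    qed
    ultimately have "closed_segment (f x) (f (x + h)) \<subseteq> (\<Union>i\<in>J. {u i..u i + \<epsilon>})" by blast
    then have "measure lborel (closed_segment (f x) (f (x + h))) \<le> measure lborel (\<Union>i\<in>J. {u i..u i + \<epsilon>})"
    proof (rule measure_mono_fmeasurable)
      have "{u i..u i + \<epsilon>} \<in> fmeasurable lborel" for i
        by (rule fmeasurableI) (auto simp: emeasure_lborel_Icc_eq)
      then show "(\<Union>i\<in>J. {u i..u i + \<epsilon>}) \<in> fmeasurable lborel"
        by (intro fmeasurable.finite_UN finJ) auto
    qed (auto simp: closed_segment_eq_real_ivl)
    also have "\<dots> \<le> (\<Sum>i\<in>J. measure lborel {u i..u i + \<epsilon>})"
      by (rule measure_UNION_le) (use finJ in auto)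
    also have "\<dots> = (\<Sum>i\<in>J. \<epsilon>)" using \<epsilon> by simp
    also have "\<dots> = (\<Sum>i\<in>I. \<epsilon> * indicator (B i) x)"
    proof -
      have "(\<Sum>i\<in>I. \<epsilon> * indicator (B i) x) = (\<Sum>i\<in>I. if x \<in> B i then \<epsilon> else 0)"
        by (rule sum.cong) (auto simp: indicator_def)
      then show ?thesis unfolding J_def by (simp only: sum.inter_filter[OF finI])
    qed
    also have "measure lborel (closed_segment (f x) (f (x + h))) = \<bar>f (x + h) - f x\<bar>"
      by (auto simp: closed_segment_eq_real_ivl)
    finally show ?thesis .
  qed
  have Bm [measurable]: "B i \<in> sets borel" for i by (simp add: B_def)
  have mB: "measure lborel (B i) = 9 * \<epsilon>\<^sup>2" for i
    unfolding B_def using \<epsilon>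
    by (subst content_cbox_cart) (auto simp: interval_ne_empty_cart UNIV_2 power2_eq_square)
  have intB: "integrable torus_measure (\<lambda>x. \<epsilon> * indicator (B i) x :: real)" for i
    by (rule integrable_torus_bounded[where B=\<epsilon>]) (use \<epsilon> in \<open>auto simp: indicator_def\<close>)
  have LB: "(LINT x|torus_measure. indicator (B i) x) \<le> 9 * \<epsilon>\<^sup>2" for i
  proof -
    have "(LINT x|torus_measure. indicator (B i) x :: real) = (LINT x|lborel. indicator (torus_cell \<inter> B i) x)"
      unfolding integral_torus by (intro Bochner_Integration.integral_cong refl) (auto simp: indicator_def)
    also have "\<dots> = measure lborel (torus_cell \<inter> B i)" by simp
    also have "\<dots> \<le> measure lborel (B i)" by (rule measure_mono_fmeasurable) (auto simp: B_def)
    finally show ?thesis by (simp add: mB)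
  qed
  have "(LINT x|torus_measure. \<bar>f (x + h) - f x\<bar>) \<le> (LINT x|torus_measure. (\<Sum>i\<in>I. \<epsilon> * indicator (B i) x))"
  proof (rule integral_mono')
    show "integrable torus_measure (\<lambda>x. \<Sum>i\<in>I. \<epsilon> * indicator (B i) x)"
      by (rule Bochner_Integration.integrable_sum) (rule intB)
  qed (use bound \<epsilon> in \<open>auto intro!: sum_nonneg\<close>)
  also have "\<dots> = (\<Sum>i\<in>I. \<epsilon> * (LINT x|torus_measure. indicator (B i) x))"
    by (subst Bochner_Integration.integral_sum[OF intB]) simp
  also have "\<dots> \<le> (\<Sum>i\<in>I. \<epsilon> * (9 * \<epsilon>\<^sup>2))"
    by (intro sum_mono mult_left_mono LB) (use \<epsilon> in auto)
  also have "\<dots> = 81 * \<epsilon> ^ 3 * real (card C)"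
    using C by (simp add: I_def card_cartesian_product grid_def power3_eq_cube power2_eq_square)
  finally show ?thesis .
qed

section \<open>Almost every time\<close>

lemma lattice_vec_inj: "lattice_vec k = lattice_vec k' \<longleftrightarrow> k = k'"
  by (auto simp: vec2_eq_iff prod_eq_iff)

text \<open>Unfolding replaces the torus integral by one over the plane; injectivity of the
  projection on \<open>Q\<close> ensures that the periodised indicator takes only the values 0 and
  1.\<close>

lemma polygon_fcoef:
  assumes Q: "compact Q" and inj: "\<And>x y. x \<in> Q \<Longrightarrow> y \<in> Q \<Longrightarrow> torus_eq x y \<Longrightarrow> x = y"
  shows "fcoef (indicator {x. \<exists>y\<in>Q. torus_eq x y}) n = (LINT y|lborel. indicator Q y * cnj (tchar n y)) / (4 * pi\<^sup>2)"
proof -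
  let ?P = "{x. \<exists>y\<in>Q. torus_eq x y}"
  let ?G = "\<lambda>y. indicator Q y * cnj (tchar n y)"
  obtain R where R: "\<And>y. y \<in> Q \<Longrightarrow> norm y \<le> R" using Q compact_imp_bounded bounded_iff by metis
  have R': "\<bar>y $ 1\<bar> \<le> R \<and> \<bar>y $ 2\<bar> \<le> R" if "y \<in> Q" for y
    using R[OF that] component_le_norm_cart[of y 1] component_le_norm_cart[of y 2] by linarith
  obtain M :: nat where "(R + 2 * pi) / (2 * pi) \<le> real M" using real_arch_simple by blast
  then have M: "R + 2 * pi \<le> 2 * pi * real M" by (simp add: field_simps)
  have int: "integrable lborel ?G"
    by (intro integrable_bounded_indicator_tchar borel_closed compact_imp_closed compact_imp_bounded Q)
  have "(LINT y|lborel. ?G y) = (LINT x|torus_measure. (\<Sum>k\<in>grid M. ?G (x + lattice_vec k)))"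
    by (rule integral_unfold[OF int _ M]) (use R' in \<open>auto simp: indicator_def split: if_splits\<close>)
  also have "\<dots> = (LINT x|torus_measure. indicator ?P x * cnj (tchar n x))"
  proof (rule Bochner_Integration.integral_cong[OF refl])
    fix x :: "real^2" assume "x \<in> space torus_measure"
    then have x: "x \<in> torus_cell" by simp
    have "(\<Sum>k\<in>grid M. (indicator Q (x + lattice_vec k) :: complex)) = indicator ?P x"
    proof (cases "x \<in> ?P")
      case True
      then obtain y j where y: "y \<in> Q" "x = y + lattice_vec j" by (auto simp: torus_eq_iff)
      define k where "k = - j"
      have xk: "x + lattice_vec k = y" by (simp add: y k_def lattice_vec_uminus)
      have "y - lattice_vec k \<in> torus_cell" using x xk by (metis add_diff_cancel_right')
      then have kM: "k \<in> grid M"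
        using cell_index_bound[of "y $ 1" R "fst k" M] cell_index_bound[of "y $ 2" R "snd k" M] R'[OF y(1)] M
        by (simp add: torus_cell_iff grid_iff)
      have eq: "(indicator Q (x + lattice_vec k') :: complex) = (if k' = k then 1 else 0)" for k'
      proof (cases "k' = k")
        case True
        then show ?thesis using xk y(1) by simp
      next
        case False
        have "x + lattice_vec k' \<notin> Q"
        proof
          assume q: "x + lattice_vec k' \<in> Q"
          have "x + lattice_vec k' = y + lattice_vec (k' - k)" using xk by (simp add: vec2_eq_iff algebra_simps)
          then have "torus_eq (x + lattice_vec k') y" unfolding torus_eq_iff by blast
          from inj[OF q y(1) this] have "lattice_vec k' = lattice_vec k" using xk by (metis add_left_cancel)
          with False show False by (simp add: lattice_vec_inj)
        qed
        with False show ?thesis by simp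
      qed
      show ?thesis unfolding eq using kM True by (simp only: sum.delta finite_grid if_True indicator_simps)
    next
      case False
      have "x + lattice_vec k \<notin> Q" for k
      proof
        assume q: "x + lattice_vec k \<in> Q"
        have "x = (x + lattice_vec k) + lattice_vec (- k)" by (simp add: lattice_vec_uminus)
        then have "torus_eq x (x + lattice_vec k)" unfolding torus_eq_iff by blast
        with q False show False by blast
      qed
      then show ?thesis using False by simp
    qed
    then have "indicator ?P x * cnj (tchar n x) = (\<Sum>k\<in>grid M. (indicator Q (x + lattice_vec k) :: complex)) * cnj (tchar n x)" by simp
    also have "\<dots> = (\<Sum>k\<in>grid M. ?G (x + lattice_vec k))"
      by (simp add: sum_distrib_right tchar_add)
    finally show "(\<Sum>k\<in>grid M. ?G (x + lattice_vec k)) = indicator ?P x * cnj (tchar n x)" ..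
  qed
  finally show ?thesis by (simp add: fcoef_def)
qed

text \<open>The Fourier transform turns the translation by \<open>h\<close> into a factor, so the
  transform of the polygon times \<open>cnj (tchar n h) - 1\<close> is a combination of strip
  transforms, which are known explicitly.\<close>

lemma translation_difference_transform:
  assumes Q: "compact Q" and S: "\<And>e. closed (S e)" "\<And>e. bounded (S e)"
    and ae: "AE x in lborel. (indicator Q (x - h) - indicator Q x :: complex) = (\<Sum>e<m. \<sigma> e * indicator (S e) x)"
  shows "(cnj (tchar n h) - 1) * (LINT y|lborel. indicator Q y * cnj (tchar n y))
    = (\<Sum>e<(m::nat). \<sigma> e * (LINT x|lborel. indicator (S e) x * cnj (tchar n x)))"
proof -
  have Qm [measurable]: "Q \<in> sets borel" using Q compact_imp_closed borel_closed by blast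
  have Sm [measurable]: "S e \<in> sets borel" for e using S borel_closed by blast
  have int: "integrable lborel (\<lambda>x. indicator Q x * cnj (tchar n x))"
    by (intro integrable_bounded_indicator_tchar Qm compact_imp_bounded Q)
  let ?f = "\<lambda>x. indicator Q (x - h) * cnj (tchar n x)"
  have eqf: "?f (x + h) = cnj (tchar n h) * (indicator Q x * cnj (tchar n x))" for x by (simp add: tchar_add)
  have fm: "?f \<in> borel_measurable borel" unfolding tchar_cnj by measurable
  have "integrable (distr lborel borel ((+) h)) ?f"
  proof (subst integrable_distr_eq)
    have "integrable lborel (\<lambda>x. ?f (x + h))" unfolding eqf by (intro integrable_mult_right int)
    then show "integrable lborel (\<lambda>x. ?f (h + x))" by (simp add: add.commute)
  qed (use fm in auto)
  then have intf: "integrable lborel ?f" by (simp add: lborel_distr_plus)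
  have "(LINT x|lborel. ?f x) = cnj (tchar n h) * (LINT x|lborel. indicator Q x * cnj (tchar n x))"
    using lborel_integral_translate[OF fm, of h] unfolding eqf by (simp only: integral_mult_right_zero)
  then have "(cnj (tchar n h) - 1) * (LINT y|lborel. indicator Q y * cnj (tchar n y)) = (LINT x|lborel. ?f x) - (LINT x|lborel. indicator Q x * cnj (tchar n x))"
    by (simp add: algebra_simps)
  also have "\<dots> = (LINT x|lborel. ?f x - indicator Q x * cnj (tchar n x))"
    by (rule Bochner_Integration.integral_diff[OF intf int, symmetric])
  also have "\<dots> = (LINT x|lborel. (\<Sum>e<m. \<sigma> e * (indicator (S e) x * cnj (tchar n x))))"
  proof (rule Bochner_Integration.integral_cong_AE)
    show "AE x in lborel. ?f x - indicator Q x * cnj (tchar n x) = (\<Sum>e<m. \<sigma> e * (indicator (S e) x * cnj (tchar n x)))"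
      using ae
    proof eventually_elim
      case (elim x)
      have "?f x - indicator Q x * cnj (tchar n x) = (indicator Q (x - h) - indicator Q x) * cnj (tchar n x)" by (simp add: algebra_simps)
      then show ?case unfolding elim sum_distrib_right by (simp only: mult.assoc)
    qed
  qed (use intf int in \<open>auto simp: tchar_cnj intro!: borel_measurable_sum\<close>)
  also have "\<dots> = (\<Sum>e<m. \<sigma> e * (LINT x|lborel. indicator (S e) x * cnj (tchar n x)))"
    by (subst Bochner_Integration.integral_sum)
       (intro integrable_mult_right integrable_bounded_indicator_tchar Sm S, simp only: integral_mult_right_zero)
  finally show ?thesis .
qed

text \<open>The evolution commutes with translations, so an increment of a Fejer mean of
  \<open>u\<close> is a combination of evolved strips, evaluated at \<open>x + h\<close>.
  Cauchy-Schwarz over the \<open>m\<close> edges allows squares to be summed.\<close>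

lemma fejm_difference_le:
  fixes \<alpha> :: "nat \<Rightarrow> int \<times> int \<Rightarrow> complex"
  assumes coef: "\<And>n. fcoef f n = cis (- phase t n) * \<gamma> n"
    and rel: "\<And>n. (cnj (tchar n h) - 1) * \<gamma> n = (\<Sum>e<m. \<sigma> e * \<alpha> e n) / (4 * pi\<^sup>2)"
    and Z: "\<And>e x y. (norm (\<Sum>n\<in>grid N. fej2 N n * \<alpha> e n * cis (- phase t n) * cis (of_int (fst n) * x + of_int (snd n) * y)))\<^sup>2 \<le> Z e"
  shows "(norm (fejm N f (x + h) - fejm N f x))\<^sup>2 \<le> real m * (\<Sum>e<m. (norm (\<sigma> e))\<^sup>2 * Z e)"
proof -
  define y where "y = x + h"
  let ?W = "\<lambda>e. \<Sum>n\<in>grid N. fej2 N n * \<alpha> e n * cis (- phase t n) * cis (of_int (fst n) * y $ 1 + of_int (snd n) * y $ 2)"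
  have "fejm N f x - fejm N f (x + h) = (\<Sum>n\<in>grid N. fej2 N n * (cis (- phase t n) * \<gamma> n) * (cnj (tchar n h) - 1) * tchar n y)"
  proof -
    have "tchar n x = tchar n y * cnj (tchar n h)" for n using tchar_diff[of n y h] by (simp add: y_def)
    then show ?thesis
      unfolding fejm_def coef y_def[symmetric] sum_subtractf[symmetric] by (intro sum.cong refl) (simp add: algebra_simps)
  qed
  also have "\<dots> = (\<Sum>n\<in>grid N. \<Sum>e<m. (\<sigma> e / (4 * pi\<^sup>2)) * (fej2 N n * \<alpha> e n * cis (- phase t n) * tchar n y))"
  proof (intro sum.cong refl)
    fix n
    have "fej2 N n * (cis (- phase t n) * \<gamma> n) * (cnj (tchar n h) - 1) * tchar n y
       = fej2 N n * cis (- phase t n) * tchar n y * ((cnj (tchar n h) - 1) * \<gamma> n)" by (simp only: mult_ac)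
    also have "\<dots> = (\<Sum>e<m. fej2 N n * cis (- phase t n) * tchar n y * (\<sigma> e * \<alpha> e n / (4 * pi\<^sup>2)))"
      unfolding rel sum_divide_distrib by (simp only: sum_distrib_left)
    also have "\<dots> = (\<Sum>e<m. (\<sigma> e / (4 * pi\<^sup>2)) * (fej2 N n * \<alpha> e n * cis (- phase t n) * tchar n y))"
      by (intro sum.cong refl) simp
    finally show "fej2 N n * (cis (- phase t n) * \<gamma> n) * (cnj (tchar n h) - 1) * tchar n y
      = (\<Sum>e<m. (\<sigma> e / (4 * pi\<^sup>2)) * (fej2 N n * \<alpha> e n * cis (- phase t n) * tchar n y))" .
  qed
  also have "\<dots> = (\<Sum>e<m. (\<sigma> e / (4 * pi\<^sup>2)) * ?W e)"
    unfolding tchar_def by (subst sum.swap) (simp only: sum_distrib_left)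
  finally have "norm (fejm N f (x + h) - fejm N f x) = norm (\<Sum>e<m. (\<sigma> e / (4 * pi\<^sup>2)) * ?W e)"
    by (metis norm_minus_commute)
  also have "\<dots> \<le> (\<Sum>e<m. norm (\<sigma> e) * norm (?W e))"
  proof (rule order_trans[OF norm_sum], rule sum_mono)
    fix e
    \<comment> \<open>The normalising factor \<open>1 / (4 * pi^2)\<close> is simply bounded by
      1.\<close>
    have "1 \<le> 4 * pi\<^sup>2" using pi_gt3 one_le_power[of pi 2] by linarith
    then have "norm (\<sigma> e) / (4 * pi\<^sup>2) \<le> norm (\<sigma> e) / 1" by (intro divide_left_mono) auto
    then show "norm (\<sigma> e / (4 * pi\<^sup>2) * ?W e) \<le> norm (\<sigma> e) * norm (?W e)"
      unfolding norm_mult by (intro mult_right_mono) (auto simp: norm_divide norm_mult norm_power)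
  qed
  finally have "(norm (fejm N f (x + h) - fejm N f x))\<^sup>2 \<le> (\<Sum>e<m. norm (\<sigma> e) * norm (?W e))\<^sup>2"
    by (intro power_mono) auto
  also have "\<dots> \<le> real m * (\<Sum>e<m. (norm (\<sigma> e) * norm (?W e))\<^sup>2)"
    using sum_squared_le_sum_of_squares[where I="{..<m}" and f="\<lambda>e. norm (\<sigma> e) * norm (?W e)"] by (simp add: mult.commute)
  also have "\<dots> \<le> real m * (\<Sum>e<m. (norm (\<sigma> e))\<^sup>2 * Z e)"
    unfolding power_mult_distrib by (intro mult_left_mono sum_mono Z) auto
  finally show ?thesis .
qed

text \<open>Packages the estimates of all edges; what matters is the order of quantifiers, with one
  \<open>K\<close> for all \<open>N\<close> and \<open>h\<close>.\<close>

lemma strip_maximal_family: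
  fixes m :: nat and s p q c :: "nat \<Rightarrow> real" and \<sigma> :: "nat \<Rightarrow> complex"
  assumes pq: "\<And>e. p e \<le> q e"
  shows "\<exists>K\<ge>0. \<forall>N\<ge>1. \<forall>h. 0 < h \<longrightarrow> h \<le> 1 \<longrightarrow> (\<exists>Z :: nat \<Rightarrow> real \<Rightarrow> real. (\<forall>e. continuous_on UNIV (Z e)) \<and>
     (\<forall>e t x y. (norm (\<Sum>n\<in>grid N. fej2 N n * strip_coeff (s e) (p e) (q e) (c e) h n * cis (- phase t n) *
         cis (of_int (fst n) * x + of_int (snd n) * y)))\<^sup>2 \<le> Z e t) \<and>
     (\<forall>k::int. integral {2 * pi * of_int k..2 * pi * of_int k + 2 * pi} (\<lambda>t. real m * (\<Sum>e<m. (norm (\<sigma> e))\<^sup>2 * Z e t)) \<le> K * h * (harm (4 * N + 1)) ^ 3))"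
proof -
  have "\<forall>e. \<exists>C\<ge>0. \<forall>N h. N \<ge> 1 \<longrightarrow> 0 < h \<longrightarrow> h \<le> 1 \<longrightarrow> (\<exists>Z. continuous_on UNIV Z \<and>
     (\<forall>t x y. (norm (\<Sum>n\<in>grid N. fej2 N n * strip_coeff (s e) (p e) (q e) (c e) h n * cis (- phase t n) *
         cis (of_int (fst n) * x + of_int (snd n) * y)))\<^sup>2 \<le> Z t) \<and>
     (\<forall>k::int. integral {2 * pi * of_int k..2 * pi * of_int k + 2 * pi} Z \<le> C * h * (harm (4 * N + 1)) ^ 3))"
  proof
    fix e
    show "\<exists>C\<ge>0. \<forall>N h. N \<ge> 1 \<longrightarrow> 0 < h \<longrightarrow> h \<le> 1 \<longrightarrow> (\<exists>Z. continuous_on UNIV Z \<and>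
     (\<forall>t x y. (norm (\<Sum>n\<in>grid N. fej2 N n * strip_coeff (s e) (p e) (q e) (c e) h n * cis (- phase t n) *
         cis (of_int (fst n) * x + of_int (snd n) * y)))\<^sup>2 \<le> Z t) \<and>
     (\<forall>k::int. integral {2 * pi * of_int k..2 * pi * of_int k + 2 * pi} Z \<le> C * h * (harm (4 * N + 1)) ^ 3))"
    proof (rule strip_maximal_estimate[OF pq[of e], of "s e" "c e"])
      fix C assume C: "0 \<le> C" and A: "\<And>N h. N \<ge> 1 \<Longrightarrow> 0 < h \<Longrightarrow> h \<le> 1 \<Longrightarrow> \<exists>Z. continuous_on UNIV Z \<and>
     (\<forall>t x y. (norm (\<Sum>n\<in>grid N. fej2 N n * strip_coeff (s e) (p e) (q e) (c e) h n * cis (- phase t n) *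
         cis (of_int (fst n) * x + of_int (snd n) * y)))\<^sup>2 \<le> Z t) \<and>
     (\<forall>k::int. integral {2 * pi * of_int k..2 * pi * of_int k + 2 * pi} Z \<le> C * h * (harm (4 * N + 1)) ^ 3)"
      show ?thesis by (intro exI[of _ C] conjI allI impI C A)
    qed
  qed
  then obtain C where C: "\<And>e. 0 \<le> C e" "\<And>e N h. N \<ge> 1 \<Longrightarrow> 0 < h \<Longrightarrow> h \<le> 1 \<Longrightarrow> \<exists>Z. continuous_on UNIV Z \<and>
     (\<forall>t x y. (norm (\<Sum>n\<in>grid N. fej2 N n * strip_coeff (s e) (p e) (q e) (c e) h n * cis (- phase t n) *
         cis (of_int (fst n) * x + of_int (snd n) * y)))\<^sup>2 \<le> Z t) \<and>
     (\<forall>k::int. integral {2 * pi * of_int k..2 * pi * of_int k + 2 * pi} Z \<le> C e * h * (harm (4 * N + 1)) ^ 3)"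
    unfolding choice_iff by blast
  show ?thesis
  proof (intro exI[of _ "real m * (\<Sum>e<m. (norm (\<sigma> e))\<^sup>2 * C e)"] conjI allI impI)
    show "0 \<le> real m * (\<Sum>e<m. (norm (\<sigma> e))\<^sup>2 * C e)" using C(1) by (intro mult_nonneg_nonneg sum_nonneg) auto
    fix N :: nat and h :: real assume N: "N \<ge> 1" and h: "0 < h" "h \<le> 1"
    have "\<forall>e. \<exists>Z. continuous_on UNIV Z \<and>
     (\<forall>t x y. (norm (\<Sum>n\<in>grid N. fej2 N n * strip_coeff (s e) (p e) (q e) (c e) h n * cis (- phase t n) *
         cis (of_int (fst n) * x + of_int (snd n) * y)))\<^sup>2 \<le> Z t) \<and>
     (\<forall>k::int. integral {2 * pi * of_int k..2 * pi * of_int k + 2 * pi} Z \<le> C e * h * (harm (4 * N + 1)) ^ 3)"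
      using C(2)[OF N h] by (rule allI)
    then obtain Z where Z: "\<And>e. continuous_on UNIV (Z e)"
     "\<And>e t x y. (norm (\<Sum>n\<in>grid N. fej2 N n * strip_coeff (s e) (p e) (q e) (c e) h n * cis (- phase t n) *
         cis (of_int (fst n) * x + of_int (snd n) * y)))\<^sup>2 \<le> Z e t"
     "\<And>e k::int. integral {2 * pi * of_int k..2 * pi * of_int k + 2 * pi} (Z e) \<le> C e * h * (harm (4 * N + 1)) ^ 3"
      unfolding choice_iff by blast
    have "integral {2 * pi * of_int k..2 * pi * of_int k + 2 * pi} (\<lambda>t. real m * (\<Sum>e<m. (norm (\<sigma> e))\<^sup>2 * Z e t))
       \<le> real m * (\<Sum>e<m. (norm (\<sigma> e))\<^sup>2 * C e) * h * (harm (4 * N + 1)) ^ 3" for k :: int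
    proof -
      let ?I = "{2 * pi * of_int k..2 * pi * of_int k + 2 * pi}"
      have "integral ?I (\<lambda>t. \<Sum>e<m. (norm (\<sigma> e))\<^sup>2 * Z e t) = (\<Sum>e<m. integral ?I (\<lambda>t. (norm (\<sigma> e))\<^sup>2 * Z e t))"
        by (rule integral_sum) (auto intro!: integrable_continuous_real continuous_intros continuous_on_subset[OF Z(1)])
      also have "\<dots> = (\<Sum>e<m. (norm (\<sigma> e))\<^sup>2 * integral ?I (Z e))" by simp
      also have "\<dots> \<le> (\<Sum>e<m. (norm (\<sigma> e))\<^sup>2 * (C e * h * (harm (4 * N + 1)) ^ 3))"
        by (intro sum_mono mult_left_mono Z(3)) auto
      finally have "real m * integral ?I (\<lambda>t. \<Sum>e<m. (norm (\<sigma> e))\<^sup>2 * Z e t) \<le> real m * (\<Sum>e<m. (norm (\<sigma> e))\<^sup>2 * (C e * h * (harm (4 * N + 1)) ^ 3))"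
        by (intro mult_left_mono) auto
      also have "\<dots> = real m * (\<Sum>e<m. (norm (\<sigma> e))\<^sup>2 * C e) * h * (harm (4 * N + 1)) ^ 3"
        by (simp add: sum_distrib_left sum_distrib_right mult_ac)
      finally show ?thesis by (simp only: integral_mult_right)
    qed
    with Z show "\<exists>Z :: nat \<Rightarrow> real \<Rightarrow> real. (\<forall>e. continuous_on UNIV (Z e)) \<and>
     (\<forall>e t x y. (norm (\<Sum>n\<in>grid N. fej2 N n * strip_coeff (s e) (p e) (q e) (c e) h n * cis (- phase t n) *
         cis (of_int (fst n) * x + of_int (snd n) * y)))\<^sup>2 \<le> Z e t) \<and>
     (\<forall>k::int. integral {2 * pi * of_int k..2 * pi * of_int k + 2 * pi} (\<lambda>t. real m * (\<Sum>e<m. (norm (\<sigma> e))\<^sup>2 * Z e t)) \<le> real m * (\<Sum>e<m. (norm (\<sigma> e))\<^sup>2 * C e) * h * (harm (4 * N + 1)) ^ 3)"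
      by (intro exI[of _ Z] conjI allI)
  qed
qed

text \<open>Weights and phase are symmetric in the two frequencies, so horizontal translations
  reduce to vertical ones with the roles of \<open>x\<close> and \<open>y\<close> exchanged.\<close>

lemma swapped_strip_sum:
  "(\<Sum>n\<in>grid N. fej2 N n * strip_coeff s p q c h (prod.swap n) * cis (- phase t n) * cis (of_int (fst n) * x + of_int (snd n) * y))
   = (\<Sum>n\<in>grid N. fej2 N n * strip_coeff s p q c h n * cis (- phase t n) * cis (of_int (fst n) * y + of_int (snd n) * x))"
  by (rule sum.reindex_bij_witness[of _ prod.swap prod.swap])
     (auto simp: grid_def fej2_def phase_def add.commute mult.commute)

lemma nn_integral_interval:
  fixes Z :: "real \<Rightarrow> real"
  assumes Z: "continuous_on UNIV Z" "\<And>t. 0 \<le> Z t"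
  shows "(\<integral>\<^sup>+ t. ennreal (Z t) * indicator {a..b} t \<partial>lborel) = ennreal (integral {a..b} Z)"
proof -
  have i: "set_integrable lborel {a..b} Z"
    by (intro borel_integrable_atLeastAtMost' continuous_on_subset[OF Z(1)]) auto
  have "(\<integral>\<^sup>+ t. ennreal (Z t) * indicator {a..b} t \<partial>lborel) = (\<integral>\<^sup>+ t. ennreal (indicator {a..b} t *\<^sub>R Z t) \<partial>lborel)"
    by (intro nn_integral_cong) (auto simp: indicator_def)
  also have "\<dots> = ennreal (LINT t|lborel. indicator {a..b} t *\<^sub>R Z t)"
    by (rule nn_integral_eq_integral[OF i[unfolded set_integrable_def]]) (use Z in auto)
  also have "(LINT t|lborel. indicator {a..b} t *\<^sub>R Z t) = integral {a..b} Z"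
    using set_borel_integral_eq_integral(2)[OF i] by (simp add: set_lebesgue_integral_def)
  finally show ?thesis .
qed

lemma ennreal_le_suminf: "f i \<le> (\<Sum>j. f j :: ennreal)"
  using sum_le_suminf[of f "{i}"] by simp

text \<open>A Borel-Cantelli argument: over one period the weighted double series has an integral of
  at most the product of two convergent series, so it is finite almost everywhere and bounds each of
  its terms.\<close>

lemma AE_weighted_bound:
  fixes Z :: "nat \<Rightarrow> nat \<Rightarrow> real \<Rightarrow> real" and A B \<alpha> \<beta> :: "nat \<Rightarrow> real"
  assumes cont: "\<And>J j. continuous_on UNIV (Z J j)" and nn: "\<And>J j t. 0 \<le> Z J j t"
    and int: "\<And>J j k. integral {2 * pi * of_int k..2 * pi * of_int k + 2 * pi} (Z J j) \<le> A J * B j"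
    and pos: "\<And>J. 0 \<le> \<alpha> J" "\<And>j. 0 \<le> \<beta> j" "\<And>J. 0 \<le> A J" "\<And>j. 0 \<le> B j"
    and sum: "summable (\<lambda>J. \<alpha> J * A J)" "summable (\<lambda>j. \<beta> j * B j)"
  shows "AE t in lborel. \<exists>H\<ge>0. \<forall>J j. \<alpha> J * \<beta> j * Z J j t \<le> H"
proof -
  have main: "AE t in lborel. t \<in> {2 * pi * of_int k..2 * pi * of_int k + 2 * pi} \<longrightarrow> (\<exists>H\<ge>0. \<forall>J j. \<alpha> J * \<beta> j * Z J j t \<le> H)" for k :: int
  proof -
    let ?I = "{2 * pi * of_int k..2 * pi * of_int k + 2 * pi}"
    let ?g = "\<lambda>J j t. ennreal (\<alpha> J * \<beta> j * Z J j t) * indicator ?I t"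
    define Y where "Y t = (\<Sum>J. \<Sum>j. ?g J j t)" for t
    have Zm [measurable]: "Z J j \<in> borel_measurable borel" for J j
      using cont by (rule borel_measurable_continuous_onI)
    have g: "(\<integral>\<^sup>+ t. ?g J j t \<partial>lborel) \<le> ennreal ((\<alpha> J * A J) * (\<beta> j * B j))" for J j
    proof -
      have "(\<integral>\<^sup>+ t. ?g J j t \<partial>lborel) = ennreal (integral ?I (\<lambda>t. \<alpha> J * \<beta> j * Z J j t))"
        by (rule nn_integral_interval) (use pos nn in \<open>auto intro!: continuous_intros cont\<close>)
      also have "\<dots> \<le> ennreal ((\<alpha> J * A J) * (\<beta> j * B j))"
        using mult_left_mono[OF int[of k J j], of "\<alpha> J * \<beta> j"] pos by (intro ennreal_leI) (simp add: mult_ac)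
      finally show ?thesis .
    qed
    have "(\<integral>\<^sup>+ t. Y t \<partial>lborel) = (\<Sum>J. \<Sum>j. (\<integral>\<^sup>+ t. ?g J j t \<partial>lborel))"
      unfolding Y_def by (subst nn_integral_suminf, measurable, subst nn_integral_suminf, measurable)
    also have "\<dots> \<le> (\<Sum>J. \<Sum>j. ennreal ((\<alpha> J * A J) * (\<beta> j * B j)))"
      by (intro suminf_le g summableI)
    also have "\<dots> = (\<Sum>J. ennreal ((\<alpha> J * A J) * (\<Sum>j. \<beta> j * B j)))"
      by (intro arg_cong[where f=suminf] ext, subst suminf_ennreal2)
         (use pos sum in \<open>auto intro!: summable_mult simp: suminf_mult\<close>)
    also have "\<dots> = ennreal (\<Sum>J. (\<alpha> J * A J) * (\<Sum>j. \<beta> j * B j))"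
      by (rule suminf_ennreal2) (use pos sum in \<open>auto intro!: summable_mult2 mult_nonneg_nonneg suminf_nonneg\<close>)
    finally have fin: "(\<integral>\<^sup>+ t. Y t \<partial>lborel) \<noteq> \<infinity>" by (auto simp: top_unique)
    have "AE t in lborel. Y t \<noteq> \<infinity>"
      by (rule nn_integral_noteq_infinite[OF _ fin]) (unfold Y_def, measurable)
    then show ?thesis
    proof eventually_elim
      case (elim t)
      show ?case
      proof (intro impI exI[of _ "enn2real (Y t)"] conjI allI)
        fix J j assume t: "t \<in> ?I"
        have "ennreal (\<alpha> J * \<beta> j * Z J j t) = ?g J j t" using t by simp
        also have "\<dots> \<le> (\<Sum>j. ?g J j t)" by (rule ennreal_le_suminf[of "\<lambda>j. ?g J j t"])
        also have "\<dots> \<le> Y t" unfolding Y_def by (rule ennreal_le_suminf[of "\<lambda>J. \<Sum>j. ?g J j t"])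
        also have "Y t = ennreal (enn2real (Y t))" using elim by (simp add: less_top)
        finally show "\<alpha> J * \<beta> j * Z J j t \<le> enn2real (Y t)" by (subst (asm) ennreal_le_iff) auto
      qed simp
    qed
  qed
  \<comment> \<open>Countably many periods cover the line, so their exceptional sets combine to a
    null set.\<close>
  then have "AE t in lborel. \<forall>k::int. t \<in> {2 * pi * of_int k..2 * pi * of_int k + 2 * pi} \<longrightarrow> (\<exists>H\<ge>0. \<forall>J j. \<alpha> J * \<beta> j * Z J j t \<le> H)"
    by (intro AE_all_countable[THEN iffD2] allI main)
  then show ?thesis
  proof eventually_elim
    case (elim t)
    define k where "k = \<lfloor>t / (2 * pi)\<rfloor>"
    have "of_int k \<le> t / (2 * pi)" "t / (2 * pi) < of_int k + 1" unfolding k_def by linarith+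
    then have "t \<in> {2 * pi * of_int k..2 * pi * of_int k + 2 * pi}" by (auto simp: field_simps)
    with elim show ?case by blast
  qed
qed

text \<open>Since \<open>harm n - ln n\<close> decreases from 1, a frequency scale
  \<open>16^J\<close> costs a factor linear in \<open>J\<close>, negligible against any exponential
  weight.\<close>

lemma harm_power16_le: "harm (4 * 16 ^ J + 1) \<le> 5 * (real J + 1)"
proof -
  have "harm (Suc (4 * 16 ^ J)) - ln (real (Suc (4 * 16 ^ J))) \<le> harm (Suc 0) - ln (real (Suc 0))"
    by (rule decseqD[OF decseq_harm_diff_ln]) simp
  then have "harm (4 * 16 ^ J + 1) \<le> 1 + ln (real (4 * 16 ^ J + 1))" by (simp add: harm_def)
  also have "ln (real (4 * 16 ^ J + 1)) \<le> ln ((16::real) ^ (J + 1))"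
  proof -
    have "(1::real) \<le> 16 ^ J" by simp
    moreover have "real (4 * 16 ^ J + 1) = 4 * 16 ^ J + 1" "(16::real) ^ (J + 1) = 16 * 16 ^ J" by simp_all
    ultimately have "real (4 * 16 ^ J + 1) \<le> 16 ^ (J + 1)" by linarith
    then show ?thesis by (subst ln_le_cancel_iff) auto
  qed
  also have "\<dots> = (real J + 1) * ln 16" by (subst ln_realpow) auto
  also have "ln (16::real) \<le> 4"
  proof -
    have "ln (16::real) = ln (2 ^ 4)" by simp
    also have "\<dots> = 4 * ln 2" by (subst ln_realpow) auto
    finally show ?thesis using ln_2_less_1 by simp
  qed
  finally have "harm (4 * 16 ^ J + 1) \<le> 1 + (real J + 1) * 4" by (simp add: mult_left_mono)
  then show ?thesis by simp
qed

lemma polygon_maximal: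
  assumes pp: "planar_polygon Q" and inj: "\<forall>x\<in>Q. \<forall>y\<in>Q. torus_eq x y \<longrightarrow> x = y"
    and coef: "\<And>t n. fcoef (u t) n = cis (- phase t n) * fcoef (indicator {x. \<exists>y\<in>Q. torus_eq x y}) n"
  shows "\<exists>K\<ge>0. \<forall>N\<ge>1. \<forall>h. 0 < h \<longrightarrow> h \<le> 1 \<longrightarrow> (\<exists>Z. continuous_on UNIV Z \<and> (\<forall>t. 0 \<le> Z t) \<and>
     (\<forall>t x. (norm (fejm N (u t) (x + vector [h, 0]) - fejm N (u t) x))\<^sup>2 \<le> Z t) \<and>
     (\<forall>t x. (norm (fejm N (u t) (x + vector [0, h]) - fejm N (u t) x))\<^sup>2 \<le> Z t) \<and>
     (\<forall>k::int. integral {2 * pi * of_int k..2 * pi * of_int k + 2 * pi} Z \<le> K * h * (harm (4 * N + 1)) ^ 3))"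
proof (rule planar_polygon_strips[OF pp])
  fix m :: nat and \<sigma> \<sigma>' :: "nat \<Rightarrow> complex" and s p q c s' p' q' c' :: "nat \<Rightarrow> real"
  assume Q: "compact Q" and pq: "\<And>e. p e \<le> q e" "\<And>e. p' e \<le> q' e"
    and v: "\<And>\<eta>. \<eta> > 0 \<Longrightarrow> AE x in lborel. (indicator Q (x - vector [0, \<eta>]) - indicator Q x :: complex)
       = (\<Sum>e<m. \<sigma> e * indicator (vstrip (s e) (p e) (q e) (c e) \<eta>) x)"
    and hz: "\<And>\<eta>. \<eta> > 0 \<Longrightarrow> AE x in lborel. (indicator Q (x - vector [\<eta>, 0]) - indicator Q x :: complex)
       = (\<Sum>e<m. \<sigma>' e * indicator (hstrip (s' e) (p' e) (q' e) (c' e) \<eta>) x)"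
  define \<gamma> where "\<gamma> n = fcoef (indicator {x. \<exists>y\<in>Q. torus_eq x y}) n" for n
  have \<gamma>: "\<gamma> n = (LINT y|lborel. indicator Q y * cnj (tchar n y)) / (4 * pi\<^sup>2)" for n
    unfolding \<gamma>_def by (rule polygon_fcoef[OF Q inj[rule_format]])
  have rv: "(cnj (tchar n (vector [0, h])) - 1) * \<gamma> n = (\<Sum>e<m. \<sigma> e * strip_coeff (s e) (p e) (q e) (c e) h n) / (4 * pi\<^sup>2)" if "h > 0" for h n
    using translation_difference_transform[OF Q closed_strips(1) vstrip_bounded v[OF that], of n] unfolding \<gamma> integral_vstrip by simp
  have rh: "(cnj (tchar n (vector [h, 0])) - 1) * \<gamma> n = (\<Sum>e<m. \<sigma>' e * strip_coeff (s' e) (p' e) (q' e) (c' e) h (prod.swap n)) / (4 * pi\<^sup>2)" if "h > 0" for h n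
    using translation_difference_transform[OF Q closed_strips(2) hstrip_bounded hz[OF that], of n] unfolding \<gamma> integral_hstrip by simp
  obtain K where K: "0 \<le> K" and KZ: "\<forall>N\<ge>1. \<forall>h. 0 < h \<longrightarrow> h \<le> 1 \<longrightarrow> (\<exists>Z :: nat \<Rightarrow> real \<Rightarrow> real. (\<forall>e. continuous_on UNIV (Z e)) \<and>
     (\<forall>e t x y. (norm (\<Sum>n\<in>grid N. fej2 N n * strip_coeff (s e) (p e) (q e) (c e) h n * cis (- phase t n) *
         cis (of_int (fst n) * x + of_int (snd n) * y)))\<^sup>2 \<le> Z e t) \<and>
     (\<forall>k::int. integral {2 * pi * of_int k..2 * pi * of_int k + 2 * pi} (\<lambda>t. real m * (\<Sum>e<m. (norm (\<sigma> e))\<^sup>2 * Z e t)) \<le> K * h * (harm (4 * N + 1)) ^ 3))"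
    using strip_maximal_family[where p=p and q=q and s=s and c=c and m=m and \<sigma>=\<sigma>, OF pq(1)]
    by (elim exE conjE) (rule that)
  obtain K' where K': "0 \<le> K'" and KZ': "\<forall>N\<ge>1. \<forall>h. 0 < h \<longrightarrow> h \<le> 1 \<longrightarrow> (\<exists>Z :: nat \<Rightarrow> real \<Rightarrow> real. (\<forall>e. continuous_on UNIV (Z e)) \<and>
     (\<forall>e t x y. (norm (\<Sum>n\<in>grid N. fej2 N n * strip_coeff (s' e) (p' e) (q' e) (c' e) h n * cis (- phase t n) *
         cis (of_int (fst n) * x + of_int (snd n) * y)))\<^sup>2 \<le> Z e t) \<and>
     (\<forall>k::int. integral {2 * pi * of_int k..2 * pi * of_int k + 2 * pi} (\<lambda>t. real m * (\<Sum>e<m. (norm (\<sigma>' e))\<^sup>2 * Z e t)) \<le> K' * h * (harm (4 * N + 1)) ^ 3))"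
    using strip_maximal_family[where p=p' and q=q' and s=s' and c=c' and m=m and \<sigma>=\<sigma>', OF pq(2)]
    by (elim exE conjE) (rule that)
  show ?thesis
  proof (intro exI[of _ "K + K'"] conjI allI impI)
    show "0 \<le> K + K'" using K K' by simp
    fix N :: nat and h :: real assume N: "N \<ge> 1" and h: "0 < h" "h \<le> 1"
    from KZ[rule_format, OF N h] obtain V where V0: "\<forall>e. continuous_on UNIV (V e)"
      "\<forall>e t x y. (norm (\<Sum>n\<in>grid N. fej2 N n * strip_coeff (s e) (p e) (q e) (c e) h n * cis (- phase t n) *
         cis (of_int (fst n) * x + of_int (snd n) * y)))\<^sup>2 \<le> V e t"
      "\<forall>k::int. integral {2 * pi * of_int k..2 * pi * of_int k + 2 * pi} (\<lambda>t. real m * (\<Sum>e<m. (norm (\<sigma> e))\<^sup>2 * V e t)) \<le> K * h * (harm (4 * N + 1)) ^ 3"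
      by (elim exE conjE) (rule that)
    note V = V0[rule_format]
    from KZ'[rule_format, OF N h] obtain W where W0: "\<forall>e. continuous_on UNIV (W e)"
      "\<forall>e t x y. (norm (\<Sum>n\<in>grid N. fej2 N n * strip_coeff (s' e) (p' e) (q' e) (c' e) h n * cis (- phase t n) *
         cis (of_int (fst n) * x + of_int (snd n) * y)))\<^sup>2 \<le> W e t"
      "\<forall>k::int. integral {2 * pi * of_int k..2 * pi * of_int k + 2 * pi} (\<lambda>t. real m * (\<Sum>e<m. (norm (\<sigma>' e))\<^sup>2 * W e t)) \<le> K' * h * (harm (4 * N + 1)) ^ 3"
      by (elim exE conjE) (rule that)
    note W = W0[rule_format]
    define X where "X t = real m * (\<Sum>e<m. (norm (\<sigma> e))\<^sup>2 * V e t)" for t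
    define Y where "Y t = real m * (\<Sum>e<m. (norm (\<sigma>' e))\<^sup>2 * W e t)" for t
    have V0: "0 \<le> V e t" and W0: "0 \<le> W e t" for e t
      using order_trans[OF zero_le_power2 V(2)] order_trans[OF zero_le_power2 W(2)] by auto
    have X0: "0 \<le> X t" and Y0: "0 \<le> Y t" for t
      unfolding X_def Y_def using V0 W0 by (auto intro!: mult_nonneg_nonneg sum_nonneg)
    have cX: "continuous_on S X" and cY: "continuous_on S Y" for S
      unfolding X_def Y_def by (auto intro!: continuous_intros continuous_on_subset[OF V(1)] continuous_on_subset[OF W(1)])
    have dv: "(norm (fejm N (u t) (x + vector [0, h]) - fejm N (u t) x))\<^sup>2 \<le> X t" for t x
      unfolding X_def by (rule fejm_difference_le[OF coef[folded \<gamma>_def] rv[OF h(1)] V(2)])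
    have dh: "(norm (fejm N (u t) (x + vector [h, 0]) - fejm N (u t) x))\<^sup>2 \<le> Y t" for t x
      unfolding Y_def by (rule fejm_difference_le[OF coef[folded \<gamma>_def] rh[OF h(1)]]) (unfold swapped_strip_sum, rule W(2))
    have iXY: "integral {2 * pi * of_int k..2 * pi * of_int k + 2 * pi} (\<lambda>t. X t + Y t) \<le> (K + K') * h * (harm (4 * N + 1)) ^ 3" for k :: int
    proof -
      have "integral {2 * pi * of_int k..2 * pi * of_int k + 2 * pi} (\<lambda>t. X t + Y t)
        = integral {2 * pi * of_int k..2 * pi * of_int k + 2 * pi} X + integral {2 * pi * of_int k..2 * pi * of_int k + 2 * pi} Y"
        by (intro integral_add integrable_continuous_real cX cY)
      also have "\<dots> \<le> K * h * (harm (4 * N + 1)) ^ 3 + K' * h * (harm (4 * N + 1)) ^ 3"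
        unfolding X_def Y_def by (intro add_mono V(3) W(3))
      finally show ?thesis by (simp add: algebra_simps)
    qed
    show "\<exists>Z. continuous_on UNIV Z \<and> (\<forall>t. 0 \<le> Z t) \<and>
     (\<forall>t x. (norm (fejm N (u t) (x + vector [h, 0]) - fejm N (u t) x))\<^sup>2 \<le> Z t) \<and>
     (\<forall>t x. (norm (fejm N (u t) (x + vector [0, h]) - fejm N (u t) x))\<^sup>2 \<le> Z t) \<and>
     (\<forall>k::int. integral {2 * pi * of_int k..2 * pi * of_int k + 2 * pi} Z \<le> (K + K') * h * (harm (4 * N + 1)) ^ 3)"
    proof (intro exI[of _ "\<lambda>t. X t + Y t"] conjI allI iXY)
      show "continuous_on UNIV (\<lambda>t. X t + Y t)" by (intro continuous_intros cX cY)
      show "0 \<le> X t + Y t" for t using X0 Y0 by (rule add_nonneg_nonneg)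
      show "(norm (fejm N (u t) (x + vector [h, 0]) - fejm N (u t) x))\<^sup>2 \<le> X t + Y t" for t x
        using dh[of t x] X0[of t] by linarith
      show "(norm (fejm N (u t) (x + vector [0, h]) - fejm N (u t) x))\<^sup>2 \<le> X t + Y t" for t x
        using dv[of t x] Y0[of t] by linarith
    qed
  qed
qed

text \<open>The mean of the squared increment is at most a constant times
  \<open>2 powr (- j) * (J + 1)^3\<close>. Weighting it by \<open>2 powr (2 * \<theta> * j)\<close>
  and \<open>2 powr (- 2 * \<eta> * J)\<close> leaves convergent series exactly because
  \<open>\<theta> < 1/2\<close> and \<open>\<eta> > 0\<close>.\<close>

lemma polygon_AE_dyadic_bound:
  assumes pp: "planar_polygon Q" and inj: "\<forall>x\<in>Q. \<forall>y\<in>Q. torus_eq x y \<longrightarrow> x = y"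
    and coef: "\<And>t n. fcoef (u t) n = cis (- phase t n) * fcoef (indicator {x. \<exists>y\<in>Q. torus_eq x y}) n"
    and \<eta>: "0 < \<eta>" and \<theta>: "0 < \<theta>" "\<theta> < 1 / 2"
  shows "AE t in lborel. \<exists>H\<ge>0. \<forall>J j x.
      norm (fejm (16 ^ J) (u t) (x + vector [1 / 2 ^ j, 0]) - fejm (16 ^ J) (u t) x) \<le> H * 2 powr (\<eta> * real J) * (2 powr (- \<theta>)) ^ j \<and>
      norm (fejm (16 ^ J) (u t) (x + vector [0, 1 / 2 ^ j]) - fejm (16 ^ J) (u t) x) \<le> H * 2 powr (\<eta> * real J) * (2 powr (- \<theta>)) ^ j"
proof -
  obtain K where K: "0 \<le> K" and KZ: "\<forall>N\<ge>1. \<forall>h. 0 < h \<longrightarrow> h \<le> 1 \<longrightarrow> (\<exists>Z. continuous_on UNIV Z \<and> (\<forall>t. 0 \<le> Z t) \<and>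
     (\<forall>t x. (norm (fejm N (u t) (x + vector [h, 0]) - fejm N (u t) x))\<^sup>2 \<le> Z t) \<and>
     (\<forall>t x. (norm (fejm N (u t) (x + vector [0, h]) - fejm N (u t) x))\<^sup>2 \<le> Z t) \<and>
     (\<forall>k::int. integral {2 * pi * of_int k..2 * pi * of_int k + 2 * pi} Z \<le> K * h * (harm (4 * N + 1)) ^ 3))"
    using polygon_maximal[OF pp inj coef]
    by (elim exE conjE) (rule that)
  have "\<forall>J j. \<exists>Z. continuous_on UNIV Z \<and> (\<forall>t. 0 \<le> Z t) \<and>
     (\<forall>t x. (norm (fejm (16 ^ J) (u t) (x + vector [1 / 2 ^ j, 0]) - fejm (16 ^ J) (u t) x))\<^sup>2 \<le> Z t) \<and>
     (\<forall>t x. (norm (fejm (16 ^ J) (u t) (x + vector [0, 1 / 2 ^ j]) - fejm (16 ^ J) (u t) x))\<^sup>2 \<le> Z t) \<and>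
     (\<forall>k::int. integral {2 * pi * of_int k..2 * pi * of_int k + 2 * pi} Z \<le> K * (1 / 2 ^ j) * (harm (4 * 16 ^ J + 1)) ^ 3)"
    by (intro allI KZ[rule_format]) auto
  then obtain Z where Z0: "\<forall>J j. continuous_on UNIV (Z J j) \<and> (\<forall>t. 0 \<le> Z J j t) \<and>
     (\<forall>t x. (norm (fejm (16 ^ J) (u t) (x + vector [1 / 2 ^ j, 0]) - fejm (16 ^ J) (u t) x))\<^sup>2 \<le> Z J j t) \<and>
     (\<forall>t x. (norm (fejm (16 ^ J) (u t) (x + vector [0, 1 / 2 ^ j]) - fejm (16 ^ J) (u t) x))\<^sup>2 \<le> Z J j t) \<and>
     (\<forall>k::int. integral {2 * pi * of_int k..2 * pi * of_int k + 2 * pi} (Z J j) \<le> K * (1 / 2 ^ j) * (harm (4 * 16 ^ J + 1)) ^ 3)"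
    unfolding choice_iff by (elim exE) (rule that)
  note Z = Z0[rule_format, THEN conjunct1] Z0[rule_format, THEN conjunct2, THEN conjunct1, rule_format] Z0[rule_format, THEN conjunct2, THEN conjunct2, THEN conjunct1, rule_format] Z0[rule_format, THEN conjunct2, THEN conjunct2, THEN conjunct2, THEN conjunct1, rule_format] Z0[rule_format, THEN conjunct2, THEN conjunct2, THEN conjunct2, THEN conjunct2, rule_format]
  define A where "A J = K * (5 * (real J + 1)) ^ 3" for J :: nat
  define B :: "nat \<Rightarrow> real" where "B j = 1 / 2 ^ j" for j
  \<comment> \<open>The exponents are doubled because \<open>Z\<close> bounds squares; the square
    root of the resulting bound \<open>H\<close> is the final constant.\<close>
  define \<alpha> where "\<alpha> J = 2 powr (- 2 * \<eta> * real J)" for J :: nat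
  define \<beta> where "\<beta> j = 2 powr (2 * \<theta> * real j)" for j :: nat
  have "AE t in lborel. \<exists>H\<ge>0. \<forall>J j. \<alpha> J * \<beta> j * Z J j t \<le> H"
  proof (rule AE_weighted_bound[OF Z(1,2)])
    fix J j :: nat and k :: int
    have "K * (1 / 2 ^ j) * (harm (4 * 16 ^ J + 1)) ^ 3 \<le> K * (1 / 2 ^ j) * (5 * (real J + 1)) ^ 3"
      using K by (intro mult_left_mono power_mono harm_power16_le harm_nonneg) auto
    then show "integral {2 * pi * of_int k..2 * pi * of_int k + 2 * pi} (Z J j) \<le> A J * B j"
      using Z(5)[of k J j] by (simp add: A_def B_def)
  next
    show "summable (\<lambda>J. \<alpha> J * A J)"
    proof (rule summable_comparison_test_bigo)
      have "summable (\<lambda>J. (2 powr (- \<eta>)) ^ J)" using \<eta> powr_less_mono[of "- \<eta>" 0 2] by (intro summable_geometric) simp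
      then show "summable (\<lambda>J. norm (2 powr (- \<eta> * real J)))" by (simp add: powr_powr flip: powr_realpow)
      show "(\<lambda>J. \<alpha> J * A J) \<in> O(\<lambda>J. 2 powr (- \<eta> * real J))" unfolding \<alpha>_def A_def using \<eta> by real_asymp
    qed
    have "\<beta> j * B j = (2 powr (2 * \<theta> - 1)) ^ j" for j
    proof -
      have "1 / 2 ^ j = 2 powr (- real j)" by (simp add: powr_minus powr_realpow inverse_eq_divide)
      then have "\<beta> j * B j = 2 powr (2 * \<theta> * real j + - real j)" unfolding \<beta>_def B_def by (simp only: powr_add)
      also have "2 * \<theta> * real j + - real j = (2 * \<theta> - 1) * real j" by (simp add: algebra_simps)
      finally show ?thesis by (simp add: powr_powr flip: powr_realpow)
    qed
    moreover have "summable (\<lambda>j. (2 powr (2 * \<theta> - 1)) ^ j)" using \<theta> powr_less_mono[of "2 * \<theta> - 1" 0 2] by (intro summable_geometric) simp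
    ultimately show "summable (\<lambda>j. \<beta> j * B j)" by simp
  qed (auto simp: \<alpha>_def \<beta>_def A_def B_def K)
  then show ?thesis
  proof eventually_elim
    case (elim t)
    then obtain H where H: "0 \<le> H" "\<And>J j. \<alpha> J * \<beta> j * Z J j t \<le> H" by blast
    have bd: "a \<le> sqrt H * 2 powr (\<eta> * real J) * (2 powr (- \<theta>)) ^ j" if "a\<^sup>2 \<le> Z J j t" "0 \<le> a" for a J j
    proof (rule power2_le_imp_le)
      have ab: "(2 powr (\<eta> * real J))\<^sup>2 * \<alpha> J = 1" "((2 powr (- \<theta>)) ^ j)\<^sup>2 * \<beta> j = 1"
      proof -
        have "(2 powr (\<eta> * real J))\<^sup>2 = 2 powr (2 * \<eta> * real J)"
          by (simp add: power2_eq_square mult.assoc powr_add[symmetric])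
        then show "(2 powr (\<eta> * real J))\<^sup>2 * \<alpha> J = 1" by (simp add: \<alpha>_def powr_add[symmetric])
        have "((2 powr (- \<theta>)) ^ j)\<^sup>2 = 2 powr (- 2 * \<theta> * real j)"
          by (simp add: power2_eq_square powr_powr mult.assoc powr_add[symmetric] flip: powr_realpow)
        then show "((2 powr (- \<theta>)) ^ j)\<^sup>2 * \<beta> j = 1" by (simp add: \<beta>_def powr_add[symmetric])
      qed
      have "(sqrt H * 2 powr (\<eta> * real J) * (2 powr (- \<theta>)) ^ j)\<^sup>2 = H * ((2 powr (\<eta> * real J))\<^sup>2 * ((2 powr (- \<theta>)) ^ j)\<^sup>2)"
        using H(1) by (simp add: power_mult_distrib)
      also have "\<dots> \<ge> (\<alpha> J * \<beta> j * Z J j t) * ((2 powr (\<eta> * real J))\<^sup>2 * ((2 powr (- \<theta>)) ^ j)\<^sup>2)"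
        by (intro mult_right_mono H(2)) auto
      also have "(\<alpha> J * \<beta> j * Z J j t) * ((2 powr (\<eta> * real J))\<^sup>2 * ((2 powr (- \<theta>)) ^ j)\<^sup>2)
        = ((2 powr (\<eta> * real J))\<^sup>2 * \<alpha> J) * (((2 powr (- \<theta>)) ^ j)\<^sup>2 * \<beta> j) * Z J j t" by (simp only: mult_ac)
      also have "\<dots> = Z J j t" by (simp only: ab mult_1)
      finally show "a\<^sup>2 \<le> (sqrt H * 2 powr (\<eta> * real J) * (2 powr (- \<theta>)) ^ j)\<^sup>2" using that by linarith
      show "0 \<le> sqrt H * 2 powr (\<eta> * real J) * (2 powr (- \<theta>)) ^ j" using H(1) by simp
    qed
    show ?case
      by (intro exI[of _ "sqrt H"] conjI allI bd Z(3) Z(4)) (use H(1) in auto)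
  qed
qed

section \<open>The modulus of continuity of an indicator function\<close>

lemma AE_open_ex:
  fixes U :: "'a::euclidean_space set"
  assumes U: "open U" "U \<noteq> {}" and ae: "AE x in lborel. R x"
  shows "\<exists>x\<in>U. R x"
proof (rule ccontr)
  assume "\<not> ?thesis"
  then have "AE x in lborel. x \<notin> U" using ae by (auto elim: eventually_mono)
  then have "emeasure lborel U = 0"
    by (subst (asm) AE_iff_measurable[where N=U]) (use U in auto)
  then have "U \<in> null_sets lebesgue" using U by (intro null_sets_completionI) (auto simp: null_sets_def)
  then show False using open_not_negligible[OF U] by (simp add: negligible_iff_null_sets)
qed

lemma AE_lborel_translate:
  fixes c :: "'a::euclidean_space"
  assumes "AE x in lborel. R x"
  shows "AE x in lborel. R (x + c)"
proof -
  have "AE x in distr lborel borel ((+) c). R x" unfolding lborel_distr_plus by (rule assms)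
  from AE_distrD[OF _ this] show ?thesis by (simp add: add.commute)
qed

text \<open>Each point has a translate in the cell, and countably many translates of a null set form
  a null set.\<close>

lemma AE_torus_periodic:
  assumes ae: "AE x in torus_measure. R x" and per: "\<And>x k. R x \<Longrightarrow> R (x + lattice_vec k)"
  shows "AE x in lborel. R x"
proof -
  have "AE x in lborel. \<forall>k. x + lattice_vec k \<in> torus_cell \<longrightarrow> R (x + lattice_vec k)"
    unfolding AE_all_countable using AE_lborel_translate[OF ae[unfolded AE_torus]] by blast
  then show ?thesis
  proof eventually_elim
    case (elim x)
    obtain k where "x - lattice_vec k \<in> torus_cell" by (rule cell_translate_unique)
    then have "R (x + lattice_vec (- k))" using elim[rule_format, of "- k"] by (simp add: lattice_vec_uminus)
    from per[OF this, of k] show ?case by (simp add: lattice_vec_uminus)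
  qed
qed

lemma torus_translates_iff: "(\<exists>y\<in>Q. torus_eq x y) \<longleftrightarrow> (\<exists>k. x + lattice_vec k \<in> Q)"
proof
  assume "\<exists>y\<in>Q. torus_eq x y"
  then obtain y k where "y \<in> Q" "x = y + lattice_vec k" by (auto simp: torus_eq_iff)
  then show "\<exists>k. x + lattice_vec k \<in> Q" by (intro exI[of _ "- k"]) (simp add: lattice_vec_uminus)
next
  assume "\<exists>k. x + lattice_vec k \<in> Q"
  then obtain k where "x + lattice_vec k \<in> Q" by blast
  moreover have "x = x + lattice_vec k + lattice_vec (- k)" by (simp add: lattice_vec_uminus)
  ultimately show "\<exists>y\<in>Q. torus_eq x y" unfolding torus_eq_iff by blast
qed

lemma lattice_vec_add: "lattice_vec (k + l) = lattice_vec k + lattice_vec l"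
  by (simp add: vec2_eq_iff algebra_simps)

lemma torus_translates_saturated:
  "(\<exists>y\<in>Q. torus_eq (x + lattice_vec k) y) \<longleftrightarrow> (\<exists>y\<in>Q. torus_eq x y)"
proof
  assume "\<exists>y\<in>Q. torus_eq (x + lattice_vec k) y"
  then obtain l where "x + lattice_vec k + lattice_vec l \<in> Q" unfolding torus_translates_iff ..
  then show "\<exists>y\<in>Q. torus_eq x y"
    unfolding torus_translates_iff by (intro exI[of _ "k + l"]) (simp add: lattice_vec_add add.assoc)
next
  assume "\<exists>y\<in>Q. torus_eq x y"
  then obtain l where "x + lattice_vec l \<in> Q" unfolding torus_translates_iff ..
  then show "\<exists>y\<in>Q. torus_eq (x + lattice_vec k) y"
    unfolding torus_translates_iff by (intro exI[of _ "- k + l"]) (simp only: lattice_vec_add lattice_vec_uminus add.assoc add_minus_cancel)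
qed

text \<open>Off all lattice translates of the frontier, a point of the saturated set lies in the
  interior of a translate of \<open>Q\<close>; a point outside has a neighbourhood outside because
  the set is closed.\<close>

lemma AE_torus_translates_locally_constant:
  assumes Q: "compact Q" and cl: "closed {x. \<exists>y\<in>Q. torus_eq x y}" and fr: "AE x in lborel. x \<notin> frontier Q"
  shows "AE x in lborel. \<exists>U. open U \<and> x \<in> U \<and> (\<forall>y\<in>U. y \<in> {x. \<exists>y\<in>Q. torus_eq x y} \<longleftrightarrow> x \<in> {x. \<exists>y\<in>Q. torus_eq x y})"
proof -
  have "AE x in lborel. \<forall>k. x + lattice_vec k \<notin> frontier Q"
    unfolding AE_all_countable using AE_lborel_translate[OF fr] by blast
  then show ?thesis
  proof eventually_elim
    case (elim x)
    let ?P = "{x. \<exists>y\<in>Q. torus_eq x y}"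
    show ?case
    proof (cases "x \<in> ?P")
      case True
      then obtain k where k: "x + lattice_vec k \<in> Q" by (auto simp: torus_translates_iff)
      with elim have i: "x + lattice_vec k \<in> interior Q"
        using elim[rule_format, of k] closure_subset[of Q] by (auto simp: frontier_def)
      have "open ((\<lambda>y. y + lattice_vec k) -` interior Q)"
        by (intro open_vimage continuous_intros) auto
      moreover have "y \<in> ?P" if "y \<in> (\<lambda>y. y + lattice_vec k) -` interior Q" for y
        using that interior_subset[of Q] unfolding torus_translates_iff mem_Collect_eq by (intro exI[of _ k]) auto
      ultimately show ?thesis using i True by (intro exI[of _ "(\<lambda>y. y + lattice_vec k) -` interior Q"]) auto
    next
      case False
      then show ?thesis using cl by (intro exI[of _ "- ?P"]) (auto simp: open_Compl)
    qed
  qed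
qed

lemma integral_torus_translate_real:
  fixes g :: "real^2 \<Rightarrow> real"
  assumes "\<And>x k. g (x + lattice_vec k) = g x" and [measurable]: "g \<in> borel_measurable borel" and B: "\<And>x. \<bar>g x\<bar> \<le> B"
  shows "(LINT x|torus_measure. g (x + h)) = (LINT x|torus_measure. g x)"
proof -
  have "(LINT x|torus_measure. complex_of_real (g (x + h))) = (LINT x|torus_measure. complex_of_real (g x))"
    by (rule integral_torus_translate[where B=B]) (use assms in \<open>auto intro!: torus_funI\<close>)
  then show ?thesis by (simp add: integral_complex_of_real)
qed

text \<open>Telescoping along \<open>m\<close> steps, each of which has the same integral by
  translation invariance. For indicators this excludes an \<open>L^1\<close> modulus of smaller
  order than \<open>1/m\<close> at \<open>h/m\<close>.\<close>

lemma L1_modulus_multiple: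
  fixes f :: "real^2 \<Rightarrow> complex"
  assumes tf: "torus_fun f" and [measurable]: "f \<in> borel_measurable borel" and B: "\<And>x. norm (f x) \<le> B"
  shows "(LINT x|torus_measure. norm (f (x + real m *\<^sub>R h) - f x)) \<le> real m * (LINT x|torus_measure. norm (f (x + h) - f x))"
proof (induction m)
  case 0
  show ?case by simp
next
  case (Suc m)
  have bd: "norm (f x - f y) \<le> 2 * B" for x y
    using norm_triangle_ineq4[of "f x" "f y"] B[of x] B[of y] by linarith
  have i: "integrable torus_measure (\<lambda>x. norm (f (x + a) - f (x + b)))" for a b
    by (rule integrable_torus_bounded[where B="2 * B"]) (use bd in auto)
  have "(LINT x|torus_measure. norm (f (x + real (Suc m) *\<^sub>R h) - f x))
     \<le> (LINT x|torus_measure. norm (f (x + (real m *\<^sub>R h + h)) - f (x + real m *\<^sub>R h)) + norm (f (x + real m *\<^sub>R h) - f (x + 0)))"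
  proof (rule integral_mono)
    show "integrable torus_measure (\<lambda>x. norm (f (x + real (Suc m) *\<^sub>R h) - f x))" using i[of _ 0] by simp
    show "integrable torus_measure (\<lambda>x. norm (f (x + (real m *\<^sub>R h + h)) - f (x + real m *\<^sub>R h)) + norm (f (x + real m *\<^sub>R h) - f (x + 0)))"
      by (intro Bochner_Integration.integrable_add i)
    show "norm (f (x + real (Suc m) *\<^sub>R h) - f x)
       \<le> norm (f (x + (real m *\<^sub>R h + h)) - f (x + real m *\<^sub>R h)) + norm (f (x + real m *\<^sub>R h) - f (x + 0))" for x
      using norm_triangle_ineq[of "f (x + (real m *\<^sub>R h + h)) - f (x + real m *\<^sub>R h)" "f (x + real m *\<^sub>R h) - f x"]
      by (simp add: algebra_simps)
  qed
  also have "\<dots> = (LINT x|torus_measure. norm (f (x + real m *\<^sub>R h + h) - f (x + real m *\<^sub>R h))) + (LINT x|torus_measure. norm (f (x + real m *\<^sub>R h) - f x))"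
    by (subst Bochner_Integration.integral_add[OF i i]) (simp add: add.assoc)
  also have "(LINT x|torus_measure. norm (f (x + real m *\<^sub>R h + h) - f (x + real m *\<^sub>R h))) = (LINT x|torus_measure. norm (f (x + h) - f x))"
  proof (rule integral_torus_translate_real[where B="2 * B" and g="\<lambda>x. norm (f (x + h) - f x)"])
    show "norm (f (x + lattice_vec k + h) - f (x + lattice_vec k)) = norm (f (x + h) - f x)" for x k
      using torus_funD[OF tf, of x k] torus_funD[OF tf, of "x + h" k] by (simp add: add_ac)
  qed (use bd in auto)
  finally show ?case using Suc by (simp add: algebra_simps)
qed

lemma indicator_modulus_pos:
  fixes P :: "(real^2) set"
  assumes P: "closed P" "P \<noteq> UNIV" "interior P \<noteq> {}" and sat: "\<And>x k. x + lattice_vec k \<in> P \<longleftrightarrow> x \<in> P"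
  obtains h where "0 < (LINT x|torus_measure. norm (indicator P (x + h) - indicator P x :: complex))"
proof -
  obtain p p' where p: "p \<in> interior P" "p' \<notin> P" using P by auto
  \<comment> \<open>Near \<open>p\<close> all points are in \<open>P\<close>, while their translates
    by \<open>h\<close> stay in the open complement around \<open>p'\<close>; a nonempty open set is
    not null.\<close>
  define h where "h = p' - p"
  define g where "g x = norm (indicator P (x + h) - indicator P x :: complex)" for x
  have [measurable]: "P \<in> sets borel" using P by auto
  have [measurable]: "g \<in> borel_measurable borel" unfolding g_def by measurable
  have i: "integrable torus_measure g"
    by (rule integrable_torus_bounded[where B=1]) (auto simp: g_def indicator_def)
  have "(LINT x|torus_measure. g x) \<noteq> 0"
  proof
    assume "(LINT x|torus_measure. g x) = 0"
    then have "AE x in torus_measure. g x = 0"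
      by (subst (asm) integral_nonneg_eq_0_iff_AE[OF i]) (auto simp: g_def)
    then have "AE x in lborel. g x = 0"
    proof (rule AE_torus_periodic)
      fix x k assume "g x = 0"
      moreover have "x + lattice_vec k + h \<in> P \<longleftrightarrow> x + h \<in> P" using sat[of "x + h" k] by (simp add: add_ac)
      ultimately show "g (x + lattice_vec k) = 0" using sat[of x k] by (simp add: g_def indicator_def)
    qed
    moreover have "open (interior P \<inter> (\<lambda>x. x + h) -` (- P))"
      using P(1) by (intro open_Int open_interior open_vimage continuous_intros) auto
    moreover have "p \<in> interior P \<inter> (\<lambda>x. x + h) -` (- P)" using p by (simp add: h_def)
    ultimately obtain x where x: "x \<in> interior P \<inter> (\<lambda>x. x + h) -` (- P)" "g x = 0"
      using AE_open_ex[of "interior P \<inter> (\<lambda>x. x + h) -` (- P)" "\<lambda>x. g x = 0"] by blast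
    then show False using interior_subset[of P] by (auto simp: g_def)
  qed
  moreover have "0 \<le> (LINT x|torus_measure. g x)" by (rule Bochner_Integration.integral_nonneg) (simp add: g_def)
  ultimately have "0 < (LINT x|torus_measure. g x)" by linarith
  then show thesis unfolding g_def[abs_def] by (rule that)
qed

section \<open>The dimension of the graph\<close>

lemma integral_square_fejm_difference:
  "(LINT x|torus_measure. (norm (fejm N f (x + h) - fejm N f x))\<^sup>2)
    = 4 * pi\<^sup>2 * (\<Sum>n\<in>grid N. (norm (fej2 N n * (tchar n h - 1)) * norm (fcoef f n))\<^sup>2)"
proof -
  have "fejm N f (x + h) - fejm N f x = (\<Sum>n\<in>grid N. (fej2 N n * fcoef f n * (tchar n h - 1)) * tchar n x)" for x
    unfolding fejm_def sum_subtractf[symmetric] by (intro sum.cong refl) (simp add: tchar_add algebra_simps)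
  then have "(LINT x|torus_measure. (norm (fejm N f (x + h) - fejm N f x))\<^sup>2)
     = 4 * pi\<^sup>2 * (\<Sum>n\<in>grid N. (norm (fej2 N n * fcoef f n * (tchar n h - 1)))\<^sup>2)"
    by (simp only: parseval_fejm)
  also have "(\<Sum>n\<in>grid N. (norm (fej2 N n * fcoef f n * (tchar n h - 1)))\<^sup>2)
     = (\<Sum>n\<in>grid N. (norm (fej2 N n * (tchar n h - 1)) * norm (fcoef f n))\<^sup>2)"
    by (intro sum.cong refl arg_cong[where f="\<lambda>r. r\<^sup>2"]) (simp add: norm_mult mult_ac)
  finally show ?thesis .
qed

text \<open>One mean is a trigonometric polynomial, hence bounded, and uniform closeness passes this
  on to the limit and to the later means. The earlier ones are avoided below by shifting the
  sequence.\<close>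

lemma uniform_limit_fejm_bounded:
  assumes lim: "uniform_limit UNIV (\<lambda>J. fejm (16 ^ J) f) v sequentially"
  obtains B J0 where "0 \<le> B" "\<And>x. norm (v x) \<le> B" "\<And>J x. J \<ge> J0 \<Longrightarrow> norm (fejm (16 ^ J) f x) \<le> B"
proof -
  from uniform_limitD[OF lim, of 1] obtain J0 where J0: "\<And>J x. J \<ge> J0 \<Longrightarrow> dist (fejm (16 ^ J) f x) (v x) < 1"
    unfolding eventually_sequentially by auto
  define A where "A = (\<Sum>n\<in>grid (16 ^ J0). norm (fej2 (16 ^ J0) n * fcoef f n))"
  have A: "norm (fejm (16 ^ J0) f x) \<le> A" for x unfolding A_def by (rule norm_fejm_le_sum)
  have v: "norm (v x) \<le> A + 1" for x
    using J0[of J0 x] A[of x] norm_triangle_ineq2[of "v x" "fejm (16 ^ J0) f x"] by (simp add: dist_norm norm_minus_commute)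
  have "norm (fejm (16 ^ J) f x) \<le> A + 2" if "J \<ge> J0" for J x
    using J0[OF that, of x] v[of x] norm_triangle_ineq2[of "fejm (16 ^ J) f x" "v x"] by (simp add: dist_norm)
  moreover have "norm (v x) \<le> A + 2" for x using v[of x] by linarith
  moreover have "0 \<le> A" unfolding A_def by (intro sum_nonneg) simp
  ultimately show thesis by (intro that[of "A + 2" J0]) auto
qed

text \<open>Fejer means of \<open>f\<close> and \<open>g\<close> of equal order have increments of
  equal \<open>L^2\<close> norm, because only the moduli of the coefficients enter Parseval. The
  means of \<open>f\<close> converge uniformly, those of \<open>g\<close> boundedly and almost
  everywhere, so the identity survives in the limit.\<close>

lemma square_modulus_eq:
  assumes coef: "\<And>n. norm (fcoef f n) = norm (fcoef g n)"
    and lim: "uniform_limit UNIV (\<lambda>J. fejm (16 ^ J) f) v sequentially" and v: "continuous_on UNIV v"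
    and g: "integrable torus_measure g" "\<And>x. norm (g x) \<le> 1" and [measurable]: "g \<in> borel_measurable borel"
    and conv: "AE x in lborel. (\<lambda>J. fejm (16 ^ J) g x) \<longlonglongrightarrow> g x"
  shows "(LINT x|torus_measure. (norm (v (x + h) - v x))\<^sup>2) = (LINT x|torus_measure. (norm (g (x + h) - g x))\<^sup>2)"
proof -
  define S where "S f J x = (norm (fejm (16 ^ J) f (x + h) - fejm (16 ^ J) f x))\<^sup>2" for f J and x :: "real^2"
  have [measurable]: "S f J \<in> borel_measurable borel" for f J unfolding S_def by measurable
  have [measurable]: "v \<in> borel_measurable borel" using v by (rule borel_measurable_continuous_onI)
  have ci: "integrable torus_measure (\<lambda>x. c :: real)" for c by (rule integrable_torus_bounded[where B="\<bar>c\<bar>"]) auto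
  have sq: "norm ((norm (a - b))\<^sup>2) \<le> (2 * B)\<^sup>2" if "norm a \<le> B" "norm b \<le> B" for a b :: complex and B
    using norm_triangle_ineq4[of a b] that unfolding real_norm_def abs_power2 by (intro power_mono) auto
  have SE: "(LINT x|torus_measure. S f J x) = (LINT x|torus_measure. S g J x)" for J
    unfolding S_def integral_square_fejm_difference coef ..
  have ptv: "(\<lambda>J. fejm (16 ^ J) f x) \<longlonglongrightarrow> v x" for x
    using tendsto_uniform_limitI[OF lim, of x] by simp
  obtain B J0 where B: "0 \<le> B" "\<And>x. norm (v x) \<le> B" "\<And>J x. J \<ge> J0 \<Longrightarrow> norm (fejm (16 ^ J) f x) \<le> B"
    by (rule uniform_limit_fejm_bounded[OF lim]) blast
  have "(\<lambda>J. LINT x|torus_measure. S f (J + J0) x) \<longlonglongrightarrow> (LINT x|torus_measure. (norm (v (x + h) - v x))\<^sup>2)"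
  proof (rule integral_dominated_convergence[where w="\<lambda>x. (2 * B)\<^sup>2"])
    have "(\<lambda>J. S f (J + J0) x) \<longlonglongrightarrow> (norm (v (x + h) - v x))\<^sup>2" for x
      unfolding S_def by (intro tendsto_intros LIMSEQ_ignore_initial_segment[OF ptv])
    then show "AE x in torus_measure. (\<lambda>J. S f (J + J0) x) \<longlonglongrightarrow> (norm (v (x + h) - v x))\<^sup>2" by simp
    show "AE x in torus_measure. norm (S f (J + J0) x) \<le> (2 * B)\<^sup>2" for J
      unfolding S_def by (intro always_eventually allI sq B) simp_all
  qed (auto intro!: ci)
  moreover have "(\<lambda>J. LINT x|torus_measure. S g J x) \<longlonglongrightarrow> (LINT x|torus_measure. (norm (g (x + h) - g x))\<^sup>2)"
  proof (rule integral_dominated_convergence[where w="\<lambda>x. (2 * 1)\<^sup>2"])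
    have "AE x in lborel. (\<lambda>J. S g J x) \<longlonglongrightarrow> (norm (g (x + h) - g x))\<^sup>2"
      using conv AE_lborel_translate[OF conv, of h]
    proof eventually_elim
      case (elim x)
      show ?case unfolding S_def by (intro tendsto_intros elim)
    qed
    then show "AE x in torus_measure. (\<lambda>J. S g J x) \<longlonglongrightarrow> (norm (g (x + h) - g x))\<^sup>2"
      unfolding AE_torus by (rule eventually_mono) simp
    have g1: "norm (fejm (16 ^ J) g x) \<le> 1" for J x by (rule fejm_bounded[OF _ g]) simp
    then show "AE x in torus_measure. norm (S g J x) \<le> (2 * 1)\<^sup>2" for J
      unfolding S_def by (intro always_eventually allI sq g1)
  qed (auto intro!: ci)
  then have "(\<lambda>J. LINT x|torus_measure. S f (J + J0) x) \<longlonglongrightarrow> (LINT x|torus_measure. (norm (g (x + h) - g x))\<^sup>2)"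
    unfolding SE by (rule LIMSEQ_ignore_initial_segment)
  ultimately show ?thesis by (rule LIMSEQ_unique)
qed

lemma graph_dim_le:
  assumes C: "0 \<le> C" and \<kappa>: "\<kappa> \<le> 1"
    and H: "\<And>\<epsilon> x y. 0 < \<epsilon> \<Longrightarrow> \<epsilon> \<le> 1 \<Longrightarrow> \<bar>x $ 1 - y $ 1\<bar> \<le> \<epsilon> \<Longrightarrow> \<bar>x $ 2 - y $ 2\<bar> \<le> \<epsilon> \<Longrightarrow> norm (v x - v y) \<le> C * \<epsilon> powr \<kappa>"
  shows "graph_dim v \<le> ereal (3 - \<kappa>)"
proof -
  have main: "fractal_dim (torus_graph f) \<le> ereal (3 - \<kappa>)" if f: "\<And>x y. \<bar>f x - f y\<bar> \<le> norm (v x - v y)" for f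
  proof (rule fractal_dim_le[where A="(2 * pi + 1)\<^sup>2 * (2 * C + 3)"])
    fix \<epsilon> :: real assume \<epsilon>: "0 < \<epsilon>" "\<epsilon> \<le> 1"
    obtain B where "finite B" "real (card B) \<le> ((2 * pi + 1)\<^sup>2 * (2 * C + 3)) * \<epsilon> powr (\<kappa> - 3)"
      "torus_graph f \<subseteq> (\<Union>c\<in>B. cbox c (c + \<epsilon> *\<^sub>R One))"
      by (rule hoelder_graph_cover[OF C _ \<epsilon> \<kappa>, of f]) (use order_trans[OF f H[OF \<epsilon>]] in blast)+
    then show "real (box_covering_number (torus_graph f) \<epsilon>) \<le> (2 * pi + 1)\<^sup>2 * (2 * C + 3) * \<epsilon> powr - (3 - \<kappa>)"
      using box_covering_number_le[of B "torus_graph f" \<epsilon>] by simp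
  next
    have "1 * 1 \<le> (2 * pi + 1)\<^sup>2 * (2 * C + 3)"
      using C by (intro mult_mono one_le_power) auto
    then show "1 \<le> (2 * pi + 1)\<^sup>2 * (2 * C + 3)" by simp
    show "0 \<le> 3 - \<kappa>" using \<kappa> by simp
  qed
  show ?thesis unfolding graph_dim_def
  proof (intro max.boundedI main)
    show "\<bar>Re (v x) - Re (v y)\<bar> \<le> norm (v x - v y)" "\<bar>Im (v x) - Im (v y)\<bar> \<le> norm (v x - v y)" for x y
      using abs_Re_le_cmod[of "v x - v y"] abs_Im_le_cmod[of "v x - v y"] by simp_all
  qed
qed

lemma torus_fun_bounded:
  assumes "torus_fun v" "continuous_on UNIV v"
  obtains B where "\<And>x. norm (v x) \<le> B"
proof -
  have "compact (v ` cbox 0 (vector [2 * pi, 2 * pi]))"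
    by (intro compact_continuous_image continuous_on_subset[OF assms(2)]) auto
  then obtain B where B: "\<And>x. x \<in> cbox 0 (vector [2 * pi, 2 * pi]) \<Longrightarrow> norm (v x) \<le> B"
    using compact_imp_bounded[THEN bounded_iff[THEN iffD1]] by fastforce
  have "norm (v x) \<le> B" for x
  proof -
    obtain k where k: "x - lattice_vec k \<in> torus_cell" by (rule cell_translate_unique)
    then have "norm (v (x - lattice_vec k)) \<le> B"
      by (intro B) (auto simp: torus_cell_iff mem_box_cart forall_2)
    then show ?thesis using torus_funD[OF assms(1), of "x - lattice_vec k" k] by simp
  qed
  then show thesis by (rule that)
qed

text \<open>At scale \<open>\<epsilon>\<close> the squared \<open>L^2\<close> increment is at least
  a multiple of \<open>\<epsilon>\<close> and at most the supremum
  \<open>C * \<epsilon> powr \<kappa>\<close> times the \<open>L^1\<close> increment, which in turn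
  is at most \<open>162 * \<epsilon>^3\<close> times the larger covering number. Solving for that
  number gives the exponent \<open>2 + \<kappa>\<close>.\<close>

lemma graph_dim_ge:
  assumes tf: "torus_fun v" and cont: "continuous_on UNIV v" and C: "0 \<le> C" and d: "0 < d"
    and \<kappa>: "\<kappa> \<le> 1"
    and H: "\<And>\<epsilon> x y. 0 < \<epsilon> \<Longrightarrow> \<epsilon> \<le> 1 \<Longrightarrow> \<bar>x $ 1 - y $ 1\<bar> \<le> \<epsilon> \<Longrightarrow> \<bar>x $ 2 - y $ 2\<bar> \<le> \<epsilon> \<Longrightarrow> norm (v x - v y) \<le> C * \<epsilon> powr \<kappa>"
    and low: "\<And>m. m \<ge> 1 \<Longrightarrow> d / real m \<le> (LINT x|torus_measure. (norm (v (x + (1 / real m) *\<^sub>R h) - v x))\<^sup>2)"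
  shows "ereal (2 + \<kappa>) \<le> graph_dim v"
proof -
  \<comment> \<open>With \<open>e k = R / M k\<close> the coordinates of the step
    \<open>h / M k\<close> are at most the box side; the summand 1 keeps \<open>R\<close> positive,
    and \<open>M k \<ge> R\<close> keeps the side at most 1.\<close>
  define R where "R = max \<bar>h $ 1\<bar> \<bar>h $ 2\<bar> + 1"
  define M where "M k = nat \<lceil>R\<rceil> + 1 + k" for k
  define e where "e k = R / real (M k)" for k
  have R: "R > 0" "\<bar>h $ 1\<bar> \<le> R" "\<bar>h $ 2\<bar> \<le> R" unfolding R_def by linarith+
  have RM: "R \<le> real (M k)" for k using real_nat_ceiling_ge[of R] unfolding M_def by linarith
  have M1: "M k \<ge> 1" "real (M k) > 0" for k unfolding M_def by auto
  have e: "0 < e k" "e k \<le> 1" for k using R RM[of k] M1[of k] unfolding e_def by auto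
  have "e \<longlonglongrightarrow> 0" unfolding e_def M_def by real_asymp
  obtain B where B: "\<And>x. norm (v x) \<le> B" using torus_fun_bounded[OF tf cont] by blast
  have [measurable]: "v \<in> borel_measurable borel" using cont by (rule borel_measurable_continuous_onI)
  \<comment> \<open>\<open>162 = 2 * 81\<close> for real and imaginary part, \<open>R\<close> from
    rewriting \<open>d / M k\<close> as \<open>d / R * e k\<close>, and \<open>C + 1\<close> to
    divide by a positive number.\<close>
  define A where "A = d / (162 * R * (C + 1))"
  have A: "A > 0" unfolding A_def using d R C by simp
  show ?thesis unfolding graph_dim_def
  proof (rule max_fractal_dim_ge[OF \<open>e \<longlonglongrightarrow> 0\<close> e(1) A])
    fix k
    let ?\<epsilon> = "e k" and ?h = "(1 / real (M k)) *\<^sub>R h"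
    let ?N = "max (box_covering_number (torus_graph (\<lambda>x. Re (v x))) (e k)) (box_covering_number (torus_graph (\<lambda>x. Im (v x))) (e k))"
    have hb: "\<bar>?h $ 1\<bar> \<le> ?\<epsilon>" "\<bar>?h $ 2\<bar> \<le> ?\<epsilon>"
      using R M1(2)[of k] unfolding e_def by (auto simp: abs_mult divide_right_mono)
    have ReIm: "\<bar>Re (v x) - Re (v y)\<bar> \<le> norm (v x - v y)" "\<bar>Im (v x) - Im (v y)\<bar> \<le> norm (v x - v y)"
      "norm (v x - v y) \<le> \<bar>Re (v x) - Re (v y)\<bar> + \<bar>Im (v x) - Im (v y)\<bar>" for x y
      using abs_Re_le_cmod[of "v x - v y"] abs_Im_le_cmod[of "v x - v y"] cmod_le[of "v x - v y"] by simp_all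
    have osc: "(LINT x|torus_measure. \<bar>f (x + ?h) - f x\<bar>) \<le> 81 * ?\<epsilon> ^ 3 * real (box_covering_number (torus_graph f) ?\<epsilon>)"
      if f: "\<And>x y. \<bar>f x - f y\<bar> \<le> norm (v x - v y)" and cf: "continuous_on UNIV f" and per: "\<And>x k. f (x + lattice_vec k) = f x" for f
    proof -
      obtain D where D: "finite D" "torus_graph f \<subseteq> (\<Union>c\<in>D. cbox c (c + ?\<epsilon> *\<^sub>R One))"
        by (rule hoelder_graph_cover[where f=f and \<epsilon>="e k", OF C _ e \<kappa>]) (use order_trans[OF f H[OF e]] in blast)+
      obtain D' where D': "finite D'" "card D' = box_covering_number (torus_graph f) ?\<epsilon>"
        "torus_graph f \<subseteq> (\<Union>c\<in>D'. cbox c (c + ?\<epsilon> *\<^sub>R One))"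
        by (rule box_covering_number_witness[OF D]) blast
      show ?thesis
        using oscillation_le_covering[OF per cf hb e D'(1,3)] unfolding D'(2) .
    qed
    define L where "L = (LINT x|torus_measure. norm (v (x + ?h) - v x))"
    have i1: "integrable torus_measure (\<lambda>x. norm (v (x + ?h) - v x))"
    proof (rule integrable_torus_bounded[where B="2 * B"])
      show "norm (norm (v (x + ?h) - v x)) \<le> 2 * B" for x
        using norm_triangle_ineq4[of "v (x + ?h)" "v x"] B[of x] B[of "x + ?h"] by simp
    qed measurable
    have iR: "integrable torus_measure (\<lambda>x. \<bar>Re (v (x + ?h)) - Re (v x)\<bar>)" "integrable torus_measure (\<lambda>x. \<bar>Im (v (x + ?h)) - Im (v x)\<bar>)"
      by (rule Bochner_Integration.integrable_bound[OF i1];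
          use ReIm in \<open>auto intro!: always_eventually\<close>)+
    have "d / real (M k) \<le> (LINT x|torus_measure. (norm (v (x + ?h) - v x))\<^sup>2)"
      by (rule low[OF M1(1)])
    also have "\<dots> \<le> (LINT x|torus_measure. (C * ?\<epsilon> powr \<kappa>) * norm (v (x + ?h) - v x))"
    proof (rule integral_mono')
      show "integrable torus_measure (\<lambda>x. (C * ?\<epsilon> powr \<kappa>) * norm (v (x + ?h) - v x))"
        using i1 by (rule integrable_mult_right)
      show "(norm (v (x + ?h) - v x))\<^sup>2 \<le> (C * ?\<epsilon> powr \<kappa>) * norm (v (x + ?h) - v x)" for x
        unfolding power2_eq_square by (intro mult_right_mono H[OF e]) (use hb in auto)
    qed (use C in auto)
    also have "\<dots> = (C * ?\<epsilon> powr \<kappa>) * L" unfolding L_def by (rule integral_mult_right_zero)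
    also have "L \<le> (LINT x|torus_measure. \<bar>Re (v (x + ?h)) - Re (v x)\<bar> + \<bar>Im (v (x + ?h)) - Im (v x)\<bar>)"
      unfolding L_def by (intro integral_mono i1 Bochner_Integration.integrable_add iR ReIm)
    also have "\<dots> = (LINT x|torus_measure. \<bar>Re (v (x + ?h)) - Re (v x)\<bar>) + (LINT x|torus_measure. \<bar>Im (v (x + ?h)) - Im (v x)\<bar>)"
      by (rule Bochner_Integration.integral_add[OF iR])
    also have "\<dots> \<le> 81 * ?\<epsilon> ^ 3 * real ?N + 81 * ?\<epsilon> ^ 3 * real ?N"
    proof (intro add_mono)
      have "(LINT x|torus_measure. \<bar>Re (v (x + ?h)) - Re (v x)\<bar>) \<le> 81 * ?\<epsilon> ^ 3 * real (box_covering_number (torus_graph (\<lambda>x. Re (v x))) ?\<epsilon>)"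
        by (rule osc) (intro ReIm, intro continuous_intros cont, simp add: torus_funD[OF tf])
      also have "\<dots> \<le> 81 * ?\<epsilon> ^ 3 * real ?N" using e(1)[of k] by (intro mult_left_mono) auto
      finally show "(LINT x|torus_measure. \<bar>Re (v (x + ?h)) - Re (v x)\<bar>) \<le> 81 * ?\<epsilon> ^ 3 * real ?N" .
      have "(LINT x|torus_measure. \<bar>Im (v (x + ?h)) - Im (v x)\<bar>) \<le> 81 * ?\<epsilon> ^ 3 * real (box_covering_number (torus_graph (\<lambda>x. Im (v x))) ?\<epsilon>)"
        by (rule osc) (intro ReIm, intro continuous_intros cont, simp add: torus_funD[OF tf])
      also have "\<dots> \<le> 81 * ?\<epsilon> ^ 3 * real ?N" using e(1)[of k] by (intro mult_left_mono) auto
      finally show "(LINT x|torus_measure. \<bar>Im (v (x + ?h)) - Im (v x)\<bar>) \<le> 81 * ?\<epsilon> ^ 3 * real ?N" .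
    qed
    finally have "d / real (M k) \<le> (C * ?\<epsilon> powr \<kappa>) * (162 * ?\<epsilon> ^ 3 * real ?N)"
      using C by (simp add: mult_left_mono)
    also have "\<dots> \<le> ((C + 1) * ?\<epsilon> powr \<kappa>) * (162 * ?\<epsilon> ^ 3 * real ?N)"
      using C e(1)[of k] by (intro mult_right_mono) auto
    finally have "d / R * ?\<epsilon> \<le> ((C + 1) * ?\<epsilon> powr \<kappa>) * (162 * ?\<epsilon> ^ 3 * real ?N)"
      using R by (simp add: e_def)
    then have "d / R * ?\<epsilon> / ((C + 1) * ?\<epsilon> powr \<kappa> * (162 * ?\<epsilon> ^ 3)) \<le> real ?N"
      using C e(1)[of k] by (subst pos_divide_le_eq) (auto simp: mult_ac)
    also have "d / R * ?\<epsilon> / ((C + 1) * ?\<epsilon> powr \<kappa> * (162 * ?\<epsilon> ^ 3)) = A * ?\<epsilon> powr - (2 + \<kappa>)"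
    proof -
      have "?\<epsilon> powr - (2 + \<kappa>) = inverse (?\<epsilon> ^ 2 * ?\<epsilon> powr \<kappa>)"
        unfolding powr_minus using e(1)[of k] by (simp add: powr_add)
      then have "A * ?\<epsilon> powr - (2 + \<kappa>) = A * inverse (?\<epsilon> ^ 2 * ?\<epsilon> powr \<kappa>)" by (rule arg_cong)
      also have "\<dots> = d / R * ?\<epsilon> / ((C + 1) * ?\<epsilon> powr \<kappa> * (162 * ?\<epsilon> ^ 3))"
      proof -
        have "d / (162 * R * c) * inverse (a ^ 2 * p) = d / R * a / (c * p * (162 * a ^ 3))" if "a > 0" "p > 0" "c > 0" for a p c :: real
          using that R by (simp add: field_simps power3_eq_cube power2_eq_square)
        from this[of ?\<epsilon> "?\<epsilon> powr \<kappa>" "C + 1"] show ?thesis unfolding A_def using e(1)[of k] C by simp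
      qed
      finally show ?thesis ..
    qed
    finally show "A * ?\<epsilon> powr - (2 + \<kappa>) \<le> real ?N" .
  qed
qed

text \<open>The coefficients of the means tend to those of \<open>f\<close>, since the Fejer weight
  of a fixed frequency tends to 1, and by dominated convergence also to those of \<open>v\<close>.
  Uniqueness of Fourier coefficients then identifies the two.\<close>

lemma uniform_limit_fejm_version:
  assumes f: "torus_L2 f" and tf: "torus_fun v" and v: "continuous_on UNIV v"
    and lim: "uniform_limit UNIV (\<lambda>J. fejm (16 ^ J) f) v sequentially"
  shows "continuous_version f v"
proof -
  have fi: "integrable torus_measure f" using f by (rule torus_L2_integrable)
  have [measurable]: "v \<in> borel_measurable borel" using v by (rule borel_measurable_continuous_onI)
  obtain B J0 where B: "0 \<le> B" "\<And>x. norm (v x) \<le> B" "\<And>J x. J \<ge> J0 \<Longrightarrow> norm (fejm (16 ^ J) f x) \<le> B"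
    by (rule uniform_limit_fejm_bounded[OF lim]) blast
  have vi: "integrable torus_measure v" by (rule integrable_torus_bounded[OF _ B(2)]) measurable
  have "fcoef (\<lambda>x. v x - f x) n = 0" for n
  proof -
    have [measurable]: "(\<lambda>x. cnj (tchar n x)) \<in> borel_measurable borel" unfolding tchar_cnj by measurable
    have "(\<lambda>J. LINT x|torus_measure. fejm (16 ^ (J + J0)) f x * cnj (tchar n x)) \<longlonglongrightarrow> (LINT x|torus_measure. v x * cnj (tchar n x))"
    proof (rule integral_dominated_convergence[where w="\<lambda>x. B"])
      have "(\<lambda>J. fejm (16 ^ (J + J0)) f x * cnj (tchar n x)) \<longlonglongrightarrow> v x * cnj (tchar n x)" for x
        using LIMSEQ_ignore_initial_segment[OF tendsto_uniform_limitI[OF lim UNIV_I[of x]], of J0] by (intro tendsto_intros)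
      then show "AE x in torus_measure. (\<lambda>J. fejm (16 ^ (J + J0)) f x * cnj (tchar n x)) \<longlonglongrightarrow> v x * cnj (tchar n x)" by simp
      show "AE x in torus_measure. norm (fejm (16 ^ (J + J0)) f x * cnj (tchar n x)) \<le> B" for J
        using B(3)[of "J + J0"] by (intro always_eventually allI) (simp add: norm_mult)
      show "integrable torus_measure (\<lambda>x. B)" by (rule integrable_torus_bounded[where B="\<bar>B\<bar>"]) auto
    qed measurable
    then have "(\<lambda>J. fcoef (fejm (16 ^ (J + J0)) f) n) \<longlonglongrightarrow> fcoef v n"
      unfolding fcoef_def by (intro tendsto_divide tendsto_const) auto
    then have "(\<lambda>J. fej2 (16 ^ (J + J0)) n * fcoef f n) \<longlonglongrightarrow> fcoef v n" by (simp add: fcoef_fejm)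
    moreover have "(\<lambda>J. fej2 (16 ^ (J + J0)) n * fcoef f n) \<longlonglongrightarrow> of_real 1 * fcoef f n"
    proof (intro tendsto_intros)
      have "(\<lambda>J. c / real (16 ^ J)) \<longlonglongrightarrow> 0" for c :: real unfolding of_nat_power of_nat_numeral by real_asymp
      from LIMSEQ_ignore_initial_segment[OF this, of _ J0]
      have "(\<lambda>J. fej (16 ^ (J + J0)) k) \<longlonglongrightarrow> max 0 (1 - 0)" for k
        unfolding fej_def by (intro tendsto_max tendsto_diff tendsto_const)
      from tendsto_mult[OF this this]
      show "(\<lambda>J. fej2 (16 ^ (J + J0)) n) \<longlonglongrightarrow> 1" unfolding fej2_def by simp
    qed
    ultimately have "fcoef v n = fcoef f n" using LIMSEQ_unique by fastforce
    then show ?thesis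
      unfolding fcoef_def left_diff_distrib
      by (subst Bochner_Integration.integral_diff) (auto intro!: integrable_tchar_mult vi fi simp: diff_divide_distrib)
  qed
  then have "AE x in torus_measure. v x - f x = 0"
    by (intro fcoef_zero_imp_AE_zero Bochner_Integration.integrable_diff vi fi)
  then show ?thesis unfolding continuous_version_def using tf v by simp
qed

text \<open>The Hoelder exponent 1/2 itself is never reached; a sequence of exponents increasing to
  it squeezes the dimension from both sides.\<close>

lemma uniform_limit_fejm_graph_dim:
  assumes P: "closed P" "P \<noteq> UNIV" "interior P \<noteq> {}" and sat: "\<And>x k. x + lattice_vec k \<in> P \<longleftrightarrow> x \<in> P"
    and loc: "AE x in lborel. \<exists>U. open U \<and> x \<in> U \<and> (\<forall>y\<in>U. y \<in> P \<longleftrightarrow> x \<in> P)"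
    and coef: "\<And>n. norm (fcoef f n) = norm (fcoef (indicator P) n)"
    and f: "integrable torus_measure f"
    and bd: "\<And>k::nat. \<exists>H\<ge>0. \<forall>J j x.
      norm (fejm (16 ^ J) f (x + vector [1 / 2 ^ j, 0]) - fejm (16 ^ J) f x) \<le> H * 2 powr (1 / (real k + 5) * real J) * (2 powr (- (1 / 2 - 1 / (real k + 5)))) ^ j \<and>
      norm (fejm (16 ^ J) f (x + vector [0, 1 / 2 ^ j]) - fejm (16 ^ J) f x) \<le> H * 2 powr (1 / (real k + 5) * real J) * (2 powr (- (1 / 2 - 1 / (real k + 5)))) ^ j"
  obtains v where "torus_fun v" "continuous_on UNIV v" "uniform_limit UNIV (\<lambda>J. fejm (16 ^ J) f) v sequentially"
    "graph_dim v = ereal (5 / 2)"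
proof -
  \<comment> \<open>This is \<open>\<theta> - \<eta>\<close> with
    \<open>\<eta> = 1 / (k + 5)\<close> and \<open>\<theta> = 1/2 - \<eta>\<close>; the 5 makes
    \<open>\<eta> < \<theta>\<close> from \<open>k = 0\<close> on.\<close>
  define \<kappa> where "\<kappa> k = 1 / 2 - 2 / (real k + 5)" for k :: nat
  have ex: "\<exists>v C. torus_fun v \<and> continuous_on UNIV v \<and> 0 \<le> C \<and>
    (\<forall>\<epsilon> x y. 0 < \<epsilon> \<longrightarrow> \<epsilon> \<le> 1 \<longrightarrow> \<bar>x $ 1 - y $ 1\<bar> \<le> \<epsilon> \<longrightarrow> \<bar>x $ 2 - y $ 2\<bar> \<le> \<epsilon> \<longrightarrow> norm (v x - v y) \<le> C * \<epsilon> powr \<kappa> k) \<and>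
    uniform_limit UNIV (\<lambda>J. fejm (16 ^ J) f) v sequentially" for k
  proof -
    obtain H where H: "0 \<le> H" and HH: "\<forall>J j x.
      norm (fejm (16 ^ J) f (x + vector [1 / 2 ^ j, 0]) - fejm (16 ^ J) f x) \<le> H * 2 powr (1 / (real k + 5) * real J) * (2 powr (- (1 / 2 - 1 / (real k + 5)))) ^ j \<and>
      norm (fejm (16 ^ J) f (x + vector [0, 1 / 2 ^ j]) - fejm (16 ^ J) f x) \<le> H * 2 powr (1 / (real k + 5) * real J) * (2 powr (- (1 / 2 - 1 / (real k + 5)))) ^ j"
      using bd[of k] by (elim exE conjE) (rule that)
    have q: "0 < 1 / (real k + 5)" "1 / (real k + 5) \<le> 1 / 5"
      by (simp_all add: divide_simps)
    have \<theta>: "0 < 1 / (real k + 5)" "1 / (real k + 5) < 1 / 2 - 1 / (real k + 5)" "1 / 2 - 1 / (real k + 5) \<le> 1"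
      using q by linarith+
    have \<kappa>: "1 / 2 - 1 / (real k + 5) - 1 / (real k + 5) = \<kappa> k" by (simp add: \<kappa>_def)
    show ?thesis
      by (rule fejer_means_limit[OF f H \<theta> HH[rule_format, THEN conjunct1] HH[rule_format, THEN conjunct2], unfolded \<kappa>])
         (intro exI conjI allI impI; assumption)
  qed
  have "\<forall>k. \<exists>v C. torus_fun v \<and> continuous_on UNIV v \<and> 0 \<le> C \<and>
    (\<forall>\<epsilon> x y. 0 < \<epsilon> \<longrightarrow> \<epsilon> \<le> 1 \<longrightarrow> \<bar>x $ 1 - y $ 1\<bar> \<le> \<epsilon> \<longrightarrow> \<bar>x $ 2 - y $ 2\<bar> \<le> \<epsilon> \<longrightarrow> norm (v x - v y) \<le> C * \<epsilon> powr \<kappa> k) \<and>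
    uniform_limit UNIV (\<lambda>J. fejm (16 ^ J) f) v sequentially" by (rule allI[OF ex])
  then obtain V C where VC: "\<forall>k. torus_fun (V k) \<and> continuous_on UNIV (V k) \<and> 0 \<le> C k \<and>
    (\<forall>\<epsilon> x y. 0 < \<epsilon> \<longrightarrow> \<epsilon> \<le> 1 \<longrightarrow> \<bar>x $ 1 - y $ 1\<bar> \<le> \<epsilon> \<longrightarrow> \<bar>x $ 2 - y $ 2\<bar> \<le> \<epsilon> \<longrightarrow> norm (V k x - V k y) \<le> C k * \<epsilon> powr \<kappa> k) \<and>
    uniform_limit UNIV (\<lambda>J. fejm (16 ^ J) f) (V k) sequentially"
    unfolding choice_iff by (elim exE) (rule that)
  define v where "v = V 0"
  have lim: "uniform_limit UNIV (\<lambda>J. fejm (16 ^ J) f) (V k) sequentially" for k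
    using VC[rule_format, of k] by (elim conjE)
  have tf: "torus_fun v" and cont: "continuous_on UNIV v"
    unfolding v_def by (rule VC[rule_format, THEN conjunct1], rule VC[rule_format, THEN conjunct2, THEN conjunct1])
  \<comment> \<open>All \<open>V k\<close> are limits of the same sequence of means, so one function
    carries every exponent.\<close>
  have "V k x = v x" for k x
    unfolding v_def by (rule LIMSEQ_unique[OF tendsto_uniform_limitI[OF lim UNIV_I] tendsto_uniform_limitI[OF lim UNIV_I]])
  then have Vv: "V k = v" for k by (intro ext)
  have C: "0 \<le> C k" for k using VC[rule_format, of k] by (elim conjE)
  have Hoe: "norm (v x - v y) \<le> C k * \<epsilon> powr \<kappa> k" if "0 < \<epsilon>" "\<epsilon> \<le> 1" "\<bar>x $ 1 - y $ 1\<bar> \<le> \<epsilon>" "\<bar>x $ 2 - y $ 2\<bar> \<le> \<epsilon>" for \<epsilon> x y k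
    using VC[rule_format, THEN conjunct2, THEN conjunct2, THEN conjunct2, THEN conjunct1, rule_format, OF that, of k] unfolding Vv .
  have \<kappa>1: "\<kappa> k \<le> 1" for k unfolding \<kappa>_def by (simp add: field_simps)
  have Pb [measurable]: "P \<in> sets borel" using P by auto
  have conv: "AE x in lborel. (\<lambda>J. fejm (16 ^ J) (indicator P) x) \<longlonglongrightarrow> (indicator P x :: complex)"
    using loc
  proof eventually_elim
    case (elim x)
    then obtain U where U: "open U" "x \<in> U" "\<forall>y\<in>U. y \<in> P \<longleftrightarrow> x \<in> P" by (elim exE conjE) (rule that)
    have *: "(\<lambda>j. fejm (Suc j) (indicator P) x) \<longlonglongrightarrow> (indicator P x :: complex)"
      by (rule fejm_indicator_tendsto[OF sat Pb U(1,2) bspec[OF U(3)]])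
    \<comment> \<open>The pointwise convergence is indexed by \<open>Suc j\<close>, so the orders
      \<open>16^J\<close> form the subsequence \<open>j = 16^J - 1\<close>.\<close>
    have "strict_mono (\<lambda>J. 16 ^ J - 1 :: nat)"
    proof (rule strict_monoI_Suc)
      show "16 ^ J - 1 < 16 ^ Suc J - (1::nat)" for J
        using one_le_power[of "16::nat" J] unfolding power_Suc by linarith
    qed
    from LIMSEQ_subseq_LIMSEQ[OF * this] show ?case by (simp add: o_def)
  qed
  define D where "D h = (LINT x|torus_measure. norm (indicator P (x + h) - indicator P x :: complex))" for h
  have mod: "(LINT x|torus_measure. (norm (v (x + h) - v x))\<^sup>2) = D h" for h
  proof -
    have "(LINT x|torus_measure. (norm (v (x + h) - v x))\<^sup>2) = (LINT x|torus_measure. (norm (indicator P (x + h) - indicator P x :: complex))\<^sup>2)"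
      using lim[of 0] unfolding Vv
      by (rule square_modulus_eq[OF coef _ cont integrable_indicator_torus _ _ conv]) (auto simp: indicator_def)
    \<comment> \<open>Differences of indicator values have modulus 0 or 1, so squaring changes
      nothing and the \<open>L^2\<close> modulus becomes subadditive in \<open>h\<close>.\<close>
    also have "\<dots> = D h" unfolding D_def by (intro Bochner_Integration.integral_cong refl) (simp add: indicator_def)
    finally show ?thesis .
  qed
  obtain h where h: "0 < D h" unfolding D_def by (rule indicator_modulus_pos[OF P sat])
  have low: "D h / real m \<le> (LINT x|torus_measure. (norm (v (x + (1 / real m) *\<^sub>R h) - v x))\<^sup>2)" if m: "m \<ge> 1" for m
  proof -
    have "D (real m *\<^sub>R ((1 / real m) *\<^sub>R h)) \<le> real m * D ((1 / real m) *\<^sub>R h)"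
      unfolding D_def by (rule L1_modulus_multiple[where B=1]) (use sat in \<open>auto intro!: torus_funI simp: indicator_def\<close>)
    then show ?thesis using m unfolding mod by (simp add: pos_divide_le_eq mult.commute)
  qed
  have le: "graph_dim v \<le> ereal (3 - \<kappa> k)" for k by (rule graph_dim_le[OF C \<kappa>1 Hoe])
  have ge: "ereal (2 + \<kappa> k) \<le> graph_dim v" for k by (rule graph_dim_ge[OF tf cont C h \<kappa>1 Hoe low])
  have lims: "(\<lambda>k. ereal (3 - \<kappa> k)) \<longlonglongrightarrow> ereal (5 / 2)" "(\<lambda>k. ereal (2 + \<kappa> k)) \<longlonglongrightarrow> ereal (5 / 2)"
    unfolding lim_ereal \<kappa>_def by real_asymp+
  have "graph_dim v = ereal (5 / 2)"
    by (rule antisym[OF LIMSEQ_le_const[OF lims(1)] LIMSEQ_le_const2[OF lims(2)]]) (use le ge in blast)+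
  then show thesis using tf cont lim[of 0] unfolding Vv by (intro that[of v])
qed

theorem theorem6p8:
  fixes P :: "(real^2) set" and u :: "real \<Rightarrow> real^2 \<Rightarrow> complex"
  assumes "torus_polygon P"
    and "schrodinger_solution (indicator P) u"
  shows "AE t in lborel. \<exists>v. continuous_version (u t) v \<and> graph_dim v = ereal (5 / 2)"
proof -
  obtain Q where Q: "planar_polygon Q" and inj: "\<forall>x\<in>Q. \<forall>y\<in>Q. torus_eq x y \<longrightarrow> x = y" and P: "P = {x. \<exists>y\<in>Q. torus_eq x y}"
    using assms(1) unfolding torus_polygon_def by (elim exE conjE) (rule that)
  have cQ: "compact Q" and iQ: "interior Q \<noteq> {}" and fQ: "AE x in lborel. x \<notin> frontier Q"
    using planar_polygon_strips[OF Q] by metis+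
  have cP: "closed P" "P \<noteq> UNIV"
    unfolding P using iQ interior_subset[of Q] inj by (intro torus_translates_not_UNIV[OF cQ]; blast)+
  have "Q \<subseteq> P" unfolding P by (auto simp: torus_eq_def intro!: bexI exI[of _ 0])
  then have iP: "interior P \<noteq> {}" using iQ interior_mono by blast
  have [measurable]: "P \<in> sets borel" using cP by auto
  have sat: "x + lattice_vec k \<in> P \<longleftrightarrow> x \<in> P" for x k
    unfolding P mem_Collect_eq by (rule torus_translates_saturated)
  have loc: "AE x in lborel. \<exists>U. open U \<and> x \<in> U \<and> (\<forall>y\<in>U. y \<in> P \<longleftrightarrow> x \<in> P)"
    using AE_torus_translates_locally_constant[OF cQ _ fQ] cP(1) unfolding P by blast
  have coef: "fcoef (u t) n = cis (- phase t n) * fcoef (indicator P) n" for t n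
    by (rule fcoef_solution[OF assms(2)]) measurable
  have "AE t in lborel. \<exists>H\<ge>0. \<forall>J j x.
      norm (fejm (16 ^ J) (u t) (x + vector [1 / 2 ^ j, 0]) - fejm (16 ^ J) (u t) x) \<le> H * 2 powr (1 / (real k + 5) * real J) * (2 powr (- (1 / 2 - 1 / (real k + 5)))) ^ j \<and>
      norm (fejm (16 ^ J) (u t) (x + vector [0, 1 / 2 ^ j]) - fejm (16 ^ J) (u t) x) \<le> H * 2 powr (1 / (real k + 5) * real J) * (2 powr (- (1 / 2 - 1 / (real k + 5)))) ^ j" for k :: nat
  proof -
    have q: "0 < 1 / (real k + 5)" "1 / (real k + 5) \<le> 1 / 5"
      by (simp_all add: divide_simps)
    show ?thesis by (rule polygon_AE_dyadic_bound[OF Q inj coef[unfolded P]]) (use q in linarith)+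
  qed
  \<comment> \<open>Only countably many exponents are used, so a single null set of times serves all
    of them.\<close>
  then have "AE t in lborel. \<forall>k::nat. \<exists>H\<ge>0. \<forall>J j x.
      norm (fejm (16 ^ J) (u t) (x + vector [1 / 2 ^ j, 0]) - fejm (16 ^ J) (u t) x) \<le> H * 2 powr (1 / (real k + 5) * real J) * (2 powr (- (1 / 2 - 1 / (real k + 5)))) ^ j \<and>
      norm (fejm (16 ^ J) (u t) (x + vector [0, 1 / 2 ^ j]) - fejm (16 ^ J) (u t) x) \<le> H * 2 powr (1 / (real k + 5) * real J) * (2 powr (- (1 / 2 - 1 / (real k + 5)))) ^ j"
    by (intro AE_all_countable[THEN iffD2] allI)
  then show ?thesis
  proof eventually_elim
    case (elim t)
    have L2: "torus_L2 (u t)" using assms(2) unfolding schrodinger_solution_def by (elim conjE) (rule spec)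
    obtain v where "torus_fun v" "continuous_on UNIV v" "uniform_limit UNIV (\<lambda>J. fejm (16 ^ J) (u t)) v sequentially"
      and d: "graph_dim v = ereal (5 / 2)"
      by (rule uniform_limit_fejm_graph_dim[OF cP iP sat loc _ torus_L2_integrable[OF L2] elim[rule_format]])
         (simp_all add: coef norm_mult)
    then have "continuous_version (u t) v" by (intro uniform_limit_fejm_version[OF L2])
    with d show ?case by (intro exI conjI)
  qed
qed

end
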